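(* Let $p$ be an odd prime, $k$ an algebraically closed field of characteristic $p$, and $G=SL_2$ over $k$. For all integers $m_1,m_2\ge 0$, $$\dim\mathrm{Ext}^3_G(V(m_2),V(m_1))\le 3.$$
   Context: Dominant weights of $SL_2$ are identified with $\mathbb N=\{0,1,2,\dots\}$. $V(m)=\mathrm{ind}_B^G(m)^*$ is the Weyl module of highest weight $m$, where $B$ is a Borel subgroup (corresponding to the negative root). $\mathrm{Ext}_G$ is taken in the category of rational $G$-modules. *)

theory Defs
  imports "HOL-Algebra.AbelCoset" "Jordan_Normal_Form.VS_Connect"
begin

hide_const (open) Modules.module_hom

text \<open>
  The ground field is the type \<open>'k\<close>, viewed as the HOL-Algebra ring \<open>class_ring\<close>.
  Vector spaces are HOL-Algebra module records with explicit carrier, so that their ring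
  components \<open>mult\<close> and \<open>one\<close> carry no information; they are left undefined below.

  As the ground field is algebraically closed in the application, \<open>SL\<^sub>2\<close> is represented by its group of rational points,
  together with its coordinate ring. Functions on the group and linear maps are normalised to be
  \<open>extensional\<close> on their domain.
\<close>

definition SL2 :: "'k::field mat monoid" where
  "SL2 = \<lparr>carrier = {g \<in> carrier_mat 2 2. det g = 1}, mult = (*), one = 1\<^sub>m 2\<rparr>"

inductive_set coord_ring :: "('k::field mat \<Rightarrow> 'k) set" where
  const: "(\<lambda>g\<in>carrier SL2. c) \<in> coord_ring"
| entry: "i < 2 \<Longrightarrow> j < 2 \<Longrightarrow> (\<lambda>g\<in>carrier SL2. g $$ (i, j)) \<in> coord_ring"
| add: "f \<in> coord_ring \<Longrightarrow> h \<in> coord_ring \<Longrightarrow> (\<lambda>g\<in>carrier SL2. f g + h g) \<in> coord_ring"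
| mult: "f \<in> coord_ring \<Longrightarrow> h \<in> coord_ring \<Longrightarrow> (\<lambda>g\<in>carrier SL2. f g * h g) \<in> coord_ring"


section \<open>Rational modules\<close>

record ('k, 'v) gmod = "('k, 'v) module" +
  act :: "'k mat \<Rightarrow> 'v \<Rightarrow> 'v"

text \<open>
  Rationality: every vector lies in a finite-dimensional \<open>G\<close>-stable subspace (with basis \<open>B\<close>)
  on which \<open>G\<close> acts through a matrix \<open>a\<close> of regular functions.
\<close>

locale rational_gmod =
  fixes M :: "('k::field, 'v) gmod" (structure)
  assumes vectorspace: "vectorspace class_ring M"
    and act_linear: "g \<in> carrier SL2 \<Longrightarrow> act M g \<in> module_hom class_ring M M"
    and act_one: "v \<in> carrier M \<Longrightarrow> act M \<one>\<^bsub>SL2\<^esub> v = v"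
    and act_mult: "g \<in> carrier SL2 \<Longrightarrow> h \<in> carrier SL2 \<Longrightarrow> v \<in> carrier M \<Longrightarrow>
      act M (g \<otimes>\<^bsub>SL2\<^esub> h) v = act M g (act M h v)"
    and rational: "v \<in> carrier M \<Longrightarrow>
      \<exists>B a. finite B \<and> B \<subseteq> carrier M \<and> \<not> module.lin_dep class_ring M B \<and>
        v \<in> LinearCombinations.module.span class_ring M B \<and>
        (\<forall>b\<in>B. \<forall>c\<in>B. a c b \<in> coord_ring) \<and>
        (\<forall>g\<in>carrier SL2. \<forall>b\<in>B. act M g b = module.lincomb M (\<lambda>c. a c b g) B)"

definition gmod_hom :: "('k::field, 'v) gmod \<Rightarrow> ('k, 'w) gmod \<Rightarrow> ('v \<Rightarrow> 'w) set" where
  "gmod_hom M N = {f \<in> module_hom class_ring M N \<inter> extensional (carrier M).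
     \<forall>g\<in>carrier SL2. \<forall>v\<in>carrier M. f (act M g v) = act N g (f v)}"

definition Hom_G :: "('k::field, 'v) gmod \<Rightarrow> ('k, 'w) gmod \<Rightarrow> ('k, 'v \<Rightarrow> 'w) module" where
  "Hom_G M N = \<lparr>carrier = gmod_hom M N, mult = undefined, one = undefined,
     zero = (\<lambda>v\<in>carrier M. \<zero>\<^bsub>N\<^esub>),
     add = (\<lambda>f h. \<lambda>v\<in>carrier M. f v \<oplus>\<^bsub>N\<^esub> h v),
     smult = (\<lambda>c f. \<lambda>v\<in>carrier M. c \<odot>\<^bsub>N\<^esub> f v)\<rparr>"


section \<open>Weyl modules\<close>

text \<open>The Borel subgroup of the negative root: with respect to the diagonal torus, the positive
  root \<open>diag(t, t\<^sup>-\<^sup>1) \<mapsto> t\<^sup>2\<close> has the upper unitriangular root subgroup.\<close>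

definition Borel :: "'k::field mat set" where
  "Borel = {b \<in> carrier SL2. b $$ (0, 1) = 0}"

text \<open>
  The weight \<open>m\<close> is \<open>diag(t, t\<^sup>-\<^sup>1) \<mapsto> t\<^sup>m\<close>, extended to the Borel subgroup by \<open>b \<mapsto> (b $$ (0, 0))\<^sup>m\<close>.
  The induced module consists of the regular functions with \<open>f (g b) = m(b)\<^sup>-\<^sup>1 f g\<close>, on which the
  group acts by left translation.
\<close>

definition ind_B :: "nat \<Rightarrow> ('k::field, 'k mat \<Rightarrow> 'k) gmod" where
  "ind_B m = \<lparr>carrier = {f \<in> coord_ring. \<forall>g\<in>carrier SL2. \<forall>b\<in>Borel.
       f (g \<otimes>\<^bsub>SL2\<^esub> b) = inverse ((b $$ (0, 0)) ^ m) * f g},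
     mult = undefined, one = undefined,
     zero = (\<lambda>x\<in>carrier SL2. 0),
     add = (\<lambda>f h. \<lambda>x\<in>carrier SL2. f x + h x),
     smult = (\<lambda>c f. \<lambda>x\<in>carrier SL2. c * f x),
     act = (\<lambda>g f. \<lambda>x\<in>carrier SL2. f (inv\<^bsub>SL2\<^esub> g \<otimes>\<^bsub>SL2\<^esub> x))\<rparr>"

definition dual :: "('k::field, 'v) gmod \<Rightarrow> ('k, 'v \<Rightarrow> 'k) gmod" where
  "dual M = \<lparr>carrier = {\<phi> \<in> extensional (carrier M).
       (\<forall>u\<in>carrier M. \<forall>v\<in>carrier M. \<phi> (u \<oplus>\<^bsub>M\<^esub> v) = \<phi> u + \<phi> v) \<and>
       (\<forall>c. \<forall>v\<in>carrier M. \<phi> (c \<odot>\<^bsub>M\<^esub> v) = c * \<phi> v)},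
     mult = undefined, one = undefined,
     zero = (\<lambda>v\<in>carrier M. 0),
     add = (\<lambda>\<phi> \<psi>. \<lambda>v\<in>carrier M. \<phi> v + \<psi> v),
     smult = (\<lambda>c \<phi>. \<lambda>v\<in>carrier M. c * \<phi> v),
     act = (\<lambda>g \<phi>. \<lambda>v\<in>carrier M. \<phi> (act M (inv\<^bsub>SL2\<^esub> g) v))\<rparr>"

definition weyl :: "nat \<Rightarrow> ('k::field, ('k mat \<Rightarrow> 'k) \<Rightarrow> 'k) gmod" where
  "weyl m = dual (ind_B m)"


section \<open>Ext groups\<close>

text \<open>
  The type \<open>'u\<close> plays the role of a universe: injectivity is tested against the rational modules
  with carrier in \<open>'u\<close>. Suppose \<open>'k\<close> is infinite. If \<open>'u\<close> has at least the cardinality of \<open>'k\<close>, then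
  every rational module of at most countable dimension has a copy in \<open>'u\<close>; as rational modules are
  locally finite, the finite-dimensional ones suffice to test injectivity, so the notion
  agrees with injectivity in the category of all rational modules, and every rational module of
  at most countable dimension has an injective resolution in \<open>'u\<close>, obtained by repeatedly
  embedding \<open>N\<close> in \<open>N \<otimes> k[G]\<close>. If \<open>'u\<close> is smaller than \<open>'k\<close>, it only carries zero modules and a
  nonzero module has no resolution in \<open>'u\<close>.
\<close>

definition injective_gmod :: "('k::field, 'u) gmod \<Rightarrow> bool" where
  "injective_gmod Q \<longleftrightarrow> rational_gmod Q \<and>
     (\<forall>(M :: ('k, 'u) gmod) (N :: ('k, 'u) gmod) i f.
        rational_gmod M \<and> rational_gmod N \<and>
        i \<in> gmod_hom M N \<and> inj_on i (carrier M) \<and> f \<in> gmod_hom M Q \<longrightarrow>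
        (\<exists>h\<in>gmod_hom N Q. \<forall>v\<in>carrier M. h (i v) = f v))"

definition injective_resolution ::
  "('k::field, 'v) gmod \<Rightarrow> ('v \<Rightarrow> 'u) \<Rightarrow> (nat \<Rightarrow> ('k, 'u) gmod) \<Rightarrow> (nat \<Rightarrow> 'u \<Rightarrow> 'u) \<Rightarrow> bool" where
  "injective_resolution N \<epsilon> I d \<longleftrightarrow>
     (\<forall>n. injective_gmod (I n)) \<and>
     \<epsilon> \<in> gmod_hom N (I 0) \<and> inj_on \<epsilon> (carrier N) \<and>
     (\<forall>n. d n \<in> gmod_hom (I n) (I (Suc n))) \<and>
     \<epsilon> ` carrier N = {v \<in> carrier (I 0). d 0 v = \<zero>\<^bsub>I 1\<^esub>} \<and>
     (\<forall>n. d n ` carrier (I n) = {v \<in> carrier (I (Suc n)). d (Suc n) v = \<zero>\<^bsub>I (Suc (Suc n))\<^esub>})"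

definition quotient_space :: "('k, 'v) module \<Rightarrow> 'v set \<Rightarrow> ('k, 'v set) module" where
  "quotient_space V W = \<lparr>carrier = a_rcosets\<^bsub>V\<^esub> W, mult = undefined, one = undefined,
     zero = W,
     add = (\<lambda>X Y. X <+>\<^bsub>V\<^esub> Y),
     smult = (\<lambda>c X. W <+>\<^bsub>V\<^esub> (\<lambda>x. c \<odot>\<^bsub>V\<^esub> x) ` X)\<rparr>"

definition cocycles ::
  "nat \<Rightarrow> ('k::field, 'v) gmod \<Rightarrow> (nat \<Rightarrow> ('k, 'u) gmod) \<Rightarrow> (nat \<Rightarrow> 'u \<Rightarrow> 'u) \<Rightarrow> ('v \<Rightarrow> 'u) set" where
  "cocycles n M I d =
     {f \<in> carrier (Hom_G M (I n)). compose (carrier M) (d n) f = \<zero>\<^bsub>Hom_G M (I (Suc n))\<^esub>}"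

definition coboundaries ::
  "nat \<Rightarrow> ('k::field, 'v) gmod \<Rightarrow> (nat \<Rightarrow> ('k, 'u) gmod) \<Rightarrow> (nat \<Rightarrow> 'u \<Rightarrow> 'u) \<Rightarrow> ('v \<Rightarrow> 'u) set" where
  "coboundaries n M I d = (case n of
       0 \<Rightarrow> {\<zero>\<^bsub>Hom_G M (I 0)\<^esub>}
     | Suc l \<Rightarrow> compose (carrier M) (d l) ` carrier (Hom_G M (I l)))"

text \<open>\<open>Ext\<^sup>n(M, N)\<close> computed from an injective resolution \<open>(I, d)\<close> of \<open>N\<close>, i.e. the \<open>n\<close>-th
  cohomology of the complex \<open>Hom_G M I\<close>.\<close>

definition Ext_G ::
  "nat \<Rightarrow> ('k::field, 'v) gmod \<Rightarrow> (nat \<Rightarrow> ('k, 'u) gmod) \<Rightarrow> (nat \<Rightarrow> 'u \<Rightarrow> 'u) \<Rightarrow>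
    ('k, ('v \<Rightarrow> 'u) set) module" where
  "Ext_G n M I d =
     quotient_space (Hom_G M (I n)\<lparr>carrier := cocycles n M I d\<rparr>) (coboundaries n M I d)"

end

(*
  Let U be the upper unitriangular group. Its algebra of divided powers is the tensor product of
  the algebras k[u_i]/(u_i^p), u_i = e^(p^i), so the U-invariants of a resolution can be compared
  with the small complex obtained from the periodic resolutions of the factors; its basis elements
  are indexed by finitely supported sequences nu. A G-homomorphism from V(b) is a U-invariant
  vector of weight b. For b >= 0 an injective module has no cohomology of weight b in positive
  degrees, since it is a direct summand of a module of regular functions, where the complex
  reduces to k[x] with the divided derivatives. Dimension shifting along the resolution embeds
  Ext^3_G(V(b), V(a)) into the weight b part of the degree 3 cohomology of V(a). All weight spaces
  of V(a) have dimension at most 1, so that complex is a based complex of scalars, and a discrete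
  Morse matching leaves only few critical cells. Those of degree 3 are
  described by the base p digits of (a - b)/2, and there are at most 3 of them.
*)
theory Submission
  imports Defs
begin

section \<open>The cell complex\<close>

text \<open>One scalar complex is used twice: with indices bounded by the highest weight plus 1 it
  is the Weyl module, with indices bounded by 0 it is k[x]. A cell is critical when its upward move
  has a nonzero coefficient but would leave the range; for the bound 0 congruences exclude this, so
  k[x] is acyclic by the same homotopy that treats the Weyl module. The obstacle to the acyclicity
  of an injective module is that orbit maps on the big cell involve negative powers of the first
  matrix entry. Discarding the negative weights of the orbit map removes them for vectors of
  nonnegative weight; this is where the sign of b enters. The truncated map stays injective, as the
  Weyl element exchanges opposite weights. Lifts through the resolution are arbitrary choices, so a
  cocycle is merely related to coefficient vectors on the critical cells; a linear relation that is
  total and has trivial kernel bounds a dimension as well as an embedding does. The number 3 is a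
  maximum over two cases: at most 2 critical cells with odd active entry if there is none with even
  entry, otherwise at most 1 odd and 2 even ones.\<close>

definition fsupp :: "(nat \<Rightarrow> nat) \<Rightarrow> bool" where
  "fsupp \<nu> \<longleftrightarrow> finite {i. \<nu> i \<noteq> 0}"

definition msize :: "(nat \<Rightarrow> nat) \<Rightarrow> nat" where
  "msize \<nu> = (\<Sum>i | \<nu> i \<noteq> 0. \<nu> i)"

definition inc :: "(nat \<Rightarrow> nat) \<Rightarrow> nat \<Rightarrow> nat \<Rightarrow> nat" where
  "inc \<nu> i = \<nu>(i := Suc (\<nu> i))"

definition dec :: "(nat \<Rightarrow> nat) \<Rightarrow> nat \<Rightarrow> nat \<Rightarrow> nat" where
  "dec \<nu> i = \<nu>(i := \<nu> i - 1)"

text \<open>The Koszul sign of the factor \<open>i\<close> in a tensor product of complexes.\<close>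

definition msign :: "(nat \<Rightarrow> nat) \<Rightarrow> nat \<Rightarrow> 'k::field" where
  "msign \<nu> i = (- 1) ^ (\<Sum>l<i. \<nu> l)"

lemma dec_inc [simp]: "dec (inc \<nu> i) i = \<nu>"
  by (auto simp: inc_def dec_def)

lemma inc_dec [simp]: "\<nu> i \<noteq> 0 \<Longrightarrow> inc (dec \<nu> i) i = \<nu>"
  by (auto simp: inc_def dec_def)

lemma dec_inc_commute: "i \<noteq> l \<Longrightarrow> dec (inc \<nu> i) l = inc (dec \<nu> l) i"
  by (auto simp: inc_def dec_def fun_upd_twist)

lemma dec_dec_commute: "dec (dec \<nu> i) l = dec (dec \<nu> l) i"
  by (cases "i = l") (auto simp: dec_def fun_upd_twist)

lemma fsupp_dec [simp]: "fsupp \<nu> \<Longrightarrow> fsupp (dec \<nu> i)"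
  unfolding fsupp_def dec_def by (rule finite_subset[of _ "insert i {i. \<nu> i \<noteq> 0}"]) auto

lemma fsupp_inc [simp]: "fsupp \<nu> \<Longrightarrow> fsupp (inc \<nu> i)"
  unfolding fsupp_def inc_def by (rule finite_subset[of _ "insert i {i. \<nu> i \<noteq> 0}"]) auto

lemma sum_supp:
  assumes "fsupp \<nu>" "finite A" "{i. \<nu> i \<noteq> 0} \<subseteq> A" "\<And>i. \<nu> i = 0 \<Longrightarrow> h i = (0::'a::comm_monoid_add)"
  shows "(\<Sum>i | \<nu> i \<noteq> 0. h i) = (\<Sum>i\<in>A. h i)"
  using assms by (intro sum.mono_neutral_left) auto

text \<open>The supports of \<open>\<nu>\<close> and \<open>inc \<nu> i\<close> may differ at
  \<open>i\<close>, so both sums are extended to a common index set, where \<open>g\<close> vanishes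
  at 0. The additive form avoids subtraction of natural numbers; it yields both the size and the
  degree of \<open>inc \<nu> i\<close>.\<close>

lemma sum_supp_inc:
  fixes g :: "nat \<Rightarrow> nat \<Rightarrow> nat"
  assumes "fsupp \<nu>" "\<And>i. g 0 i = 0"
  shows "(\<Sum>j | inc \<nu> i j \<noteq> 0. g (inc \<nu> i j) j) + g (\<nu> i) i = (\<Sum>j | \<nu> j \<noteq> 0. g (\<nu> j) j) + g (Suc (\<nu> i)) i"
proof -
  let ?A = "insert i {j. \<nu> j \<noteq> 0}"
  have fin: "finite ?A" using assms by (auto simp: fsupp_def)
  have 1: "(\<Sum>j | inc \<nu> i j \<noteq> 0. g (inc \<nu> i j) j) = (\<Sum>j\<in>?A. g (inc \<nu> i j) j)"
    by (rule sum_supp[OF fsupp_inc[OF assms(1)] fin]) (auto simp: inc_def assms(2) split: if_splits)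
  have 2: "(\<Sum>j | \<nu> j \<noteq> 0. g (\<nu> j) j) = (\<Sum>j\<in>?A. g (\<nu> j) j)"
    by (rule sum_supp) (use assms fin in auto)
  have 3: "(\<Sum>j\<in>?A - {i}. g (inc \<nu> i j) j) = (\<Sum>j\<in>?A - {i}. g (\<nu> j) j)"
    by (rule sum.cong) (auto simp: inc_def)
  show ?thesis unfolding 1 2
    using sum.remove[OF fin, of i "\<lambda>j. g (inc \<nu> i j) j"] sum.remove[OF fin, of i "\<lambda>j. g (\<nu> j) j"] 3
    by (simp add: inc_def)
qed

lemma msize_inc: "fsupp \<nu> \<Longrightarrow> msize (inc \<nu> i) = Suc (msize \<nu>)"
  using sum_supp_inc[of \<nu> "\<lambda>n i. n" i] by (simp add: msize_def)

lemma msize_dec: "fsupp \<nu> \<Longrightarrow> \<nu> i \<noteq> 0 \<Longrightarrow> Suc (msize (dec \<nu> i)) = msize \<nu>"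
  using msize_inc[of "dec \<nu> i" i] by simp

lemma msize_eq_0: "fsupp \<nu> \<Longrightarrow> msize \<nu> = 0 \<longleftrightarrow> \<nu> = (\<lambda>_. 0)"
  by (auto simp: msize_def fsupp_def)

text \<open>The basis element with multi-index \<open>\<nu>\<close> of the minimal resolution of the trivial module over
  the tensor product of the algebras \<open>k[u\<^sub>i]/(u\<^sub>i\<^sup>p)\<close>, with \<open>u\<^sub>i\<close> of degree \<open>p\<^sup>i\<close>, has degree
  \<open>mdeg p \<nu>\<close>. The differential from the factor \<open>i\<close> is alternately \<open>u\<^sub>i\<close> and \<open>u\<^sub>i\<^sup>p\<^sup>-\<^sup>1\<close>.\<close>

definition dg :: "nat \<Rightarrow> nat \<Rightarrow> nat" where
  "dg p n = (n div 2) * p + n mod 2"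

definition mdeg :: "nat \<Rightarrow> (nat \<Rightarrow> nat) \<Rightarrow> nat" where
  "mdeg p \<nu> = (\<Sum>i | \<nu> i \<noteq> 0. dg p (\<nu> i) * p ^ i)"

definition stp :: "nat \<Rightarrow> nat \<Rightarrow> nat \<Rightarrow> nat" where
  "stp p n i = (if even n then 1 else p - 1) * p ^ i"

lemma dg_0 [simp]: "dg p 0 = 0"
  by (simp add: dg_def)

lemma dg_Suc: "p > 0 \<Longrightarrow> dg p (Suc n) = dg p n + (if even n then 1 else p - 1)"
  by (cases p) (auto simp: dg_def elim!: evenE oddE)

lemma mdeg_inc:
  assumes "fsupp \<nu>" "p > 0"
  shows "mdeg p (inc \<nu> i) = mdeg p \<nu> + stp p (\<nu> i) i"
  using sum_supp_inc[OF assms(1), of "\<lambda>n i. dg p n * p ^ i" i] assms(2)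
  by (simp add: mdeg_def dg_Suc stp_def algebra_simps)

lemma mdeg_dec:
  assumes "fsupp \<nu>" "p > 0" "\<nu> i \<noteq> 0"
  shows "mdeg p \<nu> = mdeg p (dec \<nu> i) + stp p (\<nu> i - 1) i"
proof -
  have "dec \<nu> i i = \<nu> i - 1" by (simp add: dec_def)
  then show ?thesis using mdeg_inc[of "dec \<nu> i" p i] assms by simp
qed

text \<open>\<open>cf p n i \<kappa>\<close> is the coefficient with which \<open>u\<^sub>i\<close> (for even \<open>n\<close>) or its power \<open>p - 1\<close> (for odd \<open>n\<close>)
  moves the basis vector \<open>\<kappa> - 1\<close> of a Weyl module; by Lucas, \<open>(K + p\<^sup>i choose p\<^sup>i) = K div p\<^sup>i + 1\<close>
  modulo \<open>p\<close>. Indices \<open>\<kappa> \<le> 0\<close> describe \<open>k[x]\<close> with \<open>u\<^sub>i\<close> acting by divided powers of \<open>d/dx\<close>,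
  where \<open>x\<^sup>j\<close> has index \<open>- j\<close>.\<close>

definition cf :: "nat \<Rightarrow> nat \<Rightarrow> nat \<Rightarrow> int \<Rightarrow> 'k::field" where
  "cf p n i \<kappa> = (if even n then of_int ((\<kappa> - 1) div int p ^ i + 1)
     else (\<Prod>r<p - 1. of_int ((\<kappa> - 1) div int p ^ i + 1 + int r)))"

text \<open>The cochain differential after the basis vectors of the one-dimensional weight spaces
  are stripped off; \<open>\<mu>\<close> is the index belonging to the zero multi-index.\<close>

definition sdiff :: "nat \<Rightarrow> int \<Rightarrow> ((nat \<Rightarrow> nat) \<Rightarrow> 'k::field) \<Rightarrow> (nat \<Rightarrow> nat) \<Rightarrow> 'k" where
  "sdiff p \<mu> c \<nu> =
     (\<Sum>i | \<nu> i \<noteq> 0. msign \<nu> i * (cf p (\<nu> i - 1) i (\<mu> + int (mdeg p (dec \<nu> i))) * c (dec \<nu> i)))"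

text \<open>Below this coordinate neither direction is available: the entry is 0, so nothing can be
  lowered, and divisibility of the index by p^(l+1) makes the coefficient of u_l vanish. For
  \<open>\<nu>\<close> = 0 with index 0 no such coordinate exists; the matching is applied in
  positive degree only.\<close>

definition actv :: "nat \<Rightarrow> int \<Rightarrow> (nat \<Rightarrow> nat) \<Rightarrow> nat" where
  "actv p \<mu> \<nu> = (LEAST i. \<nu> i \<noteq> 0 \<or> \<not> int p ^ Suc i dvd \<mu> + int (mdeg p \<nu>))"

text \<open>Such cells are matched with their upper neighbour in the active coordinate. The
  \<open>itself\<close> argument names the field in which the coefficient is tested.\<close>

definition mup :: "'k::field itself \<Rightarrow> nat \<Rightarrow> int \<Rightarrow> int \<Rightarrow> (nat \<Rightarrow> nat) \<Rightarrow> bool" where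
  "mup _ p \<alpha> \<mu> \<nu> \<longleftrightarrow> (let i = actv p \<mu> \<nu> in
     (cf p (\<nu> i) i (\<mu> + int (mdeg p \<nu>)) :: 'k) \<noteq> 0 \<and> \<mu> + int (mdeg p \<nu>) + int (stp p (\<nu> i) i) \<le> \<alpha>)"

definition mdown :: "'k::field itself \<Rightarrow> nat \<Rightarrow> int \<Rightarrow> (nat \<Rightarrow> nat) \<Rightarrow> bool" where
  "mdown _ p \<mu> \<nu> \<longleftrightarrow> (let i = actv p \<mu> \<nu> in
     \<nu> i \<noteq> 0 \<and> (cf p (\<nu> i - 1) i (\<mu> + int (mdeg p (dec \<nu> i))) :: 'k) \<noteq> 0)"

definition hcoef :: "nat \<Rightarrow> int \<Rightarrow> int \<Rightarrow> (nat \<Rightarrow> nat) \<Rightarrow> 'k::field" where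
  "hcoef p \<alpha> \<mu> \<nu> = (let i = actv p \<mu> \<nu> in
     if mup TYPE('k) p \<alpha> \<mu> \<nu> then inverse (cf p (\<nu> i) i (\<mu> + int (mdeg p \<nu>))) else 0)"

section \<open>Arithmetic of the coefficients modulo p\<close>

locale odd_char =
  fixes p :: nat and T :: "'k::field itself"
  assumes prime_p: "prime p" and odd_p: "odd p" and char_k: "CHAR('k) = p"
begin

lemma p_ge3: "p \<ge> 3"
proof -
  have "p \<ge> 2" using prime_p by (rule prime_ge_2_nat)
  moreover have "p \<noteq> 2" using odd_p by auto
  ultimately show ?thesis by simp
qed

lemma p_pos [simp]: "p > 0"
  using p_ge3 by simp

lemma p_neq_0 [simp]: "p \<noteq> 0"
  using p_ge3 by simp

lemma of_int_eq_0: "of_int x = (0::'k) \<longleftrightarrow> int p dvd x"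
  using of_int_eq_0_iff_char_dvd[where 'a='k] char_k by auto

text \<open>Since p^i x - 1 = p^i (x - 1) + (p^i - 1), the lowest i digits of the basis index are
  all p - 1 and drop out on division. This is why indices are shifted by 1: for an index p^i x the
  coefficient of u_i becomes simply x.\<close>

lemma pow_div_shift:
  assumes "i \<le> l"
  shows "(int p ^ i * x - 1) div int p ^ l = (x - 1) div int p ^ (l - i)"
proof -
  have "int p ^ l = int p ^ i * int p ^ (l - i)"
    using assms by (metis power_add le_add_diff_inverse)
  moreover have "(int p ^ i * x - 1) div int p ^ i = x - 1"
  proof -
    have "int p ^ i * x - 1 = int p ^ i * (x - 1) + (int p ^ i - 1)" by (simp add: algebra_simps)
    moreover have "(int p ^ i - 1) div int p ^ i = 0"
      using p_pos by (intro div_pos_pos_trivial) auto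
    moreover have "(int p ^ i * (x - 1) + (int p ^ i - 1)) div int p ^ i = x - 1 + (int p ^ i - 1) div int p ^ i"
      using p_pos by (intro div_mult_self4) simp
    ultimately show ?thesis by (simp only: add_0_right)
  qed
  ultimately show ?thesis using zdiv_zmult2_eq[of "int p ^ (l - i)" "int p ^ i * x - 1" "int p ^ i"] by simp
qed

lemma cf_even: "even n \<Longrightarrow> cf p n i (int p ^ i * x) = (of_int x :: 'k)"
  using pow_div_shift[of i i x] by (simp add: cf_def)

lemma cf_odd: "odd n \<Longrightarrow> cf p n i (int p ^ i * x) = (\<Prod>r<p - 1. of_int (x + int r) :: 'k)"
  using pow_div_shift[of i i x] by (simp add: cf_def)

lemma cf_even_0: "even n \<Longrightarrow> (cf p n i (int p ^ i * x) :: 'k) = 0 \<longleftrightarrow> int p dvd x"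
  by (simp add: cf_even of_int_eq_0 del: of_int_add)

text \<open>The p - 1 consecutive integers x, ..., x + p - 2 omit exactly one residue class modulo
  p, that of x - 1; their product is nonzero only if the omitted class is 0.\<close>

lemma cf_odd_0:
  assumes "odd n"
  shows "(cf p n i (int p ^ i * x) :: 'k) \<noteq> 0 \<longleftrightarrow> int p dvd x - 1"
proof -
  have "(cf p n i (int p ^ i * x) :: 'k) = 0 \<longleftrightarrow> (\<exists>r<p - 1. int p dvd x + int r)"
    using assms by (auto simp: cf_odd of_int_eq_0 simp del: of_int_add)
  also have "\<dots> \<longleftrightarrow> \<not> int p dvd x - 1"
  proof
    assume "\<exists>r<p - 1. int p dvd x + int r"
    then obtain r where r: "r < p - 1" "int p dvd x + int r" by auto
    show "\<not> int p dvd x - 1"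
    proof
      assume "int p dvd x - 1"
      then have "int p dvd (x + int r) - (x - 1)" using r(2) dvd_diff by blast
      then have "int p dvd int (Suc r)" by (simp add: algebra_simps)
      then have "p dvd Suc r" by (simp only: int_dvd_int_iff)
      then show False using r(1) by (auto dest: dvd_imp_le)
    qed
  next
    assume n: "\<not> int p dvd x - 1"
    \<comment> \<open>The residue in 0..p-1 for which p divides x + r; the assumption excludes its
      largest value p - 1.\<close>
    define r where "r = nat ((- x) mod int p)"
    have r0: "int r = (- x) mod int p" unfolding r_def using p_pos by (intro nat_0_le pos_mod_sign) simp
    have "int r < int p" unfolding r0 using p_pos by (intro pos_mod_bound) simp
    then have "r < p" by simp
    have d: "int p dvd x + int r" unfolding r0
      using mod_add_right_eq[of x "- x" "int p"] by (simp add: dvd_eq_mod_eq_0)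
    have "r \<noteq> p - 1"
    proof
      assume "r = p - 1"
      then have "int p dvd x + int p - 1" using d p_pos by (simp add: of_nat_diff algebra_simps)
      then have "int p dvd x - 1 + int p" by (simp add: algebra_simps)
      then show False using n by simp
    qed
    then show "\<exists>r<p - 1. int p dvd x + int r" using d \<open>r < p\<close> by (intro exI[of _ r]) auto
  qed
  finally show ?thesis by blast
qed

text \<open>A multiple of p^(i+1) changes the quotient by p^i by a multiple of p, so the coefficient
  sees the index only modulo p^(i+1).\<close>

lemma cf_cong_mult:
  assumes "int p ^ Suc i dvd y"
  shows "cf p n i (\<kappa> + y) = (cf p n i \<kappa> :: 'k)"
proof -
  obtain z where "y = int p ^ Suc i * z" using assms by (elim dvdE)
  then have z: "y = int p ^ i * (int p * z)" by (simp add: mult_ac)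
  have "(\<kappa> + y - 1) div int p ^ i = (\<kappa> - 1 + int p ^ i * (int p * z)) div int p ^ i"
    by (simp add: z algebra_simps)
  also have "\<dots> = (\<kappa> - 1) div int p ^ i + int p * z"
    using p_pos by simp
  finally have *: "(\<kappa> + y - 1) div int p ^ i = (\<kappa> - 1) div int p ^ i + int p * z" .
  have p0: "of_int (int p * z) = (0::'k)" by (subst of_int_eq_0) simp
  show ?thesis unfolding cf_def * using p0 by (simp add: add_ac del: of_int_mult)
qed

lemma stp_odd: "odd n \<Longrightarrow> int (stp p n i) = (int p - 1) * int p ^ i"
  using p_pos by (auto simp: stp_def int_ops(6))

text \<open>A nonzero coefficient means that the move causes no carry out of digit i of the basis
  index: in the even case this digit is not p - 1, in the odd case it is 0. The higher digits, on
  which the coefficients of the coordinates l > i depend, therefore do not change.\<close>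

lemma cf_no_carry:
  assumes "i < l" "(cf p n i (int p ^ i * x) :: 'k) \<noteq> 0"
  shows "cf p m l (int p ^ i * x + int (stp p n i)) = (cf p m l (int p ^ i * x) :: 'k)"
proof -
  define d where "d = l - i"
  have d: "d > 0" "i \<le> l" using assms by (auto simp: d_def)
  then obtain d' where d': "d = Suc d'" by (cases d) auto
  have "(int p ^ i * x + int (stp p n i) - 1) div int p ^ l = (int p ^ i * x - 1) div int p ^ l"
  proof (cases "even n")
    case True
    then have nd: "\<not> int p dvd x" using assms cf_even_0 by blast
    have "int p ^ i * x + int (stp p n i) = int p ^ i * (x + 1)" using True by (simp add: stp_def algebra_simps)
    then have "(int p ^ i * x + int (stp p n i) - 1) div int p ^ l = x div int p ^ d"
      using pow_div_shift[OF d(2), of "x + 1"] d_def by simp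
    moreover have "x div int p ^ d = (x - 1) div int p ^ d"
    proof -
      have *: "x mod int p ^ d \<noteq> 0" using nd d'
        using dvd_power[of d "int p"] d(1) by (auto simp: dvd_eq_mod_eq_0[symmetric] dest: dvd_trans[rotated])
      have pp: "int p ^ d > 0" using p_pos by simp
      have e: "x - 1 = int p ^ d * (x div int p ^ d) + (x mod int p ^ d - 1)"
        using mult_div_mod_eq[of "int p ^ d" x] by linarith
      have "(x mod int p ^ d - 1) div int p ^ d = 0"
        using * pp pos_mod_sign[OF pp, of x] pos_mod_bound[OF pp, of x] by (intro div_pos_pos_trivial) linarith+
      moreover have "(int p ^ d * (x div int p ^ d) + (x mod int p ^ d - 1)) div int p ^ d
          = x div int p ^ d + (x mod int p ^ d - 1) div int p ^ d"
        using pp by (intro div_mult_self4) simp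
      ultimately show ?thesis by (simp only: add_0_right flip: e)
    qed
    ultimately show ?thesis using pow_div_shift[OF d(2), of x] d_def by simp
  next
    case False
    then have "int p dvd x - 1" using assms cf_odd_0 by blast
    then obtain y where "x - 1 = int p * y" by (elim dvdE)
    then have y: "x = int p * y + 1" by simp
    have "int p ^ i * x + int (stp p n i) = int p ^ i * (x + int p - 1)"
      using False by (simp add: stp_odd algebra_simps)
    then have "(int p ^ i * x + int (stp p n i) - 1) div int p ^ l = (int p * y + int p - 1) div (int p * int p ^ d')"
      using pow_div_shift[OF d(2), of "x + int p - 1"] d_def d' y by (metis add.commute add_diff_cancel_right' diff_add_eq power_Suc)
    also have "\<dots> = (int p * y + (int p - 1)) div int p div int p ^ d'"
      by (subst zdiv_zmult2_eq) (auto simp: algebra_simps)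
    also have "(int p * y + (int p - 1)) div int p = y"
    proof -
      have "(int p - 1) div int p = 0" using p_pos by (intro div_pos_pos_trivial) auto
      then show ?thesis using p_pos by simp
    qed
    also have "y div int p ^ d' = (x - 1) div int p ^ d"
      unfolding y d' by (simp add: p_pos[THEN less_imp_neq, symmetric])
    finally show ?thesis using pow_div_shift[OF d(2), of x] d_def by simp
  qed
  then show ?thesis unfolding cf_def by simp
qed

text \<open>The relation u_i^p = 0 on coefficients: the first move is nonzero under exactly the
  congruence under which the second vanishes.\<close>

lemma cf_cf_0: "int p ^ i dvd \<kappa> \<Longrightarrow> cf p n i \<kappa> * cf p (Suc n) i (\<kappa> + int (stp p n i)) = (0 :: 'k)"
proof -
  assume "int p ^ i dvd \<kappa>"
  then obtain x where x: "\<kappa> = int p ^ i * x" by (elim dvdE)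
  show ?thesis
  proof (cases "even n")
    case True
    have "\<kappa> + int (stp p n i) = int p ^ i * (x + 1)" using True x by (simp add: stp_def algebra_simps)
    then have "(cf p (Suc n) i (\<kappa> + int (stp p n i)) :: 'k) \<noteq> 0 \<longleftrightarrow> int p dvd x"
      using cf_odd_0[of "Suc n" i "x + 1"] True by simp
    moreover have "(cf p n i \<kappa> :: 'k) = 0 \<longleftrightarrow> int p dvd x" using cf_even_0[OF True] x by simp
    ultimately show ?thesis by auto
  next
    case False
    have "\<kappa> + int (stp p n i) = int p ^ i * (x - 1 + int p)" using False x
      by (simp add: stp_odd algebra_simps)
    then have "(cf p (Suc n) i (\<kappa> + int (stp p n i)) :: 'k) = 0 \<longleftrightarrow> int p dvd x - 1"
      using cf_even_0[of "Suc n" i "x - 1 + int p"] False by simp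
    moreover have "(cf p n i \<kappa> :: 'k) \<noteq> 0 \<longleftrightarrow> int p dvd x - 1" using cf_odd_0[OF False] x by simp
    ultimately show ?thesis by auto
  qed
qed

lemma stp_dvd: "int p ^ l dvd int (stp p n l)"
  by (simp add: stp_def)

text \<open>Moves in higher coordinates preserve the index modulo p^(i+1), hence also whether
  \<open>i\<close> is active and with which coefficient.\<close>

lemma stp_dvd_Suc: "i < l \<Longrightarrow> int p ^ Suc i dvd int (stp p n l)"
  by (rule dvd_trans[OF le_imp_power_dvd[of "Suc i" l] stp_dvd]) simp

section \<open>Cells, active coordinates and the contracting homotopy\<close>

definition cell :: "int \<Rightarrow> int \<Rightarrow> nat \<Rightarrow> (nat \<Rightarrow> nat) \<Rightarrow> bool" where
  "cell \<alpha> \<mu> q \<nu> \<longleftrightarrow> fsupp \<nu> \<and> msize \<nu> = q \<and> \<mu> + int (mdeg p \<nu>) \<le> \<alpha>"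

lemma actv_props:
  fixes \<mu> :: int
  assumes "\<nu> \<noteq> (\<lambda>_. 0)"
  defines "i \<equiv> actv p \<mu> \<nu>"
  shows "\<nu> i \<noteq> 0 \<or> \<not> int p ^ Suc i dvd \<mu> + int (mdeg p \<nu>)"
    and "l < i \<Longrightarrow> \<nu> l = 0"
    and "l \<le> i \<Longrightarrow> int p ^ l dvd \<mu> + int (mdeg p \<nu>)"
proof -
  have "\<exists>j. \<nu> j \<noteq> 0" using assms by auto
  then obtain j where j: "\<nu> j \<noteq> 0 \<or> \<not> int p ^ Suc j dvd \<mu> + int (mdeg p \<nu>)" by auto
  show "\<nu> i \<noteq> 0 \<or> \<not> int p ^ Suc i dvd \<mu> + int (mdeg p \<nu>)"
    unfolding i_def actv_def by (rule LeastI[where P = "\<lambda>i. \<nu> i \<noteq> 0 \<or> \<not> int p ^ Suc i dvd \<mu> + int (mdeg p \<nu>)", OF j])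
  have less: "\<nu> l = 0 \<and> int p ^ Suc l dvd \<mu> + int (mdeg p \<nu>)" if "l < i" for l
    using not_less_Least[OF that[unfolded i_def actv_def]] by simp
  then show "l < i \<Longrightarrow> \<nu> l = 0" by simp
  show "int p ^ l dvd \<mu> + int (mdeg p \<nu>)" if "l \<le> i"
  proof (cases l)
    case (Suc m)
    then show ?thesis using less[of m] that by simp
  qed simp
qed

lemma actv_eqI:
  assumes "\<nu> i \<noteq> 0 \<or> \<not> int p ^ Suc i dvd \<mu> + int (mdeg p \<nu>)"
    and "\<And>l. l < i \<Longrightarrow> \<nu> l = 0" and "int p ^ i dvd \<mu> + int (mdeg p \<nu>)"
  shows "actv p \<mu> \<nu> = i"
  unfolding actv_def
proof (rule Least_equality[where P = "\<lambda>i. \<nu> i \<noteq> 0 \<or> \<not> int p ^ Suc i dvd \<mu> + int (mdeg p \<nu>)", OF assms(1)])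
  fix y assume y: "\<nu> y \<noteq> 0 \<or> \<not> int p ^ Suc y dvd \<mu> + int (mdeg p \<nu>)"
  show "i \<le> y"
  proof (rule ccontr)
    assume "\<not> i \<le> y"
    then have "\<nu> y = 0" "int p ^ Suc y dvd \<mu> + int (mdeg p \<nu>)"
      using assms(2,3) le_imp_power_dvd[of "Suc y" i "int p"] by (auto dest: dvd_trans)
    then show False using y by simp
  qed
qed

text \<open>\<open>hcoef\<close> defines a contracting homotopy away from the cells that are neither \<open>mup\<close> nor
  \<open>mdown\<close>; this is a discrete Morse matching of \<open>\<nu>\<close> with \<open>inc \<nu> i\<close> in the least possible
  coordinate \<open>i\<close>.\<close>

lemma morse:
  fixes c :: "(nat \<Rightarrow> nat) \<Rightarrow> 'k"
  assumes cocycle: "\<And>\<nu>. cell \<alpha> \<mu> (Suc q) \<nu> \<Longrightarrow> sdiff p \<mu> c \<nu> = 0"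
    and \<nu>: "cell \<alpha> \<mu> q \<nu>" and q: "q > 0"
    and matched: "mup T p \<alpha> \<mu> \<nu> \<or> mdown T p \<mu> \<nu>"
  shows "sdiff p \<mu> (\<lambda>\<nu>. hcoef p \<alpha> \<mu> \<nu> * c (inc \<nu> (actv p \<mu> \<nu>))) \<nu> = c \<nu>"
proof -
  define i where "i = actv p \<mu> \<nu>"
  define \<kappa> where "\<kappa> = \<mu> + int (mdeg p \<nu>)"
  define kd where "kd l = \<mu> + int (mdeg p (dec \<nu> l))" for l
  define h where "h = (\<lambda>\<nu>. hcoef p \<alpha> \<mu> \<nu> * c (inc \<nu> (actv p \<mu> \<nu>)))"
  have fs: "fsupp \<nu>" and sz: "msize \<nu> = q" and le: "\<kappa> \<le> \<alpha>" using \<nu> by (auto simp: cell_def \<kappa>_def)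
  have nz: "\<nu> \<noteq> (\<lambda>_. 0)" using q sz msize_eq_0[OF fs] by auto
  note act = actv_props[OF nz, where \<mu> = \<mu>, folded i_def, folded \<kappa>_def]
  have kd: "\<kappa> = kd l + int (stp p (\<nu> l - 1) l)" if "\<nu> l \<noteq> 0" for l
    using mdeg_dec[of \<nu> p l] that fs by (simp add: \<kappa>_def kd_def)
  have ge: "l \<ge> i" if "\<nu> l \<noteq> 0" for l using act(2)[of l] that by (meson not_le)
  define S where "S = {l. \<nu> l \<noteq> 0 \<and> l \<noteq> i}"
  have finS: "finite S" using fs by (auto simp: S_def fsupp_def)
  have Sgt: "l > i" "\<nu> l \<noteq> 0" if "l \<in> S" for l using that ge[of l] by (auto simp: S_def)
  have pi: "int p ^ i dvd \<kappa>" using act(3)[of i] by simp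
  obtain x where x: "\<kappa> = int p ^ i * x" using pi by (elim dvdE)
  \<comment> \<open>Lowering a coordinate above \<open>i\<close> changes the index by a multiple of
    p^(i+1), so \<open>\<nu>\<close> and \<open>dec \<nu> l\<close> share the active coordinate and
    its coefficient.\<close>
  have kdS: "int p ^ i dvd kd l" "(int p ^ Suc i dvd kd l) = (int p ^ Suc i dvd \<kappa>)"
    "(cf p n i (kd l) :: 'k) = cf p n i \<kappa>" if "l \<in> S" for l n
  proof -
    have d: "int p ^ Suc i dvd int (stp p (\<nu> l - 1) l)" using stp_dvd_Suc[OF Sgt(1)[OF that]] .
    have e: "\<kappa> = kd l + int (stp p (\<nu> l - 1) l)" using kd Sgt(2)[OF that] by simp
    show "(int p ^ Suc i dvd kd l) = (int p ^ Suc i dvd \<kappa>)" unfolding e using d by (metis dvd_add_left_iff)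
    show "(cf p n i (kd l) :: 'k) = cf p n i \<kappa>" unfolding e using cf_cong_mult[OF d] by simp
    have "int p ^ i dvd int (stp p (\<nu> l - 1) l)" using d by (meson dvd_trans le_imp_power_dvd le_SucI order_refl)
    then show "int p ^ i dvd kd l" using pi unfolding e by (metis dvd_add_left_iff)
  qed
  have decS: "dec \<nu> l i = \<nu> i" "\<And>j. j < i \<Longrightarrow> dec \<nu> l j = 0" if "l \<in> S" for l
    using Sgt[OF that] act(2) by (auto simp: dec_def)
  have actS: "actv p \<mu> (dec \<nu> l) = i" if "l \<in> S" for l
    by (rule actv_eqI) (use kdS[OF that] decS[OF that] act(1) in \<open>auto simp: kd_def\<close>)
  have sgn_i: "msign \<nu> i = (1::'k)" using act(2) by (simp add: msign_def)
  have split: "sdiff p \<mu> f \<nu> = (if \<nu> i \<noteq> 0 then cf p (\<nu> i - 1) i (kd i) * f (dec \<nu> i) else 0)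
      + (\<Sum>l\<in>S. msign \<nu> l * (cf p (\<nu> l - 1) l (kd l) * f (dec \<nu> l)))" for f :: "(nat \<Rightarrow> nat) \<Rightarrow> 'k"
  proof (cases "\<nu> i = 0")
    case True
    then have "{l. \<nu> l \<noteq> 0} = S" by (auto simp: S_def)
    then show ?thesis using True by (simp add: sdiff_def kd_def)
  next
    case False
    then have "{l. \<nu> l \<noteq> 0} = insert i S" "i \<notin> S" by (auto simp: S_def)
    then show ?thesis using False finS sgn_i by (simp add: sdiff_def kd_def)
  qed
  show ?thesis
  proof (cases "mup T p \<alpha> \<mu> \<nu>")
    case True
    define C where "C = (cf p (\<nu> i) i \<kappa> :: 'k)"
    have C: "C \<noteq> 0" and st: "\<kappa> + int (stp p (\<nu> i) i) \<le> \<alpha>"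
      using True by (auto simp: mup_def Let_def i_def \<kappa>_def C_def)
    \<comment> \<open>If \<open>\<nu>\<close> can be raised in \<open>i\<close> with a nonzero
      coefficient, then u_i^p = 0 kills the coefficient leading into \<open>\<nu>\<close> from
      \<open>dec \<nu> i\<close>.\<close>
    have noi: "cf p (\<nu> i - 1) i (kd i) = (0::'k)" if "\<nu> i \<noteq> 0"
    proof -
      have "int p ^ i dvd kd i" using pi kd[OF that] stp_dvd by (metis dvd_add_left_iff)
      then have "cf p (\<nu> i - 1) i (kd i) * (cf p (Suc (\<nu> i - 1)) i (kd i + int (stp p (\<nu> i - 1) i)) :: 'k) = 0"
        by (rule cf_cf_0)
      then show ?thesis using that C kd[OF that] by (simp add: C_def)
    qed
    have hS: "h (dec \<nu> l) = inverse C * c (dec (inc \<nu> i) l)" if l: "l \<in> S" for l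
    proof -
      have kl: "kd l + int (stp p (\<nu> i) i) \<le> \<alpha>" using st kd[OF Sgt(2)[OF l]] by simp
      have "mup TYPE('k) p \<alpha> \<mu> (dec \<nu> l)"
        unfolding mup_def Let_def actS[OF l] decS(1)[OF l] kd_def[symmetric] using kdS(3)[OF l] C kl by (simp add: C_def)
      then have "hcoef p \<alpha> \<mu> (dec \<nu> l) = inverse C"
        unfolding hcoef_def Let_def actS[OF l] decS(1)[OF l] kd_def[symmetric] using kdS(3)[OF l] by (simp add: C_def)
      then show ?thesis using dec_inc_commute[of i l \<nu>] Sgt[OF l] by (simp add: h_def actS[OF l])
    qed
    \<comment> \<open>The cocycle condition at \<open>inc \<nu> i\<close> has
      \<open>C * c \<nu>\<close> as its term at \<open>i\<close>; its other terms are, up to the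
      factor -C, those of the differential of the homotopy at \<open>\<nu>\<close>.\<close>
    have "cell \<alpha> \<mu> (Suc q) (inc \<nu> i)"
      using fs sz st by (simp add: cell_def msize_inc mdeg_inc \<kappa>_def algebra_simps)
    then have "0 = sdiff p \<mu> c (inc \<nu> i)" using cocycle by simp
    also have "{l. inc \<nu> i l \<noteq> 0} = insert i S" by (auto simp: inc_def S_def)
    then have "sdiff p \<mu> c (inc \<nu> i) = (\<Sum>l\<in>insert i S. msign (inc \<nu> i) l *
        (cf p (inc \<nu> i l - 1) l (\<mu> + int (mdeg p (dec (inc \<nu> i) l))) * c (dec (inc \<nu> i) l)))"
      by (simp only: sdiff_def)
    also have "\<dots> = C * c \<nu> + (\<Sum>l\<in>S. msign (inc \<nu> i) l *
        (cf p (inc \<nu> i l - 1) l (\<mu> + int (mdeg p (dec (inc \<nu> i) l))) * c (dec (inc \<nu> i) l)))"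
    proof -
      have "i \<notin> S" by (simp add: S_def)
      moreover have "msign (inc \<nu> i) i = (1::'k)" using act(2) by (simp add: msign_def inc_def)
      ultimately show ?thesis using finS by (simp add: C_def \<kappa>_def) (simp add: inc_def)
    qed
    also have "(\<Sum>l\<in>S. msign (inc \<nu> i) l *
        (cf p (inc \<nu> i l - 1) l (\<mu> + int (mdeg p (dec (inc \<nu> i) l))) * c (dec (inc \<nu> i) l)))
      = (\<Sum>l\<in>S. - (C * (msign \<nu> l * (cf p (\<nu> l - 1) l (kd l) * h (dec \<nu> l)))))"
    proof (rule sum.cong[OF refl])
      fix l assume l: "l \<in> S"
      \<comment> \<open>Raising a coordinate below \<open>l\<close> by one flips the Koszul sign at
        \<open>l\<close>.\<close>
      have "i \<in> {..<l}" using Sgt[OF l] by simp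
      then have s: "msign (inc \<nu> i) l = - (msign \<nu> l :: 'k)"
        by (simp add: msign_def inc_def sum.remove[of "{..<l}" i] sum.remove[of "{..<l}" i \<nu>])
      obtain y where y: "kd l = int p ^ i * y" using kdS(1)[OF l] by (elim dvdE)
      have m: "mdeg p (dec (inc \<nu> i) l) = mdeg p (dec \<nu> l) + stp p (\<nu> i) i"
        using dec_inc_commute[of i l \<nu>] Sgt[OF l] mdeg_inc[of "dec \<nu> l" p i] fs decS(1)[OF l] by simp
      have "cf p (\<nu> l - 1) l (kd l + int (stp p (\<nu> i) i)) = (cf p (\<nu> l - 1) l (kd l) :: 'k)"
        unfolding y by (rule cf_no_carry) (use Sgt[OF l] C kdS(3)[OF l] in \<open>auto simp: C_def y\<close>)
      moreover have "inc \<nu> i l = \<nu> l" using Sgt[OF l] by (simp add: inc_def)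
      ultimately have "cf p (inc \<nu> i l - 1) l (\<mu> + int (mdeg p (dec (inc \<nu> i) l))) = (cf p (\<nu> l - 1) l (kd l) :: 'k)"
        by (simp add: m kd_def add_ac)
      then show "msign (inc \<nu> i) l *
        (cf p (inc \<nu> i l - 1) l (\<mu> + int (mdeg p (dec (inc \<nu> i) l))) * c (dec (inc \<nu> i) l))
       = - (C * (msign \<nu> l * (cf p (\<nu> l - 1) l (kd l) * h (dec \<nu> l))))"
        using C s by (simp add: hS[OF l] field_simps)
    qed
    also have "\<dots> = - (C * (\<Sum>l\<in>S. msign \<nu> l * (cf p (\<nu> l - 1) l (kd l) * h (dec \<nu> l))))"
      by (simp add: sum_negf sum_distrib_left)
    finally have "C * c \<nu> - C * (\<Sum>l\<in>S. msign \<nu> l * (cf p (\<nu> l - 1) l (kd l) * h (dec \<nu> l))) = 0"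
      by (simp only: diff_conv_add_uminus)
    then have "C * c \<nu> = C * (\<Sum>l\<in>S. msign \<nu> l * (cf p (\<nu> l - 1) l (kd l) * h (dec \<nu> l)))"
      by (simp only: right_minus_eq)
    then have "(\<Sum>l\<in>S. msign \<nu> l * (cf p (\<nu> l - 1) l (kd l) * h (dec \<nu> l))) = c \<nu>"
      by (simp only: mult_left_cancel[OF C])
    then show ?thesis unfolding h_def[symmetric] split using noi by simp
  next
    case False
    then have "mdown T p \<mu> \<nu>" using matched by simp
    then have ni: "\<nu> i \<noteq> 0" and C: "(cf p (\<nu> i - 1) i (kd i) :: 'k) \<noteq> 0"
      by (auto simp: mdown_def Let_def i_def kd_def)
    have pk: "int p ^ i dvd kd i" using pi kd[OF ni] stp_dvd by (metis dvd_add_left_iff)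
    then obtain y where y: "kd i = int p ^ i * y" by (elim dvdE)
    \<comment> \<open>If the entry drops to 0, then \<open>i\<close> stays active because the
      nonzero coefficient excludes divisibility of the index by p^(i+1).\<close>
    have ai: "actv p \<mu> (dec \<nu> i) = i"
    proof (rule actv_eqI)
      show "dec \<nu> i i \<noteq> 0 \<or> \<not> int p ^ Suc i dvd \<mu> + int (mdeg p (dec \<nu> i))"
      proof (cases "\<nu> i = 1")
        case True
        then have "\<not> int p dvd y" using C cf_even_0[of 0 i y] by (simp add: y)
        then show ?thesis using p_pos by (simp add: kd_def[symmetric] y)
      next
        case False
        then show ?thesis using ni by (simp add: dec_def)
      qed
    qed (use act(2) pk in \<open>auto simp: dec_def kd_def\<close>)
    have d: "dec \<nu> i i = \<nu> i - 1" by (simp add: dec_def)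
    have "mup TYPE('k) p \<alpha> \<mu> (dec \<nu> i)"
      unfolding mup_def Let_def ai d kd_def[symmetric] using C kd[OF ni] le by simp
    then have hi: "h (dec \<nu> i) = inverse (cf p (\<nu> i - 1) i (kd i)) * c \<nu>"
      using ni by (simp add: h_def hcoef_def Let_def ai d kd_def)
    \<comment> \<open>No other term survives: \<open>dec \<nu> l\<close> has the same upward
      coefficient as \<open>\<nu>\<close>, and this is 0 because \<open>\<nu>\<close> is reached
      from below with a nonzero one.\<close>
    have "h (dec \<nu> l) = 0" if l: "l \<in> S" for l
    proof -
      have "cf p (\<nu> i - 1) i (kd i) * (cf p (Suc (\<nu> i - 1)) i (kd i + int (stp p (\<nu> i - 1) i)) :: 'k) = 0"
        using pk by (rule cf_cf_0)
      then have "(cf p (\<nu> i) i \<kappa> :: 'k) = 0" using C kd[OF ni] ni by simp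
      then have "\<not> mup TYPE('k) p \<alpha> \<mu> (dec \<nu> l)"
        unfolding mup_def Let_def actS[OF l] decS(1)[OF l] kd_def[symmetric] using kdS(3)[OF l] by simp
      then show ?thesis by (simp add: h_def hcoef_def)
    qed
    then show ?thesis unfolding h_def[symmetric] split using ni C hi by simp
  qed
qed

end

section \<open>Counting the critical cells\<close>

context odd_char
begin

section \<open>Base p digits and the possible tails of critical cells\<close>

definition dig :: "nat \<Rightarrow> nat \<Rightarrow> nat" where
  "dig n j = (n div p ^ j) mod p"

text \<open>Summing over j < n reaches all digits, because n < p^n.\<close>

definition dsum :: "nat \<Rightarrow> nat" where
  "dsum n = (\<Sum>j<n. dig n j)"

lemma dig_div: "dig (n div p ^ i) j = dig n (i + j)"
  by (simp add: dig_def power_add div_mult2_eq)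

lemma dig_0: "j \<ge> n \<Longrightarrow> dig n j = 0"
proof -
  assume "j \<ge> n"
  have "n < 2 ^ n" by (rule less_exp)
  also have "\<dots> \<le> p ^ n" using p_ge3 by (intro power_mono) auto
  also have "p ^ n \<le> p ^ j" using \<open>j \<ge> n\<close> p_pos by (intro power_increasing) (auto simp: Suc_le_eq)
  finally show ?thesis by (simp add: dig_def)
qed

lemma dsum_eq: "N \<ge> n \<Longrightarrow> dsum n = (\<Sum>j<N. dig n j)"
  unfolding dsum_def by (rule sum.mono_neutral_left) (auto simp: dig_0)

lemma dsum_rec: "dsum n = n mod p + dsum (n div p)"
proof -
  have "dsum n = (\<Sum>j<Suc n. dig n j)" by (rule dsum_eq) simp
  also have "\<dots> = dig n 0 + (\<Sum>j<n. dig n (Suc j))" by (rule sum.lessThan_Suc_shift)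
  also have "(\<Sum>j<n. dig n (Suc j)) = (\<Sum>j<n. dig (n div p) j)" using dig_div[of n 1] by simp
  also have "\<dots> = dsum (n div p)" by (rule dsum_eq[symmetric]) simp
  finally show ?thesis by (simp add: dig_def)
qed

lemma dsum_div_Suc: "dsum (n div p ^ i) = dig n i + dsum (n div p ^ Suc i)"
proof -
  have "n div p ^ i div p = n div p ^ Suc i"
    by (simp add: div_mult2_eq[symmetric] mult.commute)
  then show ?thesis using dsum_rec[of "n div p ^ i"] by (simp add: dig_def)
qed

lemma dsum_div_mono: "i \<le> j \<Longrightarrow> dsum (n div p ^ j) \<le> dsum (n div p ^ i)"
proof (induction rule: dec_induct)
  case (step m)
  then show ?case using dsum_div_Suc[of n m] by linarith
qed simp

text \<open>Uniqueness of the base p expansion, by splitting off the lowest digit.\<close>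

lemma dig_sum:
  "(\<And>j. F j < p) \<Longrightarrow> (\<And>j. j \<ge> N \<Longrightarrow> F j = 0) \<Longrightarrow> dig (\<Sum>j<N. F j * p ^ j) = F"
proof (induction N arbitrary: F)
  case 0
  then show ?case by (auto simp: dig_def)
next
  case (Suc N)
  define m where "m = (\<Sum>j<N. F (Suc j) * p ^ j)"
  have "dig m = (\<lambda>j. F (Suc j))" unfolding m_def using Suc.prems by (intro Suc.IH) auto
  have e: "(\<Sum>j<Suc N. F j * p ^ j) = F 0 + p * m"
    unfolding m_def sum.lessThan_Suc_shift by (simp add: sum_distrib_left mult_ac)
  show ?case
  proof
    fix j
    show "dig (\<Sum>j<Suc N. F j * p ^ j) j = F j"
    proof (cases j)
      case 0
      then show ?thesis using Suc.prems(1)[of 0] by (simp add: dig_def e del: sum.lessThan_Suc)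
    next
      case (Suc l)
      have "dig (F 0 + p * m) (Suc l) = dig ((F 0 + p * m) div p) l"
        using dig_div[of "F 0 + p * m" 1 l] by (simp only: power_one_right plus_1_eq_Suc)
      also have "(F 0 + p * m) div p = m" using Suc.prems(1)[of 0] by simp
      finally show ?thesis using \<open>dig m = _\<close> by (simp add: e Suc del: sum.lessThan_Suc)
    qed
  qed
qed

text \<open>Describes a critical cell from its active coordinate i upwards: \<open>e\<close> is half
  of the entry at i, rounded down, and \<open>\<tau>\<close> is the part above i, shifted down by i
  + 1. Two units of the entry at i have degree p^(i+1), so \<open>e\<close> counts twice in the size
  and once in the degree.\<close>

definition Xset :: "nat \<Rightarrow> nat \<Rightarrow> (nat \<times> (nat \<Rightarrow> nat)) set" where
  "Xset r \<sigma> = {(e, \<tau>). fsupp \<tau> \<and> 2 * e + msize \<tau> = r \<and> e + mdeg p \<tau> = \<sigma>}"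

text \<open>Writing \<open>e + mdeg p \<tau>\<close> in base \<open>p\<close>: the digits are the sum of \<open>pairs (e, \<tau>)\<close> and of the
  parities of \<open>\<tau>\<close>, no carries occurring for \<open>r \<le> 3\<close>.\<close>

definition pairs :: "nat \<times> (nat \<Rightarrow> nat) \<Rightarrow> nat \<Rightarrow> nat" where
  "pairs x j = (if j = 0 then fst x else snd x (j - 1) div 2)"

text \<open>For r \<le> 3 each value of \<open>pairs\<close> is at most 1, so the candidates
  \<open>F j\<close> are at most 2 < p and hence are the digits. The size counts a pair twice and
  the digit sum counts it once, so their difference is the number of pairs. The sum is stated for
  all large \<open>N\<close>, as the support of \<open>pairs\<close> has no explicit bound.\<close>

lemma Xset_props:
  assumes "(e, \<tau>) \<in> Xset r \<sigma>" "r \<le> 3"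
  shows "dig \<sigma> = (\<lambda>j. pairs (e, \<tau>) j + \<tau> j mod 2)"
    and "\<exists>M. (\<forall>N\<ge>M. dsum \<sigma> + (\<Sum>j<N. pairs (e, \<tau>) j) = r \<and> 2 * (\<Sum>j<N. pairs (e, \<tau>) j) \<le> r)"
proof -
  have fs: "fsupp \<tau>" and r: "2 * e + msize \<tau> = r" and \<sigma>: "e + mdeg p \<tau> = \<sigma>"
    using assms(1) by (auto simp: Xset_def)
  obtain N0 where N0: "\<And>j. \<tau> j \<noteq> 0 \<Longrightarrow> j < N0"
    using fs unfolding fsupp_def finite_nat_set_iff_bounded by auto
  define F where "F j = pairs (e, \<tau>) j + \<tau> j mod 2" for j
  have size: "msize \<tau> = (\<Sum>j<N. 2 * (\<tau> j div 2) + \<tau> j mod 2)"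
    and deg: "mdeg p \<tau> = (\<Sum>j<N. dg p (\<tau> j) * p ^ j)" if "N \<ge> N0" for N
  proof -
    have sub: "{i. \<tau> i \<noteq> 0} \<subseteq> {..<N}" using N0 that less_le_trans by fastforce
    show "msize \<tau> = (\<Sum>j<N. 2 * (\<tau> j div 2) + \<tau> j mod 2)"
      unfolding msize_def mult_div_mod_eq by (rule sum_supp[OF fs _ sub]) auto
    show "mdeg p \<tau> = (\<Sum>j<N. dg p (\<tau> j) * p ^ j)"
      unfolding mdeg_def by (rule sum_supp[OF fs _ sub]) auto
  qed
  have P: "(\<Sum>j<Suc N. pairs (e, \<tau>) j) = e + (\<Sum>j<N. \<tau> j div 2)" for N
    by (simp add: sum.lessThan_Suc_shift pairs_def del: sum.lessThan_Suc)
  have rP: "r = 2 * (\<Sum>j<Suc N. pairs (e, \<tau>) j) + (\<Sum>j<Suc N. \<tau> j mod 2)" if "N \<ge> N0" for N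
  proof -
    have "\<tau> N = 0" using N0 that by (meson not_le)
    then show ?thesis
      unfolding P using r size[OF that, unfolded sum.distrib] by (simp add: sum_distrib_left)
  qed
  have G1: "2 * pairs (e, \<tau>) j \<le> r" for j
  proof -
    define N where "N = max N0 j"
    have "pairs (e, \<tau>) j \<le> (\<Sum>j<Suc N. pairs (e, \<tau>) j)"
      by (rule member_le_sum) (auto simp: N_def)
    then show ?thesis using rP[of N] by (auto simp: N_def)
  qed
  have Fp: "F j < p" for j using G1[of j] assms(2) p_ge3 by (auto simp: F_def)
  have F0: "F j = 0" if "j \<ge> Suc N0" for j
  proof -
    have "\<tau> j = 0" "\<tau> (j - 1) = 0" using that N0[of j] N0[of "j - 1"] by linarith+
    then show ?thesis using that by (simp add: F_def pairs_def)
  qed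
  have sumF: "(\<Sum>j<Suc N. F j * p ^ j) = \<sigma>" if "N \<ge> N0" for N
  proof -
    have "\<tau> N = 0" using N0 that by (meson not_le)
    then have "(\<Sum>j<Suc N. F j * p ^ j) = (\<Sum>j<Suc N. pairs (e, \<tau>) j * p ^ j) + (\<Sum>j<N. \<tau> j mod 2 * p ^ j)"
      by (simp add: F_def sum.distrib algebra_simps)
    also have "(\<Sum>j<Suc N. pairs (e, \<tau>) j * p ^ j) = e + (\<Sum>j<N. (\<tau> j div 2) * p * p ^ j)"
      by (simp add: sum.lessThan_Suc_shift pairs_def algebra_simps del: sum.lessThan_Suc)
    finally show ?thesis using \<sigma> deg[OF that] by (simp add: dg_def sum.distrib algebra_simps)
  qed
  have "dig (\<Sum>j<Suc N0. F j * p ^ j) = F" by (rule dig_sum) (use Fp F0 in auto)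
  then show dF: "dig \<sigma> = (\<lambda>j. pairs (e, \<tau>) j + \<tau> j mod 2)"
    unfolding sumF[OF order_refl] by (simp add: F_def fun_eq_iff)
  show "\<exists>M. \<forall>N\<ge>M. dsum \<sigma> + (\<Sum>j<N. pairs (e, \<tau>) j) = r \<and> 2 * (\<Sum>j<N. pairs (e, \<tau>) j) \<le> r"
  proof (intro exI allI impI)
    fix N assume N: "Suc (N0 + \<sigma>) \<le> N"
    then obtain N' where N': "N = Suc N'" "N' \<ge> N0" "N \<ge> \<sigma>" by (cases N) auto
    have "dsum \<sigma> = (\<Sum>j<N. pairs (e, \<tau>) j) + (\<Sum>j<N. \<tau> j mod 2)"
      unfolding dsum_eq[OF N'(3)] dF by (simp add: sum.distrib)
    then show "dsum \<sigma> + (\<Sum>j<N. pairs (e, \<tau>) j) = r \<and> 2 * (\<Sum>j<N. pairs (e, \<tau>) j) \<le> r"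
      using rP[OF N'(2)] N'(1) by simp
  qed
qed

text \<open>A size of 2 or 3 has room for at most one pair.\<close>

lemma Xset_dsum:
  assumes "x \<in> Xset r \<sigma>" "2 \<le> r" "r \<le> 3"
  shows "dsum \<sigma> = r \<or> dsum \<sigma> = r - 1"
proof -
  obtain e \<tau> where x: "x = (e, \<tau>)" by (cases x)
  obtain M where "dsum \<sigma> + (\<Sum>j<M. pairs (e, \<tau>) j) = r" "2 * (\<Sum>j<M. pairs (e, \<tau>) j) \<le> r"
    using Xset_props(2)[OF assms(1)[unfolded x] assms(3)] by auto
  then show ?thesis using assms by linarith
qed

text \<open>The number \<open>h\<close> of pairs is determined by \<open>\<sigma>\<close>, and it is
  0 or 1 if the set is nonempty. Without a pair there is one element; a single pair must sit at a
  nonzero digit of \<open>\<sigma>\<close>, and the number of these is at most the digit sum, which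
  is then r - 1.\<close>

lemma card_Xset:
  assumes "2 \<le> r" "r \<le> 3"
  shows "finite (Xset r \<sigma>) \<and> card (Xset r \<sigma>) \<le> r - 1"
proof -
  define h where "h = r - dsum \<sigma>"
  define S where "S = {j. j < \<sigma> \<and> dig \<sigma> j \<noteq> 0}"
  \<comment> \<open>The shapes that \<open>pairs\<close> can take: no pair, or one pair at a nonzero
    digit.\<close>
  define G where "G = (if h = 0 then {\<lambda>_. 0} else (\<lambda>y j. if j = y then 1 else 0 :: nat) ` S)"
  have finS: "finite S" by (simp add: S_def)
  have cS: "card S \<le> dsum \<sigma>"
  proof -
    have "card S = (\<Sum>j\<in>S. 1)" by simp
    also have "\<dots> \<le> (\<Sum>j\<in>S. dig \<sigma> j)" by (rule sum_mono) (auto simp: S_def)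
    also have "\<dots> \<le> dsum \<sigma>" unfolding dsum_def by (rule sum_mono2) (auto simp: S_def)
    finally show ?thesis .
  qed
  \<comment> \<open>The digits minus the pairs are the parities of \<open>\<tau>\<close>, so the
    pairs alone determine the element.\<close>
  have inj: "inj_on pairs (Xset r \<sigma>)"
  proof (rule inj_onI)
    fix x y assume x: "x \<in> Xset r \<sigma>" and y: "y \<in> Xset r \<sigma>" and eq: "pairs x = pairs y"
    obtain e \<tau> e' \<tau>' where xy: "x = (e, \<tau>)" "y = (e', \<tau>')" by (cases x, cases y)
    have d: "pairs x j + \<tau> j mod 2 = pairs y j + \<tau>' j mod 2" for j
      using fun_cong[OF Xset_props(1)[OF x[unfolded xy] assms(2)], of j]
        fun_cong[OF Xset_props(1)[OF y[unfolded xy] assms(2)], of j] by (simp add: xy)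
    have "e = e'" using fun_cong[OF eq, of 0] by (simp add: xy pairs_def)
    moreover have "\<tau> j = \<tau>' j" for j
    proof -
      have "\<tau> j div 2 = \<tau>' j div 2" using fun_cong[OF eq, of "Suc j"] by (simp add: xy pairs_def)
      moreover have "\<tau> j mod 2 = \<tau>' j mod 2" using d[of j] eq by simp
      ultimately show ?thesis by (metis div_mult_mod_eq)
    qed
    ultimately show "x = y" using xy by auto
  qed
  have im: "pairs ` Xset r \<sigma> \<subseteq> G"
  proof
    fix g assume "g \<in> pairs ` Xset r \<sigma>"
    then obtain e \<tau> where x: "(e, \<tau>) \<in> Xset r \<sigma>" and g: "g = pairs (e, \<tau>)" by auto
    obtain M where M: "\<And>N. N \<ge> M \<Longrightarrow> dsum \<sigma> + (\<Sum>j<N. g j) = r \<and> 2 * (\<Sum>j<N. g j) \<le> r"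
      using Xset_props(2)[OF x assms(2)] g by auto
    have sumg: "(\<Sum>j<N. g j) = h" if "N \<ge> M" for N using M[OF that] by (auto simp: h_def)
    have h1: "h \<le> 1" using M[of M] sumg[of M] assms by simp
    show "g \<in> G"
    proof (cases "h = 0")
      case True
      have "g j = 0" for j
      proof -
        have "(\<Sum>i<max M (Suc j). g i) = 0" using sumg[of "max M (Suc j)"] True by simp
        then show ?thesis by (simp del: sum.lessThan_Suc)
      qed
      then show ?thesis using True by (auto simp: G_def)
    next
      case False
      then have h: "h = 1" using h1 by simp
      then have "(\<Sum>j<M. g j) \<noteq> 0" using sumg[of M] by simp
      then obtain y where y: "y < M" "g y \<noteq> 0" by (meson lessThan_iff sum.neutral)
      have "g j = (if j = y then 1 else 0)" for j
      proof -
        define N where "N = max M (Suc j)"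
        have fN: "finite {..<N}" "y \<in> {..<N}" using y by (auto simp: N_def)
        have s: "g y + (\<Sum>i\<in>{..<N} - {y}. g i) = 1" using sumg[of N] h sum.remove[OF fN, of g] by (simp add: N_def)
        then have "g y = 1" "(\<Sum>i\<in>{..<N} - {y}. g i) = 0" using y(2) by linarith+
        moreover have "g j \<le> (\<Sum>i\<in>{..<N} - {y}. g i)" if "j \<noteq> y"
          by (rule member_le_sum) (use that in \<open>auto simp: N_def\<close>)
        ultimately show ?thesis by auto
      qed
      moreover have "y \<in> S"
      proof -
        have "dig \<sigma> y \<noteq> 0" using Xset_props(1)[OF x assms(2)] y g by auto
        moreover have "y < \<sigma>" using dig_0[of \<sigma> y] calculation by (meson not_le)
        ultimately show ?thesis by (simp add: S_def)
      qed
      ultimately show ?thesis using False by (auto simp: G_def intro!: image_eqI[of _ _ y])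
    qed
  qed
  have finG: "finite G" using finS by (simp add: G_def)
  have "card (Xset r \<sigma>) = card (pairs ` Xset r \<sigma>)" using inj by (simp add: card_image)
  also have "\<dots> \<le> card G" using im finG by (rule card_mono[rotated])
  also have "\<dots> \<le> r - 1"
  proof (cases "h = 0")
    case False
    then have "dsum \<sigma> \<le> r - 1" by (simp add: h_def)
    then show ?thesis using False cS card_image_le[OF finS] by (auto simp: G_def intro: order_trans)
  qed (use assms in \<open>simp add: G_def\<close>)
  finally show ?thesis using finite_imageD[OF finite_subset[OF im finG] inj] by simp
qed

section \<open>Critical cells and their number\<close>

definition crit :: "int \<Rightarrow> int \<Rightarrow> nat \<Rightarrow> (nat \<Rightarrow> nat) set" where
  "crit \<alpha> \<mu> q = {\<nu>. cell \<alpha> \<mu> q \<nu> \<and> \<not> mup T p \<alpha> \<mu> \<nu> \<and> \<not> mdown T p \<mu> \<nu>}"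

text \<open>A critical cell has a nonzero upward coefficient: this follows from the congruence that
  rules out a match downwards or, if the active entry is 0, from the choice of the active
  coordinate. So it is unmatched only because the upward move would exceed
  \<open>\<alpha>\<close>.\<close>

lemma crit_local:
  assumes "\<nu> \<in> crit \<alpha> \<mu> q" "q > 0"
  defines "i \<equiv> actv p \<mu> \<nu>" and "\<kappa> \<equiv> \<mu> + int (mdeg p \<nu>)"
  shows "if even (\<nu> i) then \<not> int p ^ Suc i dvd \<kappa> \<and> \<alpha> < \<kappa> + int p ^ i
    else int p ^ Suc i dvd \<kappa> - int p ^ i \<and> \<alpha> < \<kappa> + (int p - 1) * int p ^ i"
    and "int p ^ i dvd \<kappa>" and "\<kappa> \<le> \<alpha>" and "l < i \<Longrightarrow> \<nu> l = 0"
proof -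
  have fs: "fsupp \<nu>" and sz: "msize \<nu> = q" and le: "\<kappa> \<le> \<alpha>" and
    nup: "\<not> mup T p \<alpha> \<mu> \<nu>" and ndn: "\<not> mdown T p \<mu> \<nu>"
    using assms by (auto simp: crit_def cell_def)
  have nz: "\<nu> \<noteq> (\<lambda>_. 0)" using assms(2) sz msize_eq_0[OF fs] by auto
  note act = actv_props[OF nz, where \<mu> = \<mu>, folded i_def, folded \<kappa>_def]
  show pi: "int p ^ i dvd \<kappa>" using act(3)[of i] by simp
  then obtain x where x: "\<kappa> = int p ^ i * x" by (elim dvdE)
  show "\<kappa> \<le> \<alpha>" by (fact le)
  show "l < i \<Longrightarrow> \<nu> l = 0" by (fact act(2))
  have psuc: "int p ^ Suc i dvd int p ^ i * y \<longleftrightarrow> int p dvd y" for y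
    by simp
  have up: "(cf p (\<nu> i) i \<kappa> :: 'k) \<noteq> 0 \<Longrightarrow> \<alpha> < \<kappa> + int (stp p (\<nu> i) i)"
    using nup by (simp add: mup_def Let_def i_def \<kappa>_def)
  have down: "cf p (\<nu> i - 1) i (\<mu> + int (mdeg p (dec \<nu> i))) = (0 :: 'k)" if "\<nu> i \<noteq> 0"
    using ndn that by (simp add: mdown_def Let_def i_def \<kappa>_def)
  have kd: "\<mu> + int (mdeg p (dec \<nu> i)) = \<kappa> - int (stp p (\<nu> i - 1) i)" if "\<nu> i \<noteq> 0"
    using mdeg_dec[of \<nu> p i] that fs by (simp add: \<kappa>_def)
  show "if even (\<nu> i) then \<not> int p ^ Suc i dvd \<kappa> \<and> \<alpha> < \<kappa> + int p ^ i
    else int p ^ Suc i dvd \<kappa> - int p ^ i \<and> \<alpha> < \<kappa> + (int p - 1) * int p ^ i"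
  proof (cases "even (\<nu> i)")
    case True
    have npx: "\<not> int p dvd x"
    proof (cases "\<nu> i = 0")
      case True
      then show ?thesis using act(1) x psuc by simp
    next
      case False
      then have o: "odd (\<nu> i - 1)" using True by simp
      have "\<kappa> - int (stp p (\<nu> i - 1) i) = int p ^ i * (x - int p + 1)"
        using o by (simp add: x stp_odd algebra_simps)
      then have "\<not> int p dvd x - int p" using down[OF False] kd[OF False] cf_odd_0[OF o, of i "x - int p + 1"] by simp
      then show ?thesis using dvd_diff[of "int p" x "int p"] by auto
    qed
    then have "(cf p (\<nu> i) i \<kappa> :: 'k) \<noteq> 0" using cf_even_0[OF True] x by simp
    from up[OF this] show ?thesis using True npx by (simp add: psuc stp_def x)
  next
    case False
    then have ni: "\<nu> i \<noteq> 0" and e: "even (\<nu> i - 1)" by (auto simp: odd_pos)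
    have "\<kappa> - int (stp p (\<nu> i - 1) i) = int p ^ i * (x - 1)"
      using e by (simp add: x stp_def algebra_simps)
    then have px: "int p dvd x - 1" using down[OF ni] kd[OF ni] cf_even_0[OF e, of i "x - 1"] by simp
    then have "(cf p (\<nu> i) i \<kappa> :: 'k) \<noteq> 0" using cf_odd_0[OF False] x by simp
    from up[OF this] have "\<alpha> < \<kappa> + (int p - 1) * int p ^ i" using False by (simp add: stp_odd)
    moreover have "\<kappa> - int p ^ i = int p ^ i * (x - 1)" by (simp add: x algebra_simps)
    ultimately show ?thesis using False px by (simp add: psuc del: power_Suc)
  qed
qed

text \<open>The scalar form of the acyclicity of k[x]. In units of p^i, a critical index x would
  satisfy -1 < x \<le> 0 with p not dividing x, or 1 - p < x \<le> 0 with x = 1 modulo p; neither is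
  possible.\<close>

lemma crit_0: "q > 0 \<Longrightarrow> crit 0 \<mu> q = {}"
proof (rule ccontr)
  assume q: "q > 0" and "crit 0 \<mu> q \<noteq> {}"
  then obtain \<nu> where \<nu>: "\<nu> \<in> crit 0 \<mu> q" by auto
  define i where "i = actv p \<mu> \<nu>"
  define \<kappa> where "\<kappa> = \<mu> + int (mdeg p \<nu>)"
  note c = crit_local[OF \<nu> q, folded i_def \<kappa>_def]
  obtain x where x: "\<kappa> = int p ^ i * x" using c(2) by (elim dvdE)
  have pp: "int p ^ i > 0" by simp
  have x0: "x \<le> 0" using c(3) pp by (simp add: x mult_le_0_iff)
  show False
  proof (cases "even (\<nu> i)")
    case True
    then have "\<not> int p dvd x" "0 < int p ^ i * (x + 1)" using c(1) by (auto simp: x algebra_simps)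
    then have "x + 1 > 0" "x \<noteq> 0" using pp by (auto simp: zero_less_mult_iff)
    then show False using x0 by simp
  next
    case False
    then have "int p ^ Suc i dvd int p ^ i * (x - 1)" "0 < int p ^ i * (x + int p - 1)"
      using c(1) by (auto simp: x algebra_simps)
    then have "int p dvd x - 1" "x + int p - 1 > 0" using pp by (auto simp: zero_less_mult_iff)
    then obtain y where "x - 1 = int p * y" by (elim dvdE)
    then have "int p * y < 0" "int p * (y + 1) > 0" using x0 \<open>x + int p - 1 > 0\<close> by (auto simp: algebra_simps)
    then have "y < 0" "y + 1 > 0" by (auto simp: mult_less_0_iff zero_less_mult_iff)
    then show False by simp
  qed
qed

definition mtail :: "nat \<Rightarrow> (nat \<Rightarrow> nat) \<Rightarrow> nat \<times> (nat \<Rightarrow> nat)" where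
  "mtail i \<nu> = (\<nu> i div 2, \<lambda>j. \<nu> (Suc i + j))"

lemma mtail_split:
  assumes fs: "fsupp \<nu>" and z: "\<And>l. l < i \<Longrightarrow> \<nu> l = 0"
  shows "fsupp (snd (mtail i \<nu>))" and "msize \<nu> = \<nu> i + msize (snd (mtail i \<nu>))"
    and "mdeg p \<nu> = p ^ i * (\<nu> i mod 2) + p ^ Suc i * (fst (mtail i \<nu>) + mdeg p (snd (mtail i \<nu>)))"
proof -
  define \<tau> where "\<tau> = (\<lambda>j. \<nu> (Suc i + j))"
  obtain N0 where N0: "\<And>j. \<nu> j \<noteq> 0 \<Longrightarrow> j < N0"
    using fs unfolding fsupp_def finite_nat_set_iff_bounded by auto
  have sub: "{j. \<tau> j \<noteq> 0} \<subseteq> {..<N0}" using N0 by (fastforce simp: \<tau>_def)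
  then have f\<tau>: "fsupp \<tau>" unfolding fsupp_def by (rule finite_subset) simp
  then show "fsupp (snd (mtail i \<nu>))" by (simp add: mtail_def \<tau>_def)
  have *: "(\<Sum>j | \<nu> j \<noteq> 0. g (\<nu> j) j) = g (\<nu> i) i + (\<Sum>j | \<tau> j \<noteq> 0. g (\<tau> j) (Suc i + j))"
    if g0: "\<And>j. g 0 j = 0" for g :: "nat \<Rightarrow> nat \<Rightarrow> nat"
  proof -
    have "{j. \<nu> j \<noteq> 0} \<subseteq> {i..<Suc i + N0}" 
    proof
      fix j assume "j \<in> {j. \<nu> j \<noteq> 0}"
      then have "\<nu> j \<noteq> 0" by simp
      then have "i \<le> j" "j < N0" using z[of j] N0[of j] by (auto simp: not_less[symmetric])
      then show "j \<in> {i..<Suc i + N0}" by simp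
    qed
    then have "(\<Sum>j | \<nu> j \<noteq> 0. g (\<nu> j) j) = (\<Sum>j\<in>{i..<Suc i + N0}. g (\<nu> j) j)"
      by (intro sum_supp[OF fs]) (auto simp: g0)
    also have "\<dots> = g (\<nu> i) i + (\<Sum>j\<in>{Suc i..<Suc i + N0}. g (\<nu> j) j)"
      by (rule sum.atLeast_Suc_lessThan) simp
    also have "(\<Sum>j\<in>{Suc i..<Suc i + N0}. g (\<nu> j) j) = (\<Sum>j<N0. g (\<tau> j) (Suc i + j))"
      using sum.shift_bounds_nat_ivl[of "\<lambda>j. g (\<nu> j) j" 0 "Suc i" N0]
      by (simp add: \<tau>_def lessThan_atLeast0 add_ac)
    also have "\<dots> = (\<Sum>j | \<tau> j \<noteq> 0. g (\<tau> j) (Suc i + j))"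
      by (rule sum_supp[OF f\<tau> _ sub, symmetric]) (auto simp: g0)
    finally show ?thesis .
  qed
  show "msize \<nu> = \<nu> i + msize (snd (mtail i \<nu>))"
    using *[of "\<lambda>n j. n"] by (simp add: msize_def mtail_def \<tau>_def)
  have "mdeg p \<nu> = dg p (\<nu> i) * p ^ i + (\<Sum>j | \<tau> j \<noteq> 0. dg p (\<tau> j) * p ^ (Suc i + j))"
    unfolding mdeg_def by (rule *) simp
  also have "(\<Sum>j | \<tau> j \<noteq> 0. dg p (\<tau> j) * p ^ (Suc i + j)) = p ^ Suc i * mdeg p \<tau>"
    by (simp add: mdeg_def sum_distrib_left power_add mult_ac)
  finally show "mdeg p \<nu> = p ^ i * (\<nu> i mod 2) + p ^ Suc i * (fst (mtail i \<nu>) + mdeg p (snd (mtail i \<nu>)))"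
    by (simp add: mtail_def \<tau>_def dg_def algebra_simps)
qed

lemma mtail_inj:
  assumes "mtail i \<nu> = mtail i \<nu>'" "\<nu> i mod 2 = \<nu>' i mod 2"
    and "\<And>l. l < i \<Longrightarrow> \<nu> l = 0" "\<And>l. l < i \<Longrightarrow> \<nu>' l = 0"
  shows "\<nu> = \<nu>'"
proof
  fix l
  consider "l < i" | "l = i" | j where "l = Suc i + j"
    by (metis add_Suc add_Suc_shift less_iff_Suc_add not_less_iff_gr_or_eq)
  then show "\<nu> l = \<nu>' l"
  proof cases
    case 2
    have "\<nu> i div 2 = \<nu>' i div 2" using assms(1) by (simp add: mtail_def)
    then show ?thesis using assms(2) 2 by (metis div_mult_mod_eq)
  next
    case 3
    then show ?thesis using assms(1) by (auto simp: mtail_def dest: fun_cong)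
  qed (use assms in auto)
qed

text \<open>The number \<open>s\<close> splits into the distance \<open>r\<close> from the index of
  the cell up to \<open>\<alpha>\<close>, the summand p^i if the active entry is odd, and p^(i+1)
  times the degree \<open>R\<close> of the tail. By \<open>crit_local\<close> the first two stay
  below p^(i+1), so \<open>R\<close> is the quotient of \<open>s\<close> by p^(i+1).\<close>

lemma crit_mtail:
  assumes "\<nu> \<in> crit \<alpha> \<mu> q" "q > 0"
  defines "i \<equiv> actv p \<mu> \<nu>" and "s \<equiv> nat (\<alpha> - \<mu>)"
  shows "odd (\<nu> i) \<Longrightarrow> int p ^ Suc i dvd \<mu> \<and> dig s i \<noteq> 0 \<and> mtail i \<nu> \<in> Xset (q - 1) (s div p ^ Suc i)"
    and "even (\<nu> i) \<Longrightarrow> int p ^ i dvd \<mu> \<and> \<not> int p ^ Suc i dvd \<mu> \<and> mtail i \<nu> \<in> Xset q (s div p ^ Suc i)"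
proof -
  define \<kappa> where "\<kappa> = \<mu> + int (mdeg p \<nu>)"
  note c = crit_local[OF assms(1,2), folded i_def \<kappa>_def]
  have fs: "fsupp \<nu>" and sz: "msize \<nu> = q" using assms by (auto simp: crit_def cell_def)
  note m = mtail_split[OF fs c(4)]
  define R where "R = fst (mtail i \<nu>) + mdeg p (snd (mtail i \<nu>))"
  define r where "r = nat (\<alpha> - \<kappa>)"
  have r: "int r = \<alpha> - \<kappa>" using c(3) by (simp add: r_def)
  have s_int: "int s = \<alpha> - \<mu>" using c(3) by (simp add: s_def \<kappa>_def)
  have s: "s = r + p ^ i * (\<nu> i mod 2) + p ^ Suc i * R"
  proof -
    have "int s = int (r + mdeg p \<nu>)" using s_int r by (simp add: \<kappa>_def)
    then have "s = r + mdeg p \<nu>" by (simp only: of_nat_eq_iff)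
    then show ?thesis using m(3) by (simp add: R_def)
  qed
  have X: "mtail i \<nu> \<in> Xset (\<nu> i div 2 * 2 + msize (snd (mtail i \<nu>))) R"
    using m(1) by (auto simp: Xset_def R_def mtail_def)
  have \<mu>: "\<mu> = \<kappa> - int p ^ i * int (\<nu> i mod 2) - int p ^ Suc i * int R"
    using m(3) by (simp add: \<kappa>_def R_def)
  {
    assume o: "odd (\<nu> i)"
    have "int r < (int p - 1) * int p ^ i" using c(1) o r by auto
    then have "int (r + p ^ i) < int (p * p ^ i)" by (simp add: algebra_simps)
    then have rlt: "r + p ^ i < p ^ Suc i" by (simp only: of_nat_less_iff power_Suc)
    have s': "s = (r + p ^ i) + p ^ Suc i * R" using s o by (simp add: odd_iff_mod_2_eq_one)
    have "s div p ^ Suc i = R" using rlt by (simp add: s' del: power_Suc)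
    \<comment> \<open>The summand p^i of an odd entry becomes visible as a nonzero digit of
      \<open>s\<close>.\<close>
    moreover have "dig s i \<noteq> 0"
    proof -
      have "s = (p * R) * p ^ i + (r + p ^ i)" by (simp add: s' mult_ac)
      then have "s div p ^ i = p * R + (r + p ^ i) div p ^ i" by (simp only: div_mult_self3 power_not_zero p_neq_0 simp_thms)
      then have "dig s i = (r + p ^ i) div p ^ i mod p" by (simp add: dig_def)
      moreover have "(r + p ^ i) div p ^ i < p" by (rule less_mult_imp_div_less) (use rlt in simp)
      moreover have "(r + p ^ i) div p ^ i \<noteq> 0" by (simp add: div_eq_0_iff)
      ultimately show ?thesis by simp
    qed
    moreover have "\<nu> i div 2 * 2 + msize (snd (mtail i \<nu>)) = q - 1"
      using m(2) sz o by (auto elim!: oddE)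
    moreover have "int p ^ Suc i dvd \<mu>"
    proof -
      have "\<mu> = (\<kappa> - int p ^ i) - int p ^ Suc i * int R" using \<mu> o by (simp add: odd_iff_mod_2_eq_one)
      then show ?thesis using c(1) o by (auto intro!: dvd_diff simp del: power_Suc)
    qed
    ultimately show "int p ^ Suc i dvd \<mu> \<and> dig s i \<noteq> 0 \<and> mtail i \<nu> \<in> Xset (q - 1) (s div p ^ Suc i)"
      using X by simp
  next
    assume e: "even (\<nu> i)"
    have "int r < int (p ^ i)" using c(1) e r by auto
    then have "r < p ^ i" by (simp only: of_nat_less_iff)
    also have "p ^ i \<le> p ^ Suc i" using p_ge3 by simp
    finally have rlt: "r < p ^ Suc i" .
    have s': "s = r + p ^ Suc i * R" using s e by simp
    have "s div p ^ Suc i = R" using rlt by (simp add: s' del: power_Suc)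
    moreover have "\<nu> i div 2 * 2 + msize (snd (mtail i \<nu>)) = q"
      using m(2) sz e by auto
    moreover have "int p ^ i dvd \<mu>" "\<not> int p ^ Suc i dvd \<mu>"
    proof -
      have \<mu>': "\<mu> = \<kappa> - int p ^ Suc i * int R" using \<mu> e by simp
      show "int p ^ i dvd \<mu>" unfolding \<mu>' using c(2) by (auto intro!: dvd_diff)
      have "\<not> int p ^ Suc i dvd \<kappa>" using c(1) e by auto
      then show "\<not> int p ^ Suc i dvd \<mu>" unfolding \<mu>'
        by (metis diff_add_cancel dvd_add dvd_triv_left)
    qed
    ultimately show "int p ^ i dvd \<mu> \<and> \<not> int p ^ Suc i dvd \<mu> \<and> mtail i \<nu> \<in> Xset q (s div p ^ Suc i)"
      using X by simp
  }
qed

text \<open>Odd active entry: \<open>D\<close> is 1 or 2 and drops strictly when the active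
  coordinate grows, as the corresponding digit of \<open>s\<close> is nonzero; with one tail per
  coordinate there are at most 2 such cells. Even active entry: the coordinate is the p-adic
  valuation of \<open>\<mu>\<close>, and there are at most 2 tails. If an even cell exists, its
  coordinate lies above those of all odd cells, which forces \<open>D\<close> = 2 on the latter and
  leaves at most one of them.\<close>

lemma card_crit: "finite (crit \<alpha> \<mu> 3) \<and> card (crit \<alpha> \<mu> 3) \<le> 3"
proof -
  define s where "s = nat (\<alpha> - \<mu>)"
  define A where "A = (\<lambda>\<nu>. actv p \<mu> \<nu>)"
  define D where "D \<nu> = dsum (s div p ^ Suc (A \<nu>))" for \<nu>
  define Od where "Od = {\<nu> \<in> crit \<alpha> \<mu> 3. odd (\<nu> (A \<nu>))}"
  define Ev where "Ev = {\<nu> \<in> crit \<alpha> \<mu> 3. even (\<nu> (A \<nu>))}"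
  have split: "crit \<alpha> \<mu> 3 = Od \<union> Ev" by (auto simp: Od_def Ev_def)
  have OD: "int p ^ Suc (A \<nu>) dvd \<mu>" "dig s (A \<nu>) \<noteq> 0" "mtail (A \<nu>) \<nu> \<in> Xset 2 (s div p ^ Suc (A \<nu>))"
    "\<nu> (A \<nu>) mod 2 = 1" "\<And>l. l < A \<nu> \<Longrightarrow> \<nu> l = 0" if "\<nu> \<in> Od" for \<nu>
    using crit_mtail(1)[of \<nu> \<alpha> \<mu> 3] crit_local(4)[of \<nu> \<alpha> \<mu> 3] that
    by (auto simp: Od_def A_def s_def odd_iff_mod_2_eq_one)
  have E: "int p ^ A \<nu> dvd \<mu>" "\<not> int p ^ Suc (A \<nu>) dvd \<mu>" "mtail (A \<nu>) \<nu> \<in> Xset 3 (s div p ^ Suc (A \<nu>))"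
    "\<nu> (A \<nu>) mod 2 = 0" "\<And>l. l < A \<nu> \<Longrightarrow> \<nu> l = 0" if "\<nu> \<in> Ev" for \<nu>
    using crit_mtail(2)[of \<nu> \<alpha> \<mu> 3] crit_local(4)[of \<nu> \<alpha> \<mu> 3] that
    by (auto simp: Ev_def A_def s_def)
  have DO: "D \<nu> \<in> {1, 2}" if "\<nu> \<in> Od" for \<nu>
    using Xset_dsum[OF OD(3)[OF that]] by (auto simp: D_def)
  have lt: "D \<nu>' < D \<nu>" if "\<nu> \<in> Od" "\<nu>' \<in> Od" "A \<nu> < A \<nu>'" for \<nu> \<nu>'
    using dsum_div_mono[of "Suc (A \<nu>)" "A \<nu>'" s] dsum_div_Suc[of s "A \<nu>'"] OD(2)[OF that(2)] that(3)
    by (simp add: D_def)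
  have injO: "inj_on D Od"
  proof (rule inj_onI)
    fix \<nu> \<nu>' assume n: "\<nu> \<in> Od" "\<nu>' \<in> Od" "D \<nu> = D \<nu>'"
    then have a: "A \<nu> = A \<nu>'" using lt[of \<nu> \<nu>'] lt[of \<nu>' \<nu>] by (metis less_irrefl linorder_neqE_nat)
    have "mtail (A \<nu>) \<nu> = mtail (A \<nu>) \<nu>'"
    proof -
      have "finite (Xset 2 (s div p ^ Suc (A \<nu>)))" "card (Xset 2 (s div p ^ Suc (A \<nu>))) \<le> Suc 0"
        using card_Xset[of 2 "s div p ^ Suc (A \<nu>)"] by auto
      then show ?thesis using OD(3)[OF n(1)] OD(3)[OF n(2)] a by (auto simp: card_le_Suc0_iff_eq)
    qed
    then show "\<nu> = \<nu>'"
      by (rule mtail_inj) (use OD(4,5)[OF n(1)] OD(4,5)[OF n(2)] a in auto)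
  qed
  have finO: "finite Od" using DO inj_on_finite[OF injO, of "{1, 2}"] by blast
  show ?thesis
  proof (cases "Ev = {}")
    case True
    have "card Od \<le> card {1, 2 :: nat}" by (rule card_inj_on_le[OF injO]) (use DO in blast)+
    then show ?thesis using True split finO by simp
  next
    case False
    then obtain e where e: "e \<in> Ev" by auto
    have Ae: "A \<nu> = A e" if "\<nu> \<in> Ev" for \<nu>
    proof -
      have "\<not> A \<nu> < A e" "\<not> A e < A \<nu>"
        using E(1,2)[OF that] E(1,2)[OF e] le_imp_power_dvd[of "Suc (A \<nu>)" "A e" "int p"]
          le_imp_power_dvd[of "Suc (A e)" "A \<nu>" "int p"] by (auto dest: dvd_trans simp del: power_Suc)
      then show ?thesis by simp
    qed
    have injE: "inj_on (mtail (A e)) Ev"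
      by (rule inj_onI, erule mtail_inj) (use E(4,5) Ae in auto)
    have imE: "mtail (A e) ` Ev \<subseteq> Xset 3 (s div p ^ Suc (A e))" using E(3) Ae by force
    have X3: "finite (Xset 3 (s div p ^ Suc (A e)))" "card (Xset 3 (s div p ^ Suc (A e))) \<le> 2"
      using card_Xset[of 3 "s div p ^ Suc (A e)"] by auto
    have finE: "finite Ev" using inj_on_finite[OF injE imE X3(1)] .
    have cE: "card Ev \<le> 2" using card_inj_on_le[OF injE imE X3(1)] X3(2) by simp
    have "D \<nu> = 2" if "\<nu> \<in> Od" for \<nu>
    proof -
      have "Suc (A \<nu>) \<le> A e"
        using E(2)[OF e] OD(1)[OF that] le_imp_power_dvd[of "Suc (A e)" "Suc (A \<nu>)" "int p"]
        by (auto dest: dvd_trans simp del: power_Suc simp: not_less_eq_eq[symmetric])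
      then have "dsum (s div p ^ Suc (A e)) \<le> D \<nu>" unfolding D_def by (intro dsum_div_mono) simp
      moreover have "dsum (s div p ^ Suc (A e)) \<ge> 2" using Xset_dsum[OF E(3)[OF e]] by auto
      ultimately show ?thesis using DO[OF that] by auto
    qed
    then have "card Od \<le> card {2 :: nat}" by (intro card_inj_on_le[OF injO]) auto
    then show ?thesis using cE finE finO split card_Un_le[of Od Ev] by simp
  qed
qed

end

section \<open>Linear functionals\<close>

text \<open>Identities of vectors are tested by functionals, which turns them into identities of
  field elements or polynomials. The maps are not \<open>extensional\<close>, so that they can be
  composed freely with operators.\<close>

definition fnl :: "('k::field, 'v, 'z) module_scheme \<Rightarrow> ('v \<Rightarrow> 'k) set" where
  "fnl M = {\<phi>. (\<forall>u\<in>carrier M. \<forall>v\<in>carrier M. \<phi> (u \<oplus>\<^bsub>M\<^esub> v) = \<phi> u + \<phi> v) \<and>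
     (\<forall>c. \<forall>v\<in>carrier M. \<phi> (c \<odot>\<^bsub>M\<^esub> v) = c * \<phi> v)}"

locale kvs =
  fixes M :: "('k::field, 'v, 'z) module_scheme" (structure)
  assumes vs: "vectorspace class_ring M"
begin

sublocale vectorspace class_ring M by (fact vs)

lemma smult_cl [simp, intro]: "v \<in> carrier M \<Longrightarrow> c \<odot> v \<in> carrier M"
  using smult_closed[of c v] by simp

lemma smult_add_l: "v \<in> carrier M \<Longrightarrow> (a + b) \<odot> v = a \<odot> v \<oplus> b \<odot> v"
  using smult_l_distr[of a b v] by simp

lemma smult_add_r: "u \<in> carrier M \<Longrightarrow> v \<in> carrier M \<Longrightarrow> a \<odot> (u \<oplus> v) = a \<odot> u \<oplus> a \<odot> v"
  using smult_r_distr[of a u v] by simp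

lemma smult_smult: "v \<in> carrier M \<Longrightarrow> a \<odot> (b \<odot> v) = (a * b) \<odot> v"
  using smult_assoc1[of a b v] by simp

lemma smult_1 [simp]: "v \<in> carrier M \<Longrightarrow> 1 \<odot> v = v"
  using smult_one[of v] by simp

lemma smult_0l [simp]: "v \<in> carrier M \<Longrightarrow> 0 \<odot> v = \<zero>"
  using lmult_0[of v] by simp

lemma smult_0r [simp]: "a \<odot> \<zero> = \<zero>"
  using rmult_0[of a] by simp

lemma smult_m1: "v \<in> carrier M \<Longrightarrow> (- 1) \<odot> v = \<ominus> v"
  using smult_add_l[of v "- 1" 1] by (intro minus_equality[symmetric]) auto

lemma fnl_add: "\<phi> \<in> fnl M \<Longrightarrow> u \<in> carrier M \<Longrightarrow> v \<in> carrier M \<Longrightarrow> \<phi> (u \<oplus> v) = \<phi> u + \<phi> v"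
  by (simp add: fnl_def)

lemma fnl_smult: "\<phi> \<in> fnl M \<Longrightarrow> v \<in> carrier M \<Longrightarrow> \<phi> (c \<odot> v) = c * \<phi> v"
  by (simp add: fnl_def)

lemma fnl_zero: "\<phi> \<in> fnl M \<Longrightarrow> \<phi> \<zero> = 0"
  using fnl_smult[of \<phi> \<zero> 0] by simp

lemma fnl_neg: "\<phi> \<in> fnl M \<Longrightarrow> v \<in> carrier M \<Longrightarrow> \<phi> (\<ominus> v) = - \<phi> v"
  using fnl_smult[of \<phi> v "- 1"] by (simp add: smult_m1)

lemma fnl_finsum:
  assumes "\<phi> \<in> fnl M" "finite A" "f \<in> A \<rightarrow> carrier M"
  shows "\<phi> (finsum M f A) = (\<Sum>a\<in>A. \<phi> (f a))"
  using assms(2,3) by induction (use assms(1) in \<open>auto simp: fnl_zero fnl_add Pi_def\<close>)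

definition subsp :: "'v set \<Rightarrow> bool" where
  "subsp W \<longleftrightarrow> W \<subseteq> carrier M \<and> \<zero> \<in> W \<and> (\<forall>u\<in>W. \<forall>v\<in>W. u \<oplus> v \<in> W) \<and> (\<forall>c. \<forall>v\<in>W. c \<odot> v \<in> W)"

text \<open>Zorn's lemma gives a subspace \<open>W\<close> maximal among those avoiding
  \<open>v\<close>. Maximality makes the module the direct sum of \<open>W\<close> and the line
  through \<open>v\<close>, and the coordinate along \<open>v\<close> is the functional.\<close>

lemma fnl_separates_0:
  assumes v: "v \<in> carrier M" "v \<noteq> \<zero>"
  shows "\<exists>\<phi>\<in>fnl M. \<phi> v \<noteq> 0"
proof -
  define \<S> where "\<S> = {W. subsp W \<and> v \<notin> W}"
  have "\<exists>W\<in>\<S>. \<forall>X\<in>\<S>. W \<subseteq> X \<longrightarrow> X = W"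
  proof (rule subset_Zorn_nonempty)
    show "\<S> \<noteq> {}" using v by (auto simp: \<S>_def subsp_def intro!: exI[of _ "{\<zero>}"])
    fix \<C> assume \<C>: "\<C> \<noteq> {}" "subset.chain \<S> \<C>"
    have mem: "X \<in> \<C> \<Longrightarrow> subsp X \<and> v \<notin> X" for X
      using \<C>(2) by (auto simp: subset_chain_def \<S>_def)
    have "u \<oplus> w \<in> \<Union>\<C>" if "u \<in> X" "X \<in> \<C>" "w \<in> Y" "Y \<in> \<C>" for u w X Y
    proof -
      have "X \<subseteq> Y \<or> Y \<subseteq> X" using \<C>(2) that by (auto simp: subset_chain_def)
      then show ?thesis using that mem[of X] mem[of Y] unfolding subsp_def by blast
    qed
    moreover have "\<zero> \<in> \<Union>\<C>" using \<C>(1) mem by (auto simp: subsp_def)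
    moreover have "c \<odot> u \<in> \<Union>\<C>" if "u \<in> X" "X \<in> \<C>" for c u X using mem[OF that(2)] that unfolding subsp_def by blast
    moreover have "\<Union>\<C> \<subseteq> carrier M" "v \<notin> \<Union>\<C>" using mem unfolding subsp_def by blast+
    ultimately show "\<Union>\<C> \<in> \<S>" unfolding \<S>_def subsp_def by blast
  qed
  then obtain W where W: "subsp W" "v \<notin> W" and max: "\<And>X. subsp X \<Longrightarrow> v \<notin> X \<Longrightarrow> W \<subseteq> X \<Longrightarrow> X = W"
    by (auto simp: \<S>_def)
  have Wc: "w \<in> carrier M" if "w \<in> W" for w using W(1) that by (auto simp: subsp_def)
  have W0: "\<zero> \<in> W" and Wadd: "u \<in> W \<Longrightarrow> w \<in> W \<Longrightarrow> u \<oplus> w \<in> W" and Wsm: "w \<in> W \<Longrightarrow> c \<odot> w \<in> W" for u w c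
    using W(1) by (auto simp: subsp_def)
  \<comment> \<open>For \<open>x\<close> outside \<open>W\<close>, maximality puts \<open>v\<close>
    into \<open>W\<close> plus the line through \<open>x\<close>; the coefficient of
    \<open>x\<close> is nonzero since \<open>v\<close> is not in \<open>W\<close>.\<close>
  have ex: "\<exists>c. \<exists>w\<in>W. x = w \<oplus> c \<odot> v" if x: "x \<in> carrier M" for x
  proof (cases "x \<in> W")
    case True
    then show ?thesis using v x by (intro exI[of _ 0] bexI[of _ x]) auto
  next
    case False
    define X where "X = {w \<oplus> c \<odot> x | w c. w \<in> W}"
    have "subsp X"
      unfolding subsp_def
    proof (intro conjI ballI allI)
      show "X \<subseteq> carrier M" using x Wc by (auto simp: X_def)
      show "\<zero> \<in> X" unfolding X_def using W0 x by (intro CollectI exI[of _ \<zero>] exI[of _ 0]) auto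
      show "u \<oplus> w \<in> X" if uw: "u \<in> X" "w \<in> X" for u w
      proof -
        obtain u' a w' b where *: "u = u' \<oplus> a \<odot> x" "w = w' \<oplus> b \<odot> x" "u' \<in> W" "w' \<in> W" using uw unfolding X_def by blast
        have "u \<oplus> w = (u' \<oplus> w') \<oplus> (a + b) \<odot> x" using * x Wc by (simp add: smult_add_l a_ac)
        then show ?thesis using Wadd[OF *(3,4)] by (auto simp: X_def)
      qed
      show "c \<odot> u \<in> X" if u: "u \<in> X" for c u
      proof -
        obtain u' a where *: "u = u' \<oplus> a \<odot> x" "u' \<in> W" using u unfolding X_def by blast
        have "c \<odot> u = c \<odot> u' \<oplus> (c * a) \<odot> x" using * x Wc by (simp add: smult_add_r smult_smult)
        then show ?thesis using Wsm[OF *(2)] by (auto simp: X_def)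
      qed
    qed
    moreover have "W \<subseteq> X"
    proof
      fix w assume "w \<in> W"
      then have "w = w \<oplus> 0 \<odot> x" using x Wc by simp
      then show "w \<in> X" using \<open>w \<in> W\<close> unfolding X_def by blast
    qed
    moreover have "x \<in> X"
    proof -
      have "x = \<zero> \<oplus> 1 \<odot> x" using x by simp
      then show ?thesis using W0 unfolding X_def by blast
    qed
    ultimately have "v \<in> X" using max[of X] False by blast
    then obtain w c where vw: "v = w \<oplus> c \<odot> x" "w \<in> W" unfolding X_def by blast
    have "c \<noteq> 0" using vw W(2) x Wc by auto
    have "inverse c \<odot> v = inverse c \<odot> w \<oplus> x"
      using vw x Wc \<open>c \<noteq> 0\<close> by (simp add: smult_add_r smult_smult)
    then have "x = (- inverse c) \<odot> w \<oplus> inverse c \<odot> v"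
      using vw(2) x Wc smult_add_l[of w "- inverse c" "inverse c"] by (simp add: a_assoc[symmetric])
    then show ?thesis using Wsm[OF vw(2)] by blast
  qed
  have uniq: "a = b" if "w \<in> W" "w' \<in> W" "w \<oplus> a \<odot> v = w' \<oplus> b \<odot> v" for a b w w'
  proof (rule ccontr)
    assume ab: "a \<noteq> b"
    have "w' \<oplus> (- 1) \<odot> w \<oplus> (w \<oplus> a \<odot> v) = w' \<oplus> (- 1) \<odot> w \<oplus> (w' \<oplus> b \<odot> v)" using that by simp
    define z where "z = w' \<oplus> (- 1) \<odot> w"
    have zW: "z \<in> W" unfolding z_def using that Wadd Wsm by blast
    have "(a - b) \<odot> v = a \<odot> v \<oplus> (- b) \<odot> v" using v smult_add_l[of v a "- b"] by simp
    also have "a \<odot> v = (- 1) \<odot> w \<oplus> (w \<oplus> a \<odot> v)"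
      using that(1) v Wc smult_add_l[of w "- 1" 1] by (simp add: a_assoc[symmetric])
    also have "\<dots> = z \<oplus> b \<odot> v" unfolding that(3) z_def using that(1,2) v Wc by (simp add: a_ac)
    also have "z \<oplus> b \<odot> v \<oplus> (- b) \<odot> v = z"
      using v zW Wc smult_add_l[of v b "- b"] by (simp add: a_assoc)
    finally have "inverse (a - b) \<odot> ((a - b) \<odot> v) \<in> W" using Wsm zW by simp
    then show False using W(2) v ab by (simp add: smult_smult)
  qed
  define \<phi> where "\<phi> x = (THE c. \<exists>w\<in>W. x = w \<oplus> c \<odot> v)" for x
  have \<phi>: "\<phi> (w \<oplus> c \<odot> v) = c" if "w \<in> W" for w c
    unfolding \<phi>_def by (rule the_equality) (use that uniq in blast)+
  have "\<phi> \<in> fnl M"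
    unfolding fnl_def
  proof (intro CollectI conjI ballI allI)
    fix x y c assume x: "x \<in> carrier M" and y: "y \<in> carrier M"
    obtain a w where xw: "w \<in> W" "x = w \<oplus> a \<odot> v" using ex[OF x] by blast
    obtain b w' where yw: "w' \<in> W" "y = w' \<oplus> b \<odot> v" using ex[OF y] by blast
    have "x \<oplus> y = (w \<oplus> w') \<oplus> (a + b) \<odot> v" using xw yw v Wc by (simp add: smult_add_l a_ac)
    then show "\<phi> (x \<oplus> y) = \<phi> x + \<phi> y" using \<phi> xw yw Wadd by simp
  next
    fix x c assume x: "x \<in> carrier M"
    obtain a w where xw: "w \<in> W" "x = w \<oplus> a \<odot> v" using ex[OF x] by blast
    have "c \<odot> x = c \<odot> w \<oplus> (c * a) \<odot> v" using xw v Wc by (simp add: smult_add_r smult_smult)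
    then show "\<phi> (c \<odot> x) = c * \<phi> x" using \<phi> xw Wsm by simp
  qed
  moreover have "\<phi> v = 1" using \<phi>[OF W0, of 1] v by simp
  ultimately show ?thesis by (metis zero_neq_one)
qed

lemma fnl_eqI:
  assumes "u \<in> carrier M" "v \<in> carrier M" "\<And>\<phi>. \<phi> \<in> fnl M \<Longrightarrow> \<phi> u = \<phi> v"
  shows "u = v"
proof (rule ccontr)
  assume "u \<noteq> v"
  then have "u \<oplus> \<ominus> v \<noteq> \<zero>" using assms(1,2) minus_equality[of u "\<ominus> v"] by auto
  then obtain \<phi> where "\<phi> \<in> fnl M" "\<phi> (u \<oplus> \<ominus> v) \<noteq> 0" using fnl_separates_0[of "u \<oplus> \<ominus> v"] assms by auto
  then show False using assms by (simp add: fnl_add fnl_neg)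
qed

end

lemma kvsI:
  fixes M :: "('k::field, 'v, 'z) module_scheme" (structure)
  assumes zero: "\<zero> \<in> carrier M"
    and add: "\<And>u v. u \<in> carrier M \<Longrightarrow> v \<in> carrier M \<Longrightarrow> u \<oplus> v \<in> carrier M"
    and smult: "\<And>c v. v \<in> carrier M \<Longrightarrow> c \<odot> v \<in> carrier M"
    and zl: "\<And>v. v \<in> carrier M \<Longrightarrow> \<zero> \<oplus> v = v"
    and comm: "\<And>u v. u \<in> carrier M \<Longrightarrow> v \<in> carrier M \<Longrightarrow> u \<oplus> v = v \<oplus> u"
    and assoc: "\<And>u v w. u \<in> carrier M \<Longrightarrow> v \<in> carrier M \<Longrightarrow> w \<in> carrier M \<Longrightarrow> (u \<oplus> v) \<oplus> w = u \<oplus> (v \<oplus> w)"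
    and inv: "\<And>v. v \<in> carrier M \<Longrightarrow> v \<oplus> (- 1) \<odot> v = \<zero>"
    and "\<And>a b v. v \<in> carrier M \<Longrightarrow> (a + b) \<odot> v = a \<odot> v \<oplus> b \<odot> v"
    and "\<And>a u v. u \<in> carrier M \<Longrightarrow> v \<in> carrier M \<Longrightarrow> a \<odot> (u \<oplus> v) = a \<odot> u \<oplus> a \<odot> v"
    and "\<And>a b v. v \<in> carrier M \<Longrightarrow> (a * b) \<odot> v = a \<odot> (b \<odot> v)"
    and "\<And>v. v \<in> carrier M \<Longrightarrow> 1 \<odot> v = v"
  shows "kvs M"
proof (rule kvs.intro)
  have f: "field (class_ring :: 'k ring)" by (rule class_field)
  have "\<exists>n\<in>carrier M. v \<oplus> n = \<zero>" if "v \<in> carrier M" for v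
    using inv smult that by blast
  moreover have "v \<oplus> \<zero> = v" if "v \<in> carrier M" for v
    using zl[OF that] comm[OF zero that] by simp
  ultimately have "module class_ring M"
    using assms f by (intro module_criteria) (auto simp: field_def domain_def)
  then show "vectorspace class_ring M"
    using f by (simp add: vectorspace_def)
qed

section \<open>The group and its coordinate ring\<close>

text \<open>Euclid's argument: one plus the product of all X - a would have no root.\<close>

lemma infinite_alg_closed: "infinite (UNIV :: 'k::alg_closed_field set)"
proof
  assume fin: "finite (UNIV :: 'k set)"
  define P where "P = (\<Prod>a\<in>(UNIV :: 'k set). [:- a, 1:]) + 1"
  have "degree (\<Prod>a\<in>(UNIV :: 'k set). [:- a, 1:]) = (\<Sum>a\<in>(UNIV :: 'k set). degree [:- a, 1:])"
    by (rule degree_prod_eq_sum_degree) auto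
  also have "\<dots> > 0" using fin by (simp add: card_gt_0_iff)
  finally have "degree P > 0" unfolding P_def by (simp add: degree_add_eq_left)
  then obtain x where "poly P x = 0" using alg_closed_imp_poly_has_root by blast
  moreover have "poly P x = 1" using fin by (simp add: P_def poly_prod prod_zero_iff)
  ultimately show False by simp
qed

text \<open>Only nonzero arguments are compared, so that identities on the torus or on an overlap of
  charts are covered.\<close>

lemma poly_eqI_inf:
  fixes q r :: "'k::alg_closed_field poly"
  assumes "\<And>x. x \<noteq> 0 \<Longrightarrow> poly q x = poly r x"
  shows "q = r"
proof (rule ccontr)
  assume "q \<noteq> r"
  then have "finite {x. poly (q - r) x = 0}" by (intro poly_roots_finite) simp
  moreover have "UNIV - {0} \<subseteq> {x. poly (q - r) x = 0}" using assms by auto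
  ultimately have "finite (UNIV - {0 :: 'k})" by (rule finite_subset[rotated])
  moreover have "infinite (UNIV - {0 :: 'k})" by (rule Diff_infinite_finite) (auto simp: infinite_alg_closed)
  ultimately show False by simp
qed

section \<open>Two by two matrices and the group structure\<close>

definition m2 :: "'k::field \<Rightarrow> 'k \<Rightarrow> 'k \<Rightarrow> 'k \<Rightarrow> 'k mat" where
  "m2 a b c d = mat 2 2 (\<lambda>(i, j). if i = 0 then if j = 0 then a else b else if j = 0 then c else d)"

lemma m2_entries [simp]: "m2 a b c d $$ (0, 0) = a" "m2 a b c d $$ (0, 1) = b" "m2 a b c d $$ (1, 0) = c"
  "m2 a b c d $$ (1, 1) = d" "m2 a b c d $$ (0, Suc 0) = b" "m2 a b c d $$ (Suc 0, 0) = c" "m2 a b c d $$ (Suc 0, Suc 0) = d"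
  by (auto simp: m2_def)

lemma m2_carrier [simp]: "m2 a b c d \<in> carrier_mat 2 2" "dim_row (m2 a b c d) = 2" "dim_col (m2 a b c d) = 2"
  by (auto simp: m2_def)

lemma less_2_cases': "i < 2 \<Longrightarrow> i = 0 \<or> i = Suc (0::nat)"
  by auto

lemma mat2_eqI: "g \<in> carrier_mat 2 2 \<Longrightarrow> h \<in> carrier_mat 2 2 \<Longrightarrow> g $$ (0,0) = h $$ (0,0) \<Longrightarrow> g $$ (0,1) = h $$ (0,1)
   \<Longrightarrow> g $$ (1,0) = h $$ (1,0) \<Longrightarrow> g $$ (1,1) = h $$ (1,1) \<Longrightarrow> g = h"
  by (rule eq_matI) (auto dest!: less_2_cases')

lemma m2_eta: "g \<in> carrier_mat 2 2 \<Longrightarrow> g = m2 (g $$ (0,0)) (g $$ (0,1)) (g $$ (1,0)) (g $$ (1,1))"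
  by (rule mat2_eqI) auto

lemma mult_entry2:
  assumes "g \<in> carrier_mat 2 2" "h \<in> carrier_mat 2 2" "i < 2" "j < 2"
  shows "(g * h) $$ (i, j) = g $$ (i, 0) * h $$ (0, j) + g $$ (i, 1) * h $$ (1, j)"
  using assms by (auto simp: scalar_prod_def numeral_2_eq_2)

lemma m2_mult: "m2 a b c d * m2 a' b' c' d' =
    m2 (a * a' + b * c') (a * b' + b * d') (c * a' + d * c') (c * b' + d * d')"
  by (rule mat2_eqI) (auto simp: mult_entry2 simp del: index_mult_mat(1))

lemma det_m2: "det (m2 a b c d) = a * d - b * c"
proof -
  have d: "det A = A $$ (0, 0)" if "dim_row A = 1" "dim_col A = 1" for A :: "'a mat"
    using that by (intro det_single) auto
  have "det (m2 a b c d) = (\<Sum>j<2. m2 a b c d $$ (0, j) * cofactor (m2 a b c d) 0 j)"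
    by (rule laplace_expansion_row) auto
  then show ?thesis
    by (simp add: numeral_2_eq_2 cofactor_def d mat_delete_dim) (simp add: mat_delete_def)
qed

lemma m2_SL2: "m2 a b c d \<in> carrier SL2 \<longleftrightarrow> a * d - b * c = 1"
  by (simp add: SL2_def det_m2)

lemma SL2_carrier_mat: "g \<in> carrier SL2 \<Longrightarrow> g \<in> carrier_mat 2 2"
  by (simp add: SL2_def)

lemma SL2_m2E:
  assumes "g \<in> carrier SL2"
  obtains a b c d where "g = m2 a b c d" "a * d - b * c = 1"
  using m2_eta[OF SL2_carrier_mat[OF assms]] assms m2_SL2 by metis

lemma mult_SL2 [simp]: "g \<otimes>\<^bsub>SL2\<^esub> h = g * h"
  by (simp add: SL2_def)

lemma one_SL2 [simp]: "\<one>\<^bsub>SL2\<^esub> = m2 1 0 0 1"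
  by (simp add: SL2_def) (rule mat2_eqI; auto)

lemma SL2_mult_cl [simp, intro]: "g \<in> carrier SL2 \<Longrightarrow> h \<in> carrier SL2 \<Longrightarrow> g * h \<in> carrier SL2"
  by (auto simp: SL2_def det_mult)

lemma SL2_assoc: "g \<in> carrier SL2 \<Longrightarrow> h \<in> carrier SL2 \<Longrightarrow> x \<in> carrier SL2 \<Longrightarrow> g * h * x = g * (h * x)"
  by (auto simp: SL2_def)

lemma SL2_one_cl [simp]: "m2 1 0 0 1 \<in> carrier SL2"
  by (simp add: m2_SL2)

lemma SL2_one_mult [simp]: "g \<in> carrier SL2 \<Longrightarrow> m2 1 0 0 1 * g = g" "g \<in> carrier SL2 \<Longrightarrow> g * m2 1 0 0 1 = g"
  by (auto elim!: SL2_m2E simp: m2_mult)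

lemma group_SL2: "group (SL2 :: 'k::field mat monoid)"
proof (rule groupI)
  fix g :: "'k mat" assume "g \<in> carrier SL2"
  then obtain a b c d where g: "g = m2 a b c d" "a * d - b * c = 1" by (rule SL2_m2E)
  have "m2 d (- b) (- c) a * m2 a b c d = m2 1 0 0 1" using g(2) by (simp add: m2_mult mult.commute)
  then show "\<exists>h\<in>carrier SL2. h \<otimes>\<^bsub>SL2\<^esub> g = \<one>\<^bsub>SL2\<^esub>"
    using g by (intro bexI[of _ "m2 d (- b) (- c) a"]) (auto simp: m2_SL2 mult.commute)
qed (auto simp: SL2_assoc)

interpretation SL2: group "SL2 :: 'k::field mat monoid"
  by (rule group_SL2)

section \<open>Closure properties of the coordinate ring\<close>

lemma coord_ring_ext: "f \<in> coord_ring \<Longrightarrow> f \<in> extensional (carrier SL2)"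
  by (induction rule: coord_ring.induct) (rule restrict_extensional)+

lemma coord_ring_cong:
  assumes "f \<in> coord_ring" "\<And>g. g \<in> carrier SL2 \<Longrightarrow> h g = f g"
  shows "restrict h (carrier SL2) \<in> coord_ring"
proof -
  have "restrict h (carrier SL2) = f" using assms coord_ring_ext[OF assms(1)]
    by (auto simp: restrict_def extensional_def)
  then show ?thesis using assms by simp
qed

lemma coord_ring_add: "restrict f (carrier SL2) \<in> coord_ring \<Longrightarrow> restrict h (carrier SL2) \<in> coord_ring
    \<Longrightarrow> restrict (\<lambda>g. f g + h g) (carrier SL2) \<in> coord_ring"
  by (rule coord_ring_cong[OF coord_ring.add[of "restrict f (carrier SL2)" "restrict h (carrier SL2)"]]) auto

lemma coord_ring_mult: "restrict f (carrier SL2) \<in> coord_ring \<Longrightarrow> restrict h (carrier SL2) \<in> coord_ring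
    \<Longrightarrow> restrict (\<lambda>g. f g * h g) (carrier SL2) \<in> coord_ring"
  by (rule coord_ring_cong[OF coord_ring.mult[of "restrict f (carrier SL2)" "restrict h (carrier SL2)"]]) auto

lemma coord_ring_restrict: "f \<in> coord_ring \<Longrightarrow> restrict f (carrier SL2) \<in> coord_ring"
  by (rule coord_ring_cong) auto

lemma coord_ring_const: "restrict (\<lambda>g. c) (carrier SL2) \<in> coord_ring"
  by (rule coord_ring.const)

lemma coord_ring_sum: "(\<And>a. a \<in> A \<Longrightarrow> restrict (f a) (carrier SL2) \<in> coord_ring)
    \<Longrightarrow> restrict (\<lambda>g. \<Sum>a\<in>A. f a g) (carrier SL2) \<in> coord_ring"
  by (induction A rule: infinite_finite_induct) (auto intro: coord_ring_const coord_ring_add)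

lemma coord_ring_power: "restrict f (carrier SL2) \<in> coord_ring \<Longrightarrow> restrict (\<lambda>g. f g ^ n) (carrier SL2) \<in> coord_ring"
  by (induction n) (auto intro: coord_ring_const coord_ring_mult)

section \<open>Regular functions on polynomial curves and on the torus\<close>

definition pcurve :: "('k::field \<Rightarrow> 'k mat) \<Rightarrow> bool" where
  "pcurve \<gamma> \<longleftrightarrow> (\<forall>x. \<gamma> x \<in> carrier SL2) \<and> (\<forall>i<2. \<forall>j<2. \<exists>q. \<forall>x. \<gamma> x $$ (i, j) = poly q x)"

lemma coord_pcurve:
  assumes "f \<in> coord_ring" "pcurve \<gamma>"
  shows "\<exists>q. \<forall>x. f (\<gamma> x) = poly q x"
  using assms(1)
proof induction
  case (const c)
  show ?case using assms(2) by (intro exI[of _ "[:c:]"]) (auto simp: pcurve_def)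
next
  case (entry i j)
  then obtain q where "\<forall>x. \<gamma> x $$ (i, j) = poly q x" using assms(2) unfolding pcurve_def by blast
  then show ?case using assms(2) by (intro exI[of _ q]) (auto simp: pcurve_def)
next
  case (add f h)
  then obtain q r where "\<forall>x. f (\<gamma> x) = poly q x" "\<forall>x. h (\<gamma> x) = poly r x" by auto
  then show ?case using assms(2) by (intro exI[of _ "q + r"]) (auto simp: pcurve_def)
next
  case (mult f h)
  then obtain q r where "\<forall>x. f (\<gamma> x) = poly q x" "\<forall>x. h (\<gamma> x) = poly r x" by auto
  then show ?case using assms(2) by (intro exI[of _ "q * r"]) (auto simp: pcurve_def)
qed

definition Um :: "'k::field \<Rightarrow> 'k mat" where "Um x = m2 1 x 0 1"
definition Lm :: "'k::field \<Rightarrow> 'k mat" where "Lm y = m2 1 0 y 1"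
definition Tm :: "'k::field \<Rightarrow> 'k mat" where "Tm z = m2 z 0 0 (inverse z)"

lemma Um_SL2 [simp]: "Um x \<in> carrier SL2" and Lm_SL2 [simp]: "Lm x \<in> carrier SL2"
  by (auto simp: Um_def Lm_def m2_SL2)

lemma Tm_SL2 [simp]: "z \<noteq> 0 \<Longrightarrow> Tm z \<in> carrier SL2"
  by (simp add: Tm_def m2_SL2)

lemma pcurve_m2:
  assumes "\<And>x. \<gamma> x = m2 (poly qa x) (poly qb x) (poly qc x) (poly qd x)" "\<And>x. \<gamma> x \<in> carrier SL2"
  shows "pcurve \<gamma>"
  unfolding pcurve_def
proof (intro conjI allI impI)
  fix i j :: nat assume "i < 2" "j < 2"
  then show "\<exists>q. \<forall>x. \<gamma> x $$ (i, j) = poly q x"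
    unfolding assms(1) by (elim less_2_cases'[THEN disjE]) (simp only: m2_entries, blast)+
qed (fact assms)

lemma pcurve_mult_Lm:
  assumes "g \<in> carrier SL2"
  shows "pcurve (\<lambda>y. g * Lm y)"
  using assms
proof (elim SL2_m2E)
  fix a b c d assume g: "g = m2 a b c d" "a * d - b * c = 1"
  show ?thesis
    by (rule pcurve_m2[of _ "[:a, b:]" "[:b:]" "[:c, d:]" "[:d:]"]) (use g in \<open>auto simp: Lm_def m2_mult m2_SL2 algebra_simps\<close>)
qed

lemma pcurve_Lm: "pcurve Lm"
  by (rule pcurve_m2[of _ 1 0 "[:0, 1:]" 1]) (auto simp: Lm_def m2_SL2)

lemma pcurve_Um: "pcurve Um"
  by (rule pcurve_m2[of _ 1 "[:0, 1:]" 0 1]) (auto simp: Um_def m2_SL2)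

text \<open>The entries of \<open>Tm z\<close> are z, 0 and 1/z, so a power of z clears all
  denominators.\<close>

lemma coord_Tm:
  assumes "f \<in> coord_ring"
  shows "\<exists>q N. \<forall>z. z \<noteq> 0 \<longrightarrow> z ^ N * f (Tm z) = poly q z"
  using assms
proof induction
  case (const c)
  show ?case by (intro exI[of _ "[:c:]"] exI[of _ 0]) auto
next
  case (entry i j)
  have "\<exists>q N. \<forall>z::'a. z \<noteq> 0 \<longrightarrow> z ^ N * z = poly q z" by (intro exI[of _ "[:0, 1:]"] exI[of _ 0]) simp
  moreover have "\<exists>q N. \<forall>z::'a. z \<noteq> 0 \<longrightarrow> z ^ N * 0 = poly q z" by (intro exI[of _ 0] exI[of _ 0]) simp
  moreover have "\<exists>q N. \<forall>z::'a. z \<noteq> 0 \<longrightarrow> z ^ N * inverse z = poly q z" by (intro exI[of _ 1] exI[of _ 1]) simp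
  moreover have "restrict (\<lambda>g. g $$ (i, j)) (carrier SL2) (Tm z) = (if i = 0 then if j = 0 then z else 0 else if j = 0 then 0 else inverse z)"
    if "z \<noteq> 0" for z :: 'a
    using entry that by (auto simp: Tm_def m2_SL2 dest!: less_2_cases')
  ultimately show ?case by (cases "i = 0"; cases "j = 0") simp_all
next
  case (add f h)
  then obtain q r N M where qr: "\<And>z. z \<noteq> 0 \<Longrightarrow> z ^ N * f (Tm z) = poly q z" "\<And>z. z \<noteq> 0 \<Longrightarrow> z ^ M * h (Tm z) = poly r z"
    by blast
  have "z ^ (N + M) * (f (Tm z) + h (Tm z)) = poly (monom 1 M * q + monom 1 N * r) z" if "z \<noteq> 0" for z
    unfolding poly_add poly_mult poly_monom qr(1)[OF that, symmetric] qr(2)[OF that, symmetric]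
    by (simp add: power_add algebra_simps)
  then show ?case by (intro exI[of _ "monom 1 M * q + monom 1 N * r"] exI[of _ "N + M"]) simp
next
  case (mult f h)
  then obtain q r N M where qr: "\<And>z. z \<noteq> 0 \<Longrightarrow> z ^ N * f (Tm z) = poly q z" "\<And>z. z \<noteq> 0 \<Longrightarrow> z ^ M * h (Tm z) = poly r z"
    by blast
  have "z ^ (N + M) * (f (Tm z) * h (Tm z)) = poly (q * r) z" if "z \<noteq> 0" for z
    unfolding poly_mult qr(1)[OF that, symmetric] qr(2)[OF that, symmetric]
    by (simp add: power_add)
  then show ?case by (intro exI[of _ "q * r"] exI[of _ "N + M"]) simp
qed

text \<open>The expansion holds over every sufficiently large symmetric range, so that several
  functions can be expanded over a common one.\<close>

lemma coord_Laurent: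
  assumes "f \<in> coord_ring"
  shows "\<exists>a N. (\<forall>n. \<bar>n\<bar> > int N \<longrightarrow> a n = 0) \<and>
    (\<forall>M\<ge>N. \<forall>z. z \<noteq> 0 \<longrightarrow> f (Tm z) = (\<Sum>n\<in>{- int M..int M}. z powi n * a n))"
proof -
  obtain q N0 where q: "\<And>z. z \<noteq> 0 \<Longrightarrow> z ^ N0 * f (Tm z) = poly q z" using coord_Tm[OF assms] by auto
  define N where "N = N0 + degree q"
  define a where "a n = (if n \<ge> - int N0 then coeff q (nat (n + int N0)) else 0)" for n
  have a0: "a n = 0" if "\<bar>n\<bar> > int N" for n
    using that by (auto simp: a_def N_def intro!: coeff_eq_0)
  have "f (Tm z) = (\<Sum>n\<in>{- int M..int M}. z powi n * a n)" if "M \<ge> N" "z \<noteq> 0" for M z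
  proof -
    have "(\<Sum>n\<in>{- int M..int M}. z powi n * a n) = (\<Sum>n\<in>(\<lambda>t. int t - int N0) ` {..degree q}. z powi n * a n)"
    proof (rule sum.mono_neutral_right)
      show "(\<lambda>t. int t - int N0) ` {..degree q} \<subseteq> {- int M..int M}" using that by (auto simp: N_def)
      show "\<forall>n\<in>{- int M..int M} - (\<lambda>t. int t - int N0) ` {..degree q}. z powi n * a n = 0"
      proof
        fix n assume n: "n \<in> {- int M..int M} - (\<lambda>t. int t - int N0) ` {..degree q}"
        have "a n = 0"
        proof (cases "n \<ge> - int N0")
          case True
          then have "n = int (nat (n + int N0)) - int N0" by simp
          then have "\<not> nat (n + int N0) \<le> degree q" using n by blast
          then show ?thesis by (simp add: a_def coeff_eq_0)
        qed (simp add: a_def)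
        then show "z powi n * a n = 0" by simp
      qed
    qed simp
    also have "\<dots> = (\<Sum>t\<le>degree q. z powi (int t - int N0) * coeff q t)"
      by (subst sum.reindex) (auto simp: inj_on_def a_def)
    also have "\<dots> = inverse (z ^ N0) * (\<Sum>t\<le>degree q. coeff q t * z ^ t)"
      using that(2) by (simp add: sum_distrib_left power_int_diff field_simps)
    also have "\<dots> = inverse (z ^ N0) * poly q z" by (simp add: poly_altdef)
    also have "\<dots> = f (Tm z)" using that(2) by (simp flip: q)
    finally show ?thesis by simp
  qed
  then show ?thesis using a0 by blast
qed

lemma Laurent_unique:
  fixes a :: "int \<Rightarrow> 'k::alg_closed_field"
  assumes "\<And>z. z \<noteq> 0 \<Longrightarrow> (\<Sum>n\<in>{- int N..int N}. z powi n * a n) = 0" "\<bar>n\<bar> \<le> int N"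
  shows "a n = 0"
proof -
  define q where "q = (\<Sum>t\<le>2 * N. monom (a (int t - int N)) t)"
  have "poly q z = 0" if "z \<noteq> 0" for z
  proof -
    have "poly q z = (\<Sum>t\<le>2 * N. z ^ t * a (int t - int N))"
      by (simp add: q_def poly_sum poly_monom mult.commute)
    also have "\<dots> = z ^ N * (\<Sum>t\<le>2 * N. z powi (int t - int N) * a (int t - int N))"
      using that by (simp add: sum_distrib_left power_int_diff field_simps)
    also have "(\<Sum>t\<le>2 * N. z powi (int t - int N) * a (int t - int N)) = (\<Sum>n\<in>{- int N..int N}. z powi n * a n)"
      by (rule sum.reindex_bij_witness[of _ "\<lambda>n. nat (n + int N)" "\<lambda>t. int t - int N"]) auto
    also have "\<dots> = 0" by (rule assms(1)[OF that])
    finally show ?thesis by simp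
  qed
  then have "q = 0" by (intro poly_eqI_inf) simp
  then have "coeff q (nat (n + int N)) = 0" by simp
  moreover have "coeff q (nat (n + int N)) = (\<Sum>t\<le>2 * N. if t = nat (n + int N) then a (int t - int N) else 0)"
    by (simp add: q_def coeff_sum)
  moreover have "\<dots> = a n" using assms(2) by (auto simp: abs_le_iff nat_le_iff)
  ultimately show ?thesis by simp
qed

section \<open>Divided powers and weights in rational modules\<close>

text \<open>The vector-valued polynomial x \<mapsto> \<gamma>(x) v has the coefficients
  \<open>w t\<close>; the polynomial identity is expressed through functionals.\<close>

definition pexp :: "('k::field, 'v) gmod \<Rightarrow> ('k \<Rightarrow> 'k mat) \<Rightarrow> 'v \<Rightarrow> (nat \<Rightarrow> 'v) \<Rightarrow> bool" where
  "pexp M \<gamma> v w \<longleftrightarrow> (\<forall>t. w t \<in> carrier M) \<and> (\<exists>D. \<forall>t\<ge>D. w t = \<zero>\<^bsub>M\<^esub>) \<and>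
     (\<forall>\<phi>\<in>fnl M. \<exists>q. (\<forall>t. coeff q t = \<phi> (w t)) \<and> (\<forall>x. \<phi> (act M (\<gamma> x) v) = poly q x))"

definition pcoef :: "('k::field, 'v) gmod \<Rightarrow> ('k \<Rightarrow> 'k mat) \<Rightarrow> 'v \<Rightarrow> nat \<Rightarrow> 'v" where
  "pcoef M \<gamma> v = (SOME w. pexp M \<gamma> v w)"

text \<open>The divided power e^t / t! of the positive root vector.\<close>

definition eop :: "('k::field, 'v) gmod \<Rightarrow> nat \<Rightarrow> 'v \<Rightarrow> 'v" where
  "eop M t v = pcoef M Um v t"

definition fop :: "('k::field, 'v) gmod \<Rightarrow> nat \<Rightarrow> 'v \<Rightarrow> 'v" where
  "fop M t v = pcoef M Lm v t"

definition wt :: "('k::field, 'v) gmod \<Rightarrow> int \<Rightarrow> 'v set" where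
  "wt M n = {v \<in> carrier M. \<forall>z. z \<noteq> 0 \<longrightarrow> act M (Tm z) v = (z powi n) \<odot>\<^bsub>M\<^esub> v}"

definition texp :: "('k::field, 'v) gmod \<Rightarrow> 'v \<Rightarrow> (int \<Rightarrow> 'v) \<Rightarrow> bool" where
  "texp M v w \<longleftrightarrow> (\<forall>n. w n \<in> carrier M) \<and>
     (\<exists>N. (\<forall>n. \<bar>n\<bar> > int N \<longrightarrow> w n = \<zero>\<^bsub>M\<^esub>) \<and>
       (\<forall>K\<ge>N. \<forall>\<phi>\<in>fnl M. \<forall>z. z \<noteq> 0 \<longrightarrow> \<phi> (act M (Tm z) v) = (\<Sum>n\<in>{- int K..int K}. z powi n * \<phi> (w n))))"

definition pr :: "('k::field, 'v) gmod \<Rightarrow> int \<Rightarrow> 'v \<Rightarrow> 'v" where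
  "pr M n v = (SOME w. texp M v w) n"

locale rat = rational_gmod M for M :: "('k::alg_closed_field, 'v) gmod" (structure)

sublocale rat \<subseteq> kvs M
  by (rule kvs.intro) (fact vectorspace)

context rat
begin

lemma act_cl [simp, intro]: "g \<in> carrier SL2 \<Longrightarrow> v \<in> carrier M \<Longrightarrow> act M g v \<in> carrier M"
  using LinearCombinations.module_hom_closed[OF act_linear] by auto

lemma act_add: "g \<in> carrier SL2 \<Longrightarrow> u \<in> carrier M \<Longrightarrow> v \<in> carrier M \<Longrightarrow> act M g (u \<oplus> v) = act M g u \<oplus> act M g v"
  by (rule LinearCombinations.module_hom_add[OF act_linear])

lemma act_smult: "g \<in> carrier SL2 \<Longrightarrow> v \<in> carrier M \<Longrightarrow> act M g (c \<odot> v) = c \<odot> act M g v"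
  using LinearCombinations.module_hom_smult[OF act_linear, of g c v] by simp

lemma act_act: "g \<in> carrier SL2 \<Longrightarrow> h \<in> carrier SL2 \<Longrightarrow> v \<in> carrier M \<Longrightarrow> act M g (act M h v) = act M (g * h) v"
  using act_mult[of g h v] by simp

lemma act_1 [simp]: "v \<in> carrier M \<Longrightarrow> act M (m2 1 0 0 1) v = v"
  using act_one by simp

lemma fnl_act: "\<phi> \<in> fnl M \<Longrightarrow> g \<in> carrier SL2 \<Longrightarrow> (\<lambda>v. \<phi> (act M g v)) \<in> fnl M"
  by (simp add: fnl_def act_add act_smult)

text \<open>Rationality for a single vector: its orbit map has regular coordinates with respect to a
  finite set \<open>B\<close>.\<close>

lemma matrix_form:
  assumes v: "v \<in> carrier M"
  shows "\<exists>B f. finite B \<and> B \<subseteq> carrier M \<and> (\<forall>c\<in>B. restrict (f c) (carrier SL2) \<in> coord_ring) \<and>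
    (\<forall>g\<in>carrier SL2. \<forall>\<phi>\<in>fnl M. \<phi> (act M g v) = (\<Sum>c\<in>B. f c g * \<phi> c))"
proof -
  obtain B a where B: "finite B" "B \<subseteq> carrier M" "v \<in> span B"
    and a: "\<And>b c. b \<in> B \<Longrightarrow> c \<in> B \<Longrightarrow> a c b \<in> coord_ring"
    and actB: "\<And>g b. g \<in> carrier SL2 \<Longrightarrow> b \<in> B \<Longrightarrow> act M g b = lincomb (\<lambda>c. a c b g) B"
    using rational[OF v] by metis
  obtain l where l: "v = lincomb l B"
    using B(3) finite_span[OF B(1,2)] by auto
  have lc: "\<phi> (lincomb h B) = (\<Sum>b\<in>B. h b * \<phi> b)" if "\<phi> \<in> fnl M" for h \<phi>
    unfolding lincomb_def using that B by (subst fnl_finsum) (auto simp: fnl_smult intro!: sum.cong)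
  define f where "f c g = (\<Sum>b\<in>B. l b * a c b g)" for c g
  have "restrict (f c) (carrier SL2) \<in> coord_ring" if "c \<in> B" for c
    unfolding f_def using a that
    by (intro coord_ring_sum coord_ring_mult coord_ring_const coord_ring_restrict) auto
  moreover have "\<phi> (act M g v) = (\<Sum>c\<in>B. f c g * \<phi> c)" if g: "g \<in> carrier SL2" and \<phi>: "\<phi> \<in> fnl M" for g \<phi>
  proof -
    have "\<phi> (act M g v) = (\<Sum>b\<in>B. l b * \<phi> (act M g b))"
      using lc[OF fnl_act[OF \<phi> g]] l by simp
    also have "\<dots> = (\<Sum>b\<in>B. \<Sum>c\<in>B. l b * a c b g * \<phi> c)"
      using actB[OF g] lc[OF \<phi>] by (auto simp: sum_distrib_left mult.assoc intro!: sum.cong)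
    also have "\<dots> = (\<Sum>c\<in>B. \<Sum>b\<in>B. l b * a c b g * \<phi> c)" by (rule sum.swap)
    finally show ?thesis by (simp add: f_def sum_distrib_right)
  qed
  ultimately show ?thesis using B by blast
qed

lemma pexp_exists:
  assumes v: "v \<in> carrier M" and \<gamma>: "pcurve \<gamma>"
  shows "\<exists>w. pexp M \<gamma> v w"
proof -
  obtain B f where B: "finite B" "B \<subseteq> carrier M" and f: "\<And>c. c \<in> B \<Longrightarrow> restrict (f c) (carrier SL2) \<in> coord_ring"
    and form: "\<And>g \<phi>. g \<in> carrier SL2 \<Longrightarrow> \<phi> \<in> fnl M \<Longrightarrow> \<phi> (act M g v) = (\<Sum>c\<in>B. f c g * \<phi> c)"
    using matrix_form[OF v] by metis
  have \<gamma>c: "\<gamma> x \<in> carrier SL2" for x using \<gamma> by (simp add: pcurve_def)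
  have "\<forall>c. \<exists>q. c \<in> B \<longrightarrow> (\<forall>x. f c (\<gamma> x) = poly q x)"
    using coord_pcurve[OF f \<gamma>] \<gamma>c by auto
  then obtain q where q: "\<And>c x. c \<in> B \<Longrightarrow> f c (\<gamma> x) = poly (q c) x" by metis
  define w where "w t = finsum M (\<lambda>c. coeff (q c) t \<odot> c) B" for t
  have Pi: "(\<lambda>c. coeff (q c) t \<odot> c) \<in> B \<rightarrow> carrier M" for t using B by auto
  have wc: "w t \<in> carrier M" for t unfolding w_def using Pi by (rule finsum_closed)
  have \<phi>w: "\<phi> (w t) = (\<Sum>c\<in>B. coeff (q c) t * \<phi> c)" if "\<phi> \<in> fnl M" for \<phi> t
    unfolding w_def fnl_finsum[OF that B(1) Pi] using B by (auto intro!: sum.cong simp: fnl_smult[OF that])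
  have "w t = \<zero>" if "t \<ge> Suc (\<Sum>c\<in>B. degree (q c))" for t
  proof (rule fnl_eqI)
    fix \<phi> assume \<phi>: "\<phi> \<in> fnl M"
    have "coeff (q c) t = 0" if "c \<in> B" for c
      using member_le_sum[OF that, of "\<lambda>c. degree (q c)"] B(1) \<open>t \<ge> _\<close> by (intro coeff_eq_0) simp
    then show "\<phi> (w t) = \<phi> \<zero>" using \<phi> by (simp add: \<phi>w fnl_zero)
  qed (auto simp: wc)
  moreover have "\<exists>r. (\<forall>t. coeff r t = \<phi> (w t)) \<and> (\<forall>x. \<phi> (act M (\<gamma> x) v) = poly r x)" if \<phi>: "\<phi> \<in> fnl M" for \<phi>
    by (rule exI[of _ "\<Sum>c\<in>B. Polynomial.smult (\<phi> c) (q c)"])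
      (simp add: coeff_sum poly_sum \<phi>w[OF \<phi>] form[OF \<gamma>c \<phi>] q mult.commute)
  ultimately show ?thesis unfolding pexp_def using wc by (intro exI[of _ w]) blast
qed

lemma pexp_unique:
  assumes "pexp M \<gamma> v w" "pexp M \<gamma> v w'"
  shows "w = w'"
proof
  fix t
  show "w t = w' t"
  proof (rule fnl_eqI)
    fix \<phi> assume "\<phi> \<in> fnl M"
    then obtain q q' where q: "\<And>t. coeff q t = \<phi> (w t)" "\<And>x. \<phi> (act M (\<gamma> x) v) = poly q x"
      "\<And>t. coeff q' t = \<phi> (w' t)" "\<And>x. \<phi> (act M (\<gamma> x) v) = poly q' x"
      using assms unfolding pexp_def by metis
    then have "q = q'" by (intro poly_eqI_inf) simp
    then show "\<phi> (w t) = \<phi> (w' t)" using q by metis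
  qed (use assms in \<open>auto simp: pexp_def\<close>)
qed

lemma pcoef_pexp: "v \<in> carrier M \<Longrightarrow> pcurve \<gamma> \<Longrightarrow> pexp M \<gamma> v (pcoef M \<gamma> v)"
  unfolding pcoef_def using pexp_exists by (rule someI_ex)

lemma pcoef_eqI: "v \<in> carrier M \<Longrightarrow> pcurve \<gamma> \<Longrightarrow> pexp M \<gamma> v w \<Longrightarrow> pcoef M \<gamma> v t = w t"
  using pexp_unique[OF pcoef_pexp] by metis

lemma pcoef_cl: "v \<in> carrier M \<Longrightarrow> pcurve \<gamma> \<Longrightarrow> pcoef M \<gamma> v t \<in> carrier M"
  using pcoef_pexp by (auto simp: pexp_def)

lemma pcoef_finite: "v \<in> carrier M \<Longrightarrow> pcurve \<gamma> \<Longrightarrow> \<exists>D. \<forall>t\<ge>D. pcoef M \<gamma> v t = \<zero>"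
  using pcoef_pexp by (auto simp: pexp_def)

lemma pcoef_poly:
  assumes "v \<in> carrier M" "pcurve \<gamma>" "\<phi> \<in> fnl M"
  obtains q where "\<And>t. coeff q t = \<phi> (pcoef M \<gamma> v t)" "\<And>x. \<phi> (act M (\<gamma> x) v) = poly q x"
  using pcoef_pexp[OF assms(1,2)] assms(3) unfolding pexp_def by metis

lemma pcoef_add:
  assumes "u \<in> carrier M" "v \<in> carrier M" "pcurve \<gamma>"
  shows "pcoef M \<gamma> (u \<oplus> v) t = pcoef M \<gamma> u t \<oplus> pcoef M \<gamma> v t"
proof (rule pcoef_eqI)
  have \<gamma>c: "\<gamma> x \<in> carrier SL2" for x using assms by (simp add: pcurve_def)
  obtain D D' where D: "\<And>t. t \<ge> D \<Longrightarrow> pcoef M \<gamma> u t = \<zero>" "\<And>t. t \<ge> D' \<Longrightarrow> pcoef M \<gamma> v t = \<zero>"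
    using pcoef_finite assms by metis
  have "\<exists>q. (\<forall>t. coeff q t = \<phi> (pcoef M \<gamma> u t \<oplus> pcoef M \<gamma> v t)) \<and> (\<forall>x. \<phi> (act M (\<gamma> x) (u \<oplus> v)) = poly q x)"
    if \<phi>: "\<phi> \<in> fnl M" for \<phi>
  proof -
    obtain q where q: "\<And>t. coeff q t = \<phi> (pcoef M \<gamma> u t)" "\<And>x. \<phi> (act M (\<gamma> x) u) = poly q x"
      using pcoef_poly[OF assms(1,3) \<phi>] by metis
    obtain r where r: "\<And>t. coeff r t = \<phi> (pcoef M \<gamma> v t)" "\<And>x. \<phi> (act M (\<gamma> x) v) = poly r x"
      using pcoef_poly[OF assms(2,3) \<phi>] by metis
    show ?thesis
      using assms \<phi> by (intro exI[of _ "q + r"]) (simp add: q r fnl_add pcoef_cl act_add \<gamma>c)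
  qed
  then show "pexp M \<gamma> (u \<oplus> v) (\<lambda>t. pcoef M \<gamma> u t \<oplus> pcoef M \<gamma> v t)"
    unfolding pexp_def using assms D by (auto simp: pcoef_cl intro!: exI[of _ "max D D'"])
qed (use assms in auto)

lemma pcoef_smult:
  assumes "v \<in> carrier M" "pcurve \<gamma>"
  shows "pcoef M \<gamma> (c \<odot> v) t = c \<odot> pcoef M \<gamma> v t"
proof (rule pcoef_eqI)
  have \<gamma>c: "\<gamma> x \<in> carrier SL2" for x using assms by (simp add: pcurve_def)
  obtain D where D: "\<And>t. t \<ge> D \<Longrightarrow> pcoef M \<gamma> v t = \<zero>"
    using pcoef_finite assms by metis
  have "\<exists>q. (\<forall>t. coeff q t = \<phi> (c \<odot> pcoef M \<gamma> v t)) \<and> (\<forall>x. \<phi> (act M (\<gamma> x) (c \<odot> v)) = poly q x)"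
    if \<phi>: "\<phi> \<in> fnl M" for \<phi>
  proof -
    obtain r where r: "\<And>t. coeff r t = \<phi> (pcoef M \<gamma> v t)" "\<And>x. \<phi> (act M (\<gamma> x) v) = poly r x"
      using pcoef_poly[OF assms \<phi>] by metis
    show ?thesis
      using assms \<phi> by (intro exI[of _ "Polynomial.smult c r"]) (simp add: r fnl_smult pcoef_cl act_smult \<gamma>c)
  qed
  then show "pexp M \<gamma> (c \<odot> v) (\<lambda>t. c \<odot> pcoef M \<gamma> v t)"
    unfolding pexp_def using assms D by (auto simp: pcoef_cl intro!: exI[of _ D])
qed (use assms in auto)

lemmas eop_cl [simp, intro] = pcoef_cl[OF _ pcurve_Um, folded eop_def]
lemmas fop_cl [simp, intro] = pcoef_cl[OF _ pcurve_Lm, folded fop_def]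
lemmas eop_finite = pcoef_finite[OF _ pcurve_Um, folded eop_def]
lemmas fop_finite = pcoef_finite[OF _ pcurve_Lm, folded fop_def]
lemmas eop_add = pcoef_add[OF _ _ pcurve_Um, folded eop_def]
lemmas fop_add = pcoef_add[OF _ _ pcurve_Lm, folded fop_def]
lemmas eop_smult = pcoef_smult[OF _ pcurve_Um, folded eop_def]
lemmas fop_smult = pcoef_smult[OF _ pcurve_Lm, folded fop_def]
lemmas eop_poly = pcoef_poly[OF _ pcurve_Um, folded eop_def]
lemmas fop_poly = pcoef_poly[OF _ pcurve_Lm, folded fop_def]

lemma eop_zero [simp]: "eop M t \<zero> = \<zero>"
  using eop_smult[of \<zero> t 0] by simp

lemma fop_zero [simp]: "fop M t \<zero> = \<zero>"
  using fop_smult[of \<zero> t 0] by simp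

lemma fnl_eop: "\<phi> \<in> fnl M \<Longrightarrow> (\<lambda>v. \<phi> (eop M t v)) \<in> fnl M"
  by (simp add: fnl_def eop_add eop_smult)

lemma fnl_fop: "\<phi> \<in> fnl M \<Longrightarrow> (\<lambda>v. \<phi> (fop M t v)) \<in> fnl M"
  by (simp add: fnl_def fop_add fop_smult)

lemma eop_0 [simp]: "v \<in> carrier M \<Longrightarrow> eop M 0 v = v"
proof (rule fnl_eqI)
  fix \<phi> assume v: "v \<in> carrier M" and \<phi>: "\<phi> \<in> fnl M"
  obtain q where q: "\<And>t. coeff q t = \<phi> (eop M t v)" "\<And>x. \<phi> (act M (Um x) v) = poly q x"
    using eop_poly[OF v \<phi>] by metis
  show "\<phi> (eop M 0 v) = \<phi> v" using q(1)[of 0] q(2)[of 0] v by (simp add: Um_def poly_0_coeff_0)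
qed auto

end

section \<open>Products of divided powers and their effect on weights\<close>

lemma coeff_shift:
  fixes q :: "'k::alg_closed_field poly"
  assumes "\<And>y. poly r y = poly q (x + y)"
  shows "coeff r t = poly (\<Sum>n\<le>degree q. monom (of_nat (n choose t) * coeff q n) (n - t)) x"
proof -
  define r' where "r' = (\<Sum>n\<le>degree q. \<Sum>t\<le>n. monom (coeff q n * of_nat (n choose t) * x ^ (n - t)) t)"
  have "poly r' y = poly q (x + y)" for y
  proof -
    have "poly q (x + y) = (\<Sum>n\<le>degree q. coeff q n * (y + x) ^ n)" by (simp add: poly_altdef add.commute)
    also have "\<dots> = poly r' y"
      unfolding binomial_ring r'_def by (simp add: poly_sum poly_monom sum_distrib_left mult_ac)
    finally show ?thesis by simp
  qed
  then have "r = r'" using assms by (intro poly_eqI_inf) simp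
  then have "coeff r t = (\<Sum>n\<le>degree q. \<Sum>t'\<le>n. if t' = t then coeff q n * of_nat (n choose t') * x ^ (n - t') else 0)"
    by (simp add: r'_def coeff_sum)
  also have "\<dots> = (\<Sum>n\<le>degree q. of_nat (n choose t) * coeff q n * x ^ (n - t))"
    by (intro sum.cong refl) (simp add: mult_ac binomial_eq_0)
  finally show ?thesis by (simp add: poly_sum poly_monom)
qed

context rat
begin

text \<open>Comparison of the coefficients of x^s y^t in U(x) U(y) = U(x + y).\<close>

lemma eop_comp:
  assumes v: "v \<in> carrier M"
  shows "eop M s (eop M t v) = of_nat ((s + t) choose t) \<odot> eop M (s + t) v"
proof (rule fnl_eqI)
  fix \<phi> assume \<phi>: "\<phi> \<in> fnl M"
  obtain q where q: "\<And>t. coeff q t = \<phi> (eop M t v)" "\<And>x. \<phi> (act M (Um x) v) = poly q x"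
    using eop_poly[OF v \<phi>] by metis
  \<comment> \<open>The coefficient of y^t for fixed x; it is a polynomial in x, whose coefficient
    of x^s is then read off.\<close>
  have c: "\<phi> (act M (Um x) (eop M t v)) = poly (\<Sum>n\<le>degree q. monom (of_nat (n choose t) * coeff q n) (n - t)) x" for x
  proof -
    have \<phi>': "(\<lambda>v. \<phi> (act M (Um x) v)) \<in> fnl M" using fnl_act[OF \<phi>] by simp
    obtain r where r: "\<And>t. coeff r t = \<phi> (act M (Um x) (eop M t v))" "\<And>y. \<phi> (act M (Um x) (act M (Um y) v)) = poly r y"
      using eop_poly[OF v \<phi>'] by metis
    have "poly r y = poly q (x + y)" for y
      using r(2)[of y] q(2)[of "x + y"] v by (simp add: act_act Um_def m2_mult m2_SL2 add.commute)
    then show ?thesis using coeff_shift[of r q x t] r(1) by simp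
  qed
  obtain r where r: "\<And>s. coeff r s = \<phi> (eop M s (eop M t v))" "\<And>x. \<phi> (act M (Um x) (eop M t v)) = poly r x"
    using eop_poly[OF eop_cl[OF v] \<phi>] by metis
  have req: "r = (\<Sum>n\<le>degree q. monom (of_nat (n choose t) * coeff q n) (n - t))"
    by (rule poly_eqI_inf) (simp add: c r(2)[symmetric])
  have "\<phi> (eop M s (eop M t v)) = (\<Sum>n\<le>degree q. if n - t = s then of_nat (n choose t) * coeff q n else 0)"
    unfolding r(1)[symmetric] req by (simp add: coeff_sum)
  also have "\<dots> = (\<Sum>n\<le>degree q. if n = s + t then of_nat (n choose t) * coeff q n else 0)"
    by (intro sum.cong refl) (auto simp: binomial_eq_0 not_less)
  also have "\<dots> = of_nat ((s + t) choose t) * coeff q (s + t)"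
    by (simp add: coeff_eq_0)
  finally show "\<phi> (eop M s (eop M t v)) = \<phi> (of_nat ((s + t) choose t) \<odot> eop M (s + t) v)"
    using v \<phi> by (simp add: fnl_smult q(1))
qed (use v in auto)

lemma eop_commute: "v \<in> carrier M \<Longrightarrow> eop M s (eop M t v) = eop M t (eop M s v)"
  by (simp add: eop_comp add.commute binomial_symmetric[of t "s + t"])

text \<open>Torus elements rescale the root subgroup, T(z) U(x) = U(z^2 x) T(z), so the coefficient
  of x^t acquires the factor z^(2t).\<close>

lemma eop_wt:
  assumes v: "v \<in> wt M n"
  shows "eop M t v \<in> wt M (n + 2 * int t)"
  unfolding wt_def
proof (intro CollectI conjI allI impI)
  have vc: "v \<in> carrier M" and vz: "\<And>z. z \<noteq> 0 \<Longrightarrow> act M (Tm z) v = (z powi n) \<odot> v" using v by (auto simp: wt_def)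
  show ec: "eop M t v \<in> carrier M" using vc by simp
  fix z :: 'k assume z: "z \<noteq> 0"
  show "act M (Tm z) (eop M t v) = z powi (n + 2 * int t) \<odot> eop M t v"
  proof (rule fnl_eqI)
    fix \<phi> assume \<phi>: "\<phi> \<in> fnl M"
    have \<phi>': "(\<lambda>v. \<phi> (act M (Tm z) v)) \<in> fnl M" using fnl_act[OF \<phi>] z by simp
    obtain q where q: "\<And>t. coeff q t = \<phi> (eop M t v)" "\<And>x. \<phi> (act M (Um x) v) = poly q x"
      using eop_poly[OF vc \<phi>] by metis
    obtain r where r: "\<And>t. coeff r t = \<phi> (act M (Tm z) (eop M t v))" "\<And>y. \<phi> (act M (Tm z) (act M (Um y) v)) = poly r y"
      using eop_poly[OF vc \<phi>'] by metis
    have "poly r x = poly (Polynomial.smult (z powi n) (pcompose q [:0, z ^ 2:])) x" for x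
    proof -
      have "act M (Tm z) (act M (Um x) v) = act M (Um (z ^ 2 * x)) (act M (Tm z) v)"
        using z vc by (simp add: act_act) (simp add: Tm_def Um_def m2_mult power2_eq_square field_simps)
      then have "poly r x = \<phi> (act M (Um (z ^ 2 * x)) (z powi n \<odot> v))" using r(2) vz[OF z] by metis
      also have "\<dots> = z powi n * poly q (z ^ 2 * x)"
        using vc \<phi> by (simp add: act_smult fnl_smult q(2))
      finally show ?thesis by (simp add: poly_pcompose mult.commute)
    qed
    then have "r = Polynomial.smult (z powi n) (pcompose q [:0, z ^ 2:])" by (intro poly_eqI_inf)
    then have "coeff r t = z powi n * ((z ^ 2) ^ t * coeff q t)" by (simp add: coeff_pcompose_linear)
    also have "\<dots> = z powi (n + 2 * int t) * coeff q t"
      using z power_int_add[of z n "int (2 * t)"] unfolding power_int_of_nat by (simp add: power_mult)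
    finally show "\<phi> (act M (Tm z) (eop M t v)) = \<phi> (z powi (n + 2 * int t) \<odot> eop M t v)"
      using \<phi> vc by (simp add: fnl_smult r(1) q(1))
  qed (use ec z in auto)
qed

lemma fop_wt:
  assumes v: "v \<in> wt M n"
  shows "fop M t v \<in> wt M (n - 2 * int t)"
  unfolding wt_def
proof (intro CollectI conjI allI impI)
  have vc: "v \<in> carrier M" and vz: "\<And>z. z \<noteq> 0 \<Longrightarrow> act M (Tm z) v = (z powi n) \<odot> v" using v by (auto simp: wt_def)
  show ec: "fop M t v \<in> carrier M" using vc by simp
  fix z :: 'k assume z: "z \<noteq> 0"
  show "act M (Tm z) (fop M t v) = z powi (n - 2 * int t) \<odot> fop M t v"
  proof (rule fnl_eqI)
    fix \<phi> assume \<phi>: "\<phi> \<in> fnl M"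
    have \<phi>': "(\<lambda>v. \<phi> (act M (Tm z) v)) \<in> fnl M" using fnl_act[OF \<phi>] z by simp
    obtain q where q: "\<And>t. coeff q t = \<phi> (fop M t v)" "\<And>x. \<phi> (act M (Lm x) v) = poly q x"
      using fop_poly[OF vc \<phi>] by metis
    obtain r where r: "\<And>t. coeff r t = \<phi> (act M (Tm z) (fop M t v))" "\<And>y. \<phi> (act M (Tm z) (act M (Lm y) v)) = poly r y"
      using fop_poly[OF vc \<phi>'] by metis
    have "poly r x = poly (Polynomial.smult (z powi n) (pcompose q [:0, inverse z ^ 2:])) x" for x
    proof -
      have "act M (Tm z) (act M (Lm x) v) = act M (Lm (inverse z ^ 2 * x)) (act M (Tm z) v)"
        using z vc by (simp add: act_act) (simp add: Tm_def Lm_def m2_mult power2_eq_square field_simps)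
      then have "poly r x = \<phi> (act M (Lm (inverse z ^ 2 * x)) (z powi n \<odot> v))" using r(2) vz[OF z] by metis
      also have "\<dots> = z powi n * poly q (inverse z ^ 2 * x)"
        using vc \<phi> by (simp add: act_smult fnl_smult q(2))
      finally show ?thesis by (simp add: poly_pcompose mult.commute)
    qed
    then have "r = Polynomial.smult (z powi n) (pcompose q [:0, inverse z ^ 2:])" by (intro poly_eqI_inf)
    then have "coeff r t = z powi n * ((inverse z ^ 2) ^ t * coeff q t)" by (simp add: coeff_pcompose_linear)
    also have "\<dots> = z powi (n - 2 * int t) * coeff q t"
      using z power_int_diff[of z n "int (2 * t)"] unfolding power_int_of_nat
      by (simp add: power_mult power_inverse divide_inverse)
    finally show "\<phi> (act M (Tm z) (fop M t v)) = \<phi> (z powi (n - 2 * int t) \<odot> fop M t v)"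
      using \<phi> vc by (simp add: fnl_smult r(1) q(1))
  qed (use ec z in auto)
qed

end

context rat
begin

section \<open>Weight spaces and weight projections\<close>

lemma wt_carrier: "v \<in> wt M n \<Longrightarrow> v \<in> carrier M"
  by (simp add: wt_def)

lemma wt_zero [simp]: "\<zero> \<in> wt M n"
proof -
  have "act M g \<zero> = \<zero>" if "g \<in> carrier SL2" for g using act_smult[OF that, of \<zero> 0] that by simp
  then show ?thesis by (simp add: wt_def)
qed

lemma wt_add: "u \<in> wt M n \<Longrightarrow> v \<in> wt M n \<Longrightarrow> u \<oplus> v \<in> wt M n"
  by (simp add: wt_def act_add smult_add_r)

lemma wt_smult: "v \<in> wt M n \<Longrightarrow> c \<odot> v \<in> wt M n"
  by (simp add: wt_def act_smult smult_smult mult.commute)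

lemma texp_exists:
  assumes v: "v \<in> carrier M"
  shows "\<exists>w. texp M v w"
proof -
  obtain B f where B: "finite B" "B \<subseteq> carrier M" and f: "\<And>c. c \<in> B \<Longrightarrow> restrict (f c) (carrier SL2) \<in> coord_ring"
    and form: "\<And>g \<phi>. g \<in> carrier SL2 \<Longrightarrow> \<phi> \<in> fnl M \<Longrightarrow> \<phi> (act M g v) = (\<Sum>c\<in>B. f c g * \<phi> c)"
    using matrix_form[OF v] by blast
  have "\<forall>c. \<exists>a N. c \<in> B \<longrightarrow> (\<forall>n. \<bar>n\<bar> > int N \<longrightarrow> a n = 0) \<and>
    (\<forall>K\<ge>N. \<forall>z. z \<noteq> 0 \<longrightarrow> f c (Tm z) = (\<Sum>n\<in>{- int K..int K}. z powi n * a n))"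
    using coord_Laurent[OF f] by auto
  then obtain a N where aN: "\<And>c n. c \<in> B \<Longrightarrow> \<bar>n\<bar> > int (N c) \<Longrightarrow> a c n = 0"
    "\<And>c K z. c \<in> B \<Longrightarrow> K \<ge> N c \<Longrightarrow> z \<noteq> 0 \<Longrightarrow> f c (Tm z) = (\<Sum>n\<in>{- int K..int K}. z powi n * a c n)"
    by metis
  define L where "L = (\<Sum>c\<in>B. N c)"
  have L: "N c \<le> L" if "c \<in> B" for c unfolding L_def using that B(1) by (intro member_le_sum) auto
  define w where "w n = finsum M (\<lambda>c. a c n \<odot> c) B" for n
  have Pi: "(\<lambda>c. a c n \<odot> c) \<in> B \<rightarrow> carrier M" for n using B by auto
  have wc: "w n \<in> carrier M" for n unfolding w_def using Pi by (rule finsum_closed)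
  have \<phi>w: "\<phi> (w n) = (\<Sum>c\<in>B. a c n * \<phi> c)" if "\<phi> \<in> fnl M" for \<phi> n
    unfolding w_def fnl_finsum[OF that B(1) Pi] using B by (auto intro!: sum.cong simp: fnl_smult[OF that])
  have "w n = \<zero>" if "\<bar>n\<bar> > int L" for n
  proof (rule fnl_eqI)
    fix \<phi> assume \<phi>: "\<phi> \<in> fnl M"
    have "a c n = 0" if "c \<in> B" for c using aN(1)[OF that] L[OF that] \<open>\<bar>n\<bar> > int L\<close> by simp
    then show "\<phi> (w n) = \<phi> \<zero>" using \<phi> by (simp add: \<phi>w fnl_zero)
  qed (auto simp: wc)
  moreover have "\<phi> (act M (Tm z) v) = (\<Sum>n\<in>{- int K..int K}. z powi n * \<phi> (w n))"
    if K: "K \<ge> L" and \<phi>: "\<phi> \<in> fnl M" and z: "z \<noteq> 0" for K \<phi> z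
  proof -
    have "\<phi> (act M (Tm z) v) = (\<Sum>c\<in>B. (\<Sum>n\<in>{- int K..int K}. z powi n * a c n) * \<phi> c)"
      unfolding form[OF Tm_SL2[OF z] \<phi>] using aN(2) L K z by (intro sum.cong refl) (metis order_trans)
    also have "\<dots> = (\<Sum>n\<in>{- int K..int K}. \<Sum>c\<in>B. z powi n * a c n * \<phi> c)"
      unfolding sum_distrib_right by (rule sum.swap)
    finally show ?thesis by (simp add: \<phi>w[OF \<phi>] sum_distrib_left mult.assoc)
  qed
  ultimately show ?thesis unfolding texp_def using wc by (intro exI[of _ w] conjI exI[of _ L]) blast+
qed

lemma texp_unique:
  assumes "texp M v w" "texp M v w'"
  shows "w = w'"
proof
  fix n
  obtain N where N: "\<forall>n. \<bar>n\<bar> > int N \<longrightarrow> w n = \<zero>"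
    "\<forall>K\<ge>N. \<forall>\<phi>\<in>fnl M. \<forall>z. z \<noteq> 0 \<longrightarrow> \<phi> (act M (Tm z) v) = (\<Sum>n\<in>{- int K..int K}. z powi n * \<phi> (w n))"
    using assms(1) unfolding texp_def by blast
  obtain N' where N': "\<forall>n. \<bar>n\<bar> > int N' \<longrightarrow> w' n = \<zero>"
    "\<forall>K\<ge>N'. \<forall>\<phi>\<in>fnl M. \<forall>z. z \<noteq> 0 \<longrightarrow> \<phi> (act M (Tm z) v) = (\<Sum>n\<in>{- int K..int K}. z powi n * \<phi> (w' n))"
    using assms(2) unfolding texp_def by blast
  define K where "K = N + N' + nat \<bar>n\<bar>"
  have nK: "\<bar>n\<bar> \<le> int K" unfolding K_def by linarith
  show "w n = w' n"
  proof (rule fnl_eqI)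
    fix \<phi> assume \<phi>: "\<phi> \<in> fnl M"
    have "(\<Sum>n\<in>{- int K..int K}. z powi n * (\<phi> (w n) - \<phi> (w' n))) = 0" if "z \<noteq> 0" for z
      using N(2)[rule_format, of K \<phi> z] N'(2)[rule_format, of K \<phi> z] \<phi> that
      by (simp add: K_def right_diff_distrib sum_subtractf)
    then have "\<phi> (w n) - \<phi> (w' n) = 0" by (rule Laurent_unique[OF _ nK])
    then show "\<phi> (w n) = \<phi> (w' n)" by simp
  qed (use assms in \<open>auto simp: texp_def\<close>)
qed

lemma pr_texp: "v \<in> carrier M \<Longrightarrow> texp M v (\<lambda>n. pr M n v)"
  unfolding pr_def using texp_exists by (rule someI_ex)

lemma pr_eqI: "v \<in> carrier M \<Longrightarrow> texp M v w \<Longrightarrow> pr M n v = w n"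
  using texp_unique[OF pr_texp] by metis

lemma pr_cl [simp, intro]: "v \<in> carrier M \<Longrightarrow> pr M n v \<in> carrier M"
  using pr_texp by (auto simp: texp_def)

lemma pr_sum:
  assumes "v \<in> carrier M"
  obtains N where "\<And>n. \<bar>n\<bar> > int N \<Longrightarrow> pr M n v = \<zero>"
    "\<And>K \<phi> z. K \<ge> N \<Longrightarrow> \<phi> \<in> fnl M \<Longrightarrow> z \<noteq> 0 \<Longrightarrow> \<phi> (act M (Tm z) v) = (\<Sum>n\<in>{- int K..int K}. z powi n * \<phi> (pr M n v))"
    "\<And>K \<phi>. K \<ge> N \<Longrightarrow> \<phi> \<in> fnl M \<Longrightarrow> \<phi> v = (\<Sum>n\<in>{- int K..int K}. \<phi> (pr M n v))"
proof -
  obtain N where N: "\<forall>n. \<bar>n\<bar> > int N \<longrightarrow> pr M n v = \<zero>"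
    "\<forall>K\<ge>N. \<forall>\<phi>\<in>fnl M. \<forall>z. z \<noteq> 0 \<longrightarrow> \<phi> (act M (Tm z) v) = (\<Sum>n\<in>{- int K..int K}. z powi n * \<phi> (pr M n v))"
    using pr_texp[OF assms] unfolding texp_def by blast
  have "\<phi> v = (\<Sum>n\<in>{- int K..int K}. \<phi> (pr M n v))" if "K \<ge> N" "\<phi> \<in> fnl M" for K \<phi>
    using N(2)[rule_format, OF that, of 1] assms by (simp add: Tm_def)
  then show ?thesis using N by (intro that[of N]) blast+
qed

text \<open>Uniqueness of the Laurent coefficients in y, applied to T(z) T(y) = T(z y).\<close>

lemma pr_wt:
  assumes v: "v \<in> carrier M"
  shows "pr M n v \<in> wt M n"
  unfolding wt_def
proof (intro CollectI conjI allI impI)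
  fix z :: 'k assume z: "z \<noteq> 0"
  obtain N where N: "\<And>n. \<bar>n\<bar> > int N \<Longrightarrow> pr M n v = \<zero>"
    "\<And>K \<phi> z. K \<ge> N \<Longrightarrow> \<phi> \<in> fnl M \<Longrightarrow> z \<noteq> 0 \<Longrightarrow> \<phi> (act M (Tm z) v) = (\<Sum>n\<in>{- int K..int K}. z powi n * \<phi> (pr M n v))"
    by (rule pr_sum[OF v]) (rule that)
  define K where "K = N + nat \<bar>n\<bar>"
  have nK: "\<bar>n\<bar> \<le> int K" unfolding K_def by linarith
  show "act M (Tm z) (pr M n v) = z powi n \<odot> pr M n v"
  proof (rule fnl_eqI)
    fix \<phi> assume \<phi>: "\<phi> \<in> fnl M"
    have "(\<Sum>n\<in>{- int K..int K}. y powi n * (\<phi> (act M (Tm z) (pr M n v)) - z powi n * \<phi> (pr M n v))) = 0" if y: "y \<noteq> 0" for y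
    proof -
      have "act M (Tm z) (act M (Tm y) v) = act M (Tm (z * y)) v"
        using z y v by (simp add: act_act) (simp add: Tm_def m2_mult)
      then have "\<phi> (act M (Tm z) (act M (Tm y) v)) = \<phi> (act M (Tm (z * y)) v)" by simp
      then have "(\<Sum>n\<in>{- int K..int K}. y powi n * \<phi> (act M (Tm z) (pr M n v)))
          = (\<Sum>n\<in>{- int K..int K}. (z * y) powi n * \<phi> (pr M n v))"
        using N(2)[of K "\<lambda>v. \<phi> (act M (Tm z) v)" y] N(2)[of K \<phi> "z * y"] fnl_act[OF \<phi> Tm_SL2[OF z]] \<phi> z y
        by (simp add: K_def)
      then show ?thesis by (simp add: right_diff_distrib sum_subtractf power_int_mult_distrib mult_ac)
    qed
    then have "\<phi> (act M (Tm z) (pr M n v)) - z powi n * \<phi> (pr M n v) = 0" by (rule Laurent_unique[OF _ nK])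
    then show "\<phi> (act M (Tm z) (pr M n v)) = \<phi> (z powi n \<odot> pr M n v)" using \<phi> v by (simp add: fnl_smult)
  qed (use v z in auto)
qed (use v in auto)

lemma pr_of_wt:
  assumes v: "v \<in> wt M m"
  shows "pr M n v = (if n = m then v else \<zero>)"
proof -
  have vc: "v \<in> carrier M" and vz: "\<And>z. z \<noteq> 0 \<Longrightarrow> act M (Tm z) v = (z powi m) \<odot> v" using v by (auto simp: wt_def)
  have "\<phi> (act M (Tm z) v) = (\<Sum>n\<in>{- int K..int K}. z powi n * \<phi> (if n = m then v else \<zero>))"
    if "K \<ge> nat \<bar>m\<bar>" "\<phi> \<in> fnl M" "z \<noteq> 0" for K \<phi> z
  proof -
    have "(\<Sum>n\<in>{- int K..int K}. z powi n * \<phi> (if n = m then v else \<zero>)) = (\<Sum>n\<in>{- int K..int K}. if n = m then z powi m * \<phi> v else 0)"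
      using that by (intro sum.cong) (auto simp: fnl_zero)
    also have "\<dots> = z powi m * \<phi> v"
    proof -
      have "m \<in> {- int K..int K}" using that(1) by auto
      then show ?thesis by simp
    qed
    finally show ?thesis using that vc by (simp add: vz fnl_smult)
  qed
  then have "texp M v (\<lambda>n. if n = m then v else \<zero>)"
    unfolding texp_def using vc by (intro conjI exI[of _ "nat \<bar>m\<bar>"]) auto
  then show ?thesis using pr_eqI[OF vc] by blast
qed

lemma pr_add:
  assumes "u \<in> carrier M" "v \<in> carrier M"
  shows "pr M n (u \<oplus> v) = pr M n u \<oplus> pr M n v"
proof (rule pr_eqI)
  obtain N where N: "\<And>n. \<bar>n\<bar> > int N \<Longrightarrow> pr M n u = \<zero>"
    "\<And>K \<phi> z. K \<ge> N \<Longrightarrow> \<phi> \<in> fnl M \<Longrightarrow> z \<noteq> 0 \<Longrightarrow> \<phi> (act M (Tm z) u) = (\<Sum>n\<in>{- int K..int K}. z powi n * \<phi> (pr M n u))"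
    by (rule pr_sum[OF assms(1)]) (rule that)
  obtain N' where N': "\<And>n. \<bar>n\<bar> > int N' \<Longrightarrow> pr M n v = \<zero>"
    "\<And>K \<phi> z. K \<ge> N' \<Longrightarrow> \<phi> \<in> fnl M \<Longrightarrow> z \<noteq> 0 \<Longrightarrow> \<phi> (act M (Tm z) v) = (\<Sum>n\<in>{- int K..int K}. z powi n * \<phi> (pr M n v))"
    by (rule pr_sum[OF assms(2)]) (rule that)
  show "texp M (u \<oplus> v) (\<lambda>n. pr M n u \<oplus> pr M n v)"
    unfolding texp_def
  proof (intro conjI exI[of _ "N + N'"] allI ballI impI)
    fix K \<phi> z assume "N + N' \<le> K" "\<phi> \<in> fnl M" "z \<noteq> (0::'k)"
    then show "\<phi> (act M (Tm z) (u \<oplus> v)) = (\<Sum>n\<in>{- int K..int K}. z powi n * \<phi> (pr M n u \<oplus> pr M n v))"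
      using N(2)[of K \<phi> z] N'(2)[of K \<phi> z] assms
      by (simp add: act_add fnl_add distrib_left sum.distrib)
  qed (use N(1) N'(1) assms in auto)
qed (use assms in auto)

lemma pr_smult:
  assumes "v \<in> carrier M"
  shows "pr M n (c \<odot> v) = c \<odot> pr M n v"
proof (rule pr_eqI)
  obtain N where N: "\<And>n. \<bar>n\<bar> > int N \<Longrightarrow> pr M n v = \<zero>"
    "\<And>K \<phi> z. K \<ge> N \<Longrightarrow> \<phi> \<in> fnl M \<Longrightarrow> z \<noteq> 0 \<Longrightarrow> \<phi> (act M (Tm z) v) = (\<Sum>n\<in>{- int K..int K}. z powi n * \<phi> (pr M n v))"
    by (rule pr_sum[OF assms(1)]) (rule that)
  show "texp M (c \<odot> v) (\<lambda>n. c \<odot> pr M n v)"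
    unfolding texp_def
  proof (intro conjI exI[of _ N] allI ballI impI)
    fix K \<phi> z assume "N \<le> K" "\<phi> \<in> fnl M" "z \<noteq> (0::'k)"
    then show "\<phi> (act M (Tm z) (c \<odot> v)) = (\<Sum>n\<in>{- int K..int K}. z powi n * \<phi> (c \<odot> pr M n v))"
      using N(2)[of K \<phi> z] assms by (simp add: act_smult fnl_smult sum_distrib_left mult_ac)
  qed (use N(1) assms in auto)
qed (use assms in auto)

lemma fnl_pr: "\<phi> \<in> fnl M \<Longrightarrow> (\<lambda>v. \<phi> (pr M n v)) \<in> fnl M"
  by (simp add: fnl_def pr_add pr_smult)

lemma pr_zero [simp]: "pr M n \<zero> = \<zero>"
  using pr_smult[of \<zero> n 0] by simp

lemma eq_zero_if_pr:
  assumes "v \<in> carrier M" "\<And>n. pr M n v = \<zero>"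
  shows "v = \<zero>"
proof (rule fnl_eqI)
  fix \<phi> assume \<phi>: "\<phi> \<in> fnl M"
  obtain N where "\<And>K \<phi>. K \<ge> N \<Longrightarrow> \<phi> \<in> fnl M \<Longrightarrow> \<phi> v = (\<Sum>n\<in>{- int K..int K}. \<phi> (pr M n v))"
    by (rule pr_sum[OF assms(1)]) (rule that)
  from this[OF order_refl \<phi>] show "\<phi> v = \<phi> \<zero>" using \<phi> assms(2) by (simp add: fnl_zero)
qed (use assms in auto)

end

section \<open>Homomorphisms commute with divided powers and weight projections\<close>

locale rat_hom = M: rat M + N: rat N
  for M :: "('k::alg_closed_field, 'v) gmod" and N :: "('k, 'w) gmod" +
  fixes h :: "'v \<Rightarrow> 'w"
  assumes hom: "h \<in> gmod_hom M N"
begin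

lemma h_cl [simp, intro]: "v \<in> carrier M \<Longrightarrow> h v \<in> carrier N"
  using hom LinearCombinations.module_hom_closed by (fastforce simp: gmod_hom_def)

lemma h_add: "u \<in> carrier M \<Longrightarrow> v \<in> carrier M \<Longrightarrow> h (u \<oplus>\<^bsub>M\<^esub> v) = h u \<oplus>\<^bsub>N\<^esub> h v"
  using hom LinearCombinations.module_hom_add by (fastforce simp: gmod_hom_def)

lemma h_smult: "v \<in> carrier M \<Longrightarrow> h (c \<odot>\<^bsub>M\<^esub> v) = c \<odot>\<^bsub>N\<^esub> h v"
  using hom LinearCombinations.module_hom_smult[of h class_ring M N c v] by (simp add: gmod_hom_def)

lemma h_act: "g \<in> carrier SL2 \<Longrightarrow> v \<in> carrier M \<Longrightarrow> h (act M g v) = act N g (h v)"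
  using hom by (simp add: gmod_hom_def)

lemma h_zero [simp]: "h \<zero>\<^bsub>M\<^esub> = \<zero>\<^bsub>N\<^esub>"
  using h_smult[of "\<zero>\<^bsub>M\<^esub>" 0] by simp

lemma fnl_h: "\<phi> \<in> fnl N \<Longrightarrow> (\<lambda>v. \<phi> (h v)) \<in> fnl M"
  by (simp add: fnl_def h_add h_smult)

lemma h_pcoef:
  assumes v: "v \<in> carrier M" and \<gamma>: "pcurve \<gamma>"
  shows "h (pcoef M \<gamma> v t) = pcoef N \<gamma> (h v) t"
proof -
  have \<gamma>c: "\<gamma> x \<in> carrier SL2" for x using \<gamma> by (simp add: pcurve_def)
  have "pexp N \<gamma> (h v) (\<lambda>t. h (pcoef M \<gamma> v t))"
    unfolding pexp_def
  proof (intro conjI ballI allI)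
    show "h (pcoef M \<gamma> v t) \<in> carrier N" for t using M.pcoef_cl[OF v \<gamma>] by simp
    show "\<exists>D. \<forall>t\<ge>D. h (pcoef M \<gamma> v t) = \<zero>\<^bsub>N\<^esub>" using M.pcoef_finite[OF v \<gamma>] by (metis h_zero)
    fix \<phi> assume \<phi>: "\<phi> \<in> fnl N"
    then show "\<exists>q. (\<forall>t. coeff q t = \<phi> (h (pcoef M \<gamma> v t))) \<and> (\<forall>x. \<phi> (act N (\<gamma> x) (h v)) = poly q x)"
      using M.pcoef_poly[OF v \<gamma> fnl_h[OF \<phi>]] h_act[OF \<gamma>c v] by metis
  qed
  from N.pcoef_eqI[OF h_cl[OF v] \<gamma> this] show ?thesis by simp
qed

lemmas h_eop = h_pcoef[OF _ pcurve_Um, folded eop_def]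

lemma h_wt: "v \<in> wt M n \<Longrightarrow> h v \<in> wt N n"
  by (auto simp: wt_def h_smult simp flip: h_act)

lemma h_pr:
  assumes v: "v \<in> carrier M"
  shows "h (pr M n v) = pr N n (h v)"
proof -
  obtain L where L: "\<And>n. \<bar>n\<bar> > int L \<Longrightarrow> pr M n v = \<zero>\<^bsub>M\<^esub>"
    "\<And>K \<phi> z. K \<ge> L \<Longrightarrow> \<phi> \<in> fnl M \<Longrightarrow> z \<noteq> 0 \<Longrightarrow> \<phi> (act M (Tm z) v) = (\<Sum>n\<in>{- int K..int K}. z powi n * \<phi> (pr M n v))"
    by (rule M.pr_sum[OF v]) (rule that)
  have "texp N (h v) (\<lambda>n. h (pr M n v))"
    unfolding texp_def
  proof (intro conjI exI[of _ L] allI ballI impI)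
    fix K \<phi> z assume "L \<le> K" "\<phi> \<in> fnl N" "z \<noteq> (0::'k)"
    then show "\<phi> (act N (Tm z) (h v)) = (\<Sum>n\<in>{- int K..int K}. z powi n * \<phi> (h (pr M n v)))"
      using L(2)[of K "\<lambda>v. \<phi> (h v)" z] fnl_h v by (simp flip: h_act)
  qed (use L(1) v in auto)
  from N.pr_eqI[OF h_cl[OF v] this] show ?thesis by simp
qed

end

section \<open>Weyl modules\<close>

text \<open>The monomials in the second column of the matrix. Right multiplication by the Borel
  subgroup only rescales this column.\<close>

definition Xm :: "nat \<Rightarrow> nat \<Rightarrow> 'k::field mat \<Rightarrow> 'k" where
  "Xm m k = (\<lambda>g\<in>carrier SL2. g $$ (0, 1) ^ k * g $$ (1, 1) ^ (m - k))"

lemma Borel_m2E: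
  assumes "\<beta> \<in> Borel"
  obtains t u where "\<beta> = m2 t 0 u (inverse t)" "t \<noteq> 0"
proof -
  have "\<beta> \<in> carrier SL2" using assms by (simp add: Borel_def)
  then obtain a b c d where *: "\<beta> = m2 a b c d" "a * d - b * c = 1" by (rule SL2_m2E)
  have "b = 0" using assms * by (simp add: Borel_def)
  then have "a * d = 1" using * by simp
  then have "a \<noteq> 0" "d = inverse a" using inverse_unique[of a d] by auto
  then show ?thesis using that * \<open>b = 0\<close> by blast
qed

lemma ind_B_simps:
  "f \<in> carrier (ind_B m) \<longleftrightarrow> f \<in> coord_ring \<and> (\<forall>g\<in>carrier SL2. \<forall>b\<in>Borel. f (g * b) = inverse ((b $$ (0, 0)) ^ m) * f g)"
  "f \<oplus>\<^bsub>ind_B m\<^esub> h = (\<lambda>x\<in>carrier SL2. f x + h x)"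
  "\<zero>\<^bsub>ind_B m\<^esub> = (\<lambda>x\<in>carrier SL2. 0)"
  "c \<odot>\<^bsub>ind_B m\<^esub> f = (\<lambda>x\<in>carrier SL2. c * f x)"
  "act (ind_B m) g f = (\<lambda>x\<in>carrier SL2. f (inv\<^bsub>SL2\<^esub> g * x))"
  by (simp_all add: ind_B_def)

lemma Borel_SL2: "b \<in> Borel \<Longrightarrow> b \<in> carrier SL2"
  by (simp add: Borel_def)

lemma SL2_mult_Borel [simp]: "g \<in> carrier SL2 \<Longrightarrow> b \<in> Borel \<Longrightarrow> g * b \<in> carrier SL2"
  using Borel_SL2 by blast

lemma kvs_ind_B: "kvs (ind_B m :: ('k::field, 'k mat \<Rightarrow> 'k) gmod)"
proof (rule kvsI)
  let ?M = "ind_B m :: ('k, 'k mat \<Rightarrow> 'k) gmod"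
  have ext: "f \<in> extensional (carrier SL2)" if "f \<in> carrier ?M" for f
    using that coord_ring_ext by (auto simp: ind_B_simps)
  show "\<zero>\<^bsub>?M\<^esub> \<in> carrier ?M" using Borel_SL2 by (auto simp: ind_B_simps intro: coord_ring_const)
  show "u \<oplus>\<^bsub>?M\<^esub> v \<in> carrier ?M" if "u \<in> carrier ?M" "v \<in> carrier ?M" for u v
    using that Borel_SL2 by (auto simp: ind_B_simps distrib_left intro: coord_ring_add coord_ring_restrict)
  show "c \<odot>\<^bsub>?M\<^esub> v \<in> carrier ?M" if "v \<in> carrier ?M" for c v
    using that Borel_SL2 by (auto simp: ind_B_simps mult_ac intro: coord_ring_mult coord_ring_const coord_ring_restrict)
  show "\<zero>\<^bsub>?M\<^esub> \<oplus>\<^bsub>?M\<^esub> v = v" "1 \<odot>\<^bsub>?M\<^esub> v = v" if "v \<in> carrier ?M" for v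
    using ext[OF that] by (auto simp: ind_B_simps(2-) extensional_restrict cong: restrict_cong)
qed (auto simp: ind_B_simps(2-) algebra_simps cong: restrict_cong)

lemma Xm_ind_B: "k \<le> m \<Longrightarrow> Xm m k \<in> carrier (ind_B m)"
  unfolding ind_B_simps
proof (intro conjI ballI)
  have e: "restrict (\<lambda>g. g $$ (i, j)) (carrier SL2) \<in> coord_ring" if "i < 2" "j < 2" for i j
    by (rule coord_ring.entry) (use that in auto)
  show "Xm m k \<in> coord_ring" unfolding Xm_def by (intro coord_ring_mult coord_ring_power e) auto
  fix g b :: "'a mat" assume k: "k \<le> m" and g: "g \<in> carrier SL2" and b: "b \<in> Borel"
  obtain t u where t: "b = m2 t 0 u (inverse t)" "t \<noteq> 0" using b by (rule Borel_m2E)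
  obtain a b' c d where g': "g = m2 a b' c d" using g by (rule SL2_m2E)
  have "Xm m k (g * b) = (b' * inverse t) ^ k * (d * inverse t) ^ (m - k)"
    using g Borel_SL2[OF b] by (simp add: Xm_def) (simp add: g' t m2_mult)
  also have "\<dots> = (inverse t ^ k * inverse t ^ (m - k)) * (b' ^ k * d ^ (m - k))"
    by (simp add: power_mult_distrib)
  also have "inverse t ^ k * inverse t ^ (m - k) = inverse t ^ (k + (m - k))" by (simp only: power_add)
  also have "\<dots> = inverse (t ^ m)" using k by (simp add: power_inverse)
  finally show "Xm m k (g * b) = inverse (b $$ (0, 0) ^ m) * Xm m k g"
    using g by (simp add: Xm_def) (simp add: g' t)
qed

lemma poly_sum_le: "degree (q :: 'k::field poly) \<le> m \<Longrightarrow> poly q x = (\<Sum>k\<le>m. coeff q k * x ^ k)"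
  unfolding poly_altdef by (rule sum.mono_neutral_left) (auto simp: coeff_eq_0)

text \<open>The elements of the induced module are the sections of O(m) on the projective line. With
  b and d the entries of the second column, the chart d \<noteq> 0 gives d^m q(b/d) and the chart b
  \<noteq> 0 gives b^m r(d/b); comparison on the overlap bounds the degree of q by m.\<close>

lemma ind_B_form:
  fixes f :: "'k::alg_closed_field mat \<Rightarrow> 'k"
  assumes f: "f \<in> carrier (ind_B m)" and q: "\<And>z. f (Um z) = poly q z" and g: "g \<in> carrier SL2"
  shows "f g = (\<Sum>k\<le>m. coeff q k * Xm m k g)"
proof -
  have fc: "f \<in> coord_ring" and fb: "\<And>g b. g \<in> carrier SL2 \<Longrightarrow> b \<in> Borel \<Longrightarrow> f (g * b) = inverse ((b $$ (0, 0)) ^ m) * f g"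
    using f by (auto simp: ind_B_simps)
  define \<gamma> :: "'k \<Rightarrow> 'k mat" where "\<gamma> y = m2 0 1 (- 1) y" for y
  have "pcurve \<gamma>"
    by (rule pcurve_m2[of _ 0 1 "-1" "[:0, 1:]"]) (auto simp: \<gamma>_def m2_SL2)
  then obtain r where r: "\<And>y. f (\<gamma> y) = poly r y" using coord_pcurve[OF fc] by blast
  have 1: "f (m2 a b c d) = d ^ m * poly q (b / d)" if "a * d - b * c = 1" "d \<noteq> 0" for a b c d
  proof -
    have e: "m2 a b c d = Um (b / d) * m2 (inverse d) 0 c d"
    proof -
      have "a = inverse d + b / d * c" using that by (simp add: field_simps)
      then show ?thesis using that(2) by (simp add: Um_def m2_mult)
    qed
    have "m2 (inverse d) 0 c d \<in> Borel" using that by (simp add: Borel_def m2_SL2)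
    then show ?thesis unfolding e by (subst fb) (auto simp: q power_inverse)
  qed
  have 2: "f (m2 a b c d) = b ^ m * poly r (d / b)" if "a * d - b * c = 1" "b \<noteq> 0" for a b c d
  proof -
    have e: "m2 a b c d = \<gamma> (d / b) * m2 (inverse b) 0 a b"
    proof -
      have "c = - inverse b + d / b * a" using that by (simp add: field_simps)
      then show ?thesis using that(2) by (simp add: \<gamma>_def m2_mult)
    qed
    have "m2 (inverse b) 0 a b \<in> Borel" using that by (simp add: Borel_def m2_SL2)
    moreover have "\<gamma> (d / b) \<in> carrier SL2" by (simp add: \<gamma>_def m2_SL2)
    ultimately show ?thesis unfolding e by (subst fb) (auto simp: r power_inverse)
  qed
  define e where "e = degree r"
  define R where "R = (\<Sum>j\<le>e. monom (coeff r j) (e - j))"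
  \<comment> \<open>On the overlap q(b) = b^m r(1/b). Multiplication by b^e turns r(1/b) into the
    reversed polynomial \<open>R\<close>, so that both sides are polynomials.\<close>
  have "monom 1 e * q = monom 1 m * R"
  proof (rule poly_eqI_inf)
    fix b :: 'k assume b: "b \<noteq> 0"
    have "poly q b = b ^ m * poly r (1 / b)"
      using 1[of 0 1 b "- 1 / b"] 2[of 0 1 b "- 1 / b"] b by simp
    moreover have "b ^ e * poly r (1 / b) = poly R b"
      using b by (simp add: R_def poly_altdef[of r] poly_sum poly_monom e_def sum_distrib_left power_diff field_simps)
    ultimately show "poly (monom 1 e * q) b = poly (monom 1 m * R) b"
      by (simp add: poly_monom mult_ac)
  qed
  then have "coeff (monom 1 e * q) (k + e) = coeff (monom 1 m * R) (k + e)" for k by simp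
  then have cq: "coeff q k = coeff (monom 1 m * R) (k + e)" for k by (simp add: coeff_monom_mult)
  have qm: "coeff q m = coeff r 0" and q0: "coeff q k = 0" if "k > m" for k
  proof -
    have "degree R \<le> e" unfolding R_def by (intro degree_sum_le) (auto intro: order_trans[OF degree_monom_le])
    then show "coeff q k = 0" using that unfolding cq by (simp add: coeff_monom_mult coeff_eq_0)
    have "coeff R e = (\<Sum>j\<le>e. if j = 0 then coeff r j else 0)"
      unfolding R_def coeff_sum by (intro sum.cong) auto
    then show "coeff q m = coeff r 0" unfolding cq by (simp add: coeff_monom_mult)
  qed
  have qm: "coeff q m = coeff r 0" using qm[of "Suc m"] by simp
  have dq: "degree q \<le> m" using q0 by (intro degree_le) auto
  obtain a b c d where g': "g = m2 a b c d" "a * d - b * c = 1" using g by (rule SL2_m2E)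
  show ?thesis
  proof (cases "d = 0")
    case False
    have "f g = d ^ m * (\<Sum>k\<le>m. coeff q k * (b / d) ^ k)"
      using 1[OF g'(2) False] by (simp add: g'(1) poly_sum_le[OF dq])
    also have "\<dots> = (\<Sum>k\<le>m. coeff q k * (b ^ k * d ^ (m - k)))"
      unfolding sum_distrib_left using False
      by (intro sum.cong refl) (simp add: power_divide power_diff field_simps)
    finally show ?thesis using g by (simp add: Xm_def) (simp add: g')
  next
    case True
    have b: "b \<noteq> 0" using g'(2) True by auto
    have "f g = b ^ m * coeff q m" using 2[OF g'(2) b] True by (simp add: g'(1) qm poly_0_coeff_0)
    also have "\<dots> = (\<Sum>k\<le>m. coeff q k * (b ^ k * d ^ (m - k)))"
    proof -
      have "(\<Sum>k\<le>m. coeff q k * (b ^ k * d ^ (m - k))) = (\<Sum>k\<le>m. if k = m then coeff q m * b ^ m else 0)"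
        by (intro sum.cong refl) (auto simp: True power_0_left)
      also have "\<dots> = coeff q m * b ^ m" by simp
      finally show ?thesis by (simp add: mult.commute)
    qed
    finally show ?thesis using g by (simp add: Xm_def) (simp add: g')
  qed
qed

lemma ind_B_act:
  assumes f: "f \<in> carrier (ind_B m)" and g: "g \<in> carrier SL2"
  shows "(\<lambda>x\<in>carrier SL2. f (g * x)) \<in> carrier (ind_B m)"
proof -
  have "f \<in> coord_ring" using f by (simp add: ind_B_simps)
  then have "restrict (\<lambda>x. f (g * x)) (carrier SL2) \<in> coord_ring"
  proof induction
    case (const c)
    then show ?case using g by (intro coord_ring_cong[OF coord_ring_const[of c]]) auto
  next
    case (entry i j)
    have e: "restrict (\<lambda>g. g $$ (i, j)) (carrier SL2) \<in> coord_ring" if "i < 2" "j < 2" for i j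
      by (rule coord_ring.entry) (use that in auto)
    show ?case
      by (rule coord_ring_cong[OF coord_ring_add[OF
        coord_ring_mult[OF coord_ring_const[of "g $$ (i, 0)"] e[of 0 j]]
        coord_ring_mult[OF coord_ring_const[of "g $$ (i, 1)"] e[of 1 j]]]])
       (use g entry in \<open>auto simp: mult_entry2[OF SL2_carrier_mat SL2_carrier_mat] simp del: index_mult_mat(1)\<close>)
  next
    case (add f h)
    show ?case by (rule coord_ring_cong[OF coord_ring_add[OF add.IH]]) (use g in auto)
  next
    case (mult f h)
    show ?case by (rule coord_ring_cong[OF coord_ring_mult[OF mult.IH]]) (use g in auto)
  qed
  moreover have "f (g * (x * b)) = inverse (b $$ (0, 0) ^ m) * f (g * x)" if "x \<in> carrier SL2" "b \<in> Borel" for x b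
  proof -
    have "g * (x * b) = g * x * b" using g that Borel_SL2 SL2_assoc by metis
    then show ?thesis using f g that by (simp add: ind_B_simps)
  qed
  ultimately show ?thesis by (auto simp: ind_B_simps)
qed

lemma ev_fnl_ind_B: "x \<in> carrier SL2 \<Longrightarrow> (\<lambda>f. f x) \<in> fnl (ind_B m)"
  by (auto simp: fnl_def ind_B_simps)

lemma fnl_ind_B_form:
  fixes f :: "'k::alg_closed_field mat \<Rightarrow> 'k"
  assumes f: "f \<in> carrier (ind_B m)" and q: "\<And>z. f (Um z) = poly q z" and \<psi>: "\<psi> \<in> fnl (ind_B m)"
  shows "\<psi> f = (\<Sum>k\<le>m. coeff q k * \<psi> (Xm m k))"
proof -
  interpret kvs "ind_B m :: ('k, 'k mat \<Rightarrow> 'k) gmod" by (rule kvs_ind_B)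
  define F where "F = finsum (ind_B m) (\<lambda>k. coeff q k \<odot>\<^bsub>ind_B m\<^esub> Xm m k) {..m}"
  have Pi: "(\<lambda>k. coeff q k \<odot>\<^bsub>ind_B m\<^esub> Xm m k) \<in> {..m} \<rightarrow> carrier (ind_B m)" using Xm_ind_B by auto
  have Fc: "F \<in> carrier (ind_B m)" unfolding F_def by (rule finsum_closed[OF Pi])
  have F: "\<psi> F = (\<Sum>k\<le>m. coeff q k * \<psi> (Xm m k))" if "\<psi> \<in> fnl (ind_B m)" for \<psi>
    unfolding F_def fnl_finsum[OF that finite_atMost Pi] by (intro sum.cong) (auto simp: fnl_smult[OF that] Xm_ind_B)
  have "f = F"
  proof
    fix x
    show "f x = F x"
    proof (cases "x \<in> carrier SL2")
      case True
      then show ?thesis using F[OF ev_fnl_ind_B[OF True]] ind_B_form[OF f q True] by simp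
    next
      case False
      then show ?thesis using f Fc coord_ring_ext[of f] coord_ring_ext[of F] by (auto simp: ind_B_simps extensional_def)
    qed
  qed
  then show ?thesis using F[OF \<psi>] by simp
qed

section \<open>The Weyl module and its dual basis\<close>

lemma weyl_simps:
  "\<psi> \<in> carrier (weyl m) \<longleftrightarrow> \<psi> \<in> extensional (carrier (ind_B m)) \<and> \<psi> \<in> fnl (ind_B m)"
  "\<psi> \<oplus>\<^bsub>weyl m\<^esub> \<chi> = (\<lambda>v\<in>carrier (ind_B m). \<psi> v + \<chi> v)"
  "\<zero>\<^bsub>weyl m\<^esub> = (\<lambda>v\<in>carrier (ind_B m). 0)"
  "c \<odot>\<^bsub>weyl m\<^esub> \<psi> = (\<lambda>v\<in>carrier (ind_B m). c * \<psi> v)"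
  by (auto simp: weyl_def dual_def fnl_def)

lemma weyl_act:
  assumes "g \<in> carrier SL2"
  shows "act (weyl m) g \<psi> = (\<lambda>f\<in>carrier (ind_B m). \<psi> (\<lambda>x\<in>carrier SL2. f (g * x)))"
  using assms by (simp add: weyl_def dual_def ind_B_simps)

lemma fnl_restrict_weyl:
  assumes "\<psi> \<in> fnl (ind_B m)"
  shows "restrict \<psi> (carrier (ind_B m)) \<in> carrier (weyl m)"
proof -
  interpret kvs "ind_B m :: ('a, 'a mat \<Rightarrow> 'a) gmod" by (rule kvs_ind_B)
  show ?thesis using assms by (auto simp: weyl_simps(1)) (auto simp: fnl_def)
qed

lemma kvs_weyl: "kvs (weyl m :: ('k::field, ('k mat \<Rightarrow> 'k) \<Rightarrow> 'k) gmod)"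
proof (rule kvsI)
  let ?M = "weyl m :: ('k, ('k mat \<Rightarrow> 'k) \<Rightarrow> 'k) gmod"
  interpret kvs "ind_B m :: ('k, 'k mat \<Rightarrow> 'k) gmod" by (rule kvs_ind_B)
  show "\<zero>\<^bsub>?M\<^esub> \<in> carrier ?M" unfolding weyl_simps(3) by (rule fnl_restrict_weyl) (simp add: fnl_def)
  show "u \<oplus>\<^bsub>?M\<^esub> v \<in> carrier ?M" if "u \<in> carrier ?M" "v \<in> carrier ?M" for u v
    unfolding weyl_simps(2) by (rule fnl_restrict_weyl) (use that in \<open>auto simp: fnl_def weyl_simps(1) algebra_simps\<close>)
  show "c \<odot>\<^bsub>?M\<^esub> v \<in> carrier ?M" if "v \<in> carrier ?M" for c v
    unfolding weyl_simps(4) by (rule fnl_restrict_weyl) (use that in \<open>auto simp: fnl_def weyl_simps(1) algebra_simps\<close>)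
  show "\<zero>\<^bsub>?M\<^esub> \<oplus>\<^bsub>?M\<^esub> v = v" "1 \<odot>\<^bsub>?M\<^esub> v = v" if "v \<in> carrier ?M" for v
    using that by (auto simp: weyl_simps extensional_restrict cong: restrict_cong)
qed (auto simp: weyl_simps(2-) algebra_simps cong: restrict_cong)

text \<open>The basis dual to the monomials \<open>Xm m k\<close>, as \<open>dlt_Xm\<close> shows:
  an element of the induced module is determined by its restriction to U, and \<open>dlt\<close>
  picks a coefficient there.\<close>

definition dlt :: "nat \<Rightarrow> nat \<Rightarrow> ('k::alg_closed_field mat \<Rightarrow> 'k) \<Rightarrow> 'k" where
  "dlt m k = (\<lambda>f\<in>carrier (ind_B m). coeff (THE q. \<forall>z. f (Um z) = poly q z) k)"

lemma dlt_eq: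
  assumes "f \<in> carrier (ind_B m)" "\<And>z. f (Um z) = poly q z"
  shows "dlt m k f = coeff q k"
proof -
  have "(THE q. \<forall>z. f (Um z) = poly q z) = q"
    by (rule the_equality) (auto intro!: poly_eqI_inf simp: assms(2))
  then show ?thesis using assms(1) by (simp add: dlt_def)
qed

lemma ind_B_poly:
  fixes f :: "'k::field mat \<Rightarrow> 'k"
  assumes "f \<in> carrier (ind_B m)"
  obtains q where "\<And>z. f (Um z) = poly q z"
  using coord_pcurve[OF _ pcurve_Um, of f] assms unfolding ind_B_simps by blast

lemma dlt_weyl: "(dlt m k :: ('k::alg_closed_field mat \<Rightarrow> 'k) \<Rightarrow> 'k) \<in> carrier (weyl m)"
proof -
  interpret kvs "ind_B m :: ('k, 'k mat \<Rightarrow> 'k) gmod" by (rule kvs_ind_B)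
  have "(dlt m k :: ('k mat \<Rightarrow> 'k) \<Rightarrow> 'k) \<in> fnl (ind_B m)"
    unfolding fnl_def
  proof (intro CollectI conjI ballI allI)
    fix u v :: "'k mat \<Rightarrow> 'k" assume u: "u \<in> carrier (ind_B m)" and v: "v \<in> carrier (ind_B m)"
    obtain q where q: "\<And>z. u (Um z) = poly q z" using u by (rule ind_B_poly) blast
    obtain r where r: "\<And>z. v (Um z) = poly r z" using v by (rule ind_B_poly) blast
    have "dlt m k (u \<oplus>\<^bsub>ind_B m\<^esub> v) = coeff (q + r) k"
    proof (rule dlt_eq)
      show "u \<oplus>\<^bsub>ind_B m\<^esub> v \<in> carrier (ind_B m)" using u v by (rule a_closed)
      show "(u \<oplus>\<^bsub>ind_B m\<^esub> v) (Um z) = poly (q + r) z" for z using q r by (simp add: ind_B_simps(2))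
    qed
    then show "dlt m k (u \<oplus>\<^bsub>ind_B m\<^esub> v) = dlt m k u + dlt m k v" using dlt_eq[OF u q] dlt_eq[OF v r] by simp
  next
    fix c and v :: "'k mat \<Rightarrow> 'k" assume v: "v \<in> carrier (ind_B m)"
    obtain r where r: "\<And>z. v (Um z) = poly r z" using v by (rule ind_B_poly) blast
    have "dlt m k (c \<odot>\<^bsub>ind_B m\<^esub> v) = coeff (Polynomial.smult c r) k"
    proof (rule dlt_eq)
      show "c \<odot>\<^bsub>ind_B m\<^esub> v \<in> carrier (ind_B m)" using v by (rule smult_cl)
      show "(c \<odot>\<^bsub>ind_B m\<^esub> v) (Um z) = poly (Polynomial.smult c r) z" for z using r by (simp add: ind_B_simps(4))
    qed
    then show "dlt m k (c \<odot>\<^bsub>ind_B m\<^esub> v) = c * dlt m k v" using dlt_eq[OF v r] by simp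
  qed
  then show ?thesis by (simp add: weyl_simps(1)) (simp add: dlt_def)
qed

lemma Xm_Um: "Xm m k (Um z) = z ^ k"
  by (simp add: Xm_def) (simp add: Um_def)

lemma dlt_Xm: "j \<le> m \<Longrightarrow> dlt m k (Xm m j) = (if j = k then 1 else 0)"
  using dlt_eq[OF Xm_ind_B, of j m "monom 1 j" k] by (simp add: Xm_Um poly_monom)

lemma weyl_expand:
  fixes \<psi> :: "('k::alg_closed_field mat \<Rightarrow> 'k) \<Rightarrow> 'k"
  assumes \<psi>: "\<psi> \<in> carrier (weyl m)" and \<theta>: "\<theta> \<in> fnl (weyl m)"
  shows "\<theta> \<psi> = (\<Sum>k\<le>m. \<psi> (Xm m k) * \<theta> (dlt m k))"
proof -
  interpret W: kvs "weyl m :: ('k, ('k mat \<Rightarrow> 'k) \<Rightarrow> 'k) gmod" by (rule kvs_weyl)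
  define F where "F = finsum (weyl m) (\<lambda>k. \<psi> (Xm m k) \<odot>\<^bsub>weyl m\<^esub> dlt m k) {..m}"
  have Pi: "(\<lambda>k. \<psi> (Xm m k) \<odot>\<^bsub>weyl m\<^esub> dlt m k) \<in> {..m} \<rightarrow> carrier (weyl m)" by (auto intro: W.smult_cl dlt_weyl)
  have Fc: "F \<in> carrier (weyl m)" unfolding F_def by (rule W.finsum_closed[OF Pi])
  have F: "\<theta> F = (\<Sum>k\<le>m. \<psi> (Xm m k) * \<theta> (dlt m k))" if "\<theta> \<in> fnl (weyl m)" for \<theta>
    unfolding F_def W.fnl_finsum[OF that finite_atMost Pi] by (intro sum.cong) (auto simp: W.fnl_smult[OF that] dlt_weyl)
  have "\<psi> = F"
  proof
    fix f
    show "\<psi> f = F f"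
    proof (cases "f \<in> carrier (ind_B m)")
      case True
      then have ev: "(\<lambda>\<psi>. \<psi> f) \<in> fnl (weyl m)" by (auto simp: fnl_def weyl_simps(2,4))
      obtain q where q: "\<And>z. f (Um z) = poly q z" using True by (rule ind_B_poly) blast
      have "\<psi> f = (\<Sum>k\<le>m. coeff q k * \<psi> (Xm m k))"
        using fnl_ind_B_form[OF True q] \<psi> by (simp add: weyl_simps(1))
      then show ?thesis using F[OF ev] dlt_eq[OF True q] by (simp add: mult.commute)
    next
      case False
      then show ?thesis using \<psi> Fc by (auto simp: weyl_simps(1) extensional_def)
    qed
  qed
  then show ?thesis using F[OF \<theta>] by simp
qed

section \<open>Root subgroups and torus in the dual basis\<close>

definition w0m :: "'k::field mat" where "w0m = m2 0 1 (- 1) 0"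

lemma w0m_SL2 [simp]: "w0m \<in> carrier SL2"
  by (simp add: w0m_def m2_SL2)

lemma weyl_act_cl:
  assumes "g \<in> carrier SL2" "\<psi> \<in> carrier (weyl m)"
  shows "act (weyl m) g \<psi> \<in> carrier (weyl m)"
proof -
  interpret kvs "ind_B m :: ('a, 'a mat \<Rightarrow> 'a) gmod" by (rule kvs_ind_B)
  have \<psi>: "\<psi> \<in> fnl (ind_B m)" using assms by (simp add: weyl_simps)
  have "(\<lambda>f. \<psi> (\<lambda>x\<in>carrier SL2. f (g * x))) \<in> fnl (ind_B m)"
    unfolding fnl_def
  proof (intro CollectI conjI ballI allI)
    fix u v :: "'a mat \<Rightarrow> 'a" assume u: "u \<in> carrier (ind_B m)" and v: "v \<in> carrier (ind_B m)"
    have "(\<lambda>x\<in>carrier SL2. (u \<oplus>\<^bsub>ind_B m\<^esub> v) (g * x)) = (\<lambda>x\<in>carrier SL2. u (g * x)) \<oplus>\<^bsub>ind_B m\<^esub> (\<lambda>x\<in>carrier SL2. v (g * x))"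
      using assms(1) by (auto simp: ind_B_simps)
    then show "\<psi> (\<lambda>x\<in>carrier SL2. (u \<oplus>\<^bsub>ind_B m\<^esub> v) (g * x)) = \<psi> (\<lambda>x\<in>carrier SL2. u (g * x)) + \<psi> (\<lambda>x\<in>carrier SL2. v (g * x))"
      using fnl_add[OF \<psi> ind_B_act[OF u assms(1)] ind_B_act[OF v assms(1)]] by simp
  next
    fix c :: 'a and v :: "'a mat \<Rightarrow> 'a" assume v: "v \<in> carrier (ind_B m)"
    have "(\<lambda>x\<in>carrier SL2. (c \<odot>\<^bsub>ind_B m\<^esub> v) (g * x)) = c \<odot>\<^bsub>ind_B m\<^esub> (\<lambda>x\<in>carrier SL2. v (g * x))"
      using assms(1) by (auto simp: ind_B_simps)
    then show "\<psi> (\<lambda>x\<in>carrier SL2. (c \<odot>\<^bsub>ind_B m\<^esub> v) (g * x)) = c * \<psi> (\<lambda>x\<in>carrier SL2. v (g * x))"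
      using fnl_smult[OF \<psi> ind_B_act[OF v assms(1)]] by simp
  qed
  then show ?thesis unfolding weyl_act[OF assms(1)] by (rule fnl_restrict_weyl)
qed

lemma weyl_act_Xm: "g \<in> carrier SL2 \<Longrightarrow> k \<le> m \<Longrightarrow> act (weyl m) g \<psi> (Xm m k) = \<psi> (\<lambda>x\<in>carrier SL2. Xm m k (g * x))"
  by (simp add: weyl_act Xm_ind_B)

text \<open>The leading coefficient is the value at the point at infinity of the projective line.
  This makes the action of the group on the highest weight vector computable.\<close>

lemma dlt_top:
  assumes f: "f \<in> carrier (ind_B m)"
  shows "dlt m m f = f w0m"
proof -
  obtain q where q: "\<And>z. f (Um z) = poly q z" using f by (rule ind_B_poly) blast
  have "f w0m = (\<Sum>k\<le>m. coeff q k * Xm m k w0m)" by (rule ind_B_form[OF f q]) simp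
  also have "\<dots> = (\<Sum>k\<le>m. if k = m then coeff q k else 0)"
    by (intro sum.cong refl) (auto simp: Xm_def, auto simp: w0m_def)
  finally show ?thesis using dlt_eq[OF f q, of m] by simp
qed

lemma act_Lm_dlt:
  assumes "k \<le> m"
  shows "act (weyl m) (Lm y) (dlt m m) (Xm m k) = y ^ (m - k)"
proof -
  have "Lm y * w0m = m2 0 1 (- 1) y" by (simp add: Lm_def w0m_def m2_mult)
  moreover have "Lm y * w0m \<in> carrier SL2" by simp
  ultimately have "Xm m k (Lm y * w0m) = y ^ (m - k)" by (simp add: Xm_def)
  then show ?thesis
    unfolding weyl_act_Xm[OF Lm_SL2 assms] dlt_top[OF ind_B_act[OF Xm_ind_B[OF assms] Lm_SL2]] by simp
qed

text \<open>Left translation by U(x) replaces z^k by (z + x)^k, whence the binomial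
  coefficients.\<close>

lemma act_Um_dlt:
  assumes "k \<le> m"
  shows "act (weyl m) (Um x) (dlt m K) (Xm m k) = of_nat (k choose K) * x ^ (k - K)"
proof -
  define r where "r = (\<Sum>t\<le>k. monom (of_nat (k choose t) * x ^ (k - t)) t)"
  have "(\<lambda>g\<in>carrier SL2. Xm m k (Um x * g)) (Um z) = poly r z" for z
  proof -
    have "Um x * Um z = Um (z + x)" by (simp add: Um_def m2_mult add.commute)
    then have "(\<lambda>g\<in>carrier SL2. Xm m k (Um x * g)) (Um z) = (z + x) ^ k" by (simp add: Xm_Um)
    also have "\<dots> = poly r z" unfolding binomial_ring r_def by (simp add: poly_sum poly_monom mult_ac)
    finally show ?thesis .
  qed
  then have "act (weyl m) (Um x) (dlt m K) (Xm m k) = coeff r K"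
    unfolding weyl_act_Xm[OF Um_SL2 assms] by (rule dlt_eq[OF ind_B_act[OF Xm_ind_B[OF assms] Um_SL2]])
  also have "\<dots> = (\<Sum>t\<le>k. if t = K then of_nat (k choose t) * x ^ (k - t) else 0)"
    by (simp add: r_def coeff_sum)
  also have "\<dots> = of_nat (k choose K) * x ^ (k - K)" by (simp add: binomial_eq_0)
  finally show ?thesis .
qed

lemma act_Tm_dlt:
  assumes "k \<le> m" "t \<noteq> 0"
  shows "act (weyl m) (Tm t) (dlt m K) (Xm m k) = (if k = K then t powi (2 * int K - int m) else 0)"
proof -
  have "(\<lambda>g\<in>carrier SL2. Xm m k (Tm t * g)) (Um z) = poly (monom (t powi (2 * int k - int m)) k) z" for z
  proof -
    have "Tm t * Um z = m2 t (t * z) 0 (inverse t)" by (simp add: Um_def Tm_def m2_mult)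
    moreover have "m2 t (t * z) 0 (inverse t) \<in> carrier SL2" using assms by (simp add: m2_SL2)
    ultimately have "(\<lambda>g\<in>carrier SL2. Xm m k (Tm t * g)) (Um z) = (t * z) ^ k * inverse t ^ (m - k)"
      by (simp add: Xm_def)
    also have "\<dots> = t ^ k * inverse t ^ (m - k) * z ^ k" by (simp add: power_mult_distrib)
    also have "t ^ k * inverse t ^ (m - k) = t powi (int k - int (m - k))"
      using assms(2) by (simp add: power_int_diff power_inverse divide_inverse)
    also have "int k - int (m - k) = 2 * int k - int m" using assms(1) by simp
    finally show ?thesis by (simp add: poly_monom)
  qed
  then have "act (weyl m) (Tm t) (dlt m K) (Xm m k) = coeff (monom (t powi (2 * int k - int m)) k) K"
    unfolding weyl_act_Xm[OF Tm_SL2[OF assms(2)] assms(1)]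
    by (rule dlt_eq[OF ind_B_act[OF Xm_ind_B[OF assms(1)] Tm_SL2[OF assms(2)]]])
  then show ?thesis by simp
qed

text \<open>Divided powers are at hand in rational modules; those of the Weyl module are therefore
  computed on its images in \<open>M\<close>.\<close>

locale weyl_hom = rat M for M :: "('k::alg_closed_field, 'v) gmod" (structure) +
  fixes m :: nat and h :: "(('k mat \<Rightarrow> 'k) \<Rightarrow> 'k) \<Rightarrow> 'v"
  assumes hom: "h \<in> gmod_hom (weyl m) M"
begin

lemma h_cl [simp, intro]: "\<psi> \<in> carrier (weyl m) \<Longrightarrow> h \<psi> \<in> carrier M"
  using hom LinearCombinations.module_hom_closed by (fastforce simp: gmod_hom_def)

lemma h_add: "u \<in> carrier (weyl m) \<Longrightarrow> v \<in> carrier (weyl m) \<Longrightarrow> h (u \<oplus>\<^bsub>weyl m\<^esub> v) = h u \<oplus> h v"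
  using hom LinearCombinations.module_hom_add by (fastforce simp: gmod_hom_def)

lemma h_smult: "v \<in> carrier (weyl m) \<Longrightarrow> h (c \<odot>\<^bsub>weyl m\<^esub> v) = c \<odot> h v"
  using hom LinearCombinations.module_hom_smult[of h class_ring "weyl m" M c v] by (simp add: gmod_hom_def)

lemma h_act: "g \<in> carrier SL2 \<Longrightarrow> v \<in> carrier (weyl m) \<Longrightarrow> h (act (weyl m) g v) = act M g (h v)"
  using hom by (simp add: gmod_hom_def)

lemma fnl_h: "\<phi> \<in> fnl M \<Longrightarrow> (\<lambda>v. \<phi> (h v)) \<in> fnl (weyl m)"
  by (simp add: fnl_def h_add h_smult)

lemma dlt_cl [simp]: "dlt m K \<in> carrier (weyl m)"
  by (rule dlt_weyl)

lemma h_expand: "\<phi> \<in> fnl M \<Longrightarrow> \<psi> \<in> carrier (weyl m) \<Longrightarrow> \<phi> (h \<psi>) = (\<Sum>k\<le>m. \<psi> (Xm m k) * \<phi> (h (dlt m k)))"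
  using weyl_expand[OF _ fnl_h] by simp

lemma h_act_dlt:
  assumes "\<phi> \<in> fnl M" "g \<in> carrier SL2"
  shows "\<phi> (act M g (h (dlt m K))) = (\<Sum>k\<le>m. act (weyl m) g (dlt m K) (Xm m k) * \<phi> (h (dlt m k)))"
  using h_expand[OF assms(1) weyl_act_cl[OF assms(2) dlt_cl[of K]]] h_act[OF assms(2) dlt_cl[of K]] by simp

lemma h_dlt_wt: "K \<le> m \<Longrightarrow> h (dlt m K) \<in> wt M (2 * int K - int m)"
  unfolding wt_def
proof (intro CollectI conjI allI impI)
  fix z :: 'k assume z: "z \<noteq> 0" and K: "K \<le> m"
  show "act M (Tm z) (h (dlt m K)) = z powi (2 * int K - int m) \<odot> h (dlt m K)"
  proof (rule fnl_eqI)
    fix \<phi> assume \<phi>: "\<phi> \<in> fnl M"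
    have "\<phi> (act M (Tm z) (h (dlt m K))) = (\<Sum>k\<le>m. if k = K then z powi (2 * int K - int m) * \<phi> (h (dlt m K)) else 0)"
      unfolding h_act_dlt[OF \<phi> Tm_SL2[OF z]] using z by (intro sum.cong) (auto simp: act_Tm_dlt)
    then show "\<phi> (act M (Tm z) (h (dlt m K))) = \<phi> (z powi (2 * int K - int m) \<odot> h (dlt m K))"
      using K \<phi> by (simp add: fnl_smult)
  qed (use z in auto)
qed auto

text \<open>These binomial coefficients are the origin of the scalars \<open>cf\<close>.\<close>

lemma h_dlt_eop: "eop M t (h (dlt m K)) = (if K + t \<le> m then of_nat ((K + t) choose K) \<odot> h (dlt m (K + t)) else \<zero>)"
  unfolding eop_def
proof (rule pcoef_eqI)
  let ?w = "\<lambda>t. if K + t \<le> m then of_nat ((K + t) choose K) \<odot> h (dlt m (K + t)) else \<zero>"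
  have "\<exists>q. (\<forall>t. coeff q t = \<phi> (?w t)) \<and> (\<forall>x. \<phi> (act M (Um x) (h (dlt m K))) = poly q x)" if \<phi>: "\<phi> \<in> fnl M" for \<phi>
  proof (intro exI conjI allI)
    let ?q = "\<Sum>k\<in>{k. K \<le> k \<and> k \<le> m}. monom (of_nat (k choose K) * \<phi> (h (dlt m k))) (k - K)"
    fix t
    have "coeff ?q t = (\<Sum>k\<in>{k. K \<le> k \<and> k \<le> m}. if k = K + t then of_nat (k choose K) * \<phi> (h (dlt m k)) else 0)"
      unfolding coeff_sum by (intro sum.cong) auto
    also have "\<dots> = (if K + t \<le> m then of_nat ((K + t) choose K) * \<phi> (h (dlt m (K + t))) else 0)"
      by (subst sum.delta) auto
    finally show "coeff ?q t = \<phi> (?w t)" using \<phi> by (simp add: fnl_smult fnl_zero)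
    fix x
    have "\<phi> (act M (Um x) (h (dlt m K))) = (\<Sum>k\<le>m. of_nat (k choose K) * x ^ (k - K) * \<phi> (h (dlt m k)))"
      unfolding h_act_dlt[OF \<phi> Um_SL2] by (intro sum.cong) (auto simp: act_Um_dlt)
    also have "\<dots> = (\<Sum>k\<in>{k. K \<le> k \<and> k \<le> m}. of_nat (k choose K) * x ^ (k - K) * \<phi> (h (dlt m k)))"
      by (rule sum.mono_neutral_right) (auto simp: binomial_eq_0)
    finally show "\<phi> (act M (Um x) (h (dlt m K))) = poly ?q x"
      by (simp add: poly_sum poly_monom mult_ac)
  qed
  then show "pexp M Um (h (dlt m K)) ?w"
    unfolding pexp_def by (auto intro!: exI[of _ "Suc m"])
qed (auto intro: pcurve_Um)

text \<open>The vector \<open>dlt m m\<close> generates the Weyl module under the divided powers of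
  the negative root vector, so its image determines the homomorphism.\<close>

lemma h_dlt_fop: "k \<le> m \<Longrightarrow> h (dlt m k) = fop M (m - k) (h (dlt m m))"
proof -
  let ?w = "\<lambda>t. if t \<le> m then h (dlt m (m - t)) else \<zero>"
  have "\<exists>q. (\<forall>t. coeff q t = \<phi> (?w t)) \<and> (\<forall>x. \<phi> (act M (Lm x) (h (dlt m m))) = poly q x)" if \<phi>: "\<phi> \<in> fnl M" for \<phi>
  proof (intro exI conjI allI)
    let ?q = "\<Sum>k\<le>m. monom (\<phi> (h (dlt m k))) (m - k)"
    fix t
    have "coeff ?q t = (\<Sum>k\<le>m. if k = m - t then if t \<le> m then \<phi> (h (dlt m k)) else 0 else 0)"
      unfolding coeff_sum by (intro sum.cong) auto
    also have "\<dots> = (if t \<le> m then \<phi> (h (dlt m (m - t))) else 0)" by (subst sum.delta) auto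
    finally show "coeff ?q t = \<phi> (?w t)" using \<phi> by (simp add: fnl_zero)
    fix x
    have "\<phi> (act M (Lm x) (h (dlt m m))) = (\<Sum>k\<le>m. x ^ (m - k) * \<phi> (h (dlt m k)))"
      unfolding h_act_dlt[OF \<phi> Lm_SL2] by (intro sum.cong) (auto simp: act_Lm_dlt)
    then show "\<phi> (act M (Lm x) (h (dlt m m))) = poly ?q x"
      by (simp add: poly_sum poly_monom mult_ac)
  qed
  then have "pexp M Lm (h (dlt m m)) ?w"
    unfolding pexp_def by (auto intro!: exI[of _ "Suc m"])
  then have "fop M (m - k) (h (dlt m m)) = ?w (m - k)"
    unfolding fop_def by (intro pcoef_eqI) (auto intro: pcurve_Lm)
  then show "k \<le> m \<Longrightarrow> h (dlt m k) = fop M (m - k) (h (dlt m m))" by simp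
qed

lemma h_top: "h (dlt m m) \<in> wt M (int m)" "t > 0 \<Longrightarrow> eop M t (h (dlt m m)) = \<zero>"
  using h_dlt_wt[of m] h_dlt_eop[of t m] by auto

end

lemma weyl_hom_determined:
  assumes "weyl_hom M m h" "weyl_hom M m h'" "h (dlt m m) = h' (dlt m m)"
  shows "h = h'"
proof
  fix \<psi>
  interpret h: weyl_hom M m h by fact
  interpret h': weyl_hom M m h' by fact
  show "h \<psi> = h' \<psi>"
  proof (cases "\<psi> \<in> carrier (weyl m)")
    case True
    show ?thesis
    proof (rule h.fnl_eqI)
      fix \<phi> assume \<phi>: "\<phi> \<in> fnl M"
      have "h (dlt m k) = h' (dlt m k)" if "k \<le> m" for k
        using h.h_dlt_fop[OF that] h'.h_dlt_fop[OF that] assms(3) by simp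
      then show "\<phi> (h \<psi>) = \<phi> (h' \<psi>)"
        unfolding h.h_expand[OF \<phi> True] h'.h_expand[OF \<phi> True] by (intro sum.cong) auto
    qed (use True in auto)
  next
    case False
    then show ?thesis using h.hom h'.hom by (auto simp: gmod_hom_def extensional_def)
  qed
qed

context rat
begin

text \<open>The universal property of the Weyl module, by duality. The vector w' is an eigenvector
  of the Borel subgroup, so each function g \<mapsto> \<phi>(g w') lies in the induced module, and
  \<open>\<psi>\<close> goes to the vector whose image under \<open>\<phi>\<close> is
  \<open>\<psi> (F \<phi>)\<close>.\<close>

lemma weyl_universal:
  assumes w: "w \<in> wt M (int m)" and inv: "\<And>t. t > 0 \<Longrightarrow> eop M t w = \<zero>"
  shows "\<exists>h\<in>gmod_hom (weyl m) M. h (dlt m m) = w"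
proof -
  have wc: "w \<in> carrier M" using w by (rule wt_carrier)
  \<comment> \<open>All coefficients of positive powers of x in U(x) w vanish.\<close>
  have Uw: "act M (Um x) w = w" for x
  proof (rule fnl_eqI)
    fix \<phi> assume \<phi>: "\<phi> \<in> fnl M"
    obtain q where q: "\<And>t. coeff q t = \<phi> (eop M t w)" "\<And>x. \<phi> (act M (Um x) w) = poly q x"
      using eop_poly[OF wc \<phi>] by metis
    have "coeff q t = coeff [:\<phi> w:] t" for t
      using q(1)[of t] inv[of t] wc \<phi> by (cases t) (auto simp: fnl_zero)
    then have "q = [:\<phi> w:]" by (intro poly_eqI)
    then show "\<phi> (act M (Um x) w) = \<phi> w" using q(2)[of x] by simp
  qed (use wc in auto)
  define w0i where "w0i = m2 0 (- 1) 1 (0 :: 'k)"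
  have w0i: "w0i \<in> carrier SL2" "w0m * w0i = m2 1 0 0 1" by (auto simp: w0i_def w0m_def m2_SL2 m2_mult)
  define w' where "w' = act M w0i w"
  have w'c: "w' \<in> carrier M" using wc w0i by (simp add: w'_def)
  define F where "F \<phi> = (\<lambda>g\<in>carrier SL2. \<phi> (act M g w'))" for \<phi> :: "'v \<Rightarrow> 'k"
  have Fc: "F \<phi> \<in> carrier (ind_B m)" if \<phi>: "\<phi> \<in> fnl M" for \<phi>
    unfolding ind_B_simps
  proof (intro conjI ballI)
    obtain B f where B: "finite B" "B \<subseteq> carrier M" and f: "\<And>c. c \<in> B \<Longrightarrow> restrict (f c) (carrier SL2) \<in> coord_ring"
      and form: "\<And>g \<phi>. g \<in> carrier SL2 \<Longrightarrow> \<phi> \<in> fnl M \<Longrightarrow> \<phi> (act M g w') = (\<Sum>c\<in>B. f c g * \<phi> c)"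
      using matrix_form[OF w'c] by blast
    have "restrict (\<lambda>g. \<Sum>c\<in>B. f c g * \<phi> c) (carrier SL2) \<in> coord_ring"
      using f by (intro coord_ring_sum coord_ring_mult coord_ring_const) auto
    then show "F \<phi> \<in> coord_ring" unfolding F_def by (rule coord_ring_cong) (simp add: form \<phi>)
    fix g b :: "'k mat" assume g: "g \<in> carrier SL2" and b: "b \<in> Borel"
    obtain t u where t: "b = m2 t 0 u (inverse t)" "t \<noteq> 0" using b by (rule Borel_m2E) blast
    have bS: "b \<in> carrier SL2" using b by (rule Borel_SL2)
    have e: "b * w0i = w0i * (Tm (inverse t) * Um (- u * t))"
      using t(2) by (simp add: t(1) w0i_def Tm_def Um_def m2_mult field_simps)
    have "act M b w' = act M w0i (act M (Tm (inverse t)) (act M (Um (- u * t)) w))"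
      using wc w0i bS t(2) e by (simp add: w'_def act_act)
    also have "\<dots> = inverse t powi int m \<odot> w'"
      using w t(2) w0i wc by (simp add: Uw wt_def act_smult w'_def)
    finally have "\<phi> (act M (g * b) w') = inverse t powi int m * \<phi> (act M g w')"
      using g bS w'c \<phi> by (simp add: act_smult fnl_smult flip: act_act)
    then show "F \<phi> (g * b) = inverse (b $$ (0, 0) ^ m) * F \<phi> g"
      using g b by (simp add: F_def) (simp add: t power_inverse)
  qed
  have Fform: "\<psi> (F \<phi>) = (\<Sum>k\<le>m. \<phi> (eop M k w') * \<psi> (Xm m k))" if \<phi>: "\<phi> \<in> fnl M" and \<psi>: "\<psi> \<in> fnl (ind_B m)" for \<phi> \<psi>
  proof -
    obtain q where q: "\<And>t. coeff q t = \<phi> (eop M t w')" "\<And>x. \<phi> (act M (Um x) w') = poly q x"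
      using eop_poly[OF w'c \<phi>] by metis
    have "F \<phi> (Um z) = poly q z" for z by (simp add: F_def q(2))
    from fnl_ind_B_form[OF Fc[OF \<phi>] this \<psi>] show ?thesis using q(1) by simp
  qed
  \<comment> \<open>The sum realises the desired vector inside \<open>M\<close>: the coefficients of
    \<open>F \<phi>\<close> along U are the values of \<open>\<phi>\<close> on the divided powers of
    w'.\<close>
  define h where "h = (\<lambda>\<psi>\<in>carrier (weyl m). finsum M (\<lambda>k. \<psi> (Xm m k) \<odot> eop M k w') {..m})"
  have Pi: "(\<lambda>k. \<psi> (Xm m k) \<odot> eop M k w') \<in> {..m} \<rightarrow> carrier M" for \<psi> :: "('k mat \<Rightarrow> 'k) \<Rightarrow> 'k" using w'c by auto
  have hc: "h \<psi> \<in> carrier M" if "\<psi> \<in> carrier (weyl m)" for \<psi>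
    using that finsum_closed[OF Pi] by (simp add: h_def)
  have \<phi>h: "\<phi> (h \<psi>) = \<psi> (F \<phi>)" if \<phi>: "\<phi> \<in> fnl M" and \<psi>: "\<psi> \<in> carrier (weyl m)" for \<phi> \<psi>
  proof -
    have "\<phi> (h \<psi>) = (\<Sum>k\<le>m. \<psi> (Xm m k) * \<phi> (eop M k w'))"
      using \<psi> w'c by (simp add: h_def fnl_finsum[OF \<phi> finite_atMost Pi] fnl_smult[OF \<phi>])
    then show ?thesis using Fform[OF \<phi>] \<psi> by (simp add: weyl_simps mult.commute)
  qed
  interpret W: kvs "weyl m :: ('k, ('k mat \<Rightarrow> 'k) \<Rightarrow> 'k) gmod" by (rule kvs_weyl)
  have "h \<in> gmod_hom (weyl m) M"
    unfolding gmod_hom_def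
  proof (intro CollectI conjI IntI ballI)
    have add: "h (u \<oplus>\<^bsub>weyl m\<^esub> v) = h u \<oplus> h v" if u: "u \<in> carrier (weyl m)" and v: "v \<in> carrier (weyl m)" for u v
    proof (rule fnl_eqI)
      fix \<phi> assume \<phi>: "\<phi> \<in> fnl M"
      show "\<phi> (h (u \<oplus>\<^bsub>weyl m\<^esub> v)) = \<phi> (h u \<oplus> h v)"
        using \<phi>h[OF \<phi> W.a_closed[OF u v]] \<phi>h[OF \<phi> u] \<phi>h[OF \<phi> v] Fc[OF \<phi>]
        by (simp add: fnl_add[OF \<phi> hc[OF u] hc[OF v]] weyl_simps(2))
    qed (use hc u v W.a_closed in auto)
    have smult: "h (c \<odot>\<^bsub>weyl m\<^esub> v) = c \<odot> h v" if v: "v \<in> carrier (weyl m)" for c v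
    proof (rule fnl_eqI)
      fix \<phi> assume \<phi>: "\<phi> \<in> fnl M"
      show "\<phi> (h (c \<odot>\<^bsub>weyl m\<^esub> v)) = \<phi> (c \<odot> h v)"
        using \<phi>h[OF \<phi> W.smult_cl[OF v]] \<phi>h[OF \<phi> v] Fc[OF \<phi>]
        by (simp add: fnl_smult[OF \<phi> hc[OF v]] weyl_simps(4))
    qed (use hc v W.smult_cl in auto)
    show "h \<in> module_hom class_ring (weyl m) M"
      using hc add smult by (auto simp: LinearCombinations.module_hom_def)
    show "h \<in> extensional (carrier (weyl m))" by (simp add: h_def)
    fix g :: "'k mat" and \<psi> :: "('k mat \<Rightarrow> 'k) \<Rightarrow> 'k" assume g: "g \<in> carrier SL2" and \<psi>: "\<psi> \<in> carrier (weyl m)"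
    show "h (act (weyl m) g \<psi>) = act M g (h \<psi>)"
    proof (rule fnl_eqI)
      fix \<phi> assume \<phi>: "\<phi> \<in> fnl M"
      have "F (\<lambda>v. \<phi> (act M g v)) = (\<lambda>x\<in>carrier SL2. F \<phi> (g * x))"
        using g w'c by (auto simp: F_def act_act)
      then have "\<phi> (act M g (h \<psi>)) = \<psi> (\<lambda>x\<in>carrier SL2. F \<phi> (g * x))"
        using \<phi>h[OF fnl_act[OF \<phi> g] \<psi>] by simp
      then show "\<phi> (h (act (weyl m) g \<psi>)) = \<phi> (act M g (h \<psi>))"
        using \<phi>h[OF \<phi> weyl_act_cl[OF g \<psi>]] Fc[OF \<phi>] by (simp add: weyl_act[OF g])
    qed (use hc g \<psi> weyl_act_cl in auto)
  qed
  moreover have "h (dlt m m) = w"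
  proof (rule fnl_eqI)
    fix \<phi> assume \<phi>: "\<phi> \<in> fnl M"
    have "\<phi> (h (dlt m m)) = F \<phi> w0m" using \<phi>h[OF \<phi> dlt_weyl] dlt_top[OF Fc[OF \<phi>]] by simp
    also have "\<dots> = \<phi> w" using wc w0i by (simp add: F_def w'_def act_act)
    finally show "\<phi> (h (dlt m m)) = \<phi> w" .
  qed (use hc dlt_weyl wc in auto)
  ultimately show ?thesis by blast
qed

end

section \<open>A criterion for rationality\<close>

text \<open>For modules of functions, evaluations at points provide such a set and are easier to
  handle than arbitrary functionals.\<close>

definition sep :: "('k::field, 'v, 'z) module_scheme \<Rightarrow> ('v \<Rightarrow> 'k) set \<Rightarrow> bool" where
  "sep M \<Phi> \<longleftrightarrow> \<Phi> \<subseteq> fnl M \<and> (\<forall>u\<in>carrier M. \<forall>v\<in>carrier M. (\<forall>\<phi>\<in>\<Phi>. \<phi> u = \<phi> v) \<longrightarrow> u = v)"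

context kvs
begin

lemma fnl_lincomb: "\<phi> \<in> fnl M \<Longrightarrow> finite A \<Longrightarrow> s ` A \<subseteq> carrier M \<Longrightarrow>
    \<phi> (finsum M (\<lambda>l. a l \<odot> s l) A) = (\<Sum>l\<in>A. a l * \<phi> (s l))"
  by (subst fnl_finsum) (auto simp: fnl_smult intro!: sum.cong)

lemma sep_lincomb:
  assumes "sep M \<Phi>" "u \<in> carrier M" "finite A" "s ` A \<subseteq> carrier M"
    and "\<And>\<phi>. \<phi> \<in> \<Phi> \<Longrightarrow> \<phi> u = (\<Sum>l\<in>A. a l * \<phi> (s l))"
  shows "u = finsum M (\<lambda>l. a l \<odot> s l) A"
proof -
  have "finsum M (\<lambda>l. a l \<odot> s l) A \<in> carrier M" using assms(4) by (intro finsum_closed) auto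
  moreover have "\<phi> u = \<phi> (finsum M (\<lambda>l. a l \<odot> s l) A)" if "\<phi> \<in> \<Phi>" for \<phi>
    using assms that by (subst fnl_lincomb) (auto simp: sep_def)
  ultimately show ?thesis using assms(1,2) by (auto simp: sep_def)
qed

lemma fnl_sep_lincomb:
  assumes "sep M \<Phi>" "u \<in> carrier M" "finite A" "s ` A \<subseteq> carrier M"
    and "\<And>\<phi>. \<phi> \<in> \<Phi> \<Longrightarrow> \<phi> u = (\<Sum>l\<in>A. a l * \<phi> (s l))" and "\<theta> \<in> fnl M"
  shows "\<theta> u = (\<Sum>l\<in>A. a l * \<theta> (s l))"
  using sep_lincomb[OF assms(1-5)] fnl_lincomb[OF assms(6,3,4)] by simp

lemma maximal_indep:
  assumes T: "finite T" "T \<subseteq> carrier M"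
  shows "\<exists>B\<subseteq>T. lin_indpt B \<and> T \<subseteq> span B"
proof -
  define P where "P B \<longleftrightarrow> B \<subseteq> T \<and> lin_indpt B" for B
  have P0: "P {}" by (simp add: P_def lin_dep_def)
  have fin: "finite (card ` {B. P B})"
    by (rule finite_imageI, rule finite_subset[of _ "Pow T"]) (use T in \<open>auto simp: P_def\<close>)
  have "Max (card ` {B. P B}) \<in> card ` {B. P B}" using P0 by (intro Max_in fin) blast
  then obtain B where B1: "P B" "card B = Max (card ` {B. P B})" by auto
  have B: "P B" "\<And>B'. P B' \<Longrightarrow> card B' \<le> card B" using B1 Max_ge[OF fin] by auto
  have fB: "finite B" "B \<subseteq> carrier M" using B(1) T by (auto simp: P_def finite_subset)
  have "t \<in> span B" if t: "t \<in> T" for t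
  proof (cases "t \<in> B")
    case True
    then show ?thesis using in_own_span[OF fB(2)] by auto
  next
    case False
    then have "\<not> P (insert t B)" using B(2)[of "insert t B"] fB by auto
    then have "lin_dep (B \<union> {t})" using t B(1) by (auto simp: P_def)
    then show ?thesis using lin_dep_iff_in_span[of B t] B(1) False t T fB by (auto simp: P_def)
  qed
  then show ?thesis using B(1) by (auto simp: P_def)
qed

end

text \<open>The family \<open>s\<close> may be linearly dependent, whereas rationality asks for a
  basis. A maximal independent subset \<open>B\<close> of its values has the same span, and
  substituting the expansions \<open>L\<close> of the family in \<open>B\<close> keeps the
  coefficients regular.\<close>

lemma rational_gmodI:
  fixes M :: "('k::field, 'v) gmod" (structure)
  assumes "kvs M" and \<Phi>: "sep M \<Phi>"
    and cl: "\<And>g v. g \<in> carrier SL2 \<Longrightarrow> v \<in> carrier M \<Longrightarrow> act M g v \<in> carrier M"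
    and "\<And>g u v. g \<in> carrier SL2 \<Longrightarrow> u \<in> carrier M \<Longrightarrow> v \<in> carrier M \<Longrightarrow> act M g (u \<oplus> v) = act M g u \<oplus> act M g v"
    and "\<And>g c v. g \<in> carrier SL2 \<Longrightarrow> v \<in> carrier M \<Longrightarrow> act M g (c \<odot> v) = c \<odot> act M g v"
    and "\<And>v. v \<in> carrier M \<Longrightarrow> act M (m2 1 0 0 1) v = v"
    and "\<And>g h v. g \<in> carrier SL2 \<Longrightarrow> h \<in> carrier SL2 \<Longrightarrow> v \<in> carrier M \<Longrightarrow> act M (g * h) v = act M g (act M h v)"
    and fam: "\<And>v. v \<in> carrier M \<Longrightarrow> \<exists>(A :: 'i set) s a c. finite A \<and> s ` A \<subseteq> carrier M \<and>
      (\<forall>i\<in>A. \<forall>l\<in>A. restrict (a l i) (carrier SL2) \<in> coord_ring) \<and>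
      (\<forall>g\<in>carrier SL2. \<forall>i\<in>A. \<forall>\<phi>\<in>\<Phi>. \<phi> (act M g (s i)) = (\<Sum>l\<in>A. a l i g * \<phi> (s l))) \<and>
      (\<forall>\<phi>\<in>\<Phi>. \<phi> v = (\<Sum>l\<in>A. c l * \<phi> (s l)))"
  shows "rational_gmod M"
proof (rule rational_gmod.intro)
  interpret kvs M by fact
  show "vectorspace class_ring M" by (rule vs)
  show "act M g \<in> module_hom class_ring M M" if "g \<in> carrier SL2" for g
    using assms(3-5) that by (auto simp: LinearCombinations.module_hom_def)
  show "act M \<one>\<^bsub>SL2\<^esub> v = v" if "v \<in> carrier M" for v using assms(6) that by simp
  show "act M (g \<otimes>\<^bsub>SL2\<^esub> h) v = act M g (act M h v)"
    if "g \<in> carrier SL2" "h \<in> carrier SL2" "v \<in> carrier M" for g h v using assms(7) that by simp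
  fix v assume v: "v \<in> carrier M"
  obtain A :: "'i set" and s a c where A: "finite A" and sA: "s ` A \<subseteq> carrier M"
    and a_ball: "\<forall>i\<in>A. \<forall>l\<in>A. restrict (a l i) (carrier SL2) \<in> coord_ring"
    and as_ball: "\<forall>g\<in>carrier SL2. \<forall>i\<in>A. \<forall>\<phi>\<in>\<Phi>. \<phi> (act M g (s i)) = (\<Sum>l\<in>A. a l i g * \<phi> (s l))"
    and vs_ball: "\<forall>\<phi>\<in>\<Phi>. \<phi> v = (\<Sum>l\<in>A. c l * \<phi> (s l))"
    using fam[OF v] by (elim exE conjE) (rule that)
  note a = a_ball[rule_format] and as = as_ball[rule_format] and vs' = vs_ball[rule_format]
  obtain B where B: "B \<subseteq> s ` A" "lin_indpt B" "s ` A \<subseteq> span B" using maximal_indep[of "s ` A"] A sA by auto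
  have fB: "finite B" "B \<subseteq> carrier M" using B(1) A sA by (auto intro: finite_subset)
  have spB: "x \<in> span B \<longleftrightarrow> (\<exists>q. x = lincomb q B)" for x using finite_span[OF fB] by auto
  have "\<forall>l. \<exists>q. l \<in> A \<longrightarrow> s l = lincomb q B" using B(3) spB by blast
  then obtain L where L: "\<And>l. l \<in> A \<Longrightarrow> s l = lincomb (L l) B" by metis
  have lc: "\<phi> (lincomb h B) = (\<Sum>b\<in>B. h b * \<phi> b)" if "\<phi> \<in> fnl M" for h \<phi>
    unfolding lincomb_def using that fB by (subst fnl_finsum) (auto simp: fnl_smult intro!: sum.cong)
  have \<Phi>f: "\<phi> \<in> fnl M" if "\<phi> \<in> \<Phi>" for \<phi> using that \<Phi> by (auto simp: sep_def)
  have eqI: "u = lincomb h B" if "u \<in> carrier M" "\<And>\<phi>. \<phi> \<in> \<Phi> \<Longrightarrow> \<phi> u = (\<Sum>b\<in>B. h b * \<phi> b)" for u h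
    unfolding lincomb_def by (rule sep_lincomb[OF \<Phi>]) (use that fB in auto)
  have resum: "(\<Sum>l\<in>A. x l * \<phi> (s l)) = (\<Sum>b\<in>B. (\<Sum>l\<in>A. L l b * x l) * \<phi> b)" if "\<phi> \<in> \<Phi>" for \<phi> x
  proof -
    have "(\<Sum>l\<in>A. x l * \<phi> (s l)) = (\<Sum>l\<in>A. \<Sum>b\<in>B. L l b * x l * \<phi> b)"
      by (intro sum.cong refl) (simp add: L lc[OF \<Phi>f[OF that]] sum_distrib_left mult_ac)
    also have "\<dots> = (\<Sum>b\<in>B. \<Sum>l\<in>A. L l b * x l * \<phi> b)" by (rule sum.swap)
    finally show ?thesis by (simp add: sum_distrib_right)
  qed
  have "\<forall>b. \<exists>i. b \<in> B \<longrightarrow> i \<in> A \<and> s i = b" using B(1) by blast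
  then obtain i where i: "\<And>b. b \<in> B \<Longrightarrow> i b \<in> A" "\<And>b. b \<in> B \<Longrightarrow> s (i b) = b" by metis
  define a' where "a' c b = (\<lambda>g\<in>carrier SL2. \<Sum>l\<in>A. L l c * a l (i b) g)" for c b
  have "v = lincomb (\<lambda>b. \<Sum>l\<in>A. L l b * c l) B" by (rule eqI[OF v]) (simp only: vs' resum)
  then have "v \<in> span B" unfolding spB by blast
  moreover have "a' c b \<in> coord_ring" if "b \<in> B" for c b
    unfolding a'_def using a i(1)[OF that] by (intro coord_ring_sum coord_ring_mult coord_ring_const) auto
  moreover have "act M g b = lincomb (\<lambda>c. a' c b g) B" if g: "g \<in> carrier SL2" and b: "b \<in> B" for g b
  proof (rule eqI)
    show "act M g b \<in> carrier M" using cl[OF g] b fB by auto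
    fix \<phi> assume \<phi>: "\<phi> \<in> \<Phi>"
    have "\<phi> (act M g b) = (\<Sum>l\<in>A. a l (i b) g * \<phi> (s l))" using as[OF g i(1)[OF b] \<phi>] i(2)[OF b] by simp
    then show "\<phi> (act M g b) = (\<Sum>c\<in>B. a' c b g * \<phi> c)" using resum[OF \<phi>, of "\<lambda>l. a l (i b) g"] g by (simp add: a'_def)
  qed
  ultimately show "\<exists>B a. finite B \<and> B \<subseteq> carrier M \<and> lin_indpt B \<and> v \<in> span B \<and>
        (\<forall>b\<in>B. \<forall>c\<in>B. a c b \<in> coord_ring) \<and>
        (\<forall>g\<in>carrier SL2. \<forall>b\<in>B. act M g b = lincomb (\<lambda>c. a c b g) B)"
    using fB B(2) by blast
qed

text \<open>A comodule condition: the coproduct of \<open>s\<close> lies in the span of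
  \<open>S\<close> tensored with the coordinate ring.\<close>

definition rtrans :: "('k::field mat \<Rightarrow> 'k) set \<Rightarrow> ('k mat \<Rightarrow> 'k) \<Rightarrow> bool" where
  "rtrans S s \<longleftrightarrow> (\<exists>a. (\<forall>c\<in>S. restrict (a c) (carrier SL2) \<in> coord_ring) \<and>
     (\<forall>x\<in>carrier SL2. \<forall>g\<in>carrier SL2. s (x * g) = (\<Sum>c\<in>S. a c g * c x)))"

text \<open>Members of the family \<open>t\<close> may coincide, so the coefficients of equal
  functions are collected.\<close>

lemma rtransI:
  fixes s :: "'k::field mat \<Rightarrow> 'k"
  assumes "finite J" "finite S" "\<And>i. i \<in> J \<Longrightarrow> t i \<in> S" "\<And>i. i \<in> J \<Longrightarrow> restrict (a i) (carrier SL2) \<in> coord_ring"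
    and "\<And>x g. x \<in> carrier SL2 \<Longrightarrow> g \<in> carrier SL2 \<Longrightarrow> s (x * g) = (\<Sum>i\<in>J. a i g * t i x)"
  shows "rtrans S s"
  unfolding rtrans_def
proof (intro exI conjI ballI)
  let ?a = "\<lambda>c g. \<Sum>i\<in>{i \<in> J. t i = c}. a i g"
  show "restrict (?a c) (carrier SL2) \<in> coord_ring" for c using assms(4) by (intro coord_ring_sum) auto
  fix x g :: "'k mat" assume x: "x \<in> carrier SL2" and g: "g \<in> carrier SL2"
  have "s (x * g) = (\<Sum>c\<in>S. \<Sum>i\<in>{i \<in> J. t i = c}. a i g * t i x)"
    unfolding assms(5)[OF x g] using assms(1-3) by (intro sum.group[symmetric]) auto
  also have "\<dots> = (\<Sum>c\<in>S. ?a c g * c x)" by (intro sum.cong refl) (simp add: sum_distrib_right)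
  finally show "s (x * g) = (\<Sum>c\<in>S. ?a c g * c x)" .
qed

lemma rtrans_mono:
  assumes "rtrans S s" "S \<subseteq> S'" "finite S'"
  shows "rtrans S' s"
proof -
  obtain a where "\<forall>c\<in>S. restrict (a c) (carrier SL2) \<in> coord_ring"
     "\<forall>x\<in>carrier SL2. \<forall>g\<in>carrier SL2. s (x * g) = (\<Sum>c\<in>S. a c g * c x)" using assms(1) by (auto simp: rtrans_def)
  then show ?thesis using assms(2,3) finite_subset by (intro rtransI[of S S' "\<lambda>c. c" a]) auto
qed

text \<open>Matrix entries translate within one row. Finite sets that work for two functions yield
  one for their sum by union and one for their product by pairwise products.\<close>

lemma coord_ring_locally_finite:
  fixes f :: "'k::field mat \<Rightarrow> 'k"
  assumes "f \<in> coord_ring"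
  shows "\<exists>S. finite S \<and> f \<in> S \<and> S \<subseteq> coord_ring \<and> (\<forall>s\<in>S. rtrans S s)"
  using assms
proof induction
  case (const c)
  define F :: "'k mat \<Rightarrow> 'k" where "F = (\<lambda>g\<in>carrier SL2. c)"
  have "rtrans {F} F"
    by (rule rtransI[of "{()}" _ "\<lambda>_. F" "\<lambda>_ _. 1"]) (auto simp: F_def intro: coord_ring_const)
  then show ?case using coord_ring_const[of c] unfolding F_def[symmetric] by (intro exI[of _ "{F}"]) simp
next
  case (entry i j)
  define E :: "nat \<Rightarrow> 'k mat \<Rightarrow> 'k" where "E j = restrict (\<lambda>g. g $$ (i, j)) (carrier SL2)" for j
  have E: "E j \<in> coord_ring" if "j < 2" for j unfolding E_def by (rule coord_ring.entry) (use entry that in auto)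
  have "rtrans (E ` {..<2}) (E j)" if "j < 2" for j
  proof (rule rtransI[of "{..<2}" _ E "\<lambda>l g. g $$ (l, j)"])
    fix l :: nat assume "l \<in> {..<2}"
    then show "restrict (\<lambda>g. g $$ (l, j)) (carrier SL2) \<in> coord_ring" using that by (intro coord_ring.entry) auto
  next
    fix x g :: "'k mat" assume x: "x \<in> carrier SL2" and g: "g \<in> carrier SL2"
    have "E j (x * g) = (x * g) $$ (i, j)" using x g by (simp add: E_def)
    also have "\<dots> = x $$ (i, 0) * g $$ (0, j) + x $$ (i, 1) * g $$ (1, j)"
      using entry(1) that x g by (intro mult_entry2 SL2_carrier_mat)
    also have "\<dots> = (\<Sum>l<2. g $$ (l, j) * E l x)" using x by (simp add: E_def numeral_2_eq_2 mult.commute)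
    finally show "E j (x * g) = (\<Sum>l<2. g $$ (l, j) * E l x)" .
  qed auto
  then show ?case using E entry unfolding E_def[symmetric] by (intro exI[of _ "E ` {..<2}"]) auto
next
  case (add f h)
  then obtain S S' where S: "finite S" "f \<in> S" "S \<subseteq> coord_ring" "\<forall>s\<in>S. rtrans S s"
    and S': "finite S'" "h \<in> S'" "S' \<subseteq> coord_ring" "\<forall>s\<in>S'. rtrans S' s" by blast
  define F :: "'k mat \<Rightarrow> 'k" where "F = (\<lambda>g\<in>carrier SL2. f g + h g)"
  let ?S = "insert F (S \<union> S')"
  obtain a where a: "\<forall>c\<in>S. restrict (a c) (carrier SL2) \<in> coord_ring"
     "\<forall>x\<in>carrier SL2. \<forall>g\<in>carrier SL2. f (x * g) = (\<Sum>c\<in>S. a c g * c x)" using S by (auto simp: rtrans_def)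
  obtain b where b: "\<forall>c\<in>S'. restrict (b c) (carrier SL2) \<in> coord_ring"
     "\<forall>x\<in>carrier SL2. \<forall>g\<in>carrier SL2. h (x * g) = (\<Sum>c\<in>S'. b c g * c x)" using S' by (auto simp: rtrans_def)
  \<comment> \<open>The index set is a disjoint union because \<open>S\<close> and \<open>S'\<close>
    may share functions.\<close>
  have "rtrans ?S F"
    by (rule rtransI[of "S <+> S'" _ "case_sum id id" "case_sum a b"])
      (use S S' a b in \<open>auto simp: sum.Plus F_def\<close>)
  moreover have "rtrans ?S s" if "s \<in> S \<union> S'" for s
    using that S S' rtrans_mono[of S s ?S] rtrans_mono[of S' s ?S] by auto
  moreover have "F \<in> coord_ring" unfolding F_def using add.hyps by (rule coord_ring.add)
  ultimately show ?case using S S' unfolding F_def[symmetric] by (intro exI[of _ ?S]) auto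
next
  case (mult f h)
  then obtain S S' where S: "finite S" "f \<in> S" "S \<subseteq> coord_ring" "\<forall>s\<in>S. rtrans S s"
    and S': "finite S'" "h \<in> S'" "S' \<subseteq> coord_ring" "\<forall>s\<in>S'. rtrans S' s" by blast
  define m :: "('k mat \<Rightarrow> 'k) \<times> ('k mat \<Rightarrow> 'k) \<Rightarrow> 'k mat \<Rightarrow> 'k"
    where "m = (\<lambda>(s, t). \<lambda>g\<in>carrier SL2. s g * t g)"
  have "rtrans (m ` (S \<times> S')) (m (s, t))" if s: "s \<in> S" and t: "t \<in> S'" for s t
  proof -
    obtain a where a: "\<forall>c\<in>S. restrict (a c) (carrier SL2) \<in> coord_ring"
       "\<forall>x\<in>carrier SL2. \<forall>g\<in>carrier SL2. s (x * g) = (\<Sum>c\<in>S. a c g * c x)" using S s unfolding rtrans_def by blast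
    obtain b where b: "\<forall>c\<in>S'. restrict (b c) (carrier SL2) \<in> coord_ring"
       "\<forall>x\<in>carrier SL2. \<forall>g\<in>carrier SL2. t (x * g) = (\<Sum>c\<in>S'. b c g * c x)" using S' t unfolding rtrans_def by blast
    show ?thesis
    proof (rule rtransI[of "S \<times> S'" _ m "\<lambda>(c, d) g. a c g * b d g"])
      fix x g :: "'k mat" assume x: "x \<in> carrier SL2" and g: "g \<in> carrier SL2"
      have "m (s, t) (x * g) = (\<Sum>c\<in>S. a c g * c x) * (\<Sum>d\<in>S'. b d g * d x)"
        using a b x g by (simp add: m_def)
      also have "\<dots> = (\<Sum>(c, d)\<in>S \<times> S'. (a c g * c x) * (b d g * d x))"
        by (simp add: sum_product sum.cartesian_product)
      also have "\<dots> = (\<Sum>i\<in>S \<times> S'. (case i of (c, d) \<Rightarrow> \<lambda>g. a c g * b d g) g * m i x)"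
        by (intro sum.cong refl) (auto simp: m_def x)
      finally show "m (s, t) (x * g) = (\<Sum>i\<in>S \<times> S'. (case i of (c, d) \<Rightarrow> \<lambda>g. a c g * b d g) g * m i x)" .
    qed (use S S' a b in \<open>auto intro: coord_ring_mult\<close>)
  qed
  moreover have "m ` (S \<times> S') \<subseteq> coord_ring" using S S' by (auto simp: m_def intro!: coord_ring.mult)
  moreover have "(\<lambda>g\<in>carrier SL2. f g * h g) = m (f, h)" by (simp add: m_def)
  ultimately show ?case using S S' by (intro exI[of _ "m ` (S \<times> S')"]) auto
qed

section \<open>Regular functions with values in a rational module\<close>

text \<open>Names for regular functions and, at the same time, for finite lists of pairs of a
  regular function and a vector. With both in one datatype, a single injection into the type of
  vectors suffices.\<close>

datatype ('k, 'u) rterm = RCon 'k | REnt nat nat | RAdd "('k, 'u) rterm" "('k, 'u) rterm"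
  | RMul "('k, 'u) rterm" "('k, 'u) rterm" | RVec "('k, 'u) rterm" 'u "('k, 'u) rterm" | RNil

text \<open>The values at \<open>RVec\<close> and \<open>RNil\<close> are dummies; these
  constructors only build lists.\<close>

primrec reval :: "('k::field, 'u) rterm \<Rightarrow> 'k mat \<Rightarrow> 'k" where
  "reval (RCon c) = (\<lambda>g\<in>carrier SL2. c)"
| "reval (REnt i j) = (\<lambda>g\<in>carrier SL2. g $$ (i, j))"
| "reval (RAdd s t) = (\<lambda>g\<in>carrier SL2. reval s g + reval t g)"
| "reval (RMul s t) = (\<lambda>g\<in>carrier SL2. reval s g * reval t g)"
| "reval (RVec s v t) = (\<lambda>g\<in>carrier SL2. 0)"
| "reval RNil = (\<lambda>g\<in>carrier SL2. 0)"

lemma coord_ring_reval: "f \<in> coord_ring \<Longrightarrow> \<exists>t :: ('k::field, 'u) rterm. reval t = f"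
proof (induction rule: coord_ring.induct)
  case (const c)
  show ?case by (rule exI[of _ "RCon c"]) simp
next
  case (entry i j)
  show ?case by (rule exI[of _ "REnt i j"]) simp
next
  case (add f h)
  then obtain s t :: "('k, 'u) rterm" where "reval s = f" "reval t = h" by blast
  then show ?case by (intro exI[of _ "RAdd s t"]) simp
next
  case (mult f h)
  then obtain s t :: "('k, 'u) rterm" where "reval s = f" "reval t = h" by blast
  then show ?case by (intro exI[of _ "RMul s t"]) simp
qed

primrec rlist :: "(('k, 'u) rterm \<times> 'u) list \<Rightarrow> ('k, 'u) rterm" where
  "rlist [] = RNil"
| "rlist (x # xs) = RVec (fst x) (snd x) (rlist xs)"

lemma rlist_inj: "rlist xs = rlist ys \<Longrightarrow> xs = ys"
proof (induction xs arbitrary: ys)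
  case Nil
  then show ?case by (cases ys) auto
next
  case (Cons x xs)
  then show ?case by (cases ys) (auto intro: prod_eqI)
qed

text \<open>An infinite type is equipotent with its square, so terms can be coded recursively as
  nested pairs headed by a tag.\<close>

lemma rterm_embeds:
  fixes \<iota> :: "'k \<Rightarrow> 'u"
  assumes \<iota>: "inj \<iota>" and inf: "infinite (UNIV :: 'k set)"
  shows "\<exists>enc :: ('k, 'u) rterm \<Rightarrow> 'u. inj enc"
proof -
  have infu: "infinite (UNIV :: 'u set)" using finite_imageD[OF _ \<iota>] inf finite_subset[of "range \<iota>" UNIV] by auto
  obtain pair :: "'u \<times> 'u \<Rightarrow> 'u" where "bij_betw pair (UNIV \<times> UNIV) UNIV"
    using card_of_ordIso[THEN iffD2, OF card_of_Times_same_infinite[OF infu]] by blast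
  then have "inj pair" by (simp only: bij_betw_def UNIV_Times_UNIV)
  then have pair: "pair x = pair y \<longleftrightarrow> x = y" for x y by (rule inj_eq)
  obtain nu :: "nat \<Rightarrow> 'u" where "inj nu" using infinite_countable_subset[OF infu] by auto
  then have nu: "nu m = nu n \<longleftrightarrow> m = n" for m n by (rule inj_eq)
  define enc where "enc = rec_rterm (\<lambda>c. pair (nu 0, \<iota> c)) (\<lambda>i j. pair (nu 1, pair (nu i, nu j)))
    (\<lambda>_ _ a b. pair (nu 2, pair (a, b))) (\<lambda>_ _ a b. pair (nu 3, pair (a, b)))
    (\<lambda>_ v _ a b. pair (nu 4, pair (a, pair (v, b)))) (pair (nu 5, nu 0))"
  have enc: "enc (RCon c) = pair (nu 0, \<iota> c)" "enc (REnt i j) = pair (nu 1, pair (nu i, nu j))"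
    "enc (RAdd s t) = pair (nu 2, pair (enc s, enc t))" "enc (RMul s t) = pair (nu 3, pair (enc s, enc t))"
    "enc (RVec s v t) = pair (nu 4, pair (enc s, pair (v, enc t)))" "enc RNil = pair (nu 5, nu 0)" for c i j s t v
    by (simp_all add: enc_def)
  have "s = t" if "enc s = enc t" for s t
    using that
  proof (induction s arbitrary: t)
    case (RCon c)
    then show ?case using \<iota> by (cases t) (auto simp: enc pair nu dest: injD)
  next
    case (REnt i j)
    then show ?case by (cases t) (auto simp: enc pair nu)
  next
    case (RAdd s1 s2)
    then show ?case by (cases t) (auto simp: enc pair nu)
  next
    case (RMul s1 s2)
    then show ?case by (cases t) (auto simp: enc pair nu)
  next
    case (RVec s1 v s2)
    then show ?case by (cases t) (auto simp: enc pair nu)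
  next
    case RNil
    then show ?case by (cases t) (auto simp: enc pair nu)
  qed
  then show ?thesis by (intro exI[of _ enc]) (auto simp: inj_def)
qed

section \<open>Regular functions with values in the module\<close>

context rat
begin

text \<open>The list represents an element of the coordinate ring tensored with the module, seen as
  a function on the group.\<close>

definition rrep :: "('k mat \<Rightarrow> 'v) \<Rightarrow> (('k mat \<Rightarrow> 'k) \<times> 'v) list \<Rightarrow> bool" where
  "rrep F xs \<longleftrightarrow> F \<in> extensional (carrier SL2) \<and> set xs \<subseteq> coord_ring \<times> carrier M \<and>
     (\<forall>g\<in>carrier SL2. F g \<in> carrier M \<and> (\<forall>\<phi>\<in>fnl M. \<phi> (F g) = (\<Sum>(f, v)\<leftarrow>xs. f g * \<phi> v)))"

definition regf :: "('k mat \<Rightarrow> 'v) set" where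
  "regf = {F. \<exists>xs. rrep F xs}"

lemma rrep_unique: "rrep F xs \<Longrightarrow> rrep G xs \<Longrightarrow> F = G"
proof
  fix g assume *: "rrep F xs" "rrep G xs"
  show "F g = G g"
  proof (cases "g \<in> carrier SL2")
    case True
    show ?thesis
    proof (rule fnl_eqI)
      fix \<phi> assume "\<phi> \<in> fnl M"
      then have "\<phi> (F g) = (\<Sum>(f, v)\<leftarrow>xs. f g * \<phi> v)" "\<phi> (G g) = (\<Sum>(f, v)\<leftarrow>xs. f g * \<phi> v)"
        using * True by (simp_all add: rrep_def)
      then show "\<phi> (F g) = \<phi> (G g)" by simp
    qed (use * True in \<open>simp_all add: rrep_def\<close>)
  qed (use * in \<open>auto simp: rrep_def extensional_def\<close>)
qed

text \<open>The multiples of a nonzero vector embed the field into the type of vectors, which allows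
  terms to be coded there. A function is coded by the list of one chosen representation.\<close>

lemma regf_embeds:
  assumes v: "v \<in> carrier M" "v \<noteq> \<zero>"
  shows "\<exists>\<theta> :: ('k mat \<Rightarrow> 'v) \<Rightarrow> 'v. inj_on \<theta> regf"
proof -
  have "inj (\<lambda>c. c \<odot> v)"
  proof (rule injI)
    fix a b assume eq: "a \<odot> v = b \<odot> v"
    obtain \<phi> where \<phi>: "\<phi> \<in> fnl M" "\<phi> v \<noteq> 0" using fnl_separates_0[OF v] by blast
    then have "a * \<phi> v = b * \<phi> v" using arg_cong[OF eq, of \<phi>] v by (simp add: fnl_smult)
    then show "a = b" using \<phi> by simp
  qed
  then obtain enc :: "('k, 'v) rterm \<Rightarrow> 'v" where enc: "inj enc"
    using rterm_embeds infinite_alg_closed by blast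
  define tm :: "('k mat \<Rightarrow> 'k) \<Rightarrow> ('k, 'v) rterm" where "tm f = (SOME t. reval t = f)" for f
  have tm: "reval (tm f) = f" if "f \<in> coord_ring" for f
    unfolding tm_def using coord_ring_reval[OF that] by (rule someI_ex)
  define xsf where "xsf F = (SOME xs. rrep F xs)" for F
  have xsf: "rrep F (xsf F)" if "F \<in> regf" for F
    unfolding xsf_def using that unfolding regf_def mem_Collect_eq by (rule someI_ex)
  define \<theta> where "\<theta> F = enc (rlist (map (\<lambda>(f, v). (tm f, v)) (xsf F)))" for F
  have "inj_on \<theta> regf"
  proof (rule inj_onI)
    fix F G assume F: "F \<in> regf" and G: "G \<in> regf" and eq: "\<theta> F = \<theta> G"
    have "map (\<lambda>(f, v). (tm f, v)) (xsf F) = map (\<lambda>(f, v). (tm f, v)) (xsf G)"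
      using rlist_inj injD[OF enc] eq by (auto simp: \<theta>_def)
    then have "map (\<lambda>(t, v). (reval t, v)) (map (\<lambda>(f, v). (tm f, v)) (xsf F))
      = map (\<lambda>(t, v). (reval t, v)) (map (\<lambda>(f, v). (tm f, v)) (xsf G))" by simp
    moreover have "map (\<lambda>(t, v). (reval t, v)) (map (\<lambda>(f, v). (tm f, v)) xs) = xs"
      if "set xs \<subseteq> coord_ring \<times> carrier M" for xs
      using that by (induction xs) (auto simp: tm)
    ultimately have "xsf F = xsf G" using xsf[OF F] xsf[OF G] by (simp add: rrep_def)
    then show "F = G" using xsf[OF F] xsf[OF G] rrep_unique[of F "xsf F" G] by simp
  qed
  then show ?thesis by blast
qed

lemma regf_cl: "F \<in> regf \<Longrightarrow> g \<in> carrier SL2 \<Longrightarrow> F g \<in> carrier M"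
  by (auto simp: regf_def rrep_def)

lemma regf_ext: "F \<in> regf \<Longrightarrow> F \<in> extensional (carrier SL2)"
  by (auto simp: regf_def rrep_def)

lemma regf_eqI: "F \<in> regf \<Longrightarrow> G \<in> regf \<Longrightarrow> (\<And>g. g \<in> carrier SL2 \<Longrightarrow> F g = G g) \<Longrightarrow> F = G"
  using regf_ext by (intro extensionalityI[of F "carrier SL2" G]) auto

lemma regfI:
  assumes "finite A" "\<And>a. a \<in> A \<Longrightarrow> restrict (f a) (carrier SL2) \<in> coord_ring" "\<And>a. a \<in> A \<Longrightarrow> v a \<in> carrier M"
    and "\<And>g. g \<in> carrier SL2 \<Longrightarrow> F g \<in> carrier M"
    and "\<And>g \<phi>. g \<in> carrier SL2 \<Longrightarrow> \<phi> \<in> fnl M \<Longrightarrow> \<phi> (F g) = (\<Sum>a\<in>A. f a g * \<phi> (v a))"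
  shows "restrict F (carrier SL2) \<in> regf"
proof -
  obtain as where as: "distinct as" "set as = A" using finite_distinct_list[OF assms(1)] by blast
  define xs where "xs = map (\<lambda>a. (restrict (f a) (carrier SL2), v a)) as"
  have "(\<Sum>a\<in>A. f a g * \<phi> (v a)) = (\<Sum>(f, v)\<leftarrow>xs. f g * \<phi> v)" if "g \<in> carrier SL2" for g \<phi>
    using that as by (simp add: xs_def o_def sum_list_distinct_conv_sum_set)
  then have "rrep (restrict F (carrier SL2)) xs"
    using assms as by (auto simp: rrep_def xs_def)
  then show ?thesis by (auto simp: regf_def)
qed

lemma regfE:
  assumes "F \<in> regf"
  obtains n f v where "\<And>i. i < (n::nat) \<Longrightarrow> f i \<in> coord_ring" "\<And>i. i < n \<Longrightarrow> v i \<in> carrier M"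
    "\<And>g \<phi>. g \<in> carrier SL2 \<Longrightarrow> \<phi> \<in> fnl M \<Longrightarrow> \<phi> (F g) = (\<Sum>i<n. f i g * \<phi> (v i))"
proof -
  obtain xs where xs: "rrep F xs" using assms by (auto simp: regf_def)
  have mem: "fst (xs ! i) \<in> coord_ring" "snd (xs ! i) \<in> carrier M" if "i < length xs" for i
    using xs nth_mem[OF that] by (auto simp: rrep_def)
  have "\<phi> (F g) = (\<Sum>i<length xs. fst (xs ! i) g * \<phi> (snd (xs ! i)))" if "g \<in> carrier SL2" "\<phi> \<in> fnl M" for g \<phi>
  proof -
    have "\<phi> (F g) = (\<Sum>(f, v)\<leftarrow>xs. f g * \<phi> v)" using xs that by (simp add: rrep_def)
    also have "\<dots> = (\<Sum>i<length xs. (\<lambda>(f, v). f g * \<phi> v) (xs ! i))"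
      by (simp add: sum_list_sum_nth lessThan_atLeast0)
    finally show ?thesis by (simp add: case_prod_unfold)
  qed
  then show ?thesis using mem by (intro that[of "length xs" "\<lambda>i. fst (xs ! i)" "\<lambda>i. snd (xs ! i)"])
qed

lemma regf_add:
  assumes "F \<in> regf" "G \<in> regf"
  shows "(\<lambda>g\<in>carrier SL2. F g \<oplus> G g) \<in> regf"
proof -
  obtain n f v where F: "\<And>i. i < (n::nat) \<Longrightarrow> f i \<in> coord_ring" "\<And>i. i < n \<Longrightarrow> v i \<in> carrier M"
    "\<And>g \<phi>. g \<in> carrier SL2 \<Longrightarrow> \<phi> \<in> fnl M \<Longrightarrow> \<phi> (F g) = (\<Sum>i<n. f i g * \<phi> (v i))" using assms(1) by (rule regfE) (rule that)
  obtain m h w where G: "\<And>i. i < (m::nat) \<Longrightarrow> h i \<in> coord_ring" "\<And>i. i < m \<Longrightarrow> w i \<in> carrier M"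
    "\<And>g \<phi>. g \<in> carrier SL2 \<Longrightarrow> \<phi> \<in> fnl M \<Longrightarrow> \<phi> (G g) = (\<Sum>i<m. h i g * \<phi> (w i))" using assms(2) by (rule regfE) (rule that)
  show ?thesis
    by (rule regfI[of "{..<n} <+> {..<m}" "case_sum f h" "case_sum v w"])
      (use F G assms in \<open>auto simp: sum.Plus fnl_add regf_cl coord_ring_restrict\<close>)
qed

lemma regf_smult:
  assumes "F \<in> regf"
  shows "(\<lambda>g\<in>carrier SL2. c \<odot> F g) \<in> regf"
proof -
  obtain n f v where F: "\<And>i. i < (n::nat) \<Longrightarrow> f i \<in> coord_ring" "\<And>i. i < n \<Longrightarrow> v i \<in> carrier M"
    "\<And>g \<phi>. g \<in> carrier SL2 \<Longrightarrow> \<phi> \<in> fnl M \<Longrightarrow> \<phi> (F g) = (\<Sum>i<n. f i g * \<phi> (v i))" using assms(1) by (rule regfE) (rule that)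
  show ?thesis
  proof (rule regfI[of "{..<n}" "\<lambda>i g. c * f i g" v])
    show "restrict (\<lambda>g. c * f i g) (carrier SL2) \<in> coord_ring" if "i \<in> {..<n}" for i
      using F(1) that by (intro coord_ring_mult coord_ring_const coord_ring_restrict) auto
    show "\<phi> (c \<odot> F g) = (\<Sum>i<n. c * f i g * \<phi> (v i))" if "g \<in> carrier SL2" "\<phi> \<in> fnl M" for g \<phi>
      using F(3)[OF that] that assms by (simp add: fnl_smult regf_cl sum_distrib_left mult.assoc)
  qed (use F assms in \<open>auto simp: regf_cl\<close>)
qed

lemma regf_zero: "(\<lambda>g\<in>carrier SL2. \<zero>) \<in> regf"
  by (rule regfI[of "{}"]) (auto simp: fnl_zero)

lemma regf_trans:
  assumes "F \<in> regf" "h \<in> carrier SL2"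
  shows "(\<lambda>g\<in>carrier SL2. F (g * h)) \<in> regf"
proof -
  obtain n f v where F: "\<And>i. i < (n::nat) \<Longrightarrow> f i \<in> coord_ring" "\<And>i. i < n \<Longrightarrow> v i \<in> carrier M"
    "\<And>g \<phi>. g \<in> carrier SL2 \<Longrightarrow> \<phi> \<in> fnl M \<Longrightarrow> \<phi> (F g) = (\<Sum>i<n. f i g * \<phi> (v i))" using assms(1) by (rule regfE) (rule that)
  have "restrict (\<lambda>g. f i (g * h)) (carrier SL2) \<in> coord_ring" if i: "i < n" for i
  proof -
    obtain S where S: "finite S" "f i \<in> S" "S \<subseteq> coord_ring" "\<forall>s\<in>S. rtrans S s"
      using coord_ring_locally_finite[OF F(1)[OF i]] by blast
    then obtain a where a: "\<forall>x\<in>carrier SL2. \<forall>g\<in>carrier SL2. f i (x * g) = (\<Sum>c\<in>S. a c g * c x)" unfolding rtrans_def by blast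
    have "restrict (\<lambda>x. \<Sum>c\<in>S. a c h * c x) (carrier SL2) \<in> coord_ring"
      using S by (intro coord_ring_sum coord_ring_mult coord_ring_const coord_ring_restrict) auto
    then show ?thesis by (rule coord_ring_cong) (use a assms in auto)
  qed
  then show ?thesis
    by (intro regfI[of "{..<n}" "\<lambda>i g. f i (g * h)" v]) (use F assms in \<open>auto simp: regf_cl\<close>)
qed

end

text \<open>Injectivity of \<open>M\<close> is only tested on modules in the type of its elements; hence the module of
  regular functions has to be transported along an injection \<open>\<theta>\<close>.\<close>

context rat
begin

lemma regf_tensor:
  assumes "restrict f (carrier SL2) \<in> coord_ring" "v \<in> carrier M"
  shows "(\<lambda>g\<in>carrier SL2. f g \<odot> v) \<in> regf"
  by (rule regfI[of "{()}" "\<lambda>_. f" "\<lambda>_. v"]) (use assms in \<open>auto simp: fnl_smult\<close>)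

context
  fixes \<theta> :: "('k mat \<Rightarrow> 'v) \<Rightarrow> 'v"
  assumes \<theta>: "inj_on \<theta> regf"
begin

definition rinv :: "'v \<Rightarrow> 'k mat \<Rightarrow> 'v" where
  "rinv x = the_inv_into regf \<theta> x"

definition regm :: "('k, 'v) gmod" where
  "regm = \<lparr>carrier = \<theta> ` regf, mult = undefined, one = undefined, zero = \<theta> (\<lambda>g\<in>carrier SL2. \<zero>),
     add = (\<lambda>x y. \<theta> (\<lambda>g\<in>carrier SL2. rinv x g \<oplus> rinv y g)),
     smult = (\<lambda>c x. \<theta> (\<lambda>g\<in>carrier SL2. c \<odot> rinv x g)),
     act = (\<lambda>h x. \<theta> (\<lambda>g\<in>carrier SL2. rinv x (g * h)))\<rparr>"

lemma rinv_\<theta>: "F \<in> regf \<Longrightarrow> rinv (\<theta> F) = F"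
  unfolding rinv_def by (rule the_inv_into_f_f[OF \<theta>])

lemma \<theta>_eq_iff: "F \<in> regf \<Longrightarrow> G \<in> regf \<Longrightarrow> \<theta> F = \<theta> G \<longleftrightarrow> F = G"
  using \<theta> by (auto simp: inj_on_def)

lemma regm_simps:
  "carrier regm = \<theta> ` regf"
  "\<zero>\<^bsub>regm\<^esub> = \<theta> (\<lambda>g\<in>carrier SL2. \<zero>)"
  "F \<in> regf \<Longrightarrow> G \<in> regf \<Longrightarrow> \<theta> F \<oplus>\<^bsub>regm\<^esub> \<theta> G = \<theta> (\<lambda>g\<in>carrier SL2. F g \<oplus> G g)"
  "F \<in> regf \<Longrightarrow> c \<odot>\<^bsub>regm\<^esub> \<theta> F = \<theta> (\<lambda>g\<in>carrier SL2. c \<odot> F g)"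
  "F \<in> regf \<Longrightarrow> act regm h (\<theta> F) = \<theta> (\<lambda>g\<in>carrier SL2. F (g * h))"
  by (simp_all add: regm_def rinv_\<theta>)

lemma kvs_regm: "kvs regm"
proof (rule kvsI)
  show "\<zero>\<^bsub>regm\<^esub> \<in> carrier regm" by (simp add: regm_simps regf_zero)
  fix u v w a b assume "u \<in> carrier regm" "v \<in> carrier regm" "w \<in> carrier regm"
  then obtain F G H where F: "F \<in> regf" and u: "u = \<theta> F" and G: "G \<in> regf" and v: "v = \<theta> G"
    and H: "H \<in> regf" and w: "w = \<theta> H" by (auto simp: regm_simps)
  note cl = F G H regf_add regf_smult regf_zero
  note c = regf_cl[OF F] regf_cl[OF G] regf_cl[OF H]
  show "u \<oplus>\<^bsub>regm\<^esub> v \<in> carrier regm" by (simp add: u v regm_simps cl)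
  show "a \<odot>\<^bsub>regm\<^esub> u \<in> carrier regm" by (simp add: u regm_simps cl)
  show "\<zero>\<^bsub>regm\<^esub> \<oplus>\<^bsub>regm\<^esub> u = u" "1 \<odot>\<^bsub>regm\<^esub> u = u"
    unfolding u by (simp_all add: regm_simps cl c extensional_restrict[OF regf_ext[OF F]] cong: restrict_cong)
  show "u \<oplus>\<^bsub>regm\<^esub> v = v \<oplus>\<^bsub>regm\<^esub> u" unfolding u v by (simp add: regm_simps cl c a_comm cong: restrict_cong)
  show "u \<oplus>\<^bsub>regm\<^esub> v \<oplus>\<^bsub>regm\<^esub> w = u \<oplus>\<^bsub>regm\<^esub> (v \<oplus>\<^bsub>regm\<^esub> w)"
    unfolding u v w by (simp add: regm_simps cl c a_assoc cong: restrict_cong)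
  show "u \<oplus>\<^bsub>regm\<^esub> (- 1) \<odot>\<^bsub>regm\<^esub> u = \<zero>\<^bsub>regm\<^esub>"
  proof -
    have "F g \<oplus> (- 1) \<odot> F g = \<zero>" if "g \<in> carrier SL2" for g
      using c(1)[OF that] by (simp add: smult_m1 r_neg)
    then show ?thesis unfolding u by (simp add: regm_simps cl cong: restrict_cong)
  qed
  show "(a + b) \<odot>\<^bsub>regm\<^esub> u = a \<odot>\<^bsub>regm\<^esub> u \<oplus>\<^bsub>regm\<^esub> b \<odot>\<^bsub>regm\<^esub> u"
    unfolding u by (simp add: regm_simps cl c smult_add_l cong: restrict_cong)
  show "a \<odot>\<^bsub>regm\<^esub> (u \<oplus>\<^bsub>regm\<^esub> v) = a \<odot>\<^bsub>regm\<^esub> u \<oplus>\<^bsub>regm\<^esub> a \<odot>\<^bsub>regm\<^esub> v"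
    unfolding u v by (simp add: regm_simps cl c smult_add_r cong: restrict_cong)
  show "(a * b) \<odot>\<^bsub>regm\<^esub> u = a \<odot>\<^bsub>regm\<^esub> (b \<odot>\<^bsub>regm\<^esub> u)"
    unfolding u by (simp add: regm_simps cl c smult_smult cong: restrict_cong)
qed

definition regphi :: "('v \<Rightarrow> 'k) set" where
  "regphi = {\<lambda>x. \<phi> (rinv x g) | \<phi> g. \<phi> \<in> fnl M \<and> g \<in> carrier SL2}"

lemma sep_regphi: "sep regm regphi"
  unfolding sep_def
proof (intro conjI ballI impI)
  show "regphi \<subseteq> fnl regm"
    by (auto simp: regphi_def fnl_def[of regm] regm_simps rinv_\<theta> regf_add regf_smult fnl_add fnl_smult regf_cl)
  fix u v assume "u \<in> carrier regm" "v \<in> carrier regm" and eq: "\<forall>\<phi>\<in>regphi. \<phi> u = \<phi> v"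
  then obtain F G where F: "F \<in> regf" "u = \<theta> F" and G: "G \<in> regf" "v = \<theta> G" by (auto simp: regm_simps)
  have "F g = G g" if g: "g \<in> carrier SL2" for g
  proof (rule fnl_eqI)
    fix \<phi> assume "\<phi> \<in> fnl M"
    then have "(\<lambda>x. \<phi> (rinv x g)) \<in> regphi" using g by (auto simp: regphi_def)
    then show "\<phi> (F g) = \<phi> (G g)" using eq F G by (auto simp: rinv_\<theta>)
  qed (use F G g in \<open>auto simp: regf_cl\<close>)
  then show "u = v" using regf_eqI F G by metis
qed

text \<open>Let \<open>F\<close> be the sum of the f i tensor w i. The required family consists of
  all s tensor w i, with s running through a finite translation-stable set that contains f
  i.\<close>

lemma rational_regm: "rational_gmod regm"
proof (rule rational_gmodI[OF kvs_regm sep_regphi])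
  fix g :: "'k mat" and u assume g: "g \<in> carrier SL2" and "u \<in> carrier regm"
  then obtain F where F: "F \<in> regf" "u = \<theta> F" by (auto simp: regm_simps)
  note cl = regf_add regf_smult regf_trans
  show "act regm g u \<in> carrier regm" using F g by (simp add: regm_simps cl)
  show "act regm g (u \<oplus>\<^bsub>regm\<^esub> v) = act regm g u \<oplus>\<^bsub>regm\<^esub> act regm g v" if "v \<in> carrier regm" for v
    using that F g by (auto simp: regm_simps cl cong: restrict_cong)
  show "act regm g (c \<odot>\<^bsub>regm\<^esub> u) = c \<odot>\<^bsub>regm\<^esub> act regm g u" for c
    using F g by (auto simp: regm_simps cl cong: restrict_cong)
  show "act regm (g * h) u = act regm g (act regm h u)" if "h \<in> carrier SL2" for h
    using F g that by (auto simp: regm_simps cl SL2_assoc cong: restrict_cong)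
next
  fix v assume "v \<in> carrier regm"
  then obtain F where F: "F \<in> regf" "v = \<theta> F" by (auto simp: regm_simps)
  have "(\<lambda>g\<in>carrier SL2. F (g * m2 1 0 0 1)) = F"
    using F by (intro regf_eqI regf_trans) auto
  then show "act regm (m2 1 0 0 1) v = v" using F by (simp add: regm_simps)
  obtain n f w where form: "\<And>i. i < (n::nat) \<Longrightarrow> f i \<in> coord_ring" "\<And>i. i < n \<Longrightarrow> w i \<in> carrier M"
    "\<And>g \<phi>. g \<in> carrier SL2 \<Longrightarrow> \<phi> \<in> fnl M \<Longrightarrow> \<phi> (F g) = (\<Sum>i<n. f i g * \<phi> (w i))" using F(1) by (rule regfE) (rule that)
  define S where "S i = (SOME S. finite S \<and> f i \<in> S \<and> S \<subseteq> coord_ring \<and> (\<forall>s\<in>S. rtrans S s))" for i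
  have "finite (S i) \<and> f i \<in> S i \<and> S i \<subseteq> coord_ring \<and> (\<forall>s\<in>S i. rtrans (S i) s)" if "i < n" for i
    unfolding S_def using coord_ring_locally_finite[OF form(1)[OF that]] by (rule someI_ex)
  then have S: "\<And>i. i < n \<Longrightarrow> finite (S i)" "\<And>i. i < n \<Longrightarrow> f i \<in> S i" "\<And>i. i < n \<Longrightarrow> S i \<subseteq> coord_ring"
    "\<And>i s. i < n \<Longrightarrow> s \<in> S i \<Longrightarrow> rtrans (S i) s" by auto
  define b where "b i s = (SOME a. (\<forall>c\<in>S i. restrict (a c) (carrier SL2) \<in> coord_ring) \<and>
     (\<forall>x\<in>carrier SL2. \<forall>g\<in>carrier SL2. s (x * g) = (\<Sum>c\<in>S i. a c g * c x)))" for i s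
  have "(\<forall>c\<in>S i. restrict (b i s c) (carrier SL2) \<in> coord_ring) \<and>
     (\<forall>x\<in>carrier SL2. \<forall>g\<in>carrier SL2. s (x * g) = (\<Sum>c\<in>S i. b i s c g * c x))" if "i < n" "s \<in> S i" for i s
    unfolding b_def using S(4)[OF that, unfolded rtrans_def] by (rule someI_ex)
  then have b: "\<And>i s c. i < n \<Longrightarrow> s \<in> S i \<Longrightarrow> c \<in> S i \<Longrightarrow> restrict (b i s c) (carrier SL2) \<in> coord_ring"
    "\<And>i s x g. i < n \<Longrightarrow> s \<in> S i \<Longrightarrow> x \<in> carrier SL2 \<Longrightarrow> g \<in> carrier SL2 \<Longrightarrow> s (x * g) = (\<Sum>c\<in>S i. b i s c g * c x)"
    by blast+
  \<comment> \<open>The index set consists of pairs because one function may be needed with several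
    vectors \<open>w i\<close>.\<close>
  define A where "A = Sigma {..<n} S"
  define t :: "nat \<times> ('k mat \<Rightarrow> 'k) \<Rightarrow> 'k mat \<Rightarrow> 'v" where "t = (\<lambda>(i, s). \<lambda>g\<in>carrier SL2. s g \<odot> w i)"
  define a :: "nat \<times> ('k mat \<Rightarrow> 'k) \<Rightarrow> nat \<times> ('k mat \<Rightarrow> 'k) \<Rightarrow> 'k mat \<Rightarrow> 'k" where "a = (\<lambda>(i', c) (i, s) g. if i' = i then b i s c g else 0)"
  define e :: "nat \<times> ('k mat \<Rightarrow> 'k) \<Rightarrow> 'k" where "e = (\<lambda>(i, s). if s = f i then 1 else (0::'k))"
  have finA: "finite A" using S(1) by (auto simp: A_def)
  have t: "t x \<in> regf" if "x \<in> A" for x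
    using that S(3) form(2) by (auto simp: A_def t_def intro!: regf_tensor coord_ring_restrict)
  have sumA: "(\<Sum>x\<in>A. h x) = (\<Sum>i<n. \<Sum>s\<in>S i. h (i, s))" for h :: "_ \<Rightarrow> 'k"
    unfolding A_def using S(1) by (subst sum.Sigma) auto
  have "\<phi> (act regm g (\<theta> (t x))) = (\<Sum>y\<in>A. a y x g * \<phi> (\<theta> (t y)))"
    if g: "g \<in> carrier SL2" and x: "x \<in> A" and \<phi>: "\<phi> \<in> regphi" for g x \<phi>
  proof -
    obtain \<psi> z where \<psi>: "\<psi> \<in> fnl M" and z: "z \<in> carrier SL2" and \<phi>': "\<phi> = (\<lambda>x. \<psi> (rinv x z))" using \<phi> by (auto simp: regphi_def)
    obtain i s where ix: "x = (i, s)" "i < n" "s \<in> S i" using x by (auto simp: A_def)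
    have tz: "\<phi> (\<theta> (t y)) = snd y z * \<psi> (w (fst y))" if "y \<in> A" for y
      using that t[OF that] z \<psi> form(2) by (auto simp: \<phi>' rinv_\<theta> t_def A_def fnl_smult)
    have "\<phi> (act regm g (\<theta> (t x))) = s (z * g) * \<psi> (w i)"
      using t[OF x] g z \<psi> ix form(2) by (simp add: \<phi>' regm_simps rinv_\<theta> regf_trans) (simp add: t_def fnl_smult)
    also have "\<dots> = (\<Sum>c\<in>S i. b i s c g * (c z * \<psi> (w i)))"
      using b(2)[OF ix(2,3) z g] by (simp add: sum_distrib_right mult.assoc)
    also have "\<dots> = (\<Sum>i'<n. if i' = i then (\<Sum>c\<in>S i. b i s c g * (c z * \<psi> (w i))) else 0)"
      using ix(2) by simp
    also have "\<dots> = (\<Sum>i'<n. \<Sum>c\<in>S i'. a (i', c) x g * \<phi> (\<theta> (t (i', c))))"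
      by (intro sum.cong refl) (auto simp: a_def ix tz A_def intro!: sum.cong)
    finally show ?thesis by (simp add: sumA)
  qed
  moreover have "\<phi> v = (\<Sum>x\<in>A. e x * \<phi> (\<theta> (t x)))" if \<phi>: "\<phi> \<in> regphi" for \<phi>
  proof -
    obtain \<psi> z where \<psi>: "\<psi> \<in> fnl M" and z: "z \<in> carrier SL2" and \<phi>': "\<phi> = (\<lambda>x. \<psi> (rinv x z))" using \<phi> by (auto simp: regphi_def)
    have tz: "\<phi> (\<theta> (t y)) = snd y z * \<psi> (w (fst y))" if "y \<in> A" for y
      using that t[OF that] z \<psi> form(2) by (auto simp: \<phi>' rinv_\<theta> t_def A_def fnl_smult)
    have "(\<Sum>x\<in>A. e x * \<phi> (\<theta> (t x))) = (\<Sum>i<n. \<Sum>s\<in>S i. if s = f i then s z * \<psi> (w i) else 0)"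
      unfolding sumA by (intro sum.cong refl) (auto simp: e_def tz A_def)
    also have "\<dots> = (\<Sum>i<n. f i z * \<psi> (w i))" using S(1,2) by (intro sum.cong refl) auto
    finally show ?thesis using form(3)[OF z \<psi>] F by (simp add: \<phi>' rinv_\<theta>)
  qed
  moreover have "restrict (a y x) (carrier SL2) \<in> coord_ring" if "x \<in> A" "y \<in> A" for x y
    using that b(1) coord_ring_const[of 0] by (cases "fst y = fst x") (auto simp: a_def A_def)
  moreover have "(\<lambda>x. \<theta> (t x)) ` A \<subseteq> carrier regm" using t by (auto simp only: regm_simps)
  ultimately show "\<exists>(A :: (nat \<times> ('k mat \<Rightarrow> 'k)) set) s a c. finite A \<and> s ` A \<subseteq> carrier regm \<and>
      (\<forall>i\<in>A. \<forall>l\<in>A. restrict (a l i) (carrier SL2) \<in> coord_ring) \<and>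
      (\<forall>g\<in>carrier SL2. \<forall>i\<in>A. \<forall>\<phi>\<in>regphi. \<phi> (act regm g (s i)) = (\<Sum>l\<in>A. a l i g * \<phi> (s l))) \<and>
      (\<forall>\<phi>\<in>regphi. \<phi> v = (\<Sum>l\<in>A. c l * \<phi> (s l)))"
    using finA by (intro exI[of _ A] exI[of _ "\<lambda>x. \<theta> (t x)"] exI[of _ a] exI[of _ e] conjI ballI) simp_all
qed

end

end

section \<open>Injective modules as direct summands\<close>

lemma coord_ring_entry: "i < 2 \<Longrightarrow> j < 2 \<Longrightarrow> restrict (\<lambda>g. g $$ (i, j)) (carrier SL2) \<in> coord_ring"
  by (rule coord_ring.entry)

text \<open>Density of the big cell: where the upper left entry is 0, the upper right one is not, so
  the curve y \<mapsto> g L(y) lies in the big cell for all y \<noteq> 0, and polynomials in y can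
  be compared.\<close>

lemma coord_ring_dense:
  fixes f f' :: "'k::alg_closed_field mat \<Rightarrow> 'k"
  assumes f: "restrict f (carrier SL2) \<in> coord_ring" and f': "restrict f' (carrier SL2) \<in> coord_ring"
    and eq: "\<And>g. g \<in> carrier SL2 \<Longrightarrow> g $$ (0, 0) \<noteq> 0 \<Longrightarrow> f g = f' g" and g: "g \<in> carrier SL2"
  shows "f g = f' g"
proof (cases "g $$ (0, 0) = 0")
  case True
  obtain a b c d where gm: "g = m2 a b c d" "a * d - b * c = 1" using g by (rule SL2_m2E)
  have b: "b \<noteq> 0" "a = 0" using gm True by auto
  have cl: "g * Lm y \<in> carrier SL2" for y using g by simp
  obtain q where q: "\<And>y. restrict f (carrier SL2) (g * Lm y) = poly q y"
    using coord_pcurve[OF f pcurve_mult_Lm[OF g]] by blast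
  obtain r where r: "\<And>y. restrict f' (carrier SL2) (g * Lm y) = poly r y"
    using coord_pcurve[OF f' pcurve_mult_Lm[OF g]] by blast
  have "q = r"
  proof (rule poly_eqI_inf)
    fix y :: 'k assume "y \<noteq> 0"
    then have "(g * Lm y) $$ (0, 0) \<noteq> 0" using b by (simp add: gm Lm_def m2_mult)
    then show "poly q y = poly r y" using eq[OF cl[of y]] cl[of y] q[of y] r[of y] by simp
  qed
  moreover have "g * Lm 0 = g" using g by (simp add: Lm_def)
  ultimately show ?thesis using q[of 0] r[of 0] g by simp
qed (use eq g in blast)

context rat
begin

section \<open>Orbit maps on the big cell and their nonnegative part\<close>

lemma fnl_Um_sum:
  assumes "\<phi> \<in> fnl M" "v \<in> carrier M" "\<And>t. t > K \<Longrightarrow> eop M t v = \<zero>"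
  shows "\<phi> (act M (Um x) v) = (\<Sum>t\<le>K. x ^ t * \<phi> (eop M t v))"
proof -
  obtain q where q: "\<And>t. coeff q t = \<phi> (eop M t v)" "\<And>x. \<phi> (act M (Um x) v) = poly q x"
    using eop_poly[OF assms(2,1)] by metis
  have "degree q \<le> K" by (rule degree_le) (simp add: q assms fnl_zero[OF assms(1)])
  then show ?thesis by (simp add: q poly_sum_le mult.commute)
qed

lemma fnl_Lm_sum:
  assumes "\<phi> \<in> fnl M" "v \<in> carrier M" "\<And>t. t > K \<Longrightarrow> fop M t v = \<zero>"
  shows "\<phi> (act M (Lm x) v) = (\<Sum>t\<le>K. x ^ t * \<phi> (fop M t v))"
proof -
  obtain q where q: "\<And>t. coeff q t = \<phi> (fop M t v)" "\<And>x. \<phi> (act M (Lm x) v) = poly q x"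
    using fop_poly[OF assms(2,1)] by metis
  have "degree q \<le> K" by (rule degree_le) (simp add: q assms fnl_zero[OF assms(1)])
  then show ?thesis by (simp add: q poly_sum_le mult.commute)
qed

text \<open>The projection onto the nonnegative weights. For vectors of nonnegative weight,
  composing the orbit map with it removes all terms in which the upper left entry would have a
  negative exponent.\<close>

definition ppr :: "'v \<Rightarrow> 'v" where
  "ppr v = finsum M (\<lambda>l. pr M l v) {l. 0 \<le> l \<and> pr M l v \<noteq> \<zero>}"

lemma finite_pr:
  assumes "v \<in> carrier M"
  shows "finite {l. pr M l v \<noteq> \<zero>}"
proof -
  obtain N where "\<And>n. \<bar>n\<bar> > int N \<Longrightarrow> pr M n v = \<zero>" using pr_sum[OF assms] by metis
  then have "{l. pr M l v \<noteq> \<zero>} \<subseteq> {- int N..int N}" by force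
  then show ?thesis by (rule finite_subset) simp
qed

lemma ppr_cl [simp]: "v \<in> carrier M \<Longrightarrow> ppr v \<in> carrier M"
  unfolding ppr_def by (rule finsum_closed) auto

lemma fnl_ppr_sum:
  assumes "v \<in> carrier M" "\<phi> \<in> fnl M" "finite S" "\<And>l. 0 \<le> l \<Longrightarrow> pr M l v \<noteq> \<zero> \<Longrightarrow> l \<in> S" "\<And>l. l \<in> S \<Longrightarrow> 0 \<le> l"
  shows "\<phi> (ppr v) = (\<Sum>l\<in>S. \<phi> (pr M l v))"
proof -
  have "\<phi> (ppr v) = (\<Sum>l | 0 \<le> l \<and> pr M l v \<noteq> \<zero>. \<phi> (pr M l v))"
    unfolding ppr_def using assms finite_pr[OF assms(1)] by (intro fnl_finsum) auto
  also have "\<dots> = (\<Sum>l\<in>S. \<phi> (pr M l v))"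
    using assms by (intro sum.mono_neutral_left) (auto simp: fnl_zero)
  finally show ?thesis .
qed

lemma fnl_ppr:
  assumes \<phi>: "\<phi> \<in> fnl M"
  shows "(\<lambda>v. \<phi> (ppr v)) \<in> fnl M"
  unfolding fnl_def
proof (intro CollectI conjI ballI allI)
  fix u v assume u: "u \<in> carrier M" and v: "v \<in> carrier M"
  define S where "S = {l. 0 \<le> l \<and> pr M l u \<noteq> \<zero>} \<union> {l. 0 \<le> l \<and> pr M l v \<noteq> \<zero>}"
  have S: "finite S" "\<And>l. l \<in> S \<Longrightarrow> 0 \<le> l"
    using finite_pr[OF u] finite_pr[OF v] by (auto simp: S_def intro: finite_subset rev_finite_subset)
  have "\<phi> (ppr u) = (\<Sum>l\<in>S. \<phi> (pr M l u))" by (rule fnl_ppr_sum[OF u \<phi> S(1) _ S(2)]) (auto simp: S_def)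
  moreover have "\<phi> (ppr v) = (\<Sum>l\<in>S. \<phi> (pr M l v))" by (rule fnl_ppr_sum[OF v \<phi> S(1) _ S(2)]) (auto simp: S_def)
  moreover have "\<phi> (ppr (u \<oplus> v)) = (\<Sum>l\<in>S. \<phi> (pr M l (u \<oplus> v)))"
    by (rule fnl_ppr_sum[OF a_closed[OF u v] \<phi> S(1) _ S(2)]) (use u v in \<open>auto simp: S_def pr_add\<close>)
  ultimately show "\<phi> (ppr (u \<oplus> v)) = \<phi> (ppr u) + \<phi> (ppr v)"
    using u v \<phi> by (simp add: pr_add fnl_add sum.distrib)
next
  fix c v assume v: "v \<in> carrier M"
  define S where "S = {l. 0 \<le> l \<and> pr M l v \<noteq> \<zero>}"
  have S: "finite S" "\<And>l. l \<in> S \<Longrightarrow> 0 \<le> l"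
    using finite_pr[OF v] by (auto simp: S_def intro: finite_subset rev_finite_subset)
  have "\<phi> (ppr v) = (\<Sum>l\<in>S. \<phi> (pr M l v))" by (rule fnl_ppr_sum[OF v \<phi> S(1) _ S(2)]) (auto simp: S_def)
  moreover have "\<phi> (ppr (c \<odot> v)) = (\<Sum>l\<in>S. \<phi> (pr M l (c \<odot> v)))"
    by (rule fnl_ppr_sum[OF smult_cl[OF v] \<phi> S(1) _ S(2)]) (use v in \<open>auto simp: S_def pr_smult\<close>)
  ultimately show "\<phi> (ppr (c \<odot> v)) = c * \<phi> (ppr v)"
    using v \<phi> by (simp add: pr_smult fnl_smult sum_distrib_left)
qed

lemma ppr_add: "u \<in> carrier M \<Longrightarrow> v \<in> carrier M \<Longrightarrow> ppr (u \<oplus> v) = ppr u \<oplus> ppr v"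
  by (rule fnl_eqI) (auto simp: fnl_add fnl_add[OF fnl_ppr])

lemma ppr_smult: "v \<in> carrier M \<Longrightarrow> ppr (c \<odot> v) = c \<odot> ppr v"
  by (rule fnl_eqI) (auto simp: fnl_smult fnl_smult[OF fnl_ppr])

lemma ppr_of_wt: "v \<in> wt M n \<Longrightarrow> ppr v = (if 0 \<le> n then v else \<zero>)"
proof (rule fnl_eqI)
  fix \<phi> assume v: "v \<in> wt M n" and \<phi>: "\<phi> \<in> fnl M"
  have "\<phi> (ppr v) = (\<Sum>l\<in>{n} \<inter> {0..}. \<phi> (pr M l v))"
    by (rule fnl_ppr_sum[OF wt_carrier[OF v] \<phi>]) (auto simp: pr_of_wt[OF v] split: if_splits)
  then show "\<phi> (ppr v) = \<phi> (if 0 \<le> n then v else \<zero>)" by (auto simp: pr_of_wt[OF v] fnl_zero[OF \<phi>])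
qed (auto simp: wt_carrier)

lemma pr_ppr:
  assumes v: "v \<in> carrier M" and l: "0 \<le> l"
  shows "pr M l (ppr v) = pr M l v"
proof (rule fnl_eqI)
  fix \<phi> assume \<phi>: "\<phi> \<in> fnl M"
  define S where "S = insert l {l. 0 \<le> l \<and> pr M l v \<noteq> \<zero>}"
  have S: "finite S" using finite_pr[OF v] by (auto simp: S_def)
  have "\<phi> (pr M l (ppr v)) = (\<Sum>l'\<in>S. \<phi> (pr M l (pr M l' v)))"
    using v l S by (intro fnl_ppr_sum[OF v fnl_pr[OF \<phi>]]) (auto simp: S_def)
  also have "\<dots> = (\<Sum>l'\<in>S. if l' = l then \<phi> (pr M l v) else 0)"
    using \<phi> by (intro sum.cong refl) (auto simp: pr_of_wt[OF pr_wt[OF v]] fnl_zero)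
  also have "\<dots> = \<phi> (pr M l v)" using S by (auto simp: S_def)
  finally show "\<phi> (pr M l (ppr v)) = \<phi> (pr M l v)" .
qed (use v in auto)

lemma w0m_Tm: "z \<noteq> 0 \<Longrightarrow> Tm z * w0m = w0m * Tm (inverse z)"
  by (simp add: Tm_def w0m_def m2_mult)

lemma pr_w0m:
  assumes v: "v \<in> carrier M"
  shows "pr M l (act M w0m v) = act M w0m (pr M (- l) v)"
proof (rule pr_eqI)
  obtain N where N: "\<And>n. \<bar>n\<bar> > int N \<Longrightarrow> pr M n v = \<zero>"
    "\<And>K \<phi> z. K \<ge> N \<Longrightarrow> \<phi> \<in> fnl M \<Longrightarrow> z \<noteq> 0 \<Longrightarrow> \<phi> (act M (Tm z) v) = (\<Sum>n\<in>{- int K..int K}. z powi n * \<phi> (pr M n v))"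
    "\<And>K \<phi>. K \<ge> N \<Longrightarrow> \<phi> \<in> fnl M \<Longrightarrow> \<phi> v = (\<Sum>n\<in>{- int K..int K}. \<phi> (pr M n v))"
    by (rule pr_sum[OF v]) (rule that)
  have "\<phi> (act M (Tm z) (act M w0m v)) = (\<Sum>n\<in>{- int K..int K}. z powi n * \<phi> (act M w0m (pr M (- n) v)))"
    if "K \<ge> N" "\<phi> \<in> fnl M" "z \<noteq> 0" for K \<phi> z
  proof -
    have "\<phi> (act M (Tm z) (act M w0m v)) = \<phi> (act M w0m (act M (Tm (inverse z)) v))"
      using that v by (simp add: act_act w0m_Tm)
    also have "\<dots> = (\<Sum>n\<in>{- int K..int K}. inverse z powi n * \<phi> (act M w0m (pr M n v)))"
      using N(2)[OF that(1) fnl_act[OF that(2) w0m_SL2], of "inverse z"] that by simp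
    also have "\<dots> = (\<Sum>n\<in>{- int K..int K}. z powi n * \<phi> (act M w0m (pr M (- n) v)))"
      by (rule sum.reindex_bij_witness[of _ uminus uminus]) (auto simp: power_int_inverse power_int_minus)
    finally show ?thesis .
  qed
  then show "texp M (act M w0m v) (\<lambda>l. act M w0m (pr M (- l) v))"
    unfolding texp_def using N(1) v act_smult[of w0m v 0] by (intro conjI allI exI[of _ N]) (auto simp: act_smult[of w0m \<zero> 0, simplified])
qed (use v in auto)

text \<open>The element \<open>w0m\<close> moves a component of negative weight to positive weight,
  so the projection cannot miss it on the whole orbit.\<close>

lemma ppr_orbit_zero:
  assumes v: "v \<in> carrier M" and z: "\<And>g. g \<in> carrier SL2 \<Longrightarrow> ppr (act M g v) = \<zero>"
  shows "v = \<zero>"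
proof (rule eq_zero_if_pr[OF v])
  fix n :: int
  have nn: "pr M l (act M g v) = \<zero>" if "0 \<le> l" "g \<in> carrier SL2" for l g
    using pr_ppr[of "act M g v" l] z[OF that(2)] v that by simp
  show "pr M n v = \<zero>"
  proof (cases "0 \<le> n")
    case True then show ?thesis using nn[of n "m2 1 0 0 1"] v by simp
  next
    case False
    then have "act M w0m (pr M n v) = \<zero>" using nn[of "- n" w0m] v pr_w0m[OF v, of "- n"] by simp
    then have "act M (inv\<^bsub>SL2\<^esub> w0m) (act M w0m (pr M n v)) = \<zero>"
      using act_smult[of "inv\<^bsub>SL2\<^esub> w0m" \<zero> 0] group.inv_closed[OF group_SL2 w0m_SL2] by simp
    moreover have "inv\<^bsub>SL2\<^esub> w0m * w0m = (m2 1 0 0 1 :: 'k mat)"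
      using group.l_inv[OF group_SL2 w0m_SL2] by simp
    ultimately show ?thesis using v group.inv_closed[OF group_SL2 w0m_SL2] by (simp add: act_act)
  qed
qed

text \<open>The order of the factors is suited to weight vectors: the torus acts first, by a
  scalar.\<close>

lemma act_decomp:
  assumes g: "g \<in> carrier SL2" and a: "g $$ (0, 0) \<noteq> 0"
  shows "g = Lm (g $$ (1, 0) / g $$ (0, 0)) * (Um (g $$ (0, 0) * g $$ (0, 1)) * Tm (g $$ (0, 0)))"
proof -
  obtain a b c d where gm: "g = m2 a b c d" "a * d - b * c = 1" using g by (rule SL2_m2E)
  have a: "a \<noteq> 0" using a gm by simp
  then have d: "d = c / a * b + 1 / a" using gm(2) by (simp add: field_simps)
  show ?thesis unfolding gm(1) d using a by (simp add: Lm_def Um_def Tm_def m2_mult inverse_eq_divide)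
qed

text \<open>Only the three entries that occur in \<open>act_decomp\<close> are used; right
  translation by U and by the torus preserves the span of these monomials.\<close>

definition mono3 :: "nat \<Rightarrow> nat \<Rightarrow> nat \<Rightarrow> 'k mat \<Rightarrow> 'k" where
  "mono3 A j k g = g $$ (0, 0) ^ A * g $$ (0, 1) ^ j * g $$ (1, 0) ^ k"

lemma mono3_coord: "restrict (mono3 A j k) (carrier SL2) \<in> coord_ring"
  unfolding mono3_def by (intro coord_ring_mult coord_ring_power coord_ring_entry) auto

lemma ppr_act_coord:
  assumes "v \<in> carrier M" "\<phi> \<in> fnl M"
  shows "restrict (\<lambda>g. \<phi> (ppr (act M g v))) (carrier SL2) \<in> coord_ring"
proof -
  obtain B f where f: "finite B" "\<forall>c\<in>B. restrict (f c) (carrier SL2) \<in> coord_ring"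
    "\<forall>g\<in>carrier SL2. \<forall>\<phi>\<in>fnl M. \<phi> (act M g v) = (\<Sum>c\<in>B. f c g * \<phi> c)" using matrix_form[OF assms(1)] by blast
  have "restrict (\<lambda>g. \<Sum>c\<in>B. f c g * \<phi> (ppr c)) (carrier SL2) \<in> coord_ring"
    using f by (intro coord_ring_sum coord_ring_mult coord_ring_const) auto
  then show ?thesis by (rule coord_ring_cong) (use f(3) fnl_ppr[OF assms(2)] in auto)
qed

lemma eop_fop_bound:
  assumes v: "v \<in> carrier M"
  obtains K0 where "\<And>K t. K \<ge> K0 \<Longrightarrow> t > K \<Longrightarrow> eop M t v = \<zero>"
    "\<And>K t j. K \<ge> K0 \<Longrightarrow> t > K \<Longrightarrow> fop M t (eop M j v) = \<zero>"
proof -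
  obtain D where D: "\<forall>t\<ge>D. eop M t v = \<zero>" using eop_finite[OF v] by blast
  have "\<forall>j. \<exists>E. \<forall>t\<ge>E. fop M t (eop M j v) = \<zero>" using fop_finite eop_cl[OF v] by blast
  then obtain E where E: "\<And>j t. t \<ge> E j \<Longrightarrow> fop M t (eop M j v) = \<zero>" by metis
  define K0 where "K0 = D + (\<Sum>j<D. E j)"
  have "fop M t (eop M j v) = \<zero>" if "K \<ge> K0" "t > K" for K t j
  proof (cases "j < D")
    case True
    then have "E j \<le> (\<Sum>j<D. E j)" by (intro member_le_sum) auto
    then show ?thesis using that by (intro E) (simp add: K0_def)
  qed (use D in auto)
  moreover have "eop M t v = \<zero>" if "K \<ge> K0" "t > K" for K t using that D by (auto simp: K0_def)
  ultimately show ?thesis using that by blast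
qed

text \<open>With a, b, c the entries of g as in \<open>mono3\<close>, on the big cell g v = a^n
  L(c/a) U(ab) v. Expansion gives a^(n+j-k) b^j c^k times a vector of weight n + 2j - 2k, which the
  projection keeps iff 2k \<le> n + 2j; then n + j - k \<ge> n/2 \<ge> 0. As both sides are regular,
  density extends the formula to all g.\<close>

lemma ppr_act_wt:
  assumes v: "v \<in> wt M n" and n: "0 \<le> n" and \<phi>: "\<phi> \<in> fnl M" and g: "g \<in> carrier SL2"
    and K: "\<And>t. t > K \<Longrightarrow> eop M t v = \<zero>" "\<And>t j. t > K \<Longrightarrow> fop M t (eop M j v) = \<zero>"
  shows "\<phi> (ppr (act M g v)) = (\<Sum>j\<le>K. \<Sum>k\<le>K. if 2 * int k \<le> n + 2 * int j
    then mono3 (nat (n + int j - int k)) j k g * \<phi> (fop M k (eop M j v)) else 0)"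
proof (rule coord_ring_dense[of "\<lambda>g. \<phi> (ppr (act M g v))", OF _ _ _ g])
  note vc = wt_carrier[OF v]
  note \<chi> = fnl_ppr[OF \<phi>]
  show "restrict (\<lambda>g. \<phi> (ppr (act M g v))) (carrier SL2) \<in> coord_ring" by (rule ppr_act_coord[OF vc \<phi>])
  have "restrict (\<lambda>g. if 2 * int k \<le> n + 2 * int j
    then mono3 (nat (n + int j - int k)) j k g * c else 0) (carrier SL2) \<in> coord_ring" for j k c
    by (cases "2 * int k \<le> n + 2 * int j") (auto intro!: coord_ring_mult coord_ring_const mono3_coord)
  then show "restrict (\<lambda>g. \<Sum>j\<le>K. \<Sum>k\<le>K. if 2 * int k \<le> n + 2 * int j
    then mono3 (nat (n + int j - int k)) j k g * \<phi> (fop M k (eop M j v)) else 0) (carrier SL2) \<in> coord_ring"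
    by (intro coord_ring_sum)
  fix g :: "'k mat" assume g: "g \<in> carrier SL2" and a0: "g $$ (0, 0) \<noteq> 0"
  define a b c where "a = g $$ (0, 0)" and "b = g $$ (0, 1)" and "c = g $$ (1, 0)"
  note abc = a_def b_def c_def
  have a: "a \<noteq> 0" using a0 by (simp add: abc)
  have dg: "g = Lm (c / a) * (Um (a * b) * Tm a)" using act_decomp[OF g a0] by (simp only: abc)
  have "act M g v = act M (Lm (c / a)) (act M (Um (a * b)) (act M (Tm a) v))"
    using vc a by (subst dg) (simp add: act_act)
  also have "\<dots> = (a powi n) \<odot> act M (Lm (c / a)) (act M (Um (a * b)) v)"
    using v a vc by (simp add: wt_def act_smult)
  finally have "\<phi> (ppr (act M g v)) = a powi n * \<phi> (ppr (act M (Lm (c / a)) (act M (Um (a * b)) v)))"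
    using vc \<phi> by (simp add: ppr_smult fnl_smult)
  also have "\<phi> (ppr (act M (Lm (c / a)) (act M (Um (a * b)) v)))
    = (\<Sum>j\<le>K. (a * b) ^ j * \<phi> (ppr (act M (Lm (c / a)) (eop M j v))))"
    using fnl_Um_sum[OF fnl_act[OF \<chi> Lm_SL2] vc K(1)] by simp
  also have "\<dots> = (\<Sum>j\<le>K. \<Sum>k\<le>K. (a * b) ^ j * ((c / a) ^ k * \<phi> (ppr (fop M k (eop M j v)))))"
    by (simp add: fnl_Lm_sum[OF \<chi> eop_cl[OF vc] K(2)] sum_distrib_left)
  also have "a powi n * \<dots> = (\<Sum>j\<le>K. \<Sum>k\<le>K. if 2 * int k \<le> n + 2 * int j
    then mono3 (nat (n + int j - int k)) j k g * \<phi> (fop M k (eop M j v)) else 0)"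
    unfolding sum_distrib_left
  proof (intro sum.cong refl)
    fix j k
    have w: "fop M k (eop M j v) \<in> wt M (n + 2 * int j - 2 * int k)" by (intro fop_wt eop_wt v)
    show "a powi n * ((a * b) ^ j * ((c / a) ^ k * \<phi> (ppr (fop M k (eop M j v))))) = (if 2 * int k \<le> n + 2 * int j
      then mono3 (nat (n + int j - int k)) j k g * \<phi> (fop M k (eop M j v)) else 0)"
    proof (cases "2 * int k \<le> n + 2 * int j")
      case True
      obtain m where m: "n = int m" using n nonneg_int_cases by blast
      have *: "nat (n + int j - int k) + k = m + j" using True m n by linarith
      have "a powi n * ((a * b) ^ j * (c / a) ^ k) = a ^ (m + j) / a ^ k * b ^ j * c ^ k"
        by (simp add: m power_add power_mult_distrib power_divide)
      also have "a ^ (m + j) / a ^ k = a ^ nat (n + int j - int k)"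
        unfolding *[symmetric] power_add using a by simp
      finally have "a powi n * ((a * b) ^ j * (c / a) ^ k) = mono3 (nat (n + int j - int k)) j k g"
        by (simp only: mono3_def abc)
      then show ?thesis using True ppr_of_wt[OF w] by (simp add: mult.assoc[symmetric])
    qed (use ppr_of_wt[OF w] fnl_zero[OF \<phi>] in simp)
  qed
  finally show "\<phi> (ppr (act M g v)) = (\<Sum>j\<le>K. \<Sum>k\<le>K. if 2 * int k \<le> n + 2 * int j
    then mono3 (nat (n + int j - int k)) j k g * \<phi> (fop M k (eop M j v)) else 0)" .
qed

end

text \<open>\<open>H A j k w\<close> stands for the image of the regular function \<open>a\<^sup>A b\<^sup>j c\<^sup>k w\<close> under a retraction of the
  module of regular functions onto \<open>M\<close>.\<close>

locale hfam = rat M for M :: "('k::alg_closed_field, 'v) gmod" (structure) +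
  fixes H :: "nat \<Rightarrow> nat \<Rightarrow> nat \<Rightarrow> 'v \<Rightarrow> 'v"
  assumes H_cl [simp, intro]: "w \<in> carrier M \<Longrightarrow> H A j k w \<in> carrier M"
    and fnl_H: "\<phi> \<in> fnl M \<Longrightarrow> (\<lambda>w. \<phi> (H A j k w)) \<in> fnl M"
    and H_eop: "w \<in> carrier M \<Longrightarrow> eop M t (H A j k w) =
      (if t \<le> j then of_nat (j choose t) \<odot> H (A + t) (j - t) k w else \<zero>)"
    and H_wt: "w \<in> carrier M \<Longrightarrow> H A j k w \<in> wt M (int A + int k - int j)"
    and H_rep: "v \<in> wt M n \<Longrightarrow> 0 \<le> n \<Longrightarrow> \<exists>K0. \<forall>K\<ge>K0. \<forall>\<phi>\<in>fnl M. \<phi> v = (\<Sum>j\<le>K. \<Sum>k\<le>K.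
      if 2 * int k \<le> n + 2 * int j then \<phi> (H (nat (n + int j - int k)) j k (fop M k (eop M j v))) else 0)"

context rat
begin

context
  fixes \<theta> :: "('k mat \<Rightarrow> 'v) \<Rightarrow> 'v"
  assumes \<theta>: "inj_on \<theta> regf"
begin

abbreviation "RM \<equiv> regm \<theta>"

section \<open>The embedding into regular functions and its retraction\<close>

definition tns :: "('k mat \<Rightarrow> 'k) \<Rightarrow> 'v \<Rightarrow> 'v" where
  "tns f w = \<theta> (\<lambda>g\<in>carrier SL2. f g \<odot> w)"

lemma rat_regm: "rat RM"
  unfolding rat_def by (rule rational_regm[OF \<theta>])

lemma tns_cl: "restrict f (carrier SL2) \<in> coord_ring \<Longrightarrow> w \<in> carrier M \<Longrightarrow> tns f w \<in> carrier RM"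
  unfolding tns_def by (auto simp: regm_simps[OF \<theta>] intro!: imageI regf_tensor)

lemma regm_expand:
  assumes F: "F \<in> regf" and A: "finite A" "\<And>i. i \<in> A \<Longrightarrow> restrict (f i) (carrier SL2) \<in> coord_ring"
    "\<And>i. i \<in> A \<Longrightarrow> w i \<in> carrier M"
    and eq: "\<And>g \<phi>. g \<in> carrier SL2 \<Longrightarrow> \<phi> \<in> fnl M \<Longrightarrow> \<phi> (F g) = (\<Sum>i\<in>A. a i * (f i g * \<phi> (w i)))" and \<chi>: "\<chi> \<in> fnl RM"
  shows "\<chi> (\<theta> F) = (\<Sum>i\<in>A. a i * \<chi> (tns (f i) (w i)))"
proof (rule kvs.fnl_sep_lincomb[OF kvs_regm[OF \<theta>] sep_regphi[OF \<theta>] _ A(1) _ _ \<chi>])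
  show "\<theta> F \<in> carrier RM" using F by (simp add: regm_simps[OF \<theta>])
  show "(\<lambda>i. tns (f i) (w i)) ` A \<subseteq> carrier RM" using A tns_cl by auto
  fix \<phi> assume "\<phi> \<in> regphi \<theta>"
  then obtain \<psi> g where \<psi>: "\<psi> \<in> fnl M" and g: "g \<in> carrier SL2" and \<phi>: "\<phi> = (\<lambda>x. \<psi> (rinv \<theta> x g))"
    by (auto simp: regphi_def[OF \<theta>])
  show "\<phi> (\<theta> F) = (\<Sum>i\<in>A. a i * \<phi> (tns (f i) (w i)))"
    using A \<psi> g by (simp add: \<phi> rinv_\<theta>[OF \<theta>] F tns_def regf_tensor eq fnl_smult)
qed

lemma fnl_tns:
  assumes f: "restrict f (carrier SL2) \<in> coord_ring" and \<chi>: "\<chi> \<in> fnl RM"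
  shows "(\<lambda>w. \<chi> (tns f w)) \<in> fnl M"
  unfolding fnl_def
proof (intro CollectI conjI ballI allI)
  interpret R: rat RM by (rule rat_regm)
  note [simp] = regm_simps(3,4)[OF \<theta>] 
  fix u v assume u: "u \<in> carrier M" and v: "v \<in> carrier M"
  have "tns f (u \<oplus> v) = tns f u \<oplus>\<^bsub>RM\<^esub> tns f v"
    using u v f by (simp add: tns_def regf_tensor smult_add_r cong: restrict_cong)
  then show "\<chi> (tns f (u \<oplus> v)) = \<chi> (tns f u) + \<chi> (tns f v)"
    using R.fnl_add[OF \<chi>] tns_cl[OF f] u v by simp
next
  interpret R: rat RM by (rule rat_regm)
  note [simp] = regm_simps(3,4)[OF \<theta>] 
  fix c v assume v: "v \<in> carrier M"
  have "tns f (c \<odot> v) = c \<odot>\<^bsub>RM\<^esub> tns f v"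
    using v f by (simp add: tns_def regf_tensor smult_smult mult.commute cong: restrict_cong)
  then show "\<chi> (tns f (c \<odot> v)) = c * \<chi> (tns f v)"
    using R.fnl_smult[OF \<chi>] tns_cl[OF f] v by simp
qed

lemma tns_trans:
  assumes "restrict f (carrier SL2) \<in> coord_ring" "w \<in> carrier M" "h \<in> carrier SL2"
  shows "act RM h (tns f w) = \<theta> (\<lambda>g\<in>carrier SL2. f (g * h) \<odot> w)"
  using assms by (simp add: tns_def regm_simps[OF \<theta>] regf_tensor cong: restrict_cong)

lemma tns_trans_regf:
  assumes "restrict f (carrier SL2) \<in> coord_ring" "w \<in> carrier M" "h \<in> carrier SL2"
  shows "(\<lambda>g\<in>carrier SL2. f (g * h) \<odot> w) \<in> regf"
  using regf_trans[OF regf_tensor[OF assms(1,2)] assms(3)] assms(3) by (simp cong: restrict_cong)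

lemma mono3_Tm:
  assumes "g \<in> carrier SL2" "z \<noteq> 0"
  shows "mono3 A j k (g * Tm z) = z powi (int A + int k - int j) * mono3 A j k g"
proof -
  obtain a b c d where g: "g = m2 a b c d" using assms(1) by (rule SL2_m2E)
  have "z powi (int A + int k - int j) = z ^ A * z ^ k * inverse z ^ j"
    using assms(2) by (simp add: power_int_diff power_int_add field_simps)
  then show ?thesis by (simp add: g Tm_def m2_mult mono3_def power_mult_distrib)
qed

text \<open>Right translation by U(x) replaces b by b + a x and fixes a and c, so the monomials
  behave like powers of the single variable b.\<close>

lemma mono3_Um:
  assumes "g \<in> carrier SL2"
  shows "mono3 A j k (g * Um x) = (\<Sum>t\<le>j. x ^ t * (of_nat (j choose t) * mono3 (A + t) (j - t) k g))"
proof -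
  obtain a b c d where g: "g = m2 a b c d" using assms(1) by (rule SL2_m2E)
  have "mono3 A j k (g * Um x) = a ^ A * (a * x + b) ^ j * c ^ k"
    by (simp add: g Um_def m2_mult mono3_def)
  also have "(a * x + b) ^ j = (\<Sum>t\<le>j. of_nat (j choose t) * (a * x) ^ t * b ^ (j - t))" by (rule binomial_ring)
  finally show ?thesis
    by (simp add: g mono3_def sum_distrib_left sum_distrib_right power_add power_mult_distrib mult_ac)
qed

lemma tns_wt:
  assumes "w \<in> carrier M"
  shows "tns (mono3 A j k) w \<in> wt RM (int A + int k - int j)"
  unfolding wt_def
proof (intro CollectI conjI allI impI)
  show "tns (mono3 A j k) w \<in> carrier RM" by (intro tns_cl mono3_coord assms)
  fix z :: 'k assume "z \<noteq> 0"
  then show "act RM (Tm z) (tns (mono3 A j k) w) = z powi (int A + int k - int j) \<odot>\<^bsub>RM\<^esub> tns (mono3 A j k) w"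
    using assms by (simp add: tns_trans mono3_coord) (simp add: tns_def regm_simps[OF \<theta>] regf_tensor mono3_coord mono3_Tm smult_smult cong: restrict_cong)
qed

lemma eop_tns:
  assumes w: "w \<in> carrier M"
  shows "eop RM t (tns (mono3 A j k) w) = (if t \<le> j then of_nat (j choose t) \<odot>\<^bsub>RM\<^esub> tns (mono3 (A + t) (j - t) k) w else \<zero>\<^bsub>RM\<^esub>)"
proof -
  interpret R: rat RM by (rule rat_regm)
  let ?w = "\<lambda>t. if t \<le> j then of_nat (j choose t) \<odot>\<^bsub>RM\<^esub> tns (mono3 (A + t) (j - t) k) w else \<zero>\<^bsub>RM\<^esub>"
  have cl: "tns (mono3 A j k) w \<in> carrier RM" for A j k by (intro tns_cl mono3_coord w)
  have "pexp RM Um (tns (mono3 A j k) w) ?w"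
    unfolding pexp_def
  proof (intro conjI ballI allI)
    show "?w t \<in> carrier RM" for t using cl by simp
    show "\<exists>D. \<forall>t\<ge>D. ?w t = \<zero>\<^bsub>RM\<^esub>" by (intro exI[of _ "Suc j"]) auto
    fix \<chi> assume \<chi>: "\<chi> \<in> fnl RM"
    define q where "q = (\<Sum>t\<le>j. monom (of_nat (j choose t) * \<chi> (tns (mono3 (A + t) (j - t) k) w)) t)"
    have "coeff q t = \<chi> (?w t)" for t
      unfolding q_def using cl \<chi> by (auto simp: coeff_sum R.fnl_smult R.fnl_zero)
    moreover have "\<chi> (act RM (Um x) (tns (mono3 A j k) w)) = poly q x" for x
    proof -
      have "\<chi> (\<theta> (\<lambda>g\<in>carrier SL2. mono3 A j k (g * Um x) \<odot> w)) =
          (\<Sum>t\<le>j. (x ^ t * of_nat (j choose t)) * \<chi> (tns (mono3 (A + t) (j - t) k) w))"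
      proof (rule regm_expand[OF _ _ _ _ _ \<chi>])
        show "(\<lambda>g\<in>carrier SL2. mono3 A j k (g * Um x) \<odot> w) \<in> regf"
          by (intro tns_trans_regf mono3_coord w Um_SL2)
      qed (use w in \<open>auto simp: mono3_coord mono3_Um fnl_smult sum_distrib_right mult.assoc intro!: sum.cong\<close>)
      then show ?thesis using w by (simp add: tns_trans mono3_coord q_def poly_sum poly_monom mult_ac)
    qed
    ultimately show "\<exists>q. (\<forall>t. coeff q t = \<chi> (?w t)) \<and> (\<forall>x. \<chi> (act RM (Um x) (tns (mono3 A j k) w)) = poly q x)"
      by blast
  qed
  then show ?thesis unfolding eop_def by (rule R.pcoef_eqI[OF cl pcurve_Um])
qed

text \<open>The projection \<open>ppr\<close> is inserted so that vectors of nonnegative weight are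
  sent to combinations of the monomials \<open>mono3\<close>.\<close>

definition orb :: "'v \<Rightarrow> 'v" where
  "orb = (\<lambda>v\<in>carrier M. \<theta> (\<lambda>g\<in>carrier SL2. ppr (act M g v)))"

lemma orb_regf:
  assumes "v \<in> carrier M"
  shows "(\<lambda>g\<in>carrier SL2. ppr (act M g v)) \<in> regf"
proof -
  obtain B f where B: "finite B" "B \<subseteq> carrier M" "\<forall>c\<in>B. restrict (f c) (carrier SL2) \<in> coord_ring"
    "\<forall>g\<in>carrier SL2. \<forall>\<phi>\<in>fnl M. \<phi> (act M g v) = (\<Sum>c\<in>B. f c g * \<phi> c)" using matrix_form[OF assms] by blast
  show ?thesis by (rule regfI[of B f ppr]) (use B assms fnl_ppr in auto)
qed

lemma orb_hom: "orb \<in> gmod_hom M RM" "inj_on orb (carrier M)"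
proof -
  note c = orb_regf
  have add: "orb (u \<oplus> v) = orb u \<oplus>\<^bsub>RM\<^esub> orb v" if "u \<in> carrier M" "v \<in> carrier M" for u v
    using that c by (simp add: orb_def regm_simps[OF \<theta>] act_add ppr_add cong: restrict_cong)
  have smult: "orb (a \<odot> v) = a \<odot>\<^bsub>RM\<^esub> orb v" if "v \<in> carrier M" for a v
    using that c by (simp add: orb_def regm_simps[OF \<theta>] act_smult ppr_smult cong: restrict_cong)
  have act: "orb (act M h v) = act RM h (orb v)" if "h \<in> carrier SL2" "v \<in> carrier M" for h v
    using that c by (simp add: orb_def regm_simps[OF \<theta>] act_act cong: restrict_cong)
  have cl: "orb v \<in> carrier RM" if "v \<in> carrier M" for v
    using that c by (simp add: orb_def regm_simps[OF \<theta>])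
  show "orb \<in> gmod_hom M RM"
    using add smult act cl by (auto simp: gmod_hom_def LinearCombinations.module_hom_def orb_def)
  show "inj_on orb (carrier M)"
  proof (rule inj_onI)
    fix u v assume u: "u \<in> carrier M" and v: "v \<in> carrier M" and eq: "orb u = orb v"
    then have eq': "(\<lambda>g\<in>carrier SL2. ppr (act M g u)) = (\<lambda>g\<in>carrier SL2. ppr (act M g v))"
      using c by (simp add: orb_def \<theta>_eq_iff[OF \<theta>])
    have "u \<oplus> (- 1) \<odot> v = \<zero>"
    proof (rule ppr_orbit_zero)
      fix g :: "'k mat" assume g: "g \<in> carrier SL2"
      then have "ppr (act M g u) = ppr (act M g v)" using fun_cong[OF eq', of g] by simp
      then show "ppr (act M g (u \<oplus> (- 1) \<odot> v)) = \<zero>"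
        using u v g by (simp add: act_add act_smult ppr_add ppr_smult) (simp add: smult_m1 r_neg)
    qed (use u v in simp)
    then have "\<phi> u = \<phi> v" if "\<phi> \<in> fnl M" for \<phi>
      using fnl_add[OF that u, of "(- 1) \<odot> v"] fnl_smult[OF that v, of "- 1"] fnl_zero[OF that] v by simp
    then show "u = v" by (rule fnl_eqI[OF u v])
  qed
qed

text \<open>A homomorphism carries the formulas for divided powers and weights of monomials over to
  \<open>M\<close>; as it inverts \<open>orb\<close>, applying it to \<open>ppr_act_wt\<close> gives
  the representation of \<open>v\<close>.\<close>

lemma hfam_retract:
  assumes h: "h \<in> gmod_hom RM M" and hr: "\<And>v. v \<in> carrier M \<Longrightarrow> h (orb v) = v"
  shows "hfam M (\<lambda>A j k w. h (tns (mono3 A j k) w))"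
proof -
  interpret R: rat RM by (rule rat_regm)
  interpret h: rat_hom RM M h by unfold_locales (rule h)
  have cl: "tns (mono3 A j k) w \<in> carrier RM" if "w \<in> carrier M" for A j k w by (intro tns_cl mono3_coord that)
  show ?thesis
  proof unfold_locales
    fix w A j k assume w: "w \<in> carrier M"
    show "h (tns (mono3 A j k) w) \<in> carrier M" using cl w by simp
    show "h (tns (mono3 A j k) w) \<in> wt M (int A + int k - int j)" by (intro h.h_wt tns_wt w)
    show "eop M t (h (tns (mono3 A j k) w)) = (if t \<le> j then of_nat (j choose t) \<odot> h (tns (mono3 (A + t) (j - t) k) w) else \<zero>)" for t
      using cl[OF w] by (simp add: h.h_eop[symmetric] eop_tns w h.h_smult)
  next
    fix \<phi> A j k assume "\<phi> \<in> fnl M"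
    then show "(\<lambda>w. \<phi> (h (tns (mono3 A j k) w))) \<in> fnl M" using fnl_tns[OF mono3_coord h.fnl_h] by simp
  next
    fix v n assume v: "v \<in> wt M n" and n: "0 \<le> n"
    note vc = wt_carrier[OF v]
    obtain K0 where K0: "\<And>K t. K \<ge> K0 \<Longrightarrow> t > K \<Longrightarrow> eop M t v = \<zero>"
      "\<And>K t j. K \<ge> K0 \<Longrightarrow> t > K \<Longrightarrow> fop M t (eop M j v) = \<zero>" by (rule eop_fop_bound[OF vc]) (rule that)
    have "\<phi> v = (\<Sum>j\<le>K. \<Sum>k\<le>K. if 2 * int k \<le> n + 2 * int j
        then \<phi> (h (tns (mono3 (nat (n + int j - int k)) j k) (fop M k (eop M j v)))) else 0)"
      if K: "K \<ge> K0" and \<phi>: "\<phi> \<in> fnl M" for K \<phi>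
    proof -
      let ?f = "\<lambda>(j, k). mono3 (nat (n + int j - int k)) j k" and ?w = "\<lambda>(j, k). fop M k (eop M j v)"
      let ?a = "\<lambda>(j, k). if 2 * int k \<le> n + 2 * int j then 1 else (0::'k)"
      have "\<phi> (h (\<theta> (\<lambda>g\<in>carrier SL2. ppr (act M g v)))) = (\<Sum>i\<in>{..K} \<times> {..K}. ?a i * \<phi> (h (tns (?f i) (?w i))))"
      proof (rule regm_expand[OF orb_regf[OF vc] _ _ _ _ h.fnl_h[OF \<phi>]])
        fix g :: "'k mat" and \<psi> assume g: "g \<in> carrier SL2" and \<psi>: "\<psi> \<in> fnl M"
        have "(\<Sum>j\<le>K. \<Sum>k\<le>K. if 2 * int k \<le> n + 2 * int j
            then mono3 (nat (n + int j - int k)) j k g * \<psi> (fop M k (eop M j v)) else 0) = (\<Sum>i\<in>{..K} \<times> {..K}. ?a i * (?f i g * \<psi> (?w i)))"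
          by (subst sum.cartesian_product) (auto intro!: sum.cong)
        then show "\<psi> ((\<lambda>g\<in>carrier SL2. ppr (act M g v)) g) = (\<Sum>i\<in>{..K} \<times> {..K}. ?a i * (?f i g * \<psi> (?w i)))"
          using ppr_act_wt[OF v n \<psi> g K0[OF K]] g by simp
      qed (use vc in \<open>auto simp: mono3_coord\<close>)
      also have "\<dots> = (\<Sum>j\<le>K. \<Sum>k\<le>K. if 2 * int k \<le> n + 2 * int j
        then \<phi> (h (tns (mono3 (nat (n + int j - int k)) j k) (fop M k (eop M j v)))) else 0)"
        by (subst sum.cartesian_product) (auto intro!: sum.cong)
      finally show ?thesis using hr[OF vc] vc by (simp add: orb_def)
    qed
    then show "\<exists>K0. \<forall>K\<ge>K0. \<forall>\<phi>\<in>fnl M. \<phi> v = (\<Sum>j\<le>K. \<Sum>k\<le>K. if 2 * int k \<le> n + 2 * int j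
        then \<phi> (h (tns (mono3 (nat (n + int j - int k)) j k) (fop M k (eop M j v)))) else 0)"
      by blast
  qed
qed

end

end

text \<open>Injectivity extends the identity of \<open>M\<close> along \<open>orb\<close>. The zero
  module is treated apart, because coding functions by vectors starts from a nonzero vector.\<close>

lemma injective_hfam:
  fixes M :: "('k::alg_closed_field, 'v) gmod"
  assumes "injective_gmod M"
  shows "\<exists>H. hfam M H"
proof -
  have "rational_gmod M" using assms by (simp add: injective_gmod_def)
  then interpret rat M by (simp add: rat_def)
  show ?thesis
  proof (cases "carrier M = {\<zero>\<^bsub>M\<^esub>}")
    case True
    have z: "eop M t \<zero>\<^bsub>M\<^esub> = \<zero>\<^bsub>M\<^esub>" for t by simp
    have "hfam M (\<lambda>A j k w. \<zero>\<^bsub>M\<^esub>)"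
    proof unfold_locales
      fix v n assume "v \<in> wt M n"
      then have "v = \<zero>\<^bsub>M\<^esub>" using wt_carrier True by blast
      then show "\<exists>K0. \<forall>K\<ge>K0. \<forall>\<phi>\<in>fnl M. \<phi> v = (\<Sum>j\<le>K. \<Sum>k\<le>K. if 2 * int k \<le> n + 2 * int j then \<phi> \<zero>\<^bsub>M\<^esub> else 0)"
        by (auto simp: fnl_zero)
    qed (auto simp: fnl_zero fnl_def)
    then show ?thesis by blast
  next
    case False
    then obtain v where "v \<in> carrier M" "v \<noteq> \<zero>\<^bsub>M\<^esub>" by blast
    then obtain \<theta> :: "('k mat \<Rightarrow> 'v) \<Rightarrow> 'v" where \<theta>: "inj_on \<theta> regf" using regf_embeds by blast
    have id: "(\<lambda>v\<in>carrier M. v) \<in> gmod_hom M M"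
      by (auto simp: gmod_hom_def LinearCombinations.module_hom_def)
    obtain h where h: "h \<in> gmod_hom (regm \<theta>) M" "\<forall>v\<in>carrier M. h (orb \<theta> v) = (\<lambda>v\<in>carrier M. v) v"
      using assms \<open>rational_gmod M\<close> rational_regm[OF \<theta>] orb_hom[OF \<theta>] id unfolding injective_gmod_def by meson
    have "hfam M (\<lambda>A j k w. h (tns \<theta> (mono3 A j k) w))" by (rule hfam_retract[OF \<theta> h(1)]) (use h(2) in simp)
    then show ?thesis by blast
  qed
qed

section \<open>Divided powers in characteristic p\<close>

context odd_char
begin

text \<open>In characteristic p, (1 + X)^(p^i) = 1 + X^(p^i); compare the coefficients of X^(p^i)
  after multiplication by (1 + X)^n.\<close>

lemma choose_p_power_add:
  "(of_nat ((n + p ^ i) choose p ^ i) :: 'k) = of_nat (n choose p ^ i) + 1"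
proof -
  let ?q = "[:1, 1:] :: 'k poly"
  have q: "?q = 1 + monom 1 1" by (simp add: monom_altdef one_pCons)
  have "?q ^ p ^ i = 1 + monom 1 (p ^ i)"
    unfolding q using prime_p by (subst freshmans_dream') (auto simp: char_k monom_power)
  then have "?q ^ (n + p ^ i) = ?q ^ n + monom 1 (p ^ i) * ?q ^ n"
    by (simp add: power_add algebra_simps)
  then have "coeff (?q ^ (n + p ^ i)) (p ^ i) = coeff (?q ^ n) (p ^ i) + coeff (?q ^ n) 0"
    by (simp add: coeff_monom_mult)
  moreover have "coeff (?q ^ m) k = of_nat (m choose k)" for m k
  proof (cases "k \<le> m")
    case False
    then show ?thesis using degree_power_le[of ?q m] by (simp add: coeff_eq_0 binomial_eq_0)
  qed (simp add: coeff_linear_poly_power)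
  ultimately show ?thesis by simp
qed

lemma less_p_power: "i < p ^ i"
proof -
  have "i < 2 ^ i" by (rule less_exp)
  also have "(2::nat) ^ i \<le> p ^ i" using p_ge3 by (intro power_mono) auto
  finally show ?thesis .
qed

lemma lucas_p_power: "(of_nat (n choose p ^ i) :: 'k) = of_nat (n div p ^ i)"
proof (induction n rule: less_induct)
  case (less n)
  show ?case
  proof (cases "n < p ^ i")
    case False
    define m where "m = n - p ^ i"
    have n: "n = m + p ^ i" using False by (simp add: m_def)
    show ?thesis using less.IH[of m] by (simp add: n choose_p_power_add)
  qed (simp add: binomial_eq_0)
qed

lemma of_nat_eq_0: "of_nat n = (0::'k) \<longleftrightarrow> p dvd n"
  using of_int_eq_0[of "int n"] by simp

end

locale prat = rat M + odd_char p "TYPE('k)" for M :: "('k::alg_closed_field, 'v) gmod" (structure) and p :: nat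

definition op :: "('k::field, 'v) gmod \<Rightarrow> nat \<Rightarrow> nat \<Rightarrow> nat \<Rightarrow> 'v \<Rightarrow> 'v" where
  "op M p i n = (eop M (p ^ i)) ^^ (if even n then 1 else p - 1)"

context prat
begin

section \<open>The generators u_i and their powers on a rational module\<close>

lemma eop_p_comp: "v \<in> carrier M \<Longrightarrow> eop M s (eop M (p ^ i) v) = of_nat ((s + p ^ i) div p ^ i) \<odot> eop M (s + p ^ i) v"
  by (simp add: eop_comp lucas_p_power)

text \<open>For p^l \<le> t < p^(l+1), composing the divided powers of exponents t - p^l and p^l
  gives t div p^l times the one of exponent t; this factor lies strictly between 0 and p and is
  invertible.\<close>

lemma eop_zero_if_p_power:
  assumes v: "v \<in> carrier M" and z: "\<And>i. eop M (p ^ i) v = \<zero>" and t: "t > 0"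
  shows "eop M t v = \<zero>"
proof -
  have "\<exists>i. t < p ^ i" using less_p_power by blast
  define i where "i = (LEAST i. t < p ^ i)"
  have i: "t < p ^ i" unfolding i_def by (rule LeastI_ex) fact
  have i0: "i \<noteq> 0" using i t by (cases i) auto
  have i1: "p ^ (i - 1) \<le> t" using not_less_Least[of "i - 1" "\<lambda>i. t < p ^ i"] i0 by (simp add: i_def[symmetric] not_less)
  define l where "l = i - 1"
  have l: "p ^ l \<le> t" "t < p * p ^ l" using i i1 i0 by (auto simp: l_def power_eq_if)
  have d: "t div p ^ l > 0" "t div p ^ l < p" using l by (auto simp: div_greater_zero_iff div_less_iff_less_mult)
  then have nz: "of_nat (t div p ^ l) \<noteq> (0::'k)" by (auto simp: of_nat_eq_0 dest: nat_dvd_not_less)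
  have "of_nat (t div p ^ l) \<odot> eop M t v = eop M (t - p ^ l) (eop M (p ^ l) v)"
    unfolding eop_p_comp[OF v] le_add_diff_inverse2[OF l(1)] ..
  also have "\<dots> = \<zero>" by (simp add: z)
  finally have "inverse (of_nat (t div p ^ l)) \<odot> (of_nat (t div p ^ l) \<odot> eop M t v) = \<zero>" by simp
  then show ?thesis using nz v by (simp add: smult_smult)
qed

lemma funpow_eop_cl [simp]: "v \<in> carrier M \<Longrightarrow> (eop M s ^^ r) v \<in> carrier M"
  by (induction r) auto

lemma op_cl [simp, intro]: "v \<in> carrier M \<Longrightarrow> op M p i n v \<in> carrier M"
  by (simp add: op_def)

lemma fnl_op: "\<phi> \<in> fnl M \<Longrightarrow> (\<lambda>v. \<phi> (op M p i n v)) \<in> fnl M"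
proof -
  have "(\<lambda>v. \<phi> ((eop M s ^^ r) v)) \<in> fnl M" if "\<phi> \<in> fnl M" for s r \<phi>
    using that
  proof (induction r arbitrary: \<phi>)
    case (Suc r)
    then show ?case using Suc.IH[OF fnl_eop[OF Suc.prems, of s]] by simp
  qed simp
  then show "\<phi> \<in> fnl M \<Longrightarrow> (\<lambda>v. \<phi> (op M p i n v)) \<in> fnl M" by (simp add: op_def)
qed

lemma op_add: "u \<in> carrier M \<Longrightarrow> v \<in> carrier M \<Longrightarrow> op M p i n (u \<oplus> v) = op M p i n u \<oplus> op M p i n v"
  by (rule fnl_eqI) (auto simp: fnl_add fnl_add[OF fnl_op])

lemma op_smult: "v \<in> carrier M \<Longrightarrow> op M p i n (c \<odot> v) = c \<odot> op M p i n v"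
  by (rule fnl_eqI) (auto simp: fnl_smult fnl_smult[OF fnl_op])

lemma op_zero [simp]: "op M p i n \<zero> = \<zero>"
  by (rule fnl_eqI) (auto simp: fnl_zero[OF fnl_op] fnl_zero)

lemma funpow_eop_commute: "v \<in> carrier M \<Longrightarrow> (eop M s ^^ r) ((eop M s' ^^ r') v) = (eop M s' ^^ r') ((eop M s ^^ r) v)"
proof (induction r)
  case (Suc r)
  have 1: "eop M s ((eop M s' ^^ r') w) = (eop M s' ^^ r') (eop M s w)" if "w \<in> carrier M" for w
  proof (induction r')
    case (Suc r')
    show ?case using Suc eop_commute[of "(eop M s' ^^ r') w" s s'] that by simp
  qed simp
  show ?case using Suc 1 by simp
qed simp

lemma op_commute: "v \<in> carrier M \<Longrightarrow> op M p i n (op M p l m v) = op M p l m (op M p i n v)"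
  unfolding op_def by (rule funpow_eop_commute)

lemma op_wt: "v \<in> wt M n \<Longrightarrow> op M p i m v \<in> wt M (n + 2 * int (stp p m i))"
proof -
  have "(eop M s ^^ r) v \<in> wt M (n + 2 * int (r * s))" if "v \<in> wt M n" for r s
    using that by (induction r) (auto dest: eop_wt[where t = s] simp: algebra_simps)
  from this[of "if even m then 1 else p - 1" "p ^ i"] show "v \<in> wt M n \<Longrightarrow> op M p i m v \<in> wt M (n + 2 * int (stp p m i))"
    by (auto simp: op_def stp_def)
qed

lemma op_finite: "v \<in> carrier M \<Longrightarrow> \<exists>D. \<forall>i\<ge>D. \<forall>n. op M p i n v = \<zero>"
proof -
  assume v: "v \<in> carrier M"
  obtain D where D: "\<forall>t\<ge>D. eop M t v = \<zero>" using eop_finite[OF v] by blast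
  have "op M p i n v = \<zero>" if "i \<ge> D" for i n
  proof -
    have "D \<le> p ^ i" using that less_p_power[of i] by simp
    then have "eop M (p ^ i) v = \<zero>" using D by blast
    moreover have "op M p i n v = (eop M (p ^ i) ^^ ((if even n then 1 else p - 1) - 1)) (eop M (p ^ i) v)"
      using p_ge3 by (simp add: op_def funpow_Suc_right[symmetric, THEN fun_cong, unfolded o_def] del: funpow.simps)
    moreover have "(eop M s ^^ r) \<zero> = \<zero>" for s r by (induction r) auto
    ultimately show ?thesis by simp
  qed
  then show ?thesis by blast
qed

text \<open>The vectors \<open>S \<kappa>\<close> form a string on which each u_i acts by the
  coefficients of a Weyl module; iteration multiplies consecutive coefficients, as in
  \<open>cf\<close>. Both the basis of a Weyl module and the monomials in b are such
  strings.\<close>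

lemma string_op:
  assumes S: "\<And>\<kappa> i. \<kappa> \<ge> L \<Longrightarrow> S \<kappa> \<in> carrier M"
    "\<And>\<kappa> i. \<kappa> \<ge> L \<Longrightarrow> eop M (p ^ i) (S \<kappa>) = of_int ((\<kappa> - 1) div int p ^ i + 1) \<odot> S (\<kappa> + int p ^ i)"
    and \<kappa>: "\<kappa> \<ge> (L::int)"
  shows "op M p i n (S \<kappa>) = cf p n i \<kappa> \<odot> S (\<kappa> + int (stp p n i))"
proof -
  have "(eop M (p ^ i) ^^ r) (S \<kappa>) = (\<Prod>t<r. of_int ((\<kappa> - 1) div int p ^ i + 1 + int t)) \<odot> S (\<kappa> + int r * int p ^ i)" for r
  proof (induction r)
    case (Suc r)
    have k: "\<kappa> + int r * int p ^ i \<ge> L" using \<kappa> by (simp add: add_increasing2)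
    have 1: "(\<kappa> + int r * int p ^ i - 1) div int p ^ i + 1 = (\<kappa> - 1) div int p ^ i + 1 + int r"
      using div_mult_self1[of "int p ^ i" "\<kappa> - 1" "int r"] by (simp add: algebra_simps)
    have 2: "\<kappa> + int r * int p ^ i + int p ^ i = \<kappa> + int (Suc r) * int p ^ i" by (simp add: algebra_simps)
    have "S (\<kappa> + int (Suc r) * int p ^ i) \<in> carrier M" using \<kappa> by (intro S(1)) (simp add: add_increasing2)
    then show ?case using S(1)[OF k] by (simp add: Suc eop_smult S(2)[OF k] 1 2 smult_smult del: of_nat_Suc of_int_add)
  qed (use S \<kappa> in simp)
  from this[of "if even n then 1 else p - 1"] show ?thesis
    by (auto simp: op_def cf_def stp_def)
qed

text \<open>The two operators are u_i and u_i^(p-1) in some order, and u_i^p is p! times a divided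
  power.\<close>

lemma op_square: 
  assumes v: "v \<in> carrier M"
  shows "op M p i n (op M p i (Suc n) v) = \<zero>"
proof -
  have *: "(eop M (p ^ i) ^^ r) v = of_nat (fact r) \<odot> eop M (r * p ^ i) v" for r
  proof (induction r)
    case (Suc r)
    have "eop M (p ^ i) (eop M (r * p ^ i) v) = eop M (r * p ^ i) (eop M (p ^ i) v)" by (rule eop_commute[OF v])
    also have "\<dots> = of_nat (Suc r) \<odot> eop M (r * p ^ i + p ^ i) v"
      using div_mult_self1_is_m[of "p ^ i" "Suc r"] p_pos by (simp only: eop_p_comp[OF v]) (simp add: add.commute)
    finally show ?case using v by (simp add: Suc eop_smult smult_smult algebra_simps)
  qed (use v in simp)
  have "op M p i n (op M p i (Suc n) v) = (eop M (p ^ i) ^^ p) v"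
  proof -
    have "(eop M (p ^ i) ^^ r) ((eop M (p ^ i) ^^ r') v) = (eop M (p ^ i) ^^ (r + r')) v" for r r'
      by (simp add: funpow_add)
    then show ?thesis using p_ge3 by (simp add: op_def del: funpow.simps One_nat_def)
  qed
  also have "\<dots> = of_nat (fact p) \<odot> eop M (p * p ^ i) v" by (rule *)
  also have "of_nat (fact p) = (0::'k)"
    unfolding of_nat_eq_0 using prime_p by (simp only: prime_dvd_fact_iff order_refl)
  finally show ?thesis using v by simp
qed

end

text \<open>Translates between an exponent x \<ge> 0 and the index -x used by
  \<open>cf\<close>.\<close>

lemma neg_div:
  assumes "(P::int) > 0"
  shows "(- x - 1) div P = - (x div P) - 1"
  using pos_mod_bound[OF assms, of x] pos_mod_sign[OF assms, of x]
  by (intro int_div_pos_eq[where r = "P - 1 - x mod P"]) (auto simp: algebra_simps)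

context odd_char
begin

text \<open>For odd p the step p^i is odd and (p - 1) p^i is even, so the sign depends only on the
  parity of \<open>n\<close>.\<close>

lemma sign_stp: "(- 1 :: 'k) ^ stp p n i = (- 1) ^ Suc n"
  using odd_p by (cases "even n") (auto simp: stp_def uminus_power_if)

end

context prat
begin

text \<open>The factors produced by moving u_i into a divided power are, up to order, the negatives
  of the factors of \<open>cf\<close> at the index of the new exponent. An odd number of them occurs
  for even \<open>n\<close> and an even number for odd \<open>n\<close>.\<close>

lemma eop_op:
  assumes v: "v \<in> carrier M"
  shows "eop M s (op M p i n v) = ((- 1) ^ Suc n * cf p n i (- int (s + stp p n i))) \<odot> eop M (s + stp p n i) v"
proof -
  let ?P = "p ^ i"
  have *: "eop M s ((eop M ?P ^^ r) v) = (\<Prod>t<r. of_nat (s div ?P + Suc t)) \<odot> eop M (s + r * ?P) v" for r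
  proof (induction r)
    case (Suc r)
    have "eop M s ((eop M ?P ^^ Suc r) v) = eop M ?P (eop M s ((eop M ?P ^^ r) v))"
      using eop_commute[OF funpow_eop_cl[OF v]] by simp
    also have "\<dots> = (\<Prod>t<r. of_nat (s div ?P + Suc t)) \<odot> eop M (s + r * ?P) (eop M ?P v)"
      using v eop_commute[OF v] by (simp only: Suc eop_smult eop_cl)
    also have "eop M (s + r * ?P) (eop M ?P v) = of_nat ((s + Suc r * ?P) div ?P) \<odot> eop M (s + Suc r * ?P) v"
      by (simp add: eop_p_comp[OF v] add_ac)
    also have "(s + Suc r * ?P) div ?P = s div ?P + Suc r" by (subst div_mult_self1) auto
    finally show ?case using v by (simp add: smult_smult mult.commute del: of_nat_Suc of_nat_add)
  qed (use v in simp)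
  have P: "int ?P > 0" by simp
  show ?thesis
  proof (cases "even n")
    case True
    have "(- int (s + ?P) - 1) div int ?P = - (int (s + ?P) div int ?P) - 1" by (rule neg_div[OF P])
    also have "int (s + ?P) div int ?P = int (s div ?P + 1)" unfolding zdiv_int[symmetric] by simp
    finally have "(- int (s + ?P) - 1) div int ?P + 1 = - int (s div ?P + 1)" by (simp only: diff_add_cancel)
    then have "cf p n i (- int (s + stp p n i)) = - (of_nat (s div ?P + 1) :: 'k)"
      using True by (simp only: cf_def stp_def if_True mult_1 of_nat_power) simp
    then show ?thesis using *[of 1] True by (simp add: op_def stp_def add.commute)
  next
    case False
    let ?r = "p - 1"
    have "(- int (s + ?r * ?P) - 1) div int ?P = - (int (s + ?r * ?P) div int ?P) - 1" by (rule neg_div[OF P])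
    also have "int (s + ?r * ?P) div int ?P = int (s div ?P + ?r)" unfolding zdiv_int[symmetric] by simp
    finally have d: "(- int (s + ?r * ?P) - 1) div int ?P + 1 = - int (s div ?P + ?r)" by (simp only: diff_add_cancel)
    have "cf p n i (- int (s + stp p n i)) = (\<Prod>t<?r. of_int (- int (s div ?P + ?r) + int t) :: 'k)"
      using False by (simp only: cf_def stp_def if_False d[symmetric]) simp
    \<comment> \<open>The factors of \<open>cf\<close> run through the same numbers in reverse
      order.\<close>
    also have "\<dots> = (\<Prod>t<?r. - of_nat (s div ?P + Suc (?r - Suc t)))"
      by (intro prod.cong refl) (auto simp: of_nat_diff)
    also have "\<dots> = (- 1) ^ ?r * (\<Prod>t<?r. of_nat (s div ?P + Suc (?r - Suc t)))"
      by (simp only: prod_uminus card_lessThan)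
    also have "(- 1 :: 'k) ^ ?r = 1" using odd_p by simp
    also have "(\<Prod>t<?r. of_nat (s div ?P + Suc (?r - Suc t))) = (\<Prod>t<?r. of_nat (s div ?P + Suc t) :: 'k)"
      by (rule prod.nat_diff_reindex)
    finally show ?thesis using *[of ?r] False by (simp add: op_def stp_def)
  qed
qed

end

locale hfamp = hfam M H + odd_char p "TYPE('k)"
  for M :: "('k::alg_closed_field, 'v) gmod" (structure) and H :: "nat \<Rightarrow> nat \<Rightarrow> nat \<Rightarrow> 'v \<Rightarrow> 'v" and p :: nat

sublocale hfamp \<subseteq> prat M p by unfold_locales

context hfamp
begin

text \<open>On monomials in b the coefficient of u_i is j div p^i, while the index -j would give its
  negative. Rescaling by (-1)^j turns the monomials with fixed A + j and k into a string for
  \<open>string_op\<close>; the rescaling is undone at the end.\<close>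

lemma op_H:
  assumes w: "w \<in> carrier M"
  shows "op M p i n (H A j k w) = (if stp p n i \<le> j
    then ((- 1) ^ Suc n * cf p n i (- int j)) \<odot> H (A + stp p n i) (j - stp p n i) k w else \<zero>)"
proof -
  \<comment> \<open>The exponent of b is minus the index, so the string is 0 for positive indices;
    it starts at -(A + j), where the exponent of a is 0.\<close>
  define S where "S \<kappa> = (if \<kappa> > 0 then \<zero> else (- 1) ^ nat (- \<kappa>) \<odot> H (nat (int (A + j) + \<kappa>)) (nat (- \<kappa>)) k w)" for \<kappa>
  have S: "S (- int j') = (- 1) ^ j' \<odot> H (A + j - j') j' k w" if "j' \<le> A + j" for j'
    using that by (simp add: S_def nat_diff_distrib' nat_int_add flip: of_nat_diff)
  have "op M p i n (S (- int j)) = cf p n i (- int j) \<odot> S (- int j + int (stp p n i))"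
  proof (rule string_op[of "- int (A + j)"])
    show "S \<kappa> \<in> carrier M" for \<kappa> using w by (simp add: S_def)
    fix \<kappa> i assume \<kappa>: "- int (A + j) \<le> \<kappa>"
    show "eop M (p ^ i) (S \<kappa>) = of_int ((\<kappa> - 1) div int p ^ i + 1) \<odot> S (\<kappa> + int p ^ i)"
    proof (cases "\<kappa> > 0")
      case True
      then show ?thesis by (simp add: S_def add_pos_nonneg)
    next
      case False
      define j' where "j' = nat (- \<kappa>)"
      have j': "\<kappa> = - int j'" "j' \<le> A + j" using False \<kappa> by (auto simp: j'_def)
      have "(\<kappa> - 1) div int p ^ i + 1 = - int (j' div p ^ i)"
        using neg_div[of "int p ^ i" "int j'"] by (simp add: j'(1) zdiv_int)
      then have c: "of_int ((\<kappa> - 1) div int p ^ i + 1) = - (of_nat (j' div p ^ i) :: 'k)"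
        by simp
      show ?thesis
      proof (cases "p ^ i \<le> j'")
        case True
        have 1: "\<kappa> + int p ^ i = - int (j' - p ^ i)" using True by (simp add: j'(1) of_nat_diff)
        have 2: "A + j - j' + p ^ i = A + j - (j' - p ^ i)" using True j' by simp
        have "(- 1 :: 'k) ^ p ^ i = - 1" using odd_p by simp
        then have 3: "(- 1 :: 'k) ^ j' = - ((- 1) ^ (j' - p ^ i))"
          using power_add[of "- 1 :: 'k" "j' - p ^ i" "p ^ i"] True by simp
        have "j' - p ^ i \<le> A + j" using j'(2) by simp
        then have "S (\<kappa> + int p ^ i) = (- 1) ^ (j' - p ^ i) \<odot> H (A + j - j' + p ^ i) (j' - p ^ i) k w"
          unfolding 1 2 by (rule S)
        moreover have "S \<kappa> = (- 1) ^ j' \<odot> H (A + j - j') j' k w" unfolding j'(1) by (rule S[OF j'(2)])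
        ultimately show ?thesis unfolding c using True w
          by (simp only: eop_smult H_eop H_cl smult_smult lucas_p_power 3 if_True smult_cl) (simp add: mult.commute)
      next
        case F: False
        then have "\<kappa> + int p ^ i > 0" unfolding j'(1) of_nat_power[symmetric] by linarith
        then show ?thesis unfolding c using F w j' by (simp add: S_def eop_smult H_eop)
      qed
    qed
  qed simp
  also have "S (- int j) = (- 1) ^ j \<odot> H A j k w" by (simp add: S)
  finally have e: "(- 1) ^ j \<odot> op M p i n (H A j k w) = cf p n i (- int j) \<odot> S (- int j + int (stp p n i))"
    using w by (simp add: op_smult)
  have "op M p i n (H A j k w) = (- 1) ^ j \<odot> ((- 1) ^ j \<odot> op M p i n (H A j k w))"
    using w by (simp add: smult_smult flip: power_add)
  also have "\<dots> = ((- 1) ^ j * cf p n i (- int j)) \<odot> S (- int j + int (stp p n i))"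
    unfolding e using w by (simp add: S_def smult_smult)
  finally have e: "op M p i n (H A j k w) = ((- 1) ^ j * cf p n i (- int j)) \<odot> S (- int j + int (stp p n i))" .
  show ?thesis
  proof (cases "stp p n i \<le> j")
    case True
    let ?s = "stp p n i"
    have 1: "- int j + int ?s = - int (j - ?s)" using True by simp
    have 2: "A + j - (j - ?s) = A + ?s" using True by simp
    have 4: "(- 1 :: 'k) ^ m * (- 1) ^ m = 1" for m by (simp flip: power_add)
    have "(- 1 :: 'k) ^ j = (- 1) ^ (j - ?s) * (- 1) ^ ?s" using True by (simp flip: power_add)
    then have "(- 1 :: 'k) ^ j * c * (- 1) ^ (j - ?s) = ((- 1) ^ (j - ?s) * (- 1) ^ (j - ?s)) * ((- 1) ^ ?s * c)" for c
      by (simp only: mult_ac)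
    then have 3: "(- 1 :: 'k) ^ j * c * (- 1) ^ (j - ?s) = (- 1) ^ Suc n * c" for c
      by (simp only: 4 sign_stp mult_1)
    have "j - ?s \<le> A + j" by simp
    then have "S (- int j + int ?s) = (- 1) ^ (j - ?s) \<odot> H (A + ?s) (j - ?s) k w"
      unfolding 1 2[symmetric] by (rule S)
    then show ?thesis unfolding e using True w by (simp only: smult_smult H_cl 3 if_True)
  next
    case False
    then show ?thesis unfolding e by (simp add: S_def)
  qed
qed

end

section \<open>Cochains\<close>

text \<open>The algebra of divided powers is \<open>\<Otimes>\<^sub>i k[u\<^sub>i]/(u\<^sub>i\<^sup>p)\<close>, and \<open>op M p i n\<close> is \<open>u\<^sub>i\<close> or \<open>u\<^sub>i\<^sup>p\<^sup>-\<^sup>1\<close>.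
  Hence \<open>coch\<close> and \<open>cdif\<close> form the weight \<open>b\<close> part of the complex computing the
  cohomology of this algebra with coefficients in \<open>M\<close>.\<close>

definition coch :: "('k::field, 'v) gmod \<Rightarrow> nat \<Rightarrow> nat \<Rightarrow> int \<Rightarrow> ((nat \<Rightarrow> nat) \<Rightarrow> 'v) set" where
  "coch M p q b = {c. (\<forall>\<nu>. c \<nu> \<in> wt M (b + 2 * int (mdeg p \<nu>))) \<and>
     (\<forall>\<nu>. \<not> (fsupp \<nu> \<and> msize \<nu> = q) \<longrightarrow> c \<nu> = \<zero>\<^bsub>M\<^esub>) \<and> finite {\<nu>. c \<nu> \<noteq> \<zero>\<^bsub>M\<^esub>}}"

definition cdif :: "('k::field, 'v) gmod \<Rightarrow> nat \<Rightarrow> ((nat \<Rightarrow> nat) \<Rightarrow> 'v) \<Rightarrow> (nat \<Rightarrow> nat) \<Rightarrow> 'v" where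
  "cdif M p c \<nu> = finsum M (\<lambda>i. msign \<nu> i \<odot>\<^bsub>M\<^esub> op M p i (\<nu> i - 1) (c (dec \<nu> i))) {i. \<nu> i \<noteq> 0}"

definition cadd :: "('k::field, 'v) gmod \<Rightarrow> 'k \<Rightarrow> ((nat \<Rightarrow> nat) \<Rightarrow> 'v) \<Rightarrow> ((nat \<Rightarrow> nat) \<Rightarrow> 'v) \<Rightarrow> (nat \<Rightarrow> nat) \<Rightarrow> 'v" where
  "cadd M s c c' \<nu> = c \<nu> \<oplus>\<^bsub>M\<^esub> s \<odot>\<^bsub>M\<^esub> c' \<nu>"

text \<open>Each multi-index in \<open>A\<close> can be lowered in only finitely many
  coordinates.\<close>

lemma finite_inc_image:
  assumes "finite A" "\<And>\<nu>. \<nu> \<in> B \<Longrightarrow> inc \<nu> (a \<nu>) \<in> A" "\<And>\<nu>. \<nu> \<in> A \<Longrightarrow> fsupp \<nu>"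
  shows "finite B"
proof (rule finite_subset)
  show "B \<subseteq> (\<Union>\<nu>\<in>A. dec \<nu> ` {i. \<nu> i \<noteq> 0})"
  proof
    fix \<nu> assume "\<nu> \<in> B"
    then have "inc \<nu> (a \<nu>) \<in> A" by (rule assms)
    moreover have "\<nu> = dec (inc \<nu> (a \<nu>)) (a \<nu>)" "inc \<nu> (a \<nu>) (a \<nu>) \<noteq> 0" by (simp_all add: inc_def dec_def)
    ultimately show "\<nu> \<in> (\<Union>\<nu>\<in>A. dec \<nu> ` {i. \<nu> i \<noteq> 0})" by blast
  qed
qed (use assms in \<open>auto simp: fsupp_def\<close>)

lemma antisym_sum_zero:
  fixes f :: "'a \<Rightarrow> 'a \<Rightarrow> 'k::field"
  assumes "finite A" "\<And>x y. x \<in> A \<Longrightarrow> y \<in> A \<Longrightarrow> f y x = - f x y" "(2 :: 'k) \<noteq> 0"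
  shows "(\<Sum>x\<in>A. \<Sum>y\<in>A. f x y) = 0"
proof -
  have "(\<Sum>x\<in>A. \<Sum>y\<in>A. f x y) = (\<Sum>y\<in>A. \<Sum>x\<in>A. f x y)" by (rule sum.swap)
  also have "\<dots> = (\<Sum>y\<in>A. \<Sum>x\<in>A. - f y x)" using assms(2) by (intro sum.cong refl)
  also have "\<dots> = - (\<Sum>x\<in>A. \<Sum>y\<in>A. f x y)" by (simp add: sum_negf)
  finally have "2 * (\<Sum>x\<in>A. \<Sum>y\<in>A. f x y) = 0" by (simp add: eq_neg_iff_add_eq_0)
  then show ?thesis using assms(3) by simp
qed

context rat
begin

lemma wt_finsum:
  assumes A: "finite A" and f: "\<And>a. a \<in> A \<Longrightarrow> f a \<in> wt M n"
  shows "finsum M f A \<in> wt M n"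
  using assms
proof (induction A rule: finite_induct)
  case (insert a A)
  then show ?case by (subst finsum_insert) (auto intro: wt_add wt_carrier)
qed simp

end

context prat
begin

section \<open>The differential on cochains\<close>

lemma coch_wt: "c \<in> coch M p q b \<Longrightarrow> c \<nu> \<in> wt M (b + 2 * int (mdeg p \<nu>))"
  by (simp add: coch_def)

lemma coch_cl: "c \<in> coch M p q b \<Longrightarrow> c \<nu> \<in> carrier M"
  by (rule wt_carrier[OF coch_wt])

lemma coch_out: "c \<in> coch M p q b \<Longrightarrow> \<not> (fsupp \<nu> \<and> msize \<nu> = q) \<Longrightarrow> c \<nu> = \<zero>"
  by (simp add: coch_def)

lemma coch_fin: "c \<in> coch M p q b \<Longrightarrow> finite {\<nu>. c \<nu> \<noteq> \<zero>}"
  by (simp add: coch_def)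

lemma fnl_cdif:
  assumes "\<phi> \<in> fnl M" "\<And>\<nu>. c \<nu> \<in> carrier M" "fsupp \<nu>"
  shows "\<phi> (cdif M p c \<nu>) = (\<Sum>i | \<nu> i \<noteq> 0. msign \<nu> i * \<phi> (op M p i (\<nu> i - 1) (c (dec \<nu> i))))"
  using assms unfolding cdif_def by (subst fnl_finsum) (auto simp: fsupp_def fnl_smult)

lemma cdif_cl: "(\<And>\<nu>. c \<nu> \<in> carrier M) \<Longrightarrow> cdif M p c \<nu> \<in> carrier M"
  unfolding cdif_def by (rule finsum_closed) auto

lemma cdif_infinite: "\<not> fsupp \<nu> \<Longrightarrow> cdif M p c \<nu> = \<zero>"
  unfolding cdif_def fsupp_def by simp

text \<open>The support stays finite because each of the finitely many nonzero values is killed by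
  all but finitely many u_i.\<close>

lemma cdif_coch:
  assumes c: "c \<in> coch M p q b"
  shows "cdif M p c \<in> coch M p (Suc q) b"
  unfolding coch_def
proof (intro CollectI conjI allI impI)
  note cl = coch_cl[OF c]
  fix \<nu>
  show "cdif M p c \<nu> \<in> wt M (b + 2 * int (mdeg p \<nu>))"
  proof (cases "fsupp \<nu>")
    case True
    show ?thesis unfolding cdif_def
    proof (intro wt_finsum wt_smult)
      show "finite {i. \<nu> i \<noteq> 0}" using True by (simp add: fsupp_def)
      fix i assume "i \<in> {i. \<nu> i \<noteq> 0}"
      then show "op M p i (\<nu> i - 1) (c (dec \<nu> i)) \<in> wt M (b + 2 * int (mdeg p \<nu>))"
        using op_wt[OF coch_wt[OF c, of "dec \<nu> i"], of i "\<nu> i - 1"] mdeg_dec[OF True, of p i] by (simp add: algebra_simps)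
    qed
  qed (simp add: cdif_infinite)
  show "cdif M p c \<nu> = \<zero>" if "\<not> (fsupp \<nu> \<and> msize \<nu> = Suc q)"
  proof (cases "fsupp \<nu>")
    case True
    have "c (dec \<nu> i) = \<zero>" if "\<nu> i \<noteq> 0" for i
      using msize_dec[OF True that] \<open>\<not> (fsupp \<nu> \<and> msize \<nu> = Suc q)\<close> True by (intro coch_out[OF c]) auto
    then show ?thesis
      by (intro fnl_eqI) (auto simp: fnl_cdif True cl cdif_cl fnl_zero)
  qed (simp add: cdif_infinite)
next
  note cl = coch_cl[OF c]
  obtain D where D: "\<And>\<nu> i n. i \<ge> D \<nu> \<Longrightarrow> op M p i n (c \<nu>) = \<zero>" using op_finite[OF cl] by metis
  show "finite {\<nu>. cdif M p c \<nu> \<noteq> \<zero>}"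
  proof (rule finite_subset)
    show "{\<nu>. cdif M p c \<nu> \<noteq> \<zero>} \<subseteq> (\<Union>\<nu>'\<in>{\<nu>. c \<nu> \<noteq> \<zero>}. inc \<nu>' ` {..<D \<nu>'})"
    proof (rule subsetI, rule ccontr)
      fix \<nu> assume "\<nu> \<in> {\<nu>. cdif M p c \<nu> \<noteq> \<zero>}" and n: "\<nu> \<notin> (\<Union>\<nu>'\<in>{\<nu>. c \<nu> \<noteq> \<zero>}. inc \<nu>' ` {..<D \<nu>'})"
      then have fs: "fsupp \<nu>" and nz: "cdif M p c \<nu> \<noteq> \<zero>" using cdif_infinite by auto
      have "op M p i (\<nu> i - 1) (c (dec \<nu> i)) = \<zero>" if "\<nu> i \<noteq> 0" for i
      proof (rule ccontr)
        assume a: "op M p i (\<nu> i - 1) (c (dec \<nu> i)) \<noteq> \<zero>"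
        then have "c (dec \<nu> i) \<noteq> \<zero>" "i < D (dec \<nu> i)" using D by (auto simp: not_less[symmetric])
        moreover have "\<nu> = inc (dec \<nu> i) i" using that by simp
        ultimately show False using n by blast
      qed
      then have "cdif M p c \<nu> = \<zero>" by (intro fnl_eqI) (auto simp: fnl_cdif fs cl cdif_cl fnl_zero)
      then show False using nz by simp
    qed
  qed (use coch_fin[OF c] in auto)
qed

lemma cadd_coch:
  assumes c: "c \<in> coch M p q b" and c': "c' \<in> coch M p q b"
  shows "cadd M s c c' \<in> coch M p q b"
  unfolding coch_def
proof (intro CollectI conjI allI impI)
  show "cadd M s c c' \<nu> \<in> wt M (b + 2 * int (mdeg p \<nu>))" for \<nu>
    unfolding cadd_def by (intro wt_add wt_smult coch_wt[OF c] coch_wt[OF c'])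
  show "cadd M s c c' \<nu> = \<zero>" if "\<not> (fsupp \<nu> \<and> msize \<nu> = q)" for \<nu>
    unfolding cadd_def coch_out[OF c that] coch_out[OF c' that] by simp
  have "{\<nu>. cadd M s c c' \<nu> \<noteq> \<zero>} \<subseteq> {\<nu>. c \<nu> \<noteq> \<zero>} \<union> {\<nu>. c' \<nu> \<noteq> \<zero>}"
    by (auto simp: cadd_def)
  then show "finite {\<nu>. cadd M s c c' \<nu> \<noteq> \<zero>}"
    by (rule finite_subset) (use coch_fin[OF c] coch_fin[OF c'] in simp)
qed

lemma cdif_cadd:
  assumes c: "c \<in> coch M p q b" and c': "c' \<in> coch M p q' b'"
  shows "cdif M p (cadd M s c c') = cadd M s (cdif M p c) (cdif M p c')"
proof
  fix \<nu>
  have cl: "cadd M s c c' \<nu> \<in> carrier M" for \<nu> using coch_cl[OF c] coch_cl[OF c'] by (simp add: cadd_def)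
  note cls = cl coch_cl[OF c] coch_cl[OF c']
  show "cdif M p (cadd M s c c') \<nu> = cadd M s (cdif M p c) (cdif M p c') \<nu>"
  proof (cases "fsupp \<nu>")
    case True
    have "\<phi> (cdif M p (cadd M s c c') \<nu>) = \<phi> (cdif M p c \<nu> \<oplus> s \<odot> cdif M p c' \<nu>)" if "\<phi> \<in> fnl M" for \<phi>
      using that cls True
      by (simp add: fnl_add fnl_smult fnl_cdif cdif_cl cadd_def op_add op_smult distrib_left sum.distrib sum_distrib_left mult_ac)
    then show ?thesis using cls by (intro fnl_eqI) (auto simp: cadd_def cdif_cl)
  qed (simp add: cdif_infinite cadd_def)
qed

text \<open>Lowering the smaller coordinate flips the sign attached to the larger one, but not
  conversely.\<close>

lemma msign_dec_swap:
  assumes "l \<noteq> i" "\<nu> i \<noteq> 0" "\<nu> l \<noteq> 0"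
  shows "msign \<nu> l * msign (dec \<nu> l) i = - (msign \<nu> i * msign (dec \<nu> i) l :: 'k)"
proof -
  have *: "msign \<nu> l * msign (dec \<nu> l) i = - (msign \<nu> i * msign (dec \<nu> i) l :: 'k)"
    if "l < i" "\<nu> l \<noteq> 0" for i l
  proof -
    have 1: "msign (dec \<nu> i) l = (msign \<nu> l :: 'k)"
      using that by (simp add: msign_def dec_def)
    have "(\<Sum>x<i. \<nu> x) = Suc (\<Sum>x<i. dec \<nu> l x)"
      using that by (subst (1 2) sum.remove[of _ l]) (auto simp: dec_def intro!: sum.cong)
    then have 2: "msign \<nu> i = - (msign (dec \<nu> l) i :: 'k)" by (simp add: msign_def)
    show ?thesis unfolding 1 2 by simp
  qed
  show ?thesis
  proof (cases "l < i")
    case True then show ?thesis using * assms by simp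
  next
    case False then show ?thesis using *[of i l] assms by (simp add: eq_neg_iff_add_eq_0 add.commute)
  qed
qed

lemma two_neq_0: "(2 :: 'k) \<noteq> 0"
  using of_nat_eq_0[of 2] p_ge3 by (auto dest: dvd_imp_le)

text \<open>Diagonal terms vanish by u_i^p = 0; the others cancel in pairs, as the operators commute
  and the signs anticommute.\<close>

lemma cdif_cdif:
  assumes c: "c \<in> coch M p q b"
  shows "cdif M p (cdif M p c) \<nu> = \<zero>"
proof (cases "fsupp \<nu>")
  case fs: True
  note cl = coch_cl[OF c] and cl' = cdif_cl[OF coch_cl[OF c]]
  show ?thesis
  proof (rule fnl_eqI)
    fix \<phi> assume \<phi>: "\<phi> \<in> fnl M"
    define T where "T i l = (if i = l then 0 else msign \<nu> i * msign (dec \<nu> i) l *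
      \<phi> (op M p i (\<nu> i - 1) (op M p l (\<nu> l - 1) (c (dec (dec \<nu> i) l)))))" for i l
    have fin: "finite {i. \<nu> i \<noteq> 0}" using fs by (simp add: fsupp_def)
    have "\<phi> (cdif M p (cdif M p c) \<nu>) = (\<Sum>i | \<nu> i \<noteq> 0. msign \<nu> i * \<phi> (op M p i (\<nu> i - 1) (cdif M p c (dec \<nu> i))))"
      by (rule fnl_cdif[OF \<phi> cl' fs])
    also have "\<dots> = (\<Sum>i | \<nu> i \<noteq> 0. \<Sum>l | \<nu> l \<noteq> 0. T i l)"
    proof (intro sum.cong refl)
      fix i assume "i \<in> {i. \<nu> i \<noteq> 0}"
      then have i: "\<nu> i \<noteq> 0" by simp
      let ?d = "dec \<nu> i"
      have "\<phi> (op M p i (\<nu> i - 1) (cdif M p c ?d)) =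
          (\<Sum>l | ?d l \<noteq> 0. msign ?d l * \<phi> (op M p i (\<nu> i - 1) (op M p l (?d l - 1) (c (dec ?d l)))))"
        by (rule fnl_cdif[OF fnl_op[OF \<phi>] cl fsupp_dec[OF fs]])
      also have "\<dots> = (\<Sum>l | \<nu> l \<noteq> 0. if ?d l \<noteq> 0 then msign ?d l * \<phi> (op M p i (\<nu> i - 1) (op M p l (?d l - 1) (c (dec ?d l)))) else 0)"
        using fin by (intro sum.mono_neutral_cong_left) (auto simp: dec_def)
      finally have e: "\<phi> (op M p i (\<nu> i - 1) (cdif M p c ?d)) = (\<Sum>l | \<nu> l \<noteq> 0.
        if ?d l \<noteq> 0 then msign ?d l * \<phi> (op M p i (\<nu> i - 1) (op M p l (?d l - 1) (c (dec ?d l)))) else 0)" .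
      show "msign \<nu> i * \<phi> (op M p i (\<nu> i - 1) (cdif M p c ?d)) = (\<Sum>l | \<nu> l \<noteq> 0. T i l)"
        unfolding e sum_distrib_left
      proof (intro sum.cong refl)
        fix l assume "l \<in> {l. \<nu> l \<noteq> 0}"
        show "msign \<nu> i * (if ?d l \<noteq> 0 then msign ?d l * \<phi> (op M p i (\<nu> i - 1) (op M p l (?d l - 1) (c (dec ?d l)))) else 0) = T i l"
        proof (cases "i = l")
          case True
          show ?thesis
          proof (cases "\<nu> i = 1")
            case False
            then have "\<nu> i - 1 = Suc (\<nu> i - 1 - 1)" using i by simp
            then have "op M p i (\<nu> i - 1) (op M p i (\<nu> i - 1 - 1) v) = \<zero>" if "v \<in> carrier M" for v
              using op_square[OF that, of i "\<nu> i - 1 - 1"] op_commute[OF that, of i "\<nu> i - 1 - 1" i "Suc (\<nu> i - 1 - 1)"] by simp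
            then show ?thesis using True cl \<phi> by (simp add: T_def dec_def fnl_zero)
          qed (use True in \<open>simp add: T_def dec_def\<close>)
        qed (use \<open>l \<in> {l. \<nu> l \<noteq> 0}\<close> in \<open>auto simp: T_def dec_def\<close>)
      qed
    qed
    also have "\<dots> = 0"
    proof (rule antisym_sum_zero[OF fin _ two_neq_0])
      fix i l assume "i \<in> {i. \<nu> i \<noteq> 0}" "l \<in> {i. \<nu> i \<noteq> 0}"
      then have "l \<noteq> i \<Longrightarrow> msign \<nu> l * msign (dec \<nu> l) i = - (msign \<nu> i * msign (dec \<nu> i) l :: 'k)"
        by (intro msign_dec_swap) auto
      then show "T l i = - T i l"
        using op_commute[OF cl, of l "\<nu> l - 1" i "\<nu> i - 1"] by (auto simp: T_def dec_dec_commute[of \<nu> l i])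
    qed
    finally show "\<phi> (cdif M p (cdif M p c) \<nu>) = \<phi> \<zero>" using \<phi> by (simp add: fnl_zero)
  qed (use cl' in \<open>auto intro: cdif_cl\<close>)
qed (simp add: cdif_infinite)

text \<open>Cocycles of degree 0 are U-invariants: the unit multi-indices test all u_i, and these
  suffice by \<open>eop_zero_if_p_power\<close>.\<close>

lemma cdif_zero_size_0:
  assumes c: "c \<in> coch M p 0 b" and z: "\<And>\<nu>. cdif M p c \<nu> = \<zero>" and t: "t > 0"
  shows "eop M t (c (\<lambda>_. 0)) = \<zero>"
proof (rule eop_zero_if_p_power[OF coch_cl[OF c] _ t])
  fix i :: nat
  define \<nu> where "\<nu> = (\<lambda>_ :: nat. 0)(i := 1 :: nat)"
  have s: "{l. \<nu> l \<noteq> 0} = {i}" "dec \<nu> i = (\<lambda>_. 0)" "\<nu> i = 1" by (auto simp: \<nu>_def dec_def)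
  have "\<phi> (eop M (p ^ i) (c (\<lambda>_. 0))) = \<phi> \<zero>" if \<phi>: "\<phi> \<in> fnl M" for \<phi>
  proof -
    have "\<phi> (cdif M p c \<nu>) = (\<Sum>i | \<nu> i \<noteq> 0. msign \<nu> i * \<phi> (op M p i (\<nu> i - 1) (c (dec \<nu> i))))"
      by (rule fnl_cdif[OF \<phi> coch_cl[OF c]]) (unfold fsupp_def s, simp)
    then have "\<phi> (cdif M p c \<nu>) = msign \<nu> i * \<phi> (op M p i 0 (c (\<lambda>_. 0)))"
      unfolding s(1) by (simp add: s(2) s(3))
    then show ?thesis using z[of \<nu>] by (simp add: msign_def op_def fnl_zero[OF \<phi>])
  qed
  then show "eop M (p ^ i) (c (\<lambda>_. 0)) = \<zero>" using coch_cl[OF c] by (intro fnl_eqI) auto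
qed

end

section \<open>Cochains under homomorphisms\<close>

locale prat_hom = rat_hom M N h + odd_char p "TYPE('k)"
  for M :: "('k::alg_closed_field, 'v) gmod" and N :: "('k, 'w) gmod" and h :: "'v \<Rightarrow> 'w" and p :: nat

sublocale prat_hom \<subseteq> P: prat M p by unfold_locales
sublocale prat_hom \<subseteq> Q: prat N p by unfold_locales

context prat_hom
begin

lemma h_op: "v \<in> carrier M \<Longrightarrow> h (op M p i n v) = op N p i n (h v)"
proof -
  have "h ((eop M s ^^ r) v) = (eop N s ^^ r) (h v)" if "v \<in> carrier M" for r s
    using that by (induction r) (auto simp: h_eop)
  then show "v \<in> carrier M \<Longrightarrow> h (op M p i n v) = op N p i n (h v)" by (simp add: op_def)
qed

lemma h_coch:
  assumes c: "c \<in> coch M p q b"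
  shows "(\<lambda>\<nu>. h (c \<nu>)) \<in> coch N p q b"
  unfolding coch_def
proof (intro CollectI conjI allI impI)
  show "h (c \<nu>) \<in> wt N (b + 2 * int (mdeg p \<nu>))" for \<nu> by (intro h_wt P.coch_wt[OF c])
  show "h (c \<nu>) = \<zero>\<^bsub>N\<^esub>" if "\<not> (fsupp \<nu> \<and> msize \<nu> = q)" for \<nu> using P.coch_out[OF c that] by simp
  have "{\<nu>. h (c \<nu>) \<noteq> \<zero>\<^bsub>N\<^esub>} \<subseteq> {\<nu>. c \<nu> \<noteq> \<zero>\<^bsub>M\<^esub>}" by auto
  then show "finite {\<nu>. h (c \<nu>) \<noteq> \<zero>\<^bsub>N\<^esub>}" by (rule finite_subset) (rule P.coch_fin[OF c])
qed

lemma h_cdif: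
  assumes c: "\<And>\<nu>. c \<nu> \<in> carrier M"
  shows "h (cdif M p c \<nu>) = cdif N p (\<lambda>\<nu>. h (c \<nu>)) \<nu>"
proof (cases "fsupp \<nu>")
  case True
  have cN: "h (c \<nu>) \<in> carrier N" for \<nu> using c by simp
  show ?thesis
    by (rule N.fnl_eqI)
       (use True c cN in \<open>auto simp: Q.fnl_cdif P.fnl_cdif[OF fnl_h] P.cdif_cl Q.cdif_cl h_op\<close>)
qed (simp add: P.cdif_infinite Q.cdif_infinite)

lemma h_cadd:
  assumes "c \<in> coch M p q b" "c' \<in> coch M p q' b'"
  shows "h (cadd M s c c' \<nu>) = cadd N s (\<lambda>\<nu>. h (c \<nu>)) (\<lambda>\<nu>. h (c' \<nu>)) \<nu>"
  using P.coch_cl[OF assms(1)] P.coch_cl[OF assms(2)] by (simp add: cadd_def h_add h_smult)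

text \<open>Arbitrary preimages are projected to the prescribed weight, which is compatible with
  \<open>h\<close>. Zero is lifted to zero to keep the support finite.\<close>

lemma coch_lift:
  assumes c: "c \<in> coch N p q b" and im: "\<And>\<nu>. c \<nu> \<in> h ` carrier M"
  obtains c' where "c' \<in> coch M p q b" "\<And>\<nu>. h (c' \<nu>) = c \<nu>"
proof -
  define u where "u \<nu> = (SOME u. u \<in> carrier M \<and> h u = c \<nu>)" for \<nu>
  have "u \<nu> \<in> carrier M \<and> h (u \<nu>) = c \<nu>" for \<nu> unfolding u_def by (rule someI_ex) (use im[of \<nu>] in auto)
  then have u: "u \<nu> \<in> carrier M" "h (u \<nu>) = c \<nu>" for \<nu> by auto
  define c' where "c' \<nu> = (if c \<nu> = \<zero>\<^bsub>N\<^esub> then \<zero>\<^bsub>M\<^esub> else pr M (b + 2 * int (mdeg p \<nu>)) (u \<nu>))" for \<nu>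
  have "c' \<in> coch M p q b"
    unfolding coch_def
  proof (intro CollectI conjI allI impI)
    show "c' \<nu> \<in> wt M (b + 2 * int (mdeg p \<nu>))" for \<nu> using M.pr_wt[OF u(1)] by (simp add: c'_def)
    show "c' \<nu> = \<zero>\<^bsub>M\<^esub>" if "\<not> (fsupp \<nu> \<and> msize \<nu> = q)" for \<nu> using Q.coch_out[OF c that] by (simp add: c'_def)
    have "{\<nu>. c' \<nu> \<noteq> \<zero>\<^bsub>M\<^esub>} \<subseteq> {\<nu>. c \<nu> \<noteq> \<zero>\<^bsub>N\<^esub>}" by (auto simp: c'_def)
    then show "finite {\<nu>. c' \<nu> \<noteq> \<zero>\<^bsub>M\<^esub>}" by (rule finite_subset) (rule Q.coch_fin[OF c])
  qed
  moreover have "h (c' \<nu>) = c \<nu>" for \<nu>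
    using h_pr[OF u(1)] N.pr_of_wt[OF Q.coch_wt[OF c]] by (simp add: c'_def u(2))
  ultimately show ?thesis by (rule that)
qed

end

context hfam
begin

lemma H_zero [simp]: "H A j k \<zero> = \<zero>"
  by (rule fnl_eqI) (auto simp: fnl_zero[OF fnl_H] fnl_zero)

text \<open>The bounds for j and k are separated because j will be shifted by the degree of a
  multi-index and k will not.\<close>

lemma H_rep2:
  assumes v: "v \<in> wt M n" and n: "0 \<le> n"
  shows "\<exists>K0. \<forall>K1\<ge>K0. \<forall>K2\<ge>K0. \<forall>\<phi>\<in>fnl M. \<phi> v = (\<Sum>j\<le>K1. \<Sum>k\<le>K2.
      if 2 * int k \<le> n + 2 * int j then \<phi> (H (nat (n + int j - int k)) j k (fop M k (eop M j v))) else 0)"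
proof -
  obtain R where R: "\<forall>K\<ge>R. \<forall>\<phi>\<in>fnl M. \<phi> v = (\<Sum>j\<le>K. \<Sum>k\<le>K.
      if 2 * int k \<le> n + 2 * int j then \<phi> (H (nat (n + int j - int k)) j k (fop M k (eop M j v))) else 0)"
    using H_rep[OF v n] by (rule exE) (rule that)
  obtain E where E: "\<And>K t. K \<ge> E \<Longrightarrow> t > K \<Longrightarrow> eop M t v = \<zero>"
      "\<And>K t j. K \<ge> E \<Longrightarrow> t > K \<Longrightarrow> fop M t (eop M j v) = \<zero>" by (rule eop_fop_bound[OF wt_carrier[OF v]]) (rule that)
  have "\<phi> v = (\<Sum>j\<le>K1. \<Sum>k\<le>K2.
      if 2 * int k \<le> n + 2 * int j then \<phi> (H (nat (n + int j - int k)) j k (fop M k (eop M j v))) else 0)"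
    if K: "K1 \<ge> max R E" "K2 \<ge> max R E" and \<phi>: "\<phi> \<in> fnl M" for K1 K2 \<phi>
  proof -
    define F where "F j k = (if 2 * int k \<le> n + 2 * int j then \<phi> (H (nat (n + int j - int k)) j k (fop M k (eop M j v))) else 0)" for j k
    define K where "K = max K1 K2"
    have z1: "F j k = 0" if "j > K1" for j k using E(1)[of K1 j] that K \<phi> by (simp add: F_def fnl_zero)
    have z2: "F j k = 0" if "k > K2" for j k using E(2)[of K2 k j] that K \<phi> by (simp add: F_def fnl_zero)
    have "\<phi> v = (\<Sum>j\<le>K. \<Sum>k\<le>K. F j k)" unfolding F_def by (rule R[rule_format]) (use K \<phi> in \<open>auto simp: K_def\<close>)
    also have "\<dots> = (\<Sum>j\<le>K1. \<Sum>k\<le>K. F j k)" by (rule sum.mono_neutral_right) (auto simp: K_def z1)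
    also have "\<dots> = (\<Sum>j\<le>K1. \<Sum>k\<le>K2. F j k)"
      by (intro sum.cong refl sum.mono_neutral_right) (auto simp: K_def z2)
    finally show ?thesis by (simp add: F_def)
  qed
  then show ?thesis by blast
qed

end

section \<open>Acyclicity of injective modules\<close>

context hfamp
begin

context
  fixes c :: "(nat \<Rightarrow> nat) \<Rightarrow> 'v" and q :: nat and b :: int
  assumes c: "c \<in> coch M p (Suc q) b" and closed: "\<And>\<nu>. cdif M p c \<nu> = \<zero>" and b: "0 \<le> b"
begin

text \<open>For fixed \<open>J\<close> and \<open>k\<close> the vectors \<open>gam J k \<nu>\<close> form, after a change of sign, a cocycle of the scalar
  complex with \<open>\<alpha> = 0\<close> and \<open>\<mu> = - J\<close>, which has no critical cells. Its primitive \<open>zet J k\<close> is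
  mapped back to a cochain of \<open>M\<close> by \<open>H\<close>.\<close>

definition gam :: "nat \<Rightarrow> nat \<Rightarrow> (nat \<Rightarrow> nat) \<Rightarrow> 'v" where
  "gam J k \<nu> = (if mdeg p \<nu> \<le> J then fop M k (eop M (J - mdeg p \<nu>) (c \<nu>)) else \<zero>)"

definition zet :: "nat \<Rightarrow> nat \<Rightarrow> (nat \<Rightarrow> nat) \<Rightarrow> 'v" where
  "zet J k \<nu> = (let \<nu>' = inc \<nu> (actv p (- int J) \<nu>) in
     ((- 1) ^ (mdeg p \<nu> + mdeg p \<nu>') * hcoef p 0 (- int J) \<nu>) \<odot> gam J k \<nu>')"

lemma gam_cl [simp]: "gam J k \<nu> \<in> carrier M"
  using coch_cl[OF c] by (simp add: gam_def)

lemma zet_cl [simp]: "zet J k \<nu> \<in> carrier M"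
  by (simp add: zet_def Let_def)

lemma mdeg_dec': "fsupp \<nu> \<Longrightarrow> \<nu> i \<noteq> 0 \<Longrightarrow> mdeg p \<nu> = mdeg p (dec \<nu> i) + stp p (\<nu> i - 1) i"
  by (rule mdeg_dec) simp_all

lemma sign_mdeg_dec:
  assumes "fsupp \<nu>" "\<nu> i \<noteq> 0"
  shows "(- 1 :: 'k) ^ Suc (\<nu> i - 1) * (- 1) ^ mdeg p (dec \<nu> i) = (- 1) ^ mdeg p \<nu>"
  unfolding mdeg_dec'[OF assms] power_add sign_stp[of "\<nu> i - 1" i, symmetric] by (rule mult.commute)

lemma sign_mdeg_dec':
  assumes "fsupp \<nu>" "\<nu> i \<noteq> 0"
  shows "(- 1 :: 'k) ^ mdeg p \<nu> * (- 1) ^ Suc (\<nu> i - 1) = (- 1) ^ mdeg p (dec \<nu> i)"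
proof -
  have "(- 1 :: 'k) ^ Suc (\<nu> i - 1) * (- 1) ^ Suc (\<nu> i - 1) = 1" by (simp flip: power_add del: power_Suc)
  then show ?thesis unfolding sign_mdeg_dec[OF assms, symmetric] by (simp only: mult_ac) simp
qed

text \<open>Apply the divided power of exponent \<open>J - mdeg p \<nu>\<close> to the cocycle
  condition at \<open>\<nu>\<close> and absorb the operators by \<open>eop_op\<close>: each term
  then contains the exponent belonging to the lowered index. The factor (-1)^mdeg absorbs the
  signs.\<close>

lemma sdiff_gam:
  assumes \<psi>: "\<psi> \<in> fnl M" and \<nu>: "fsupp \<nu>" "mdeg p \<nu> \<le> J"
  shows "sdiff p (- int J) (\<lambda>\<nu>. (- 1) ^ mdeg p \<nu> * \<psi> (gam J k \<nu>)) \<nu> = 0"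
proof -
  let ?s = "J - mdeg p \<nu>"
  have \<chi>: "(\<lambda>v. \<psi> (fop M k (eop M ?s v))) \<in> fnl M" by (rule fnl_eop[OF fnl_fop[OF \<psi>]])
  have "0 = (- 1) ^ mdeg p \<nu> * \<psi> (fop M k (eop M ?s (cdif M p c \<nu>)))" using \<psi> by (simp add: closed fnl_zero)
  also have "\<dots> = (\<Sum>i | \<nu> i \<noteq> 0. (- 1) ^ mdeg p \<nu> * (msign \<nu> i * \<psi> (fop M k (eop M ?s (op M p i (\<nu> i - 1) (c (dec \<nu> i)))))))"
    unfolding fnl_cdif[OF \<chi> coch_cl[OF c] \<nu>(1)] by (rule sum_distrib_left)
  also have "\<dots> = sdiff p (- int J) (\<lambda>\<nu>. (- 1) ^ mdeg p \<nu> * \<psi> (gam J k \<nu>)) \<nu>"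
    unfolding sdiff_def
  proof (intro sum.cong refl)
    fix i assume "i \<in> {i. \<nu> i \<noteq> 0}"
    then have i: "\<nu> i \<noteq> 0" by simp
    let ?d = "dec \<nu> i"
    have md: "mdeg p \<nu> = mdeg p ?d + stp p (\<nu> i - 1) i" by (rule mdeg_dec'[OF \<nu>(1) i])
    have s: "?s + stp p (\<nu> i - 1) i = J - mdeg p ?d" "mdeg p ?d \<le> J" using \<nu>(2) md by auto
    have k: "- int (J - mdeg p ?d) = - int J + int (mdeg p ?d)" using s(2) by (simp add: of_nat_diff)
    have "eop M ?s (op M p i (\<nu> i - 1) (c ?d)) =
        ((- 1) ^ Suc (\<nu> i - 1) * cf p (\<nu> i - 1) i (- int J + int (mdeg p ?d))) \<odot> eop M (J - mdeg p ?d) (c ?d)"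
      unfolding eop_op[OF coch_cl[OF c]] s(1) k ..
    then have "\<psi> (fop M k (eop M ?s (op M p i (\<nu> i - 1) (c ?d)))) =
        (- 1) ^ Suc (\<nu> i - 1) * cf p (\<nu> i - 1) i (- int J + int (mdeg p ?d)) * \<psi> (gam J k ?d)"
      using coch_cl[OF c] \<psi> s(2) by (simp only: gam_def if_True fop_smult eop_cl fnl_smult fop_cl)
    moreover note sign_mdeg_dec'[OF \<nu>(1) i, symmetric]
    ultimately show "(- 1) ^ mdeg p \<nu> * (msign \<nu> i * \<psi> (fop M k (eop M ?s (op M p i (\<nu> i - 1) (c ?d))))) =
      msign \<nu> i * (cf p (\<nu> i - 1) i (- int J + int (mdeg p ?d)) * ((- 1) ^ mdeg p ?d * \<psi> (gam J k ?d)))"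
      by (simp only: mult_ac)
  qed
  finally show ?thesis by simp
qed

text \<open>The homotopy of \<open>morse\<close> applies to every cell of positive size, as
  \<open>crit_0\<close> excludes critical ones. The signs on the left are those produced by
  \<open>op_H\<close>.\<close>

lemma sdiff_zet:
  assumes \<psi>: "\<psi> \<in> fnl M" and \<nu>: "fsupp \<nu>" "msize \<nu> = Suc q" "mdeg p \<nu> \<le> J"
  shows "(\<Sum>i | \<nu> i \<noteq> 0. msign \<nu> i * ((- 1) ^ Suc (\<nu> i - 1) * cf p (\<nu> i - 1) i (- int J + int (mdeg p (dec \<nu> i)))
    * \<psi> (zet J k (dec \<nu> i)))) = \<psi> (gam J k \<nu>)"
proof -
  define g where "g \<nu> = (- 1) ^ mdeg p \<nu> * \<psi> (gam J k \<nu>)" for \<nu>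
  have z: "\<psi> (zet J k \<nu>) = (- 1) ^ mdeg p \<nu> * (hcoef p 0 (- int J) \<nu> * g (inc \<nu> (actv p (- int J) \<nu>)))" for \<nu>
    using \<psi> by (simp add: zet_def Let_def fnl_smult g_def power_add)
  have "(\<Sum>i | \<nu> i \<noteq> 0. msign \<nu> i * ((- 1) ^ Suc (\<nu> i - 1) * cf p (\<nu> i - 1) i (- int J + int (mdeg p (dec \<nu> i)))
    * \<psi> (zet J k (dec \<nu> i)))) =
    (- 1) ^ mdeg p \<nu> * sdiff p (- int J) (\<lambda>\<nu>. hcoef p 0 (- int J) \<nu> * g (inc \<nu> (actv p (- int J) \<nu>))) \<nu>"
    unfolding sdiff_def sum_distrib_left
  proof (intro sum.cong refl)
    fix i assume "i \<in> {i. \<nu> i \<noteq> 0}"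
    then have "\<nu> i \<noteq> 0" by simp
    note e = sign_mdeg_dec[OF \<nu>(1) \<open>\<nu> i \<noteq> 0\<close>, symmetric]
    show "msign \<nu> i * ((- 1) ^ Suc (\<nu> i - 1) * cf p (\<nu> i - 1) i (- int J + int (mdeg p (dec \<nu> i))) * \<psi> (zet J k (dec \<nu> i))) =
      (- 1) ^ mdeg p \<nu> * (msign \<nu> i * (cf p (\<nu> i - 1) i (- int J + int (mdeg p (dec \<nu> i))) *
        (hcoef p 0 (- int J) (dec \<nu> i) * g (inc (dec \<nu> i) (actv p (- int J) (dec \<nu> i))))))"
      unfolding e z by (simp only: mult_ac)
  qed
  also have "sdiff p (- int J) (\<lambda>\<nu>. hcoef p 0 (- int J) \<nu> * g (inc \<nu> (actv p (- int J) \<nu>))) \<nu> = g \<nu>"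
  proof (rule morse)
    show "sdiff p (- int J) g \<nu> = 0" if "cell 0 (- int J) (Suc (Suc q)) \<nu>" for \<nu>
      using that sdiff_gam[OF \<psi>] unfolding g_def cell_def by auto
    show "cell 0 (- int J) (Suc q) \<nu>" using \<nu> by (simp add: cell_def)
    then show "mup TYPE('k) p 0 (- int J) \<nu> \<or> mdown TYPE('k) p (- int J) \<nu>"
      using crit_0[of "Suc q" "- int J"] by (auto simp: crit_def)
  qed simp
  finally show ?thesis by (simp add: g_def flip: mult.assoc power_add)
qed

text \<open>In the representation of \<open>H_rep2\<close>, the terms are regrouped by J = j + mdeg,
  which stays constant under the differential; the exponent of a, with n = b + 2 mdeg, becomes b + J
  + mdeg - k. The coefficient vectors are replaced by their primitives
  \<open>zet J k\<close>.\<close>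

definition prim :: "nat \<Rightarrow> (nat \<Rightarrow> nat) \<Rightarrow> 'v" where
  "prim K \<nu> = finsum M (\<lambda>(J, k). if mdeg p \<nu> \<le> J
      then H (nat (b + int J + int (mdeg p \<nu>) - int k)) (J - mdeg p \<nu>) k (zet J k \<nu>) else \<zero>)
    {(J, k). J \<le> K \<and> k \<le> K \<and> 2 * int k \<le> b + 2 * int J}"

lemma finite_idx: "finite {(J, k). J \<le> K \<and> k \<le> K \<and> 2 * int k \<le> b + 2 * int J}"
  by (rule finite_subset[of _ "{..K} \<times> {..K}"]) auto

lemma prim_cl: "prim K \<nu> \<in> carrier M"
  unfolding prim_def by (rule finsum_closed) auto

lemma prim_zero:
  assumes "\<And>J k. zet J k \<nu> = \<zero>"
  shows "prim K \<nu> = \<zero>"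
proof -
  have "prim K \<nu> = finsum M (\<lambda>_. \<zero>) {(J, k). J \<le> K \<and> k \<le> K \<and> 2 * int k \<le> b + 2 * int J}"
    unfolding prim_def by (rule finsum_cong') (auto simp: assms)
  then show ?thesis by (simp add: finsum_zero')
qed

lemma zet_zero: "c (inc \<nu> (actv p (- int J) \<nu>)) = \<zero> \<Longrightarrow> zet J k \<nu> = \<zero>"
  by (simp add: zet_def gam_def Let_def)

lemma prim_coch: "prim K \<in> coch M p q b"
  unfolding coch_def
proof (intro CollectI conjI allI impI)
  fix \<nu>
  show "prim K \<nu> \<in> wt M (b + 2 * int (mdeg p \<nu>))"
    unfolding prim_def
  proof (rule wt_finsum[OF finite_idx])
    fix x assume "x \<in> {(J, k). J \<le> K \<and> k \<le> K \<and> 2 * int k \<le> b + 2 * int J}"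
    then obtain J k where x: "x = (J, k)" "2 * int k \<le> b + 2 * int J" by auto
    have "H (nat (b + int J + int (mdeg p \<nu>) - int k)) (J - mdeg p \<nu>) k (zet J k \<nu>) \<in> wt M (b + 2 * int (mdeg p \<nu>))"
      if "mdeg p \<nu> \<le> J"
      using H_wt[OF zet_cl, of "nat (b + int J + int (mdeg p \<nu>) - int k)" "J - mdeg p \<nu>" k J k \<nu>] x(2) b that
      by (simp add: of_nat_diff algebra_simps)
    then show "(case x of (J, k) \<Rightarrow> if mdeg p \<nu> \<le> J
      then H (nat (b + int J + int (mdeg p \<nu>) - int k)) (J - mdeg p \<nu>) k (zet J k \<nu>) else \<zero>) \<in> wt M (b + 2 * int (mdeg p \<nu>))"
      by (simp add: x(1))
  qed
  show "prim K \<nu> = \<zero>" if n: "\<not> (fsupp \<nu> \<and> msize \<nu> = q)"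
  proof (rule prim_zero)
    fix J k
    have "\<not> (fsupp (inc \<nu> a) \<and> msize (inc \<nu> a) = Suc q)" for a
    proof
      assume f: "fsupp (inc \<nu> a) \<and> msize (inc \<nu> a) = Suc q"
      then have "fsupp \<nu>" using fsupp_dec[of "inc \<nu> a" a] by simp
      then show False using n f by (simp add: msize_inc)
    qed
    then show "zet J k \<nu> = \<zero>" by (intro zet_zero coch_out[OF c])
  qed
next
  show "finite {\<nu>. prim K \<nu> \<noteq> \<zero>}"
  proof (rule finite_inc_image)
    show "finite {\<nu>. c \<nu> \<noteq> \<zero>}" by (rule coch_fin[OF c])
    show "inc \<nu> (actv p (- int (SOME J. c (inc \<nu> (actv p (- int J) \<nu>)) \<noteq> \<zero>)) \<nu>) \<in> {\<nu>. c \<nu> \<noteq> \<zero>}"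
      if "\<nu> \<in> {\<nu>. prim K \<nu> \<noteq> \<zero>}" for \<nu>
    proof -
      have "\<exists>J. c (inc \<nu> (actv p (- int J) \<nu>)) \<noteq> \<zero>" using prim_zero[of \<nu> K] zet_zero[of \<nu>] that by auto
      from someI_ex[OF this] show ?thesis by simp
    qed
    show "\<nu> \<in> {\<nu>. c \<nu> \<noteq> \<zero>} \<Longrightarrow> fsupp \<nu>" for \<nu> using coch_out[OF c] by auto
  qed
qed

text \<open>Applying the operator moves one step from the exponent of b to that of a, which for
  fixed J is the passage from \<open>dec \<nu> i\<close> to \<open>\<nu>\<close>.\<close>

lemma fnl_op_prim:
  assumes \<phi>: "\<phi> \<in> fnl M" and \<nu>: "fsupp \<nu>" and i: "\<nu> i \<noteq> 0"
  shows "\<phi> (op M p i (\<nu> i - 1) (prim K (dec \<nu> i))) =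
    (\<Sum>(J, k)\<in>{(J, k). J \<le> K \<and> k \<le> K \<and> 2 * int k \<le> b + 2 * int J}. if mdeg p \<nu> \<le> J
      then (- 1) ^ Suc (\<nu> i - 1) * cf p (\<nu> i - 1) i (- int J + int (mdeg p (dec \<nu> i))) *
        \<phi> (H (nat (b + int J + int (mdeg p \<nu>) - int k)) (J - mdeg p \<nu>) k (zet J k (dec \<nu> i))) else 0)"
proof -
  let ?d = "dec \<nu> i" and ?n = "\<nu> i - 1"
  let ?F = "\<lambda>(J, k). if mdeg p ?d \<le> J
      then H (nat (b + int J + int (mdeg p ?d) - int k)) (J - mdeg p ?d) k (zet J k ?d) else \<zero>"
  have "\<phi> (op M p i ?n (prim K ?d)) = (\<Sum>x\<in>{(J, k). J \<le> K \<and> k \<le> K \<and> 2 * int k \<le> b + 2 * int J}. \<phi> (op M p i ?n (?F x)))"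
    unfolding prim_def by (rule fnl_finsum[OF fnl_op[OF \<phi>] finite_idx]) auto
  also have "\<dots> = (\<Sum>(J, k)\<in>{(J, k). J \<le> K \<and> k \<le> K \<and> 2 * int k \<le> b + 2 * int J}. if mdeg p \<nu> \<le> J
      then (- 1) ^ Suc ?n * cf p ?n i (- int J + int (mdeg p ?d)) *
        \<phi> (H (nat (b + int J + int (mdeg p \<nu>) - int k)) (J - mdeg p \<nu>) k (zet J k ?d)) else 0)"
  proof (intro sum.cong refl)
    fix x assume "x \<in> {(J, k). J \<le> K \<and> k \<le> K \<and> 2 * int k \<le> b + 2 * int J}"
    then obtain J k where x: "x = (J, k)" "2 * int k \<le> b + 2 * int J" by auto
    have md: "mdeg p \<nu> = mdeg p ?d + stp p ?n i" by (rule mdeg_dec'[OF \<nu> i])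
    show "\<phi> (op M p i ?n (?F x)) = (case x of (J, k) \<Rightarrow> if mdeg p \<nu> \<le> J
      then (- 1) ^ Suc ?n * cf p ?n i (- int J + int (mdeg p ?d)) *
        \<phi> (H (nat (b + int J + int (mdeg p \<nu>) - int k)) (J - mdeg p \<nu>) k (zet J k ?d)) else 0)"
    proof (cases "mdeg p ?d \<le> J")
      case True
      have 1: "stp p ?n i \<le> J - mdeg p ?d \<longleftrightarrow> mdeg p \<nu> \<le> J" using md True by auto
      have 2: "nat (b + int J + int (mdeg p ?d) - int k) + stp p ?n i = nat (b + int J + int (mdeg p \<nu>) - int k)"
        using md x(2) b by linarith
      have 3: "J - mdeg p ?d - stp p ?n i = J - mdeg p \<nu>" using md by simp
      have 4: "- int (J - mdeg p ?d) = - int J + int (mdeg p ?d)" using True by (simp add: of_nat_diff)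
      have "op M p i ?n (?F x) = (if mdeg p \<nu> \<le> J then ((- 1) ^ Suc ?n * cf p ?n i (- int J + int (mdeg p ?d))) \<odot>
         H (nat (b + int J + int (mdeg p \<nu>) - int k)) (J - mdeg p \<nu>) k (zet J k ?d) else \<zero>)"
        using True op_H[OF zet_cl, of i ?n "nat (b + int J + int (mdeg p ?d) - int k)" "J - mdeg p ?d" k J k ?d]
        unfolding 1 2 3 4 by (simp only: x(1) prod.case if_True)
      then show ?thesis using \<phi> by (simp add: x(1) fnl_smult fnl_zero del: power_Suc)
    next
      case False
      then show ?thesis using md \<phi> by (simp add: x(1) fnl_zero)
    qed
  qed
  finally show ?thesis .
qed

lemma cdif_prim:
  assumes \<phi>: "\<phi> \<in> fnl M" and \<nu>: "fsupp \<nu>" "msize \<nu> = Suc q"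
  shows "\<phi> (cdif M p (prim K) \<nu>) =
    (\<Sum>(J, k)\<in>{(J, k). J \<le> K \<and> k \<le> K \<and> 2 * int k \<le> b + 2 * int J}. if mdeg p \<nu> \<le> J
      then \<phi> (H (nat (b + int J + int (mdeg p \<nu>) - int k)) (J - mdeg p \<nu>) k (gam J k \<nu>)) else 0)"
proof -
  let ?idx = "{(J, k). J \<le> K \<and> k \<le> K \<and> 2 * int k \<le> b + 2 * int J}"
  have "\<phi> (cdif M p (prim K) \<nu>) = (\<Sum>i | \<nu> i \<noteq> 0. msign \<nu> i * \<phi> (op M p i (\<nu> i - 1) (prim K (dec \<nu> i))))"
    by (rule fnl_cdif[OF \<phi> prim_cl \<nu>(1)])
  also have "\<dots> = (\<Sum>i | \<nu> i \<noteq> 0. \<Sum>x\<in>?idx. msign \<nu> i * (case x of (J, k) \<Rightarrow> if mdeg p \<nu> \<le> J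
      then (- 1) ^ Suc (\<nu> i - 1) * cf p (\<nu> i - 1) i (- int J + int (mdeg p (dec \<nu> i))) *
        \<phi> (H (nat (b + int J + int (mdeg p \<nu>) - int k)) (J - mdeg p \<nu>) k (zet J k (dec \<nu> i))) else 0))"
    using fnl_op_prim[OF \<phi> \<nu>(1)] by (intro sum.cong refl) (simp add: sum_distrib_left)
  also have "\<dots> = (\<Sum>x\<in>?idx. \<Sum>i | \<nu> i \<noteq> 0. msign \<nu> i * (case x of (J, k) \<Rightarrow> if mdeg p \<nu> \<le> J
      then (- 1) ^ Suc (\<nu> i - 1) * cf p (\<nu> i - 1) i (- int J + int (mdeg p (dec \<nu> i))) *
        \<phi> (H (nat (b + int J + int (mdeg p \<nu>) - int k)) (J - mdeg p \<nu>) k (zet J k (dec \<nu> i))) else 0))"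
    by (rule sum.swap)
  also have "\<dots> = (\<Sum>(J, k)\<in>?idx. if mdeg p \<nu> \<le> J
      then \<phi> (H (nat (b + int J + int (mdeg p \<nu>) - int k)) (J - mdeg p \<nu>) k (gam J k \<nu>)) else 0)"
  proof (intro sum.cong refl)
    fix x assume "x \<in> ?idx"
    obtain J k where x: "x = (J, k)" by (cases x)
    show "(\<Sum>i | \<nu> i \<noteq> 0. msign \<nu> i * (case x of (J, k) \<Rightarrow> if mdeg p \<nu> \<le> J
      then (- 1) ^ Suc (\<nu> i - 1) * cf p (\<nu> i - 1) i (- int J + int (mdeg p (dec \<nu> i))) *
        \<phi> (H (nat (b + int J + int (mdeg p \<nu>) - int k)) (J - mdeg p \<nu>) k (zet J k (dec \<nu> i))) else 0)) =
      (case x of (J, k) \<Rightarrow> if mdeg p \<nu> \<le> J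
      then \<phi> (H (nat (b + int J + int (mdeg p \<nu>) - int k)) (J - mdeg p \<nu>) k (gam J k \<nu>)) else 0)"
    proof (cases "mdeg p \<nu> \<le> J")
      case True
      show ?thesis unfolding x prod.case if_P[OF True]
        by (rule sdiff_zet[OF fnl_H[OF \<phi>] \<nu> True])
    qed (simp add: x)
  qed
  finally show ?thesis .
qed

text \<open>The differential of \<open>prim\<close> replaces \<open>zet\<close> by
  \<open>gam\<close> in its defining sum, and this sum is the representation of
  \<open>c \<nu>\<close> reindexed by J = j + mdeg.\<close>

lemma acyclic_aux: "\<exists>y\<in>coch M p q b. cdif M p y = c"
proof -
  note cl = coch_cl[OF c]
  define Q where "Q \<nu> K0 \<longleftrightarrow> (\<forall>K1\<ge>K0. \<forall>K2\<ge>K0. \<forall>\<phi>\<in>fnl M. \<phi> (c \<nu>) = (\<Sum>j\<le>K1. \<Sum>k\<le>K2.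
      if 2 * int k \<le> (b + 2 * int (mdeg p \<nu>)) + 2 * int j then \<phi> (H (nat (b + 2 * int (mdeg p \<nu>) + int j - int k)) j k (fop M k (eop M j (c \<nu>)))) else 0))" for \<nu> K0
  have "\<forall>\<nu>. \<exists>K0. Q \<nu> K0"
    unfolding Q_def by (intro allI H_rep2[OF coch_wt[OF c]]) (use b in simp)
  then obtain K0 where "\<forall>\<nu>. Q \<nu> (K0 \<nu>)" by (rule choice[THEN exE])
  then have K0: "\<And>\<nu> K1 K2 \<phi>. K1 \<ge> K0 \<nu> \<Longrightarrow> K2 \<ge> K0 \<nu> \<Longrightarrow> \<phi> \<in> fnl M \<Longrightarrow> \<phi> (c \<nu>) = (\<Sum>j\<le>K1. \<Sum>k\<le>K2.
      if 2 * int k \<le> (b + 2 * int (mdeg p \<nu>)) + 2 * int j then \<phi> (H (nat (b + 2 * int (mdeg p \<nu>) + int j - int k)) j k (fop M k (eop M j (c \<nu>)))) else 0)"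
    unfolding Q_def by simp
  \<comment> \<open>Exceeds the bounds of all multi-indices in the finite support of
    \<open>c\<close>, with room for the shift from j to J.\<close>
  define K where "K = (\<Sum>\<nu> | c \<nu> \<noteq> \<zero>. K0 \<nu> + mdeg p \<nu>)"
  have K: "K0 \<nu> + mdeg p \<nu> \<le> K" if "c \<nu> \<noteq> \<zero>" for \<nu>
    unfolding K_def using that coch_fin[OF c] by (intro member_le_sum) auto
  have "cdif M p (prim K) \<nu> = c \<nu>" for \<nu>
  proof (cases "fsupp \<nu> \<and> msize \<nu> = Suc q")
    case False
    then show ?thesis using coch_out[OF c] coch_out[OF cdif_coch[OF prim_coch]] by simp
  next
    case True
    then have \<nu>: "fsupp \<nu>" "msize \<nu> = Suc q" by auto
    let ?m = "mdeg p \<nu>"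
    have "\<phi> (cdif M p (prim K) \<nu>) = \<phi> (c \<nu>)" if \<phi>: "\<phi> \<in> fnl M" for \<phi>
    proof (cases "c \<nu> = \<zero>")
      case True
      then have "gam J k \<nu> = \<zero>" for J k by (simp add: gam_def)
      then show ?thesis unfolding cdif_prim[OF \<phi> \<nu>] using \<phi> True by (auto simp: fnl_zero intro!: sum.neutral)
    next
      case False
      define G where "G J k = \<phi> (H (nat (b + int J + int ?m - int k)) (J - ?m) k (gam J k \<nu>))" for J k
      have "\<phi> (c \<nu>) = (\<Sum>j\<le>K - ?m. \<Sum>k\<le>K. if 2 * int k \<le> (b + 2 * int ?m) + 2 * int j
          then \<phi> (H (nat (b + 2 * int ?m + int j - int k)) j k (fop M k (eop M j (c \<nu>)))) else 0)"
        by (rule K0[OF _ _ \<phi>]) (use K[OF False] in auto)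
      also have "\<dots> = (\<Sum>j\<le>K - ?m. \<Sum>k\<le>K. if 2 * int k \<le> b + 2 * int (j + ?m) then G (j + ?m) k else 0)"
        by (intro sum.cong refl) (simp add: G_def gam_def algebra_simps)
      also have "\<dots> = (\<Sum>J\<in>{?m..K}. \<Sum>k\<le>K. if 2 * int k \<le> b + 2 * int J then G J k else 0)"
        by (rule sum.reindex_bij_witness[of _ "\<lambda>J. J - ?m" "\<lambda>j. j + ?m"]) (use K[OF False] in auto)
      also have "\<dots> = (\<Sum>J\<le>K. \<Sum>k\<le>K. if ?m \<le> J \<and> 2 * int k \<le> b + 2 * int J then G J k else 0)"
        by (intro sum.mono_neutral_cong_left) (auto intro!: sum.cong)
      also have "\<dots> = (\<Sum>(J, k)\<in>{..K} \<times> {..K}. if ?m \<le> J \<and> 2 * int k \<le> b + 2 * int J then G J k else 0)"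
        by (rule sum.cartesian_product)
      also have "\<dots> = (\<Sum>(J, k)\<in>{(J, k). J \<le> K \<and> k \<le> K \<and> 2 * int k \<le> b + 2 * int J}. if ?m \<le> J then G J k else 0)"
        by (intro sum.mono_neutral_cong_right) (auto split: if_splits)
      finally have "\<phi> (c \<nu>) = (\<Sum>(J, k)\<in>{(J, k). J \<le> K \<and> k \<le> K \<and> 2 * int k \<le> b + 2 * int J}. if ?m \<le> J then G J k else 0)" .
      then show ?thesis unfolding cdif_prim[OF \<phi> \<nu>] G_def by (rule sym)
    qed
    then show ?thesis by (intro fnl_eqI) (auto simp: cl cdif_cl[OF prim_cl])
  qed
  then show ?thesis using prim_coch by blast
qed

end

lemma acyclic:
  assumes "c \<in> coch M p (Suc q) b" "\<And>\<nu>. cdif M p c \<nu> = \<zero>" "0 \<le> b"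
  obtains y where "y \<in> coch M p q b" "cdif M p y = c"
  using acyclic_aux[OF assms] by (elim bexE) (rule that)

end

section \<open>Dimension shifting\<close>

text \<open>The resolved module has highest weight \<open>a\<close>, the first argument of Ext has
  highest weight \<open>b\<close>.\<close>

locale weyl_res = odd_char p "TYPE('k)"
  for p a b :: nat and I :: "nat \<Rightarrow> ('k::alg_closed_field, 'u) gmod"
    and \<epsilon> :: "(('k mat \<Rightarrow> 'k) \<Rightarrow> 'k) \<Rightarrow> 'u" and d :: "nat \<Rightarrow> 'u \<Rightarrow> 'u" +
  assumes res: "injective_resolution (weyl a) \<epsilon> I d"
begin

lemma inj_I: "injective_gmod (I n)"
  using res by (simp add: injective_resolution_def)

lemma rat_I: "rat (I n)"
  using inj_I[of n] by (simp add: injective_gmod_def rat_def)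

lemma d_hom: "prat_hom (I n) (I (Suc n)) (d n) p"
proof -
  have "d n \<in> gmod_hom (I n) (I (Suc n))" using res by (simp add: injective_resolution_def)
  then show ?thesis
    by (intro prat_hom.intro rat_hom.intro rat_hom_axioms.intro rat_I odd_char_axioms)
qed

lemma exact: "d n ` carrier (I n) = {v \<in> carrier (I (Suc n)). d (Suc n) v = \<zero>\<^bsub>I (Suc (Suc n))\<^esub>}"
  using res by (simp add: injective_resolution_def)

lemma exact_0: "\<epsilon> ` carrier (weyl a) = {v \<in> carrier (I 0). d 0 v = \<zero>\<^bsub>I 1\<^esub>}"
  using res by (simp add: injective_resolution_def)

lemma \<epsilon>_inj: "inj_on \<epsilon> (carrier (weyl a))"
  using res by (simp add: injective_resolution_def)

lemma \<epsilon>_hom: "weyl_hom (I 0) a \<epsilon>"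
  using res rat_I by (simp add: injective_resolution_def weyl_hom_def weyl_hom_axioms_def)

end

sublocale weyl_res \<subseteq> D0: prat_hom "I 0" "I 1" "d 0" p using d_hom[of 0] by simp
sublocale weyl_res \<subseteq> D1: prat_hom "I 1" "I 2" "d 1" p using d_hom[of 1] by (simp add: numeral_2_eq_2)
sublocale weyl_res \<subseteq> D2: prat_hom "I 2" "I 3" "d 2" p using d_hom[of 2] by (simp add: numeral_2_eq_2 numeral_3_eq_3)
sublocale weyl_res \<subseteq> E: weyl_hom "I 0" a \<epsilon> by (rule \<epsilon>_hom)

context weyl_res
begin

lemma exact_1: "d 0 ` carrier (I 0) = {v \<in> carrier (I 1). d 1 v = \<zero>\<^bsub>I 2\<^esub>}"
  using exact[of 0] by (simp add: numeral_2_eq_2)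

lemma exact_2: "d 1 ` carrier (I 1) = {v \<in> carrier (I 2). d 2 v = \<zero>\<^bsub>I 3\<^esub>}"
  using exact[of 1] by (simp add: numeral_2_eq_2 numeral_3_eq_3)

lemma exact_3: "d 2 ` carrier (I 2) = {v \<in> carrier (I 3). d 3 v = \<zero>\<^bsub>I 4\<^esub>}"
  using exact[of 2] by (simp add: numeral_eq_Suc)

lemma acyclic_I:
  assumes "c \<in> coch (I n) p (Suc q) (int b')" "\<And>\<nu>. cdif (I n) p c \<nu> = \<zero>\<^bsub>I n\<^esub>"
  obtains y where "y \<in> coch (I n) p q (int b')" "cdif (I n) p y = c"
proof -
  obtain H where "hfam (I n) H" using injective_hfam[OF inj_I] by blast
  then interpret H: hfamp "I n" H p by (intro hfamp.intro odd_char_axioms)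
  show ?thesis by (rule H.acyclic[OF assms]) (simp, rule that)
qed

text \<open>The basis vector of weight \<open>b + 2 * mdeg p \<nu>\<close> of the Weyl module has index
  \<open>K = (a + b) / 2 + mdeg p \<nu>\<close>; in the scalar complex it corresponds to \<open>\<kappa> = K + 1\<close>. If \<open>a + b\<close> is odd
  there is no such vector and \<open>\<mu>\<close> is irrelevant.\<close>

definition \<alpha> :: int where "\<alpha> = int a + 1"
definition \<mu> :: int where "\<mu> = (int a + int b) div 2 + 1"
text \<open>The value 0 outside the range lets the string run past the highest weight, where the
  Weyl module ends.\<close>

definition Sv :: "int \<Rightarrow> 'u" where
  "Sv \<kappa> = (if 1 \<le> \<kappa> \<and> \<kappa> \<le> \<alpha> then \<epsilon> (dlt a (nat (\<kappa> - 1))) else \<zero>\<^bsub>I 0\<^esub>)"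

lemma \<mu>_ge: "1 \<le> \<mu> + int m"
  by (simp add: \<mu>_def)

lemma Sv_cl [simp]: "Sv \<kappa> \<in> carrier (I 0)"
  by (simp add: Sv_def)

lemma Sv_op: 
  assumes "1 \<le> \<kappa>"
  shows "op (I 0) p i n (Sv \<kappa>) = cf p n i \<kappa> \<odot>\<^bsub>I 0\<^esub> Sv (\<kappa> + int (stp p n i))"
proof (rule D0.P.string_op[OF _ _ assms])
  fix \<kappa> :: int and i assume \<kappa>: "1 \<le> \<kappa>"
  show "eop (I 0) (p ^ i) (Sv \<kappa>) = of_int ((\<kappa> - 1) div int p ^ i + 1) \<odot>\<^bsub>I 0\<^esub> Sv (\<kappa> + int p ^ i)"
  proof (cases "\<kappa> \<le> \<alpha>")
    case True
    define K where "K = nat (\<kappa> - 1)"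
    have K: "\<kappa> = int K + 1" using \<kappa> by (simp add: K_def)
    have "(of_nat ((K + p ^ i) choose K) :: 'k) = of_nat (K div p ^ i + 1)"
      using binomial_symmetric[of K "K + p ^ i"] by (simp add: lucas_p_power)
    moreover have "of_int ((\<kappa> - 1) div int p ^ i + 1) = (of_nat (K div p ^ i + 1) :: 'k)"
      by (simp add: K flip: of_nat_power zdiv_int)
    moreover have "nat (\<kappa> + int p ^ i - 1) = K + p ^ i" by (simp add: K nat_add_distrib nat_power_eq)
    moreover have "\<kappa> + int p ^ i \<le> \<alpha> \<longleftrightarrow> K + p ^ i \<le> a"
      unfolding K \<alpha>_def of_nat_power[symmetric] by linarith
    ultimately show ?thesis using True \<kappa>
      by (simp add: Sv_def K_def[symmetric] E.h_dlt_eop add_increasing2 del: of_nat_add of_nat_Suc)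
  next
    case False
    moreover have "0 \<le> int p ^ i" by simp
    ultimately have "\<not> \<kappa> + int p ^ i \<le> \<alpha>" by linarith
    then show ?thesis using False by (simp add: Sv_def)
  qed
qed simp

lemma Sv_nonzero:
  assumes "1 \<le> \<kappa>" "\<kappa> \<le> \<alpha>"
  shows "Sv \<kappa> \<noteq> \<zero>\<^bsub>I 0\<^esub>"
proof
  assume "Sv \<kappa> = \<zero>\<^bsub>I 0\<^esub>"
  define K where "K = nat (\<kappa> - 1)"
  have K: "K \<le> a" using assms by (auto simp: K_def \<alpha>_def)
  interpret W: kvs "weyl a :: ('k, ('k mat \<Rightarrow> 'k) \<Rightarrow> 'k) gmod" by (rule kvs_weyl)
  have "\<epsilon> \<zero>\<^bsub>weyl a\<^esub> = \<epsilon> (0 \<odot>\<^bsub>weyl a\<^esub> \<zero>\<^bsub>weyl a\<^esub>)" by simp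
  also have "\<dots> = \<zero>\<^bsub>I 0\<^esub>" by (subst E.h_smult) auto
  finally have "\<epsilon> (dlt a K) = \<epsilon> \<zero>\<^bsub>weyl a\<^esub>" using \<open>Sv \<kappa> = \<zero>\<^bsub>I 0\<^esub>\<close> assms by (simp add: Sv_def K_def)
  moreover have "\<zero>\<^bsub>weyl a\<^esub> \<in> carrier (weyl a :: ('k, ('k mat \<Rightarrow> 'k) \<Rightarrow> 'k) gmod)" by simp
  ultimately have "dlt a K = (\<zero>\<^bsub>weyl a\<^esub> :: ('k mat \<Rightarrow> 'k) \<Rightarrow> 'k)" by (rule inj_onD[OF \<epsilon>_inj _ E.dlt_cl])
  moreover have "Xm a K \<in> carrier (ind_B a :: ('k, 'k mat \<Rightarrow> 'k) gmod)" by (rule Xm_ind_B[OF K])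
  ultimately have "dlt a K (Xm a K) = (0 :: 'k)" by (simp add: weyl_simps)
  then show False by (simp add: dlt_Xm[OF K])
qed

lemma Sv_wt:
  assumes "even (a + b)"
  shows "Sv (\<mu> + int m) \<in> wt (I 0) (int b + 2 * int m)"
proof (cases "\<mu> + int m \<le> \<alpha>")
  case True
  have le: "nat (\<mu> + int m - 1) \<le> a" using True by (simp add: \<alpha>_def)
  have w: "2 * int (nat (\<mu> + int m - 1)) - int a = int b + 2 * int m"
  proof -
    obtain c where "a + b = 2 * c" using assms by (rule evenE)
    then have c: "int a + int b = 2 * int c" by linarith
    then have "\<mu> = int c + 1" by (simp add: \<mu>_def)
    then show ?thesis using c by simp
  qed
  show ?thesis using E.h_dlt_wt[OF le] True \<mu>_ge[of m] by (simp only: w Sv_def if_True simp_thms)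
qed (simp add: Sv_def)

text \<open>Projecting the expansion in the dual basis to one weight leaves at most one term, and
  none if the parity of the weight differs from that of \<open>a\<close>.\<close>

lemma image_wt:
  assumes w: "w \<in> wt (I 0) (int b + 2 * int m)" and im: "w \<in> \<epsilon> ` carrier (weyl a)"
  shows "\<exists>x. w = x \<odot>\<^bsub>I 0\<^esub> Sv (\<mu> + int m)" and "odd (a + b) \<Longrightarrow> w = \<zero>\<^bsub>I 0\<^esub>"
proof -
  obtain \<psi> where \<psi>: "\<psi> \<in> carrier (weyl a)" "w = \<epsilon> \<psi>" using im by blast
  let ?n = "int b + 2 * int m"
  have e: "\<phi> w = (\<Sum>k\<le>a. if ?n = 2 * int k - int a then \<psi> (Xm a k) * \<phi> (\<epsilon> (dlt a k)) else 0)" if \<phi>: "\<phi> \<in> fnl (I 0)" for \<phi>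
  proof -
    have "\<phi> w = \<phi> (pr (I 0) ?n w)" using D0.M.pr_of_wt[OF w] by simp
    also have "\<dots> = (\<Sum>k\<le>a. \<psi> (Xm a k) * \<phi> (pr (I 0) ?n (\<epsilon> (dlt a k))))"
      unfolding \<psi>(2) by (rule E.h_expand[OF D0.M.fnl_pr[OF \<phi>] \<psi>(1)])
    also have "\<dots> = (\<Sum>k\<le>a. if ?n = 2 * int k - int a then \<psi> (Xm a k) * \<phi> (\<epsilon> (dlt a k)) else 0)"
      by (intro sum.cong refl) (auto simp: D0.M.pr_of_wt[OF E.h_dlt_wt] D0.M.fnl_zero[OF \<phi>])
    finally show ?thesis .
  qed
  have wc: "w \<in> carrier (I 0)" by (rule D0.M.wt_carrier[OF w])
  show "odd (a + b) \<Longrightarrow> w = \<zero>\<^bsub>I 0\<^esub>"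
  proof (rule D0.M.fnl_eqI[OF wc])
    fix \<phi> assume o: "odd (a + b)" and \<phi>: "\<phi> \<in> fnl (I 0)"
    have "?n \<noteq> 2 * int k - int a" for k using o by presburger
    then show "\<phi> w = \<phi> \<zero>\<^bsub>I 0\<^esub>" by (simp add: e[OF \<phi>] D0.M.fnl_zero[OF \<phi>])
  qed simp
  show "\<exists>x. w = x \<odot>\<^bsub>I 0\<^esub> Sv (\<mu> + int m)"
  proof (cases "\<exists>k\<le>a. ?n = 2 * int k - int a")
    case True
    then obtain k where k: "k \<le> a" "?n = 2 * int k - int a" by blast
    have \<kappa>: "\<mu> + int m = int k + 1" using k(2) by (simp add: \<mu>_def)
    have "Sv (\<mu> + int m) = \<epsilon> (dlt a k)" unfolding \<kappa> using k(1) by (simp add: Sv_def \<alpha>_def)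
    moreover have "w = \<psi> (Xm a k) \<odot>\<^bsub>I 0\<^esub> \<epsilon> (dlt a k)"
    proof (rule D0.M.fnl_eqI[OF wc])
      fix \<phi> assume \<phi>: "\<phi> \<in> fnl (I 0)"
      have "\<phi> w = (\<Sum>k'\<le>a. if k' = k then \<psi> (Xm a k) * \<phi> (\<epsilon> (dlt a k)) else 0)"
        unfolding e[OF \<phi>] k(2) by (intro sum.cong refl) auto
      then show "\<phi> w = \<phi> (\<psi> (Xm a k) \<odot>\<^bsub>I 0\<^esub> \<epsilon> (dlt a k))" using k(1) by (simp add: D0.M.fnl_smult[OF \<phi>])
    qed simp
    ultimately show ?thesis by auto
  next
    case False
    have "w = \<zero>\<^bsub>I 0\<^esub>"
      by (rule D0.M.fnl_eqI[OF wc]) (use False in \<open>auto simp: e D0.M.fnl_zero intro!: sum.neutral\<close>)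
    then show ?thesis by (intro exI[of _ 0]) simp
  qed
qed

section \<open>Scalar cochains on the Weyl module\<close>

definition sv :: "((nat \<Rightarrow> nat) \<Rightarrow> 'k) \<Rightarrow> (nat \<Rightarrow> nat) \<Rightarrow> 'u" where
  "sv x \<nu> = x \<nu> \<odot>\<^bsub>I 0\<^esub> Sv (\<mu> + int (mdeg p \<nu>))"

text \<open>For odd a + b the index \<open>\<mu>\<close> matches no weight, and the parity condition
  then forces x = 0.\<close>

definition good :: "nat \<Rightarrow> ((nat \<Rightarrow> nat) \<Rightarrow> 'k) \<Rightarrow> bool" where
  "good q x \<longleftrightarrow> (\<forall>\<nu>. x \<nu> \<noteq> 0 \<longrightarrow> cell \<alpha> \<mu> q \<nu> \<and> even (a + b)) \<and> finite {\<nu>. x \<nu> \<noteq> 0}"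

lemma sv_coch:
  assumes "good q x"
  shows "sv x \<in> coch (I 0) p q (int b)"
  unfolding coch_def
proof (intro CollectI conjI allI impI)
  show "sv x \<nu> \<in> wt (I 0) (int b + 2 * int (mdeg p \<nu>))" for \<nu>
  proof (cases "x \<nu> = 0")
    case False
    then have "even (a + b)" using assms by (simp add: good_def)
    then show ?thesis unfolding sv_def by (intro D0.M.wt_smult Sv_wt)
  qed (simp add: sv_def)
  show "sv x \<nu> = \<zero>\<^bsub>I 0\<^esub>" if "\<not> (fsupp \<nu> \<and> msize \<nu> = q)" for \<nu>
    using assms that by (cases "x \<nu> = 0") (auto simp: sv_def good_def cell_def)
  have "{\<nu>. sv x \<nu> \<noteq> \<zero>\<^bsub>I 0\<^esub>} \<subseteq> {\<nu>. x \<nu> \<noteq> 0}" by (auto simp: sv_def)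
  then show "finite {\<nu>. sv x \<nu> \<noteq> \<zero>\<^bsub>I 0\<^esub>}" by (rule finite_subset) (use assms in \<open>simp add: good_def\<close>)
qed

lemma cdif_sv: "cdif (I 0) p (sv x) \<nu> = sv (sdiff p \<mu> x) \<nu>"
proof (cases "fsupp \<nu>")
  case True
  have cl: "sv x \<nu> \<in> carrier (I 0)" for x \<nu> by (simp add: sv_def)
  show ?thesis
  proof (rule D0.M.fnl_eqI)
    fix \<phi> assume \<phi>: "\<phi> \<in> fnl (I 0)"
    have "\<phi> (op (I 0) p i (\<nu> i - 1) (sv x (dec \<nu> i))) =
       x (dec \<nu> i) * (cf p (\<nu> i - 1) i (\<mu> + int (mdeg p (dec \<nu> i))) * \<phi> (Sv (\<mu> + int (mdeg p \<nu>))))" if "\<nu> i \<noteq> 0" for i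
    proof -
      have "mdeg p \<nu> = mdeg p (dec \<nu> i) + stp p (\<nu> i - 1) i" by (rule mdeg_dec[OF True _ that]) simp
      then have "\<mu> + int (mdeg p (dec \<nu> i)) + int (stp p (\<nu> i - 1) i) = \<mu> + int (mdeg p \<nu>)" by simp
      then show ?thesis unfolding sv_def
        using \<phi> by (simp only: D0.P.op_smult Sv_cl Sv_op[OF \<mu>_ge] D0.M.fnl_smult D0.M.smult_cl)
    qed
    then have "\<phi> (cdif (I 0) p (sv x) \<nu>) = (\<Sum>i | \<nu> i \<noteq> 0. msign \<nu> i *
       (x (dec \<nu> i) * (cf p (\<nu> i - 1) i (\<mu> + int (mdeg p (dec \<nu> i))) * \<phi> (Sv (\<mu> + int (mdeg p \<nu>))))))"
      by (simp add: D0.P.fnl_cdif[OF \<phi> cl True])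
    also have "\<dots> = \<phi> (sv (sdiff p \<mu> x) \<nu>)"
      unfolding sv_def sdiff_def using \<phi>
      by (simp add: D0.M.fnl_smult sum_distrib_right) (intro sum.cong refl, simp only: mult_ac)
    finally show "\<phi> (cdif (I 0) p (sv x) \<nu>) = \<phi> (sv (sdiff p \<mu> x) \<nu>)" .
  qed (auto simp: cl D0.P.cdif_cl)
next
  case False
  then show ?thesis by (simp add: D0.P.cdif_infinite) (simp add: sv_def sdiff_def fsupp_def)
qed

end

section \<open>Zigzags from the resolution to scalar cochains\<close>

context weyl_res
begin

context
  notes One_nat_def [simp del]
begin

lemma weyl_homI: "f \<in> gmod_hom (weyl m) (I n) \<Longrightarrow> weyl_hom (I n) m f"
  using rat_I by (simp add: weyl_hom_def weyl_hom_axioms_def)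

text \<open>Values in the image of \<open>\<epsilon>\<close> are multiples of the vectors
  \<open>Sv\<close>, and \<open>x\<close> collects the scalars. Where the value is zero,
  \<open>x\<close> is set to 0 explicitly, since \<open>Sv\<close> may vanish there and the scalar
  would be arbitrary.\<close>

lemma cdif_scalar:
  assumes c0: "c0 \<in> coch (I 0) p q (int b)" and im: "\<And>\<nu>. cdif (I 0) p c0 \<nu> \<in> \<epsilon> ` carrier (weyl a)"
  obtains x where "good (Suc q) x" "cdif (I 0) p c0 = sv x" "\<And>\<nu>. cell \<alpha> \<mu> (Suc (Suc q)) \<nu> \<Longrightarrow> sdiff p \<mu> x \<nu> = 0"
proof -
  note cd = D0.P.cdif_coch[OF c0]
  define x where "x \<nu> = (if cdif (I 0) p c0 \<nu> = \<zero>\<^bsub>I 0\<^esub> then 0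
    else SOME x. cdif (I 0) p c0 \<nu> = x \<odot>\<^bsub>I 0\<^esub> Sv (\<mu> + int (mdeg p \<nu>)))" for \<nu>
  have x: "cdif (I 0) p c0 \<nu> = sv x \<nu>" for \<nu>
  proof (cases "cdif (I 0) p c0 \<nu> = \<zero>\<^bsub>I 0\<^esub>")
    case False
    then show ?thesis using someI_ex[OF image_wt(1)[OF D0.P.coch_wt[OF cd] im]] by (simp add: x_def sv_def)
  qed (simp add: x_def sv_def)
  have nz: "cdif (I 0) p c0 \<nu> \<noteq> \<zero>\<^bsub>I 0\<^esub>" if "x \<nu> \<noteq> 0" for \<nu> using that by (auto simp: x_def)
  have "good (Suc q) x"
    unfolding good_def
  proof (intro conjI allI impI)
    fix \<nu> assume "x \<nu> \<noteq> 0"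
    note n = nz[OF this]
    have "\<mu> + int (mdeg p \<nu>) \<le> \<alpha>"
    proof (rule ccontr)
      assume "\<not> \<mu> + int (mdeg p \<nu>) \<le> \<alpha>"
      then show False using n by (simp add: x sv_def Sv_def)
    qed
    then show "cell \<alpha> \<mu> (Suc q) \<nu>" using D0.P.coch_out[OF cd, of \<nu>] n by (auto simp: cell_def)
    show "even (a + b)" using image_wt(2)[OF D0.P.coch_wt[OF cd] im] n by blast
  next
    have "{\<nu>. x \<nu> \<noteq> 0} \<subseteq> {\<nu>. cdif (I 0) p c0 \<nu> \<noteq> \<zero>\<^bsub>I 0\<^esub>}" using nz by auto
    then show "finite {\<nu>. x \<nu> \<noteq> 0}" by (rule finite_subset) (rule D0.P.coch_fin[OF cd])
  qed
  moreover have e: "cdif (I 0) p c0 = sv x" using x by (rule ext)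
  moreover have "sdiff p \<mu> x \<nu> = 0" if "cell \<alpha> \<mu> (Suc (Suc q)) \<nu>" for \<nu>
  proof (rule ccontr)
    assume n: "sdiff p \<mu> x \<nu> \<noteq> 0"
    have "sdiff p \<mu> x \<nu> \<odot>\<^bsub>I 0\<^esub> Sv (\<mu> + int (mdeg p \<nu>)) = \<zero>\<^bsub>I 0\<^esub>"
      using D0.P.cdif_cdif[OF c0, of \<nu>] unfolding e cdif_sv by (simp add: sv_def)
    then have "inverse (sdiff p \<mu> x \<nu>) \<odot>\<^bsub>I 0\<^esub> (sdiff p \<mu> x \<nu> \<odot>\<^bsub>I 0\<^esub> Sv (\<mu> + int (mdeg p \<nu>))) = \<zero>\<^bsub>I 0\<^esub>"
      by simp
    then have "Sv (\<mu> + int (mdeg p \<nu>)) = \<zero>\<^bsub>I 0\<^esub>" using n by (simp add: D0.M.smult_smult)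
    then show False using Sv_nonzero[OF \<mu>_ge] that by (simp add: cell_def)
  qed
  ultimately show ?thesis by (rule that)
qed

text \<open>The Morse homotopy inverts the differential on a cocycle at every cell that is not
  critical; its support is controlled by that of \<open>x\<close>.\<close>

lemma reduce_crit:
  assumes x: "good (Suc q) x" and q: "q > 0" and closed: "\<And>\<nu>. cell \<alpha> \<mu> (Suc (Suc q)) \<nu> \<Longrightarrow> sdiff p \<mu> x \<nu> = 0"
  obtains y where "good q y" "\<And>\<nu>. cell \<alpha> \<mu> (Suc q) \<nu> \<Longrightarrow> \<nu> \<notin> crit \<alpha> \<mu> (Suc q) \<Longrightarrow> sdiff p \<mu> y \<nu> = x \<nu>"
proof -
  define y where "y \<nu> = hcoef p \<alpha> \<mu> \<nu> * x (inc \<nu> (actv p \<mu> \<nu>))" for \<nu>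
  have "good q y"
    unfolding good_def
  proof (intro conjI allI impI)
    fix \<nu> assume "y \<nu> \<noteq> 0"
    then have h: "hcoef p \<alpha> \<mu> \<nu> \<noteq> (0 :: 'k)" and xi: "x (inc \<nu> (actv p \<mu> \<nu>)) \<noteq> 0" by (auto simp: y_def)
    then have "cell \<alpha> \<mu> (Suc q) (inc \<nu> (actv p \<mu> \<nu>))" and ev: "even (a + b)" using x by (auto simp: good_def)
    then have fs: "fsupp (inc \<nu> (actv p \<mu> \<nu>))" and m: "msize (inc \<nu> (actv p \<mu> \<nu>)) = Suc q" by (auto simp: cell_def)
    have fs': "fsupp \<nu>" using fsupp_dec[OF fs, of "actv p \<mu> \<nu>"] by simp
    have "mup TYPE('k) p \<alpha> \<mu> \<nu>" using h by (simp add: hcoef_def Let_def split: if_splits)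
    then have "\<mu> + int (mdeg p \<nu>) \<le> \<alpha>" by (simp add: mup_def Let_def)
    then show "cell \<alpha> \<mu> q \<nu>" using fs' m by (simp add: cell_def msize_inc)
    show "even (a + b)" by (rule ev)
  next
    show "finite {\<nu>. y \<nu> \<noteq> 0}"
    proof (rule finite_inc_image)
      show "finite {\<nu>. x \<nu> \<noteq> 0}" using x by (simp add: good_def)
      show "inc \<nu> (actv p \<mu> \<nu>) \<in> {\<nu>. x \<nu> \<noteq> 0}" if "\<nu> \<in> {\<nu>. y \<nu> \<noteq> 0}" for \<nu> using that by (simp add: y_def)
      show "\<nu> \<in> {\<nu>. x \<nu> \<noteq> 0} \<Longrightarrow> fsupp \<nu>" for \<nu> using x by (auto simp: good_def cell_def)
    qed
  qed
  moreover have "sdiff p \<mu> y \<nu> = x \<nu>" if "cell \<alpha> \<mu> (Suc q) \<nu>" "\<nu> \<notin> crit \<alpha> \<mu> (Suc q)" for \<nu>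
    unfolding y_def by (rule morse[OF closed that(1)]) (use that in \<open>auto simp: crit_def\<close>)
  ultimately show ?thesis by (rule that)
qed

lemma sv_im: "sv x \<nu> \<in> \<epsilon> ` carrier (weyl a)"
proof -
  interpret W: kvs "weyl a :: ('k, ('k mat \<Rightarrow> 'k) \<Rightarrow> 'k) gmod" by (rule kvs_weyl)
  let ?\<kappa> = "\<mu> + int (mdeg p \<nu>)"
  define s where "s = (if 1 \<le> ?\<kappa> \<and> ?\<kappa> \<le> \<alpha> then x \<nu> else 0)"
  define \<delta> :: "('k mat \<Rightarrow> 'k) \<Rightarrow> 'k" where "\<delta> = dlt a (nat (?\<kappa> - 1))"
  have \<delta>: "\<delta> \<in> carrier (weyl a)" by (simp add: \<delta>_def)
  have "sv x \<nu> = s \<odot>\<^bsub>I 0\<^esub> \<epsilon> \<delta>"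
    using E.h_cl[OF \<delta>] by (simp add: sv_def Sv_def s_def \<delta>_def)
  also have "\<dots> = \<epsilon> (s \<odot>\<^bsub>weyl a\<^esub> \<delta>)" by (rule E.h_smult[OF \<delta>, symmetric])
  finally show ?thesis using W.smult_cl[OF \<delta>, of s] by (rule image_eqI)
qed

text \<open>Dimension shifting through the double complex: \<open>f = d c2\<close>, \<open>\<delta> c2 = d c1\<close>, \<open>\<delta> c1 = d c0\<close>,
  and \<open>\<delta> c0\<close> comes from a cochain of the Weyl module.\<close>

definition zig :: "((('k mat \<Rightarrow> 'k) \<Rightarrow> 'k) \<Rightarrow> 'u) \<Rightarrow> ((nat \<Rightarrow> nat) \<Rightarrow> 'k) \<Rightarrow> bool" where
  "zig f \<rho> \<longleftrightarrow> (\<exists>c2\<in>coch (I 2) p 0 (int b). \<exists>c1\<in>coch (I 1) p (Suc 0) (int b). \<exists>c0\<in>coch (I 0) p (Suc (Suc 0)) (int b).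
     d 2 (c2 (\<lambda>_. 0)) = f (dlt b b) \<and> (\<forall>\<nu>. d 1 (c1 \<nu>) = cdif (I 2) p c2 \<nu>) \<and>
     (\<forall>\<nu>. d 0 (c0 \<nu>) = cdif (I 1) p c1 \<nu>) \<and> (\<forall>\<nu>. cdif (I 0) p c0 \<nu> = sv \<rho> \<nu>))"

text \<open>Each lift exists by exactness, because the next differential of the resolution kills the
  cochain to be lifted. Finally \<open>c0\<close> is changed by a cochain with values in the image
  of \<open>\<epsilon>\<close>, which \<open>d 0\<close> does not see, in order to concentrate
  \<open>\<rho>\<close> on the critical cells.\<close>

lemma zig_total:
  assumes f: "f \<in> gmod_hom (weyl b) (I 3)" and df: "d 3 (f (dlt b b)) = \<zero>\<^bsub>I 4\<^esub>"
  obtains \<rho> where "\<And>\<nu>. \<nu> \<notin> crit \<alpha> \<mu> 3 \<Longrightarrow> \<rho> \<nu> = 0" "zig f \<rho>"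
proof -
  interpret f: weyl_hom "I 3" b f by (rule weyl_homI[OF f])
  \<comment> \<open>The image of the highest weight vector as a cochain of degree 0; its
    U-invariance makes it a cocycle.\<close>
  define c3 where "c3 \<nu> = (if \<nu> = (\<lambda>_. 0) then f (dlt b b) else \<zero>\<^bsub>I 3\<^esub>)" for \<nu> :: "nat \<Rightarrow> nat"
  have c3: "c3 \<in> coch (I 3) p 0 (int b)"
    unfolding coch_def
  proof (intro CollectI conjI allI impI)
    have "mdeg p (\<lambda>_. 0) = 0" by (simp add: mdeg_def)
    then show "c3 \<nu> \<in> wt (I 3) (int b + 2 * int (mdeg p \<nu>))" for \<nu> using f.h_top(1) by (auto simp: c3_def)
    show "c3 \<nu> = \<zero>\<^bsub>I 3\<^esub>" if "\<not> (fsupp \<nu> \<and> msize \<nu> = 0)" for \<nu> using that by (auto simp: c3_def fsupp_def msize_def)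
    have "{\<nu>. c3 \<nu> \<noteq> \<zero>\<^bsub>I 3\<^esub>} \<subseteq> {\<lambda>_. 0}" by (auto simp: c3_def)
    then show "finite {\<nu>. c3 \<nu> \<noteq> \<zero>\<^bsub>I 3\<^esub>}" by (rule finite_subset) simp
  qed
  have op0: "op (I 3) p i n (f (dlt b b)) = \<zero>\<^bsub>I 3\<^esub>" for i n
  proof -
    have "(eop (I 3) s ^^ r) \<zero>\<^bsub>I 3\<^esub> = \<zero>\<^bsub>I 3\<^esub>" for s r by (induction r) auto
    moreover have "\<exists>r. (if even n then 1 else p - 1) = Suc r" using p_ge3 by (intro exI[of _ "if even n then 0 else p - 2"]) auto
    ultimately show ?thesis using f.h_top(2)[of "p ^ i"] by (auto simp: op_def funpow_Suc_right One_nat_def simp del: funpow.simps)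
  qed
  have dc3: "cdif (I 3) p c3 \<nu> = \<zero>\<^bsub>I 3\<^esub>" for \<nu>
  proof (cases "fsupp \<nu>")
    case True
    show ?thesis
    proof (rule D2.N.fnl_eqI)
      fix \<phi> assume \<phi>: "\<phi> \<in> fnl (I 3)"
      have "op (I 3) p i n (c3 \<nu>) = \<zero>\<^bsub>I 3\<^esub>" for i n \<nu> by (simp add: c3_def op0)
      then show "\<phi> (cdif (I 3) p c3 \<nu>) = \<phi> \<zero>\<^bsub>I 3\<^esub>"
        by (simp add: D2.Q.fnl_cdif[where c = c3, OF \<phi> D2.Q.coch_cl[OF c3] True] D2.N.fnl_zero[OF \<phi>])
    qed (auto intro: D2.Q.cdif_cl D2.Q.coch_cl[OF c3])
  qed (simp add: D2.Q.cdif_infinite)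
  have "c3 \<nu> \<in> d 2 ` carrier (I 2)" for \<nu>
  proof -
    have "d 3 \<zero>\<^bsub>I 3\<^esub> = \<zero>\<^bsub>I 4\<^esub>"
    proof -
      interpret D3: prat_hom "I 3" "I 4" "d 3" p using d_hom[of 3] by (simp add: numeral_eq_Suc)
      show ?thesis by simp
    qed
    then show ?thesis unfolding exact_3 using df by (simp add: c3_def)
  qed
  then obtain c2 where c2: "c2 \<in> coch (I 2) p 0 (int b)" "\<And>\<nu>. d 2 (c2 \<nu>) = c3 \<nu>"
    by (rule D2.coch_lift[OF c3]) (rule that)
  note cd2 = D1.Q.cdif_coch[OF c2(1)]
  have "d 2 (cdif (I 2) p c2 \<nu>) = \<zero>\<^bsub>I 3\<^esub>" for \<nu>
    using D2.h_cdif[of c2 \<nu>, OF D1.Q.coch_cl[OF c2(1)]] by (simp add: c2(2) dc3)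
  then have "cdif (I 2) p c2 \<nu> \<in> d 1 ` carrier (I 1)" for \<nu>
    unfolding exact_2 using D1.Q.coch_cl[OF cd2] by simp
  then obtain c1 where c1: "c1 \<in> coch (I 1) p (Suc 0) (int b)" "\<And>\<nu>. d 1 (c1 \<nu>) = cdif (I 2) p c2 \<nu>"
    by (rule D1.coch_lift[OF cd2]) (rule that)
  note cd1 = D0.Q.cdif_coch[OF c1(1)]
  have "d 1 (cdif (I 1) p c1 \<nu>) = \<zero>\<^bsub>I 2\<^esub>" for \<nu>
    using D1.h_cdif[of c1 \<nu>, OF D0.Q.coch_cl[OF c1(1)]] D1.Q.cdif_cdif[OF c2(1), of \<nu>] by (simp add: c1(2))
  then have "cdif (I 1) p c1 \<nu> \<in> d 0 ` carrier (I 0)" for \<nu>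
    unfolding exact_1 using D0.Q.coch_cl[OF cd1] by simp
  then obtain c0 where c0: "c0 \<in> coch (I 0) p (Suc (Suc 0)) (int b)" "\<And>\<nu>. d 0 (c0 \<nu>) = cdif (I 1) p c1 \<nu>"
    by (rule D0.coch_lift[OF cd1]) (rule that)
  note cd0 = D0.P.cdif_coch[OF c0(1)]
  have "d 0 (cdif (I 0) p c0 \<nu>) = \<zero>\<^bsub>I 1\<^esub>" for \<nu>
    using D0.h_cdif[of c0 \<nu>, OF D0.P.coch_cl[OF c0(1)]] D0.Q.cdif_cdif[OF c1(1), of \<nu>] by (simp add: c0(2))
  then have "cdif (I 0) p c0 \<nu> \<in> \<epsilon> ` carrier (weyl a)" for \<nu>
    unfolding exact_0 using D0.P.coch_cl[OF cd0] by simp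
  then obtain x where x: "good (Suc (Suc (Suc 0))) x" "cdif (I 0) p c0 = sv x"
    "\<And>\<nu>. cell \<alpha> \<mu> (Suc (Suc (Suc (Suc 0)))) \<nu> \<Longrightarrow> sdiff p \<mu> x \<nu> = 0"
    by (rule cdif_scalar[OF c0(1)]) (rule that)
  obtain y where y: "good (Suc (Suc 0)) y"
    "\<And>\<nu>. cell \<alpha> \<mu> (Suc (Suc (Suc 0))) \<nu> \<Longrightarrow> \<nu> \<notin> crit \<alpha> \<mu> (Suc (Suc (Suc 0))) \<Longrightarrow> sdiff p \<mu> y \<nu> = x \<nu>"
    by (rule reduce_crit[OF x(1) _ x(3)]) (simp, assumption, rule that)
  \<comment> \<open>What is left of \<open>x\<close> after the coboundary of \<open>y\<close> is
    subtracted; on cells that are not critical the two agree.\<close>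
  define \<rho> where "\<rho> \<nu> = (if \<nu> \<in> crit \<alpha> \<mu> 3 then x \<nu> - sdiff p \<mu> y \<nu> else 0)" for \<nu>
  note svy = sv_coch[OF y(1)]
  let ?c = "cadd (I 0) (- 1) c0 (sv y)"
  have c: "?c \<in> coch (I 0) p (Suc (Suc 0)) (int b)" by (rule D0.P.cadd_coch[OF c0(1) svy])
  have "d 0 (?c \<nu>) = cdif (I 1) p c1 \<nu>" for \<nu>
  proof -
    have "sv y \<nu> \<in> \<epsilon> ` carrier (weyl a)" by (rule sv_im)
    then have "d 0 (sv y \<nu>) = \<zero>\<^bsub>I 1\<^esub>" unfolding exact_0 by simp
    then show ?thesis unfolding D0.h_cadd[OF c0(1) svy] unfolding cadd_def c0(2) using D0.Q.coch_cl[OF cd1, of \<nu>] by simp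
  qed
  moreover have "cdif (I 0) p ?c \<nu> = sv \<rho> \<nu>" for \<nu>
  proof -
    have e: "cdif (I 0) p ?c \<nu> = sv (\<lambda>\<nu>. x \<nu> - sdiff p \<mu> y \<nu>) \<nu>"
      unfolding D0.P.cdif_cadd[OF c0(1) svy] unfolding cadd_def x(2) cdif_sv sv_def
      using D0.M.smult_add_l[OF Sv_cl, of "x \<nu>" "- sdiff p \<mu> y \<nu>" "\<mu> + int (mdeg p \<nu>)"]
      by (simp add: D0.M.smult_smult)
    show ?thesis
    proof (cases "\<nu> \<in> crit \<alpha> \<mu> 3")
      case True
      then show ?thesis unfolding e by (simp add: sv_def \<rho>_def)
    next
      case False
      show ?thesis
      proof (cases "cell \<alpha> \<mu> 3 \<nu>")
        case True
        then have "sdiff p \<mu> y \<nu> = x \<nu>" using False y(2) by (simp add: numeral_3_eq_3)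
        then show ?thesis unfolding e using False by (simp add: sv_def \<rho>_def)
      next
        case nc: False
        have "cdif (I 0) p ?c \<nu> = \<zero>\<^bsub>I 0\<^esub>"
        proof (cases "fsupp \<nu> \<and> msize \<nu> = 3")
          case True
          then have "\<not> \<mu> + int (mdeg p \<nu>) \<le> \<alpha>" using nc by (simp add: cell_def)
          then show ?thesis unfolding e by (simp add: sv_def Sv_def)
        next
          case False
          then show ?thesis using D0.P.coch_out[OF D0.P.cdif_coch[OF c]] by (simp add: numeral_3_eq_3 numeral_2_eq_2)
        qed
        then show ?thesis using False by (simp add: sv_def \<rho>_def)
      qed
    qed
  qed
  ultimately have "zig f \<rho>"
    unfolding zig_def using c1 c2 by (intro bexI[OF _ c2(1)] bexI[OF _ c1(1)] bexI[OF _ c] conjI allI) (simp_all add: c3_def)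
  then show ?thesis by (rule that[rotated]) (simp add: \<rho>_def)
qed

text \<open>The lifts in a zigzag are choices, so \<open>\<rho>\<close> is not a function of
  \<open>f\<close>; linearity of the relation takes the place of a linear map.\<close>

lemma zig_linear:
  assumes f: "zig f \<rho>" and g: "zig g \<sigma>"
    and fg: "h (dlt b b) = f (dlt b b) \<oplus>\<^bsub>I 3\<^esub> s \<odot>\<^bsub>I 3\<^esub> g (dlt b b)"
  shows "zig h (\<lambda>\<nu>. \<rho> \<nu> + s * \<sigma> \<nu>)"
proof -
  obtain c2 c1 c0 where c: "c2 \<in> coch (I 2) p 0 (int b)" "c1 \<in> coch (I 1) p (Suc 0) (int b)" "c0 \<in> coch (I 0) p (Suc (Suc 0)) (int b)"
    and e: "d 2 (c2 (\<lambda>_. 0)) = f (dlt b b)" "\<And>\<nu>. d 1 (c1 \<nu>) = cdif (I 2) p c2 \<nu>"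
     "\<And>\<nu>. d 0 (c0 \<nu>) = cdif (I 1) p c1 \<nu>" "\<And>\<nu>. cdif (I 0) p c0 \<nu> = sv \<rho> \<nu>"
    using f unfolding zig_def by blast
  obtain b2 b1 b0 where c': "b2 \<in> coch (I 2) p 0 (int b)" "b1 \<in> coch (I 1) p (Suc 0) (int b)" "b0 \<in> coch (I 0) p (Suc (Suc 0)) (int b)"
    and e': "d 2 (b2 (\<lambda>_. 0)) = g (dlt b b)" "\<And>\<nu>. d 1 (b1 \<nu>) = cdif (I 2) p b2 \<nu>"
     "\<And>\<nu>. d 0 (b0 \<nu>) = cdif (I 1) p b1 \<nu>" "\<And>\<nu>. cdif (I 0) p b0 \<nu> = sv \<sigma> \<nu>"
    using g unfolding zig_def by blast
  show ?thesis unfolding zig_def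
  proof (intro bexI conjI allI)
    show "cadd (I 2) s c2 b2 \<in> coch (I 2) p 0 (int b)" by (rule D1.Q.cadd_coch[OF c(1) c'(1)])
    show "cadd (I 1) s c1 b1 \<in> coch (I 1) p (Suc 0) (int b)" by (rule D0.Q.cadd_coch[OF c(2) c'(2)])
    show "cadd (I 0) s c0 b0 \<in> coch (I 0) p (Suc (Suc 0)) (int b)" by (rule D0.P.cadd_coch[OF c(3) c'(3)])
    show "d 2 (cadd (I 2) s c2 b2 (\<lambda>_. 0)) = h (dlt b b)"
      unfolding D2.h_cadd[OF c(1) c'(1)] unfolding cadd_def e e' fg ..
    show "d 1 (cadd (I 1) s c1 b1 \<nu>) = cdif (I 2) p (cadd (I 2) s c2 b2) \<nu>" for \<nu>
      unfolding D1.h_cadd[OF c(2) c'(2)] D1.Q.cdif_cadd[OF c(1) c'(1)] unfolding cadd_def e e' ..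
    show "d 0 (cadd (I 0) s c0 b0 \<nu>) = cdif (I 1) p (cadd (I 1) s c1 b1) \<nu>" for \<nu>
      unfolding D0.h_cadd[OF c(3) c'(3)] D0.Q.cdif_cadd[OF c(2) c'(2)] unfolding cadd_def e e' ..
    show "cdif (I 0) p (cadd (I 0) s c0 b0) \<nu> = sv (\<lambda>\<nu>. \<rho> \<nu> + s * \<sigma> \<nu>) \<nu>" for \<nu>
      unfolding D0.P.cdif_cadd[OF c(3) c'(3)] unfolding cadd_def e e' sv_def
      by (simp add: D0.M.smult_add_l D0.M.smult_smult)
  qed
qed

text \<open>The zigzag run backwards, with \<delta> the cochain differential: acyclicity gives c0 =
  \<delta> z0 and then c1 - d z0 = \<delta> z1, so c2 - d z1 is a U-invariant vector of weight b. By
  the universal property it defines \<open>h\<close>, and \<open>d 2\<close> sends it to the vector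
  of \<open>f\<close> because d d = 0.\<close>

lemma zig_zero:
  assumes f: "f \<in> gmod_hom (weyl b) (I 3)" and z: "zig f (\<lambda>_. 0)"
  shows "\<exists>h\<in>gmod_hom (weyl b) (I 2). f = compose (carrier (weyl b)) (d 2) h"
proof -
  obtain c2 c1 c0 where c: "c2 \<in> coch (I 2) p 0 (int b)" "c1 \<in> coch (I 1) p (Suc 0) (int b)" "c0 \<in> coch (I 0) p (Suc (Suc 0)) (int b)"
    and e: "d 2 (c2 (\<lambda>_. 0)) = f (dlt b b)" "\<And>\<nu>. d 1 (c1 \<nu>) = cdif (I 2) p c2 \<nu>"
     "\<And>\<nu>. d 0 (c0 \<nu>) = cdif (I 1) p c1 \<nu>" "\<And>\<nu>. cdif (I 0) p c0 \<nu> = sv (\<lambda>_. 0) \<nu>"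
    using z unfolding zig_def by blast
  have "cdif (I 0) p c0 \<nu> = \<zero>\<^bsub>I 0\<^esub>" for \<nu> by (simp add: e sv_def)
  then obtain z0 where z0: "z0 \<in> coch (I 0) p (Suc 0) (int b)" "cdif (I 0) p z0 = c0"
    by (rule acyclic_I[OF c(3)]) (rule that)
  note dz0 = D0.h_coch[OF z0(1)]
  define b1 where "b1 = cadd (I 1) (- 1) c1 (\<lambda>\<nu>. d 0 (z0 \<nu>))"
  have b1: "b1 \<in> coch (I 1) p (Suc 0) (int b)" unfolding b1_def by (rule D0.Q.cadd_coch[OF c(2) dz0])
  have "cdif (I 1) p b1 \<nu> = \<zero>\<^bsub>I 1\<^esub>" for \<nu>
  proof -
    have "cdif (I 1) p (\<lambda>\<nu>. d 0 (z0 \<nu>)) \<nu> = cdif (I 1) p c1 \<nu>"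
      using D0.h_cdif[of z0 \<nu>, OF D0.P.coch_cl[OF z0(1)]] by (simp add: z0(2) e(3))
    then show ?thesis unfolding b1_def D0.Q.cdif_cadd[OF c(2) dz0] unfolding cadd_def
      using D0.Q.coch_cl[OF D0.Q.cdif_coch[OF c(2)]] by (simp add: D0.N.smult_m1 D0.N.r_neg)
  qed
  then obtain z1 where z1: "z1 \<in> coch (I 1) p 0 (int b)" "cdif (I 1) p z1 = b1"
    by (rule acyclic_I[OF b1]) (rule that)
  note dz1 = D1.h_coch[OF z1(1)]
  define b2 where "b2 = cadd (I 2) (- 1) c2 (\<lambda>\<nu>. d 1 (z1 \<nu>))"
  have b2: "b2 \<in> coch (I 2) p 0 (int b)" unfolding b2_def by (rule D1.Q.cadd_coch[OF c(1) dz1])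
  have dd: "d 1 (d 0 v) = \<zero>\<^bsub>I 2\<^esub>" if "v \<in> carrier (I 0)" for v using exact_1 that by blast
  have dd': "d 2 (d 1 v) = \<zero>\<^bsub>I 3\<^esub>" if "v \<in> carrier (I 1)" for v using exact_2 that by blast
  have "cdif (I 2) p b2 \<nu> = \<zero>\<^bsub>I 2\<^esub>" for \<nu>
  proof -
    have "cdif (I 2) p (\<lambda>\<nu>. d 1 (z1 \<nu>)) \<nu> = d 1 (b1 \<nu>)"
      using D1.h_cdif[of z1 \<nu>, OF D0.Q.coch_cl[OF z1(1)]] by (simp add: z1(2))
    also have "\<dots> = cdif (I 2) p c2 \<nu>"
      unfolding b1_def D1.h_cadd[OF c(2) dz0] unfolding cadd_def e(2) dd[OF D0.P.coch_cl[OF z0(1)]]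
      using D1.Q.coch_cl[OF D1.Q.cdif_coch[OF c(1)]] by simp
    finally show ?thesis unfolding b2_def D1.Q.cdif_cadd[OF c(1) dz1] unfolding cadd_def
      using D1.Q.coch_cl[OF D1.Q.cdif_coch[OF c(1)]] by (simp add: D1.N.smult_m1 D1.N.r_neg)
  qed
  then have inv: "eop (I 2) t (b2 (\<lambda>_. 0)) = \<zero>\<^bsub>I 2\<^esub>" if "t > 0" for t using D1.Q.cdif_zero_size_0[OF b2 _ that] by blast
  have "b2 (\<lambda>_. 0) \<in> wt (I 2) (int b)" using D1.Q.coch_wt[OF b2, of "\<lambda>_. 0"] by (simp add: mdeg_def)
  then obtain h where h: "h \<in> gmod_hom (weyl b) (I 2)" "h (dlt b b) = b2 (\<lambda>_. 0)"
    using D1.N.weyl_universal[OF _ inv] by blast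
  have "d 2 (b2 (\<lambda>_. 0)) = f (dlt b b)"
    unfolding b2_def D2.h_cadd[OF c(1) dz1] unfolding cadd_def e(1) dd'[OF D0.Q.coch_cl[OF z1(1)]]
    using D1.Q.coch_cl[OF c(1), of "\<lambda>_. 0"] D2.h_cl[of "c2 (\<lambda>_. 0)"] by (simp add: e(1))
  then have top: "d 2 (h (dlt b b)) = f (dlt b b)" by (simp add: h(2))
  interpret h: weyl_hom "I 2" b h by (rule weyl_homI[OF h(1)])
  interpret W: kvs "weyl b :: ('k, ('k mat \<Rightarrow> 'k) \<Rightarrow> 'k) gmod" by (rule kvs_weyl)
  have "compose (carrier (weyl b)) (d 2) h \<in> gmod_hom (weyl b) (I 3)"
    unfolding gmod_hom_def LinearCombinations.module_hom_def
    by (auto simp: compose_def h.h_add h.h_smult h.h_act D2.h_add D2.h_smult D2.h_act weyl_act_cl)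
  then have "f = compose (carrier (weyl b)) (d 2) h"
    using top by (intro weyl_hom_determined[OF weyl_homI[OF f] weyl_homI]) (auto simp: compose_def)
  then show ?thesis using h(1) by blast
qed

end

end

section \<open>The dimension bound\<close>

context kvs
begin

section \<open>Dimension bounds from linear relations\<close>

lemma span_add: "S \<subseteq> carrier M \<Longrightarrow> u \<in> span S \<Longrightarrow> v \<in> span S \<Longrightarrow> u \<oplus> v \<in> span S"
  and span_smult: "S \<subseteq> carrier M \<Longrightarrow> v \<in> span S \<Longrightarrow> c \<odot> v \<in> span S"
  and span_zero: "S \<subseteq> carrier M \<Longrightarrow> \<zero> \<in> span S"
  using span_is_submodule[of S] by (auto simp: submodule_def class_ring_simps)

text \<open>Gaussian elimination for a linear relation. If \<open>u0\<close> has a nonzero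
  coordinate at \<open>c\<close>, subtracting a multiple of it brings any element of
  \<open>U\<close> into the part \<open>U'\<close> whose coordinates live on \<open>C\<close>; when
  all coordinates are gone, the kernel condition applies.\<close>

lemma linear_relation_span:
  fixes R :: "'v \<Rightarrow> ('c \<Rightarrow> 'k) \<Rightarrow> bool"
  assumes C: "finite C" and U: "U \<subseteq> carrier M" "\<zero> \<in> U" "\<And>u v s. u \<in> U \<Longrightarrow> v \<in> U \<Longrightarrow> u \<oplus> s \<odot> v \<in> U"
    and lin: "\<And>u v \<rho> \<sigma> s. R u \<rho> \<Longrightarrow> R v \<sigma> \<Longrightarrow> R (u \<oplus> s \<odot> v) (\<lambda>c. \<rho> c + s * \<sigma> c)"
    and total: "\<And>u. u \<in> U \<Longrightarrow> \<exists>\<rho>. (\<forall>c. c \<notin> C \<longrightarrow> \<rho> c = 0) \<and> R u \<rho>"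
    and ker: "\<And>u. u \<in> U \<Longrightarrow> R u (\<lambda>_. 0) \<Longrightarrow> u = \<zero>"
  shows "\<exists>A. finite A \<and> card A \<le> card C \<and> A \<subseteq> U \<and> U \<subseteq> span A"
  using C U total ker
proof (induction C arbitrary: U rule: finite_induct)
  case empty
  have "U \<subseteq> {\<zero>}"
  proof
    fix u assume u: "u \<in> U"
    obtain \<rho> where "\<forall>c. c \<notin> {} \<longrightarrow> \<rho> c = 0" "R u \<rho>" using empty.prems(4)[OF u] by blast
    moreover from this have "\<rho> = (\<lambda>_. 0)" by auto
    ultimately show "u \<in> {\<zero>}" using empty.prems(5)[OF u] by simp
  qed
  then show ?case using span_zero[of "{}"] by (intro exI[of _ "{}"]) auto
next
  case (insert c C)
  define U' where "U' = {u \<in> U. \<exists>\<rho>. (\<forall>c. c \<notin> C \<longrightarrow> \<rho> c = 0) \<and> R u \<rho>}"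
  have cl: "u \<in> carrier M" if "u \<in> U" for u using that insert.prems(1) by blast
  have smul: "s \<odot> v \<in> U" if "v \<in> U" for v s
    using insert.prems(3)[OF insert.prems(2) that, of s] cl[OF that] by simp
  have lin': "u \<oplus> s \<odot> v \<in> U'" if "u \<in> U'" "v \<in> U'" for u v s
  proof -
    obtain \<rho> \<sigma> where "\<forall>c. c \<notin> C \<longrightarrow> \<rho> c = 0" "R u \<rho>" "\<forall>c. c \<notin> C \<longrightarrow> \<sigma> c = 0" "R v \<sigma>"
      using \<open>u \<in> U'\<close> \<open>v \<in> U'\<close> unfolding U'_def by blast
    then have "(\<forall>c. c \<notin> C \<longrightarrow> \<rho> c + s * \<sigma> c = 0) \<and> R (u \<oplus> s \<odot> v) (\<lambda>c. \<rho> c + s * \<sigma> c)" by (simp add: lin)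
    from exI[of "\<lambda>\<rho>. (\<forall>c. c \<notin> C \<longrightarrow> \<rho> c = 0) \<and> R (u \<oplus> s \<odot> v) \<rho>", OF this] show ?thesis
      using that insert.prems(3)[of u v s] by (simp add: U'_def)
  qed
  \<comment> \<open>Subtracting a related pair from itself relates 0 to the zero
    coordinates.\<close>
  have zero': "\<zero> \<in> U'"
  proof -
    obtain \<rho> where "R \<zero> \<rho>" using insert.prems(4)[OF insert.prems(2)] by blast
    then have "R (\<zero> \<oplus> (- 1) \<odot> \<zero>) (\<lambda>c. \<rho> c + (- 1) * \<rho> c)" by (intro lin)
    then have "R \<zero> (\<lambda>_. 0)" by simp
    then show ?thesis using insert.prems(2) unfolding U'_def by auto
  qed
  have "\<exists>A. finite A \<and> card A \<le> card C \<and> A \<subseteq> U' \<and> U' \<subseteq> span A"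
  proof (rule insert.IH)
    show "U' \<subseteq> carrier M" using insert.prems(1) by (auto simp: U'_def)
    show "\<exists>\<rho>. (\<forall>c. c \<notin> C \<longrightarrow> \<rho> c = 0) \<and> R u \<rho>" if "u \<in> U'" for u using that by (simp add: U'_def)
    show "u = \<zero>" if "u \<in> U'" "R u (\<lambda>_. 0)" for u using that insert.prems(5) by (simp add: U'_def)
  qed (fact zero' lin')+
  then obtain A where A: "finite A" "card A \<le> card C" "A \<subseteq> U'" "U' \<subseteq> span A" by blast
  show ?case
  proof (cases "U \<subseteq> U'")
    case True
    then show ?thesis using A insert.hyps by (intro exI[of _ A]) (auto simp: U'_def)
  next
    case False
    then obtain u0 where u0: "u0 \<in> U" "u0 \<notin> U'" by blast
    obtain \<rho>0 where r0: "\<forall>c'. c' \<notin> insert c C \<longrightarrow> \<rho>0 c' = 0" "R u0 \<rho>0" using insert.prems(4)[OF u0(1)] by blast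
    have nz: "\<rho>0 c \<noteq> 0"
    proof
      assume "\<rho>0 c = 0"
      then have "\<forall>c'. c' \<notin> C \<longrightarrow> \<rho>0 c' = 0" using r0(1) by auto
      then show False using u0 r0(2) unfolding U'_def by blast
    qed
    have As: "insert u0 A \<subseteq> U" using A(3) u0(1) by (auto simp: U'_def)
    then have Ac: "insert u0 A \<subseteq> carrier M" using insert.prems(1) by blast
    have "U \<subseteq> span (insert u0 A)"
    proof
      fix u assume u: "u \<in> U"
      obtain \<rho> where r: "\<forall>c'. c' \<notin> insert c C \<longrightarrow> \<rho> c' = 0" "R u \<rho>" using insert.prems(4)[OF u] by blast
      define s where "s = \<rho> c / \<rho>0 c"
      have "u \<oplus> (- s) \<odot> u0 \<in> U'"
        unfolding U'_def
      proof (intro CollectI conjI exI allI impI)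
        show "u \<oplus> (- s) \<odot> u0 \<in> U" by (rule insert.prems(3)[OF u u0(1)])
        show "R (u \<oplus> (- s) \<odot> u0) (\<lambda>c. \<rho> c + (- s) * \<rho>0 c)" by (rule lin[OF r(2) r0(2)])
        show "\<rho> c' + (- s) * \<rho>0 c' = 0" if "c' \<notin> C" for c'
          using that r(1) r0(1) nz by (cases "c' = c") (auto simp: s_def)
      qed
      then have 1: "u \<oplus> (- s) \<odot> u0 \<in> span (insert u0 A)"
        using A(4) span_is_monotone[of A "insert u0 A"] by blast
      have 2: "s \<odot> u0 \<in> span (insert u0 A)"
        using in_own_span[OF Ac] by (intro span_smult[OF Ac]) auto
      have "u = (u \<oplus> (- s) \<odot> u0) \<oplus> s \<odot> u0"
        using cl[OF u] cl[OF u0(1)] by (intro fnl_eqI) (auto simp: fnl_add fnl_smult)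
      then show "u \<in> span (insert u0 A)" using span_add[OF Ac 1 2] by simp
    qed
    moreover have "card (insert u0 A) \<le> card (insert c C)"
      using A(2) card_insert_le_m1[of "Suc (card C)" A u0] insert.hyps A(1) by (simp add: card_insert_if)
    ultimately show ?thesis using A(1) As by (intro exI[of _ "insert u0 A"]) auto
  qed
qed

lemma fin_dim_dim_le:
  assumes "finite A" "A \<subseteq> carrier M" "carrier M \<subseteq> span A"
  shows "fin_dim" "dim \<le> card A"
proof -
  have "span A = carrier M" using assms span_is_subset2[of A] by blast
  then show "fin_dim" "dim \<le> card A" using assms unfolding fin_dim_def dim_def by (auto intro: Least_le)
qed

section \<open>Subspaces, quotients and spaces of homomorphisms\<close>

lemma kvs_restrict:
  assumes U: "subsp U"
  shows "kvs (M\<lparr>carrier := U\<rparr>)"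
proof (rule kvsI)
  have c: "u \<in> carrier M" if "u \<in> U" for u using that U by (auto simp: subsp_def)
  show "\<zero>\<^bsub>M\<lparr>carrier := U\<rparr>\<^esub> \<in> carrier (M\<lparr>carrier := U\<rparr>)" using U by (simp add: subsp_def)
  fix u v w a b assume "u \<in> carrier (M\<lparr>carrier := U\<rparr>)" "v \<in> carrier (M\<lparr>carrier := U\<rparr>)" "w \<in> carrier (M\<lparr>carrier := U\<rparr>)"
  then have m: "u \<in> U" "v \<in> U" "w \<in> U" by auto
  note cm = m[THEN c]
  show "u \<oplus>\<^bsub>M\<lparr>carrier := U\<rparr>\<^esub> v \<in> carrier (M\<lparr>carrier := U\<rparr>)" using m U by (simp add: subsp_def)
  show "a \<odot>\<^bsub>M\<lparr>carrier := U\<rparr>\<^esub> u \<in> carrier (M\<lparr>carrier := U\<rparr>)" using m U by (simp add: subsp_def)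
  show "\<zero>\<^bsub>M\<lparr>carrier := U\<rparr>\<^esub> \<oplus>\<^bsub>M\<lparr>carrier := U\<rparr>\<^esub> u = u" "1 \<odot>\<^bsub>M\<lparr>carrier := U\<rparr>\<^esub> u = u" using cm by simp_all
  show "u \<oplus>\<^bsub>M\<lparr>carrier := U\<rparr>\<^esub> v = v \<oplus>\<^bsub>M\<lparr>carrier := U\<rparr>\<^esub> u" using cm by (simp add: a_comm)
  show "u \<oplus>\<^bsub>M\<lparr>carrier := U\<rparr>\<^esub> v \<oplus>\<^bsub>M\<lparr>carrier := U\<rparr>\<^esub> w = u \<oplus>\<^bsub>M\<lparr>carrier := U\<rparr>\<^esub> (v \<oplus>\<^bsub>M\<lparr>carrier := U\<rparr>\<^esub> w)" using cm by (simp add: a_assoc)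
  show "u \<oplus>\<^bsub>M\<lparr>carrier := U\<rparr>\<^esub> (- 1) \<odot>\<^bsub>M\<lparr>carrier := U\<rparr>\<^esub> u = \<zero>\<^bsub>M\<lparr>carrier := U\<rparr>\<^esub>" using cm by (simp add: smult_m1 r_neg)
  show "(a + b) \<odot>\<^bsub>M\<lparr>carrier := U\<rparr>\<^esub> u = a \<odot>\<^bsub>M\<lparr>carrier := U\<rparr>\<^esub> u \<oplus>\<^bsub>M\<lparr>carrier := U\<rparr>\<^esub> b \<odot>\<^bsub>M\<lparr>carrier := U\<rparr>\<^esub> u" using cm by (simp add: smult_add_l)
  show "a \<odot>\<^bsub>M\<lparr>carrier := U\<rparr>\<^esub> (u \<oplus>\<^bsub>M\<lparr>carrier := U\<rparr>\<^esub> v) = a \<odot>\<^bsub>M\<lparr>carrier := U\<rparr>\<^esub> u \<oplus>\<^bsub>M\<lparr>carrier := U\<rparr>\<^esub> a \<odot>\<^bsub>M\<lparr>carrier := U\<rparr>\<^esub> v" using cm by (simp add: smult_add_r)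
  show "(a * b) \<odot>\<^bsub>M\<lparr>carrier := U\<rparr>\<^esub> u = a \<odot>\<^bsub>M\<lparr>carrier := U\<rparr>\<^esub> (b \<odot>\<^bsub>M\<lparr>carrier := U\<rparr>\<^esub> u)" using cm by (simp add: smult_smult)
qed

end

text \<open>All operations, including zero, are expressed on representatives, so that the vector
  space laws can be checked there.\<close>

lemma quotient_space_simps:
  fixes V :: "('k::field, 'v) module"
  assumes "kvs V" and W: "kvs.subsp V W"
  shows "carrier (quotient_space V W) = (\<lambda>x. W +>\<^bsub>V\<^esub> x) ` carrier V"
    and "\<zero>\<^bsub>quotient_space V W\<^esub> = W +>\<^bsub>V\<^esub> \<zero>\<^bsub>V\<^esub>"
    and "x \<in> carrier V \<Longrightarrow> y \<in> carrier V \<Longrightarrow> (W +>\<^bsub>V\<^esub> x) \<oplus>\<^bsub>quotient_space V W\<^esub> (W +>\<^bsub>V\<^esub> y) = W +>\<^bsub>V\<^esub> (x \<oplus>\<^bsub>V\<^esub> y)"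
    and "x \<in> carrier V \<Longrightarrow> c \<odot>\<^bsub>quotient_space V W\<^esub> (W +>\<^bsub>V\<^esub> x) = W +>\<^bsub>V\<^esub> (c \<odot>\<^bsub>V\<^esub> x)"
    and "x \<in> W \<Longrightarrow> W +>\<^bsub>V\<^esub> x = W +>\<^bsub>V\<^esub> \<zero>\<^bsub>V\<^esub>"
proof -
  interpret kvs V by fact
  have Wc: "w \<in> carrier V" if "w \<in> W" for w using W that by (auto simp: subsp_def)
  have W': "\<zero>\<^bsub>V\<^esub> \<in> W" "\<And>u v. u \<in> W \<Longrightarrow> v \<in> W \<Longrightarrow> u \<oplus>\<^bsub>V\<^esub> v \<in> W" "\<And>c v. v \<in> W \<Longrightarrow> c \<odot>\<^bsub>V\<^esub> v \<in> W"
    using W by (auto simp: subsp_def)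
  have sg: "subgroup W (add_monoid V)"
  proof (rule subgroup.intro)
    fix x assume "x \<in> W"
    then have "(- 1) \<odot>\<^bsub>V\<^esub> x \<in> W" by (rule W')
    then show "inv\<^bsub>add_monoid V\<^esub> x \<in> W" using Wc[OF \<open>x \<in> W\<close>] by (simp add: smult_m1 a_inv_def)
  qed (use W' Wc in auto)
  have ab: "abelian_subgroup W V"
    by (rule abelian_subgroupI3[OF additive_subgroupI[OF sg]]) (rule abelian_group_axioms)
  show "carrier (quotient_space V W) = (\<lambda>x. W +>\<^bsub>V\<^esub> x) ` carrier V"
    by (auto simp: quotient_space_def A_RCOSETS_def')
  have z: "W +>\<^bsub>V\<^esub> \<zero>\<^bsub>V\<^esub> = W" using Wc by (auto simp: a_r_coset_def')
  then show "\<zero>\<^bsub>quotient_space V W\<^esub> = W +>\<^bsub>V\<^esub> \<zero>\<^bsub>V\<^esub>" by (simp add: quotient_space_def)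
  show "x \<in> carrier V \<Longrightarrow> y \<in> carrier V \<Longrightarrow> (W +>\<^bsub>V\<^esub> x) \<oplus>\<^bsub>quotient_space V W\<^esub> (W +>\<^bsub>V\<^esub> y) = W +>\<^bsub>V\<^esub> (x \<oplus>\<^bsub>V\<^esub> y)"
    by (simp add: quotient_space_def abelian_subgroup.a_rcos_sum[OF ab])
  show "c \<odot>\<^bsub>quotient_space V W\<^esub> (W +>\<^bsub>V\<^esub> x) = W +>\<^bsub>V\<^esub> (c \<odot>\<^bsub>V\<^esub> x)" if x: "x \<in> carrier V"
  proof -
    have "W <+>\<^bsub>V\<^esub> (\<lambda>x. c \<odot>\<^bsub>V\<^esub> x) ` (W +>\<^bsub>V\<^esub> x) = W +>\<^bsub>V\<^esub> (c \<odot>\<^bsub>V\<^esub> x)"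
    proof (intro equalityI subsetI)
      fix y assume "y \<in> W <+>\<^bsub>V\<^esub> (\<lambda>x. c \<odot>\<^bsub>V\<^esub> x) ` (W +>\<^bsub>V\<^esub> x)"
      then obtain w w' where w: "w \<in> W" "w' \<in> W" "y = w \<oplus>\<^bsub>V\<^esub> c \<odot>\<^bsub>V\<^esub> (w' \<oplus>\<^bsub>V\<^esub> x)"
        by (auto simp: set_add_def' a_r_coset_def')
      then have "y = (w \<oplus>\<^bsub>V\<^esub> c \<odot>\<^bsub>V\<^esub> w') \<oplus>\<^bsub>V\<^esub> c \<odot>\<^bsub>V\<^esub> x" using x Wc by (simp add: smult_add_r a_assoc)
      then show "y \<in> W +>\<^bsub>V\<^esub> (c \<odot>\<^bsub>V\<^esub> x)" using w W' by (auto simp: a_r_coset_def')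
    next
      fix y assume "y \<in> W +>\<^bsub>V\<^esub> (c \<odot>\<^bsub>V\<^esub> x)"
      then obtain w where w: "w \<in> W" "y = w \<oplus>\<^bsub>V\<^esub> c \<odot>\<^bsub>V\<^esub> x" by (auto simp: a_r_coset_def')
      have "x \<in> W +>\<^bsub>V\<^esub> x" using W'(1) x by (auto simp: a_r_coset_def' intro!: bexI[of _ "\<zero>\<^bsub>V\<^esub>"])
      then show "y \<in> W <+>\<^bsub>V\<^esub> (\<lambda>x. c \<odot>\<^bsub>V\<^esub> x) ` (W +>\<^bsub>V\<^esub> x)" using w by (auto simp: set_add_def')
    qed
    then show ?thesis by (simp add: quotient_space_def)
  qed
  show "W +>\<^bsub>V\<^esub> x = W +>\<^bsub>V\<^esub> \<zero>\<^bsub>V\<^esub>" if "x \<in> W"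
    unfolding z by (rule a_coset_join2) (use that Wc sg in auto)
qed

lemma kvs_quotient_space:
  fixes V :: "('k::field, 'v) module"
  assumes V: "kvs V" and W: "kvs.subsp V W"
  shows "kvs (quotient_space V W)"
proof -
  interpret kvs V by fact
  note q = quotient_space_simps[OF V W]
  show ?thesis
  proof (rule kvsI)
    show "\<zero>\<^bsub>quotient_space V W\<^esub> \<in> carrier (quotient_space V W)" unfolding q(1,2) by simp
    fix X Y Z a b assume "X \<in> carrier (quotient_space V W)" "Y \<in> carrier (quotient_space V W)" "Z \<in> carrier (quotient_space V W)"
    then obtain x y z where x: "x \<in> carrier V" "X = W +>\<^bsub>V\<^esub> x" and y: "y \<in> carrier V" "Y = W +>\<^bsub>V\<^esub> y" and z: "z \<in> carrier V" "Z = W +>\<^bsub>V\<^esub> z"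
      unfolding q(1) by blast
    note s = x y z q(3,4)
    show "X \<oplus>\<^bsub>quotient_space V W\<^esub> Y \<in> carrier (quotient_space V W)" "a \<odot>\<^bsub>quotient_space V W\<^esub> X \<in> carrier (quotient_space V W)"
      unfolding q(1) by (simp_all add: s)
    show "\<zero>\<^bsub>quotient_space V W\<^esub> \<oplus>\<^bsub>quotient_space V W\<^esub> X = X" "1 \<odot>\<^bsub>quotient_space V W\<^esub> X = X"
      unfolding q(2) by (simp_all add: s)
    show "X \<oplus>\<^bsub>quotient_space V W\<^esub> Y = Y \<oplus>\<^bsub>quotient_space V W\<^esub> X" by (simp add: s a_comm)
    show "X \<oplus>\<^bsub>quotient_space V W\<^esub> Y \<oplus>\<^bsub>quotient_space V W\<^esub> Z = X \<oplus>\<^bsub>quotient_space V W\<^esub> (Y \<oplus>\<^bsub>quotient_space V W\<^esub> Z)"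
      by (simp add: s a_assoc)
    show "X \<oplus>\<^bsub>quotient_space V W\<^esub> (- 1) \<odot>\<^bsub>quotient_space V W\<^esub> X = \<zero>\<^bsub>quotient_space V W\<^esub>"
    proof -
      have "X \<oplus>\<^bsub>quotient_space V W\<^esub> (- 1) \<odot>\<^bsub>quotient_space V W\<^esub> X = W +>\<^bsub>V\<^esub> (x \<oplus>\<^bsub>V\<^esub> (- 1) \<odot>\<^bsub>V\<^esub> x)" by (simp add: s)
      also have "x \<oplus>\<^bsub>V\<^esub> (- 1) \<odot>\<^bsub>V\<^esub> x = \<zero>\<^bsub>V\<^esub>" using x by (simp add: smult_m1 r_neg)
      finally show ?thesis by (simp add: q(2))
    qed
    show "(a + b) \<odot>\<^bsub>quotient_space V W\<^esub> X = a \<odot>\<^bsub>quotient_space V W\<^esub> X \<oplus>\<^bsub>quotient_space V W\<^esub> b \<odot>\<^bsub>quotient_space V W\<^esub> X"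
      by (simp add: s smult_add_l)
    show "a \<odot>\<^bsub>quotient_space V W\<^esub> (X \<oplus>\<^bsub>quotient_space V W\<^esub> Y) = a \<odot>\<^bsub>quotient_space V W\<^esub> X \<oplus>\<^bsub>quotient_space V W\<^esub> a \<odot>\<^bsub>quotient_space V W\<^esub> Y"
      by (simp add: s smult_add_r)
    show "(a * b) \<odot>\<^bsub>quotient_space V W\<^esub> X = a \<odot>\<^bsub>quotient_space V W\<^esub> (b \<odot>\<^bsub>quotient_space V W\<^esub> X)"
      by (simp add: s smult_smult)
  qed
qed

context rat
begin

lemma weyl_gmod_hom_iff: "f \<in> gmod_hom (weyl m) M \<longleftrightarrow> f \<in> extensional (carrier (weyl m)) \<and>
    (\<forall>u\<in>carrier (weyl m). f u \<in> carrier M) \<and>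
    (\<forall>u\<in>carrier (weyl m). \<forall>v\<in>carrier (weyl m). f (u \<oplus>\<^bsub>weyl m\<^esub> v) = f u \<oplus> f v) \<and>
    (\<forall>c. \<forall>v\<in>carrier (weyl m). f (c \<odot>\<^bsub>weyl m\<^esub> v) = c \<odot> f v) \<and>
    (\<forall>g\<in>carrier SL2. \<forall>v\<in>carrier (weyl m). f (act (weyl m) g v) = act M g (f v))"
  by (auto simp: gmod_hom_def LinearCombinations.module_hom_def)

lemma kvs_Hom_weyl: "kvs (Hom_G (weyl m) M)"
proof (rule kvsI)
  interpret W: kvs "weyl m :: ('k, ('k mat \<Rightarrow> 'k) \<Rightarrow> 'k) gmod" by (rule kvs_weyl)
  let ?H = "Hom_G (weyl m) M"
  have act0: "act M g \<zero> = \<zero>" if "g \<in> carrier SL2" for g using act_smult[OF that zero_closed, of 0] that by simp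
  have s: "carrier ?H = gmod_hom (weyl m) M" "\<zero>\<^bsub>?H\<^esub> = (\<lambda>v\<in>carrier (weyl m). \<zero>)"
    "f \<oplus>\<^bsub>?H\<^esub> h = (\<lambda>v\<in>carrier (weyl m). f v \<oplus> h v)" "c \<odot>\<^bsub>?H\<^esub> f = (\<lambda>v\<in>carrier (weyl m). c \<odot> f v)" for f h c
    by (simp_all add: Hom_G_def)
  show "\<zero>\<^bsub>?H\<^esub> \<in> carrier ?H" unfolding s weyl_gmod_hom_iff by (auto simp: act0 weyl_act_cl)
  fix f g h a b assume "f \<in> carrier ?H" "g \<in> carrier ?H" "h \<in> carrier ?H"
  then have m: "f \<in> gmod_hom (weyl m) M" "g \<in> gmod_hom (weyl m) M" "h \<in> gmod_hom (weyl m) M" by (simp_all add: s)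
  have cl: "f v \<in> carrier M" "g v \<in> carrier M" "h v \<in> carrier M" if "v \<in> carrier (weyl m)" for v
    using m that by (simp_all add: weyl_gmod_hom_iff)
  have ex: "(\<lambda>v\<in>carrier (weyl m). f v) = f" using m(1) by (simp add: weyl_gmod_hom_iff extensional_restrict)
  show "f \<oplus>\<^bsub>?H\<^esub> g \<in> carrier ?H"
    using m(1,2) cl unfolding s weyl_gmod_hom_iff
    by (auto simp: act_add weyl_act_cl smult_add_r intro!: fnl_eqI simp: fnl_add)
  show "a \<odot>\<^bsub>?H\<^esub> f \<in> carrier ?H"
    using m(1) cl unfolding s weyl_gmod_hom_iff
    by (auto simp: act_smult weyl_act_cl smult_add_r smult_smult mult.commute)
  show "\<zero>\<^bsub>?H\<^esub> \<oplus>\<^bsub>?H\<^esub> f = f" "1 \<odot>\<^bsub>?H\<^esub> f = f"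
    unfolding s by (simp_all add: cl ex cong: restrict_cong)
  show "f \<oplus>\<^bsub>?H\<^esub> g = g \<oplus>\<^bsub>?H\<^esub> f" unfolding s by (simp add: cl a_comm cong: restrict_cong)
  show "f \<oplus>\<^bsub>?H\<^esub> g \<oplus>\<^bsub>?H\<^esub> h = f \<oplus>\<^bsub>?H\<^esub> (g \<oplus>\<^bsub>?H\<^esub> h)" unfolding s by (simp add: cl a_assoc cong: restrict_cong)
  have "f v \<oplus> (- 1) \<odot> f v = \<zero>" if "v \<in> carrier (weyl m)" for v using cl(1)[OF that] by (simp add: smult_m1 r_neg)
  then show "f \<oplus>\<^bsub>?H\<^esub> (- 1) \<odot>\<^bsub>?H\<^esub> f = \<zero>\<^bsub>?H\<^esub>" unfolding s by (simp cong: restrict_cong)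
  show "(a + b) \<odot>\<^bsub>?H\<^esub> f = a \<odot>\<^bsub>?H\<^esub> f \<oplus>\<^bsub>?H\<^esub> b \<odot>\<^bsub>?H\<^esub> f" unfolding s by (simp add: cl smult_add_l cong: restrict_cong)
  show "a \<odot>\<^bsub>?H\<^esub> (f \<oplus>\<^bsub>?H\<^esub> g) = a \<odot>\<^bsub>?H\<^esub> f \<oplus>\<^bsub>?H\<^esub> a \<odot>\<^bsub>?H\<^esub> g" unfolding s by (simp add: cl smult_add_r cong: restrict_cong)
  show "(a * b) \<odot>\<^bsub>?H\<^esub> f = a \<odot>\<^bsub>?H\<^esub> (b \<odot>\<^bsub>?H\<^esub> f)" unfolding s by (simp add: cl smult_smult cong: restrict_cong)
qed

end

context weyl_res
begin

text \<open>\<open>R\<close> relates a class to the coefficient vectors of all zigzags of its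
  representing cocycles. It is total with support in the critical cells by \<open>zig_total\<close>,
  and by \<open>zig_zero\<close> only the zero class is related to the zero vector.\<close>

lemma Ext_bound:
  "vectorspace.fin_dim class_ring (Ext_G 3 (weyl b) I d) \<and> vectorspace.dim class_ring (Ext_G 3 (weyl b) I d) \<le> 3"
proof -
  let ?W = "weyl b :: ('k, ('k mat \<Rightarrow> 'k) \<Rightarrow> 'k) gmod"
  let ?H = "Hom_G ?W (I 3)" and ?Z = "cocycles 3 ?W I d" and ?B = "coboundaries 3 ?W I d"
  let ?V = "?H\<lparr>carrier := ?Z\<rparr>"
  let ?Q = "quotient_space ?V ?B"
  let ?top = "dlt b b :: ('k mat \<Rightarrow> 'k) \<Rightarrow> 'k"
  interpret D3: prat_hom "I 3" "I 4" "d 3" p using d_hom[of 3] by (simp add: numeral_eq_Suc)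
  interpret H: kvs ?H by (rule D2.N.kvs_Hom_weyl)
  interpret H2: kvs "Hom_G ?W (I 2)" by (rule D1.N.kvs_Hom_weyl)
  have top: "?top \<in> carrier ?W" by (rule dlt_weyl)
  have s: "carrier ?H = gmod_hom ?W (I 3)" "\<zero>\<^bsub>?H\<^esub> = (\<lambda>v\<in>carrier ?W. \<zero>\<^bsub>I 3\<^esub>)"
    "f \<oplus>\<^bsub>?H\<^esub> h = (\<lambda>v\<in>carrier ?W. f v \<oplus>\<^bsub>I 3\<^esub> h v)" "c \<odot>\<^bsub>?H\<^esub> f = (\<lambda>v\<in>carrier ?W. c \<odot>\<^bsub>I 3\<^esub> f v)" for f h c
    by (simp_all add: Hom_G_def)
  have s2: "carrier (Hom_G ?W (I 2)) = gmod_hom ?W (I 2)" "\<zero>\<^bsub>Hom_G ?W (I 2)\<^esub> = (\<lambda>v\<in>carrier ?W. \<zero>\<^bsub>I 2\<^esub>)"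
    "f \<oplus>\<^bsub>Hom_G ?W (I 2)\<^esub> h = (\<lambda>v\<in>carrier ?W. f v \<oplus>\<^bsub>I 2\<^esub> h v)" "c \<odot>\<^bsub>Hom_G ?W (I 2)\<^esub> f = (\<lambda>v\<in>carrier ?W. c \<odot>\<^bsub>I 2\<^esub> f v)" for f h c
    by (simp_all add: Hom_G_def)
  have Z: "f \<in> ?Z \<longleftrightarrow> f \<in> gmod_hom ?W (I 3) \<and> (\<forall>v\<in>carrier ?W. d 3 (f v) = \<zero>\<^bsub>I 4\<^esub>)" for f
    by (auto simp: cocycles_def Hom_G_def compose_def numeral_eq_Suc restrict_def fun_eq_iff)
  have B: "?B = compose (carrier ?W) (d 2) ` gmod_hom ?W (I 2)"
    by (simp add: coboundaries_def numeral_3_eq_3 numeral_2_eq_2 Hom_G_def)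
  have cl3: "f v \<in> carrier (I 3)" if "f \<in> gmod_hom ?W (I 3)" "v \<in> carrier ?W" for f v
    using that by (simp add: D2.N.weyl_gmod_hom_iff)
  have cl2: "f v \<in> carrier (I 2)" if "f \<in> gmod_hom ?W (I 2)" "v \<in> carrier ?W" for f v
    using that by (simp add: D1.N.weyl_gmod_hom_iff)
  have dd: "d 3 (d 2 v) = \<zero>\<^bsub>I 4\<^esub>" if "v \<in> carrier (I 2)" for v using exact_3 that by blast
  have HZ: "H.subsp ?Z"
    unfolding H.subsp_def
  proof (intro conjI ballI allI subsetI)
    show "f \<in> carrier ?H" if "f \<in> ?Z" for f using that by (simp add: Z s)
    show "\<zero>\<^bsub>?H\<^esub> \<in> ?Z" using H.zero_closed unfolding Z s by simp
    show "f \<oplus>\<^bsub>?H\<^esub> h \<in> ?Z" if "f \<in> ?Z" "h \<in> ?Z" for f h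
      using that H.a_closed[of f h] unfolding Z s by (simp add: D3.h_add cl3)
    show "c \<odot>\<^bsub>?H\<^esub> f \<in> ?Z" if "f \<in> ?Z" for c f
      using that H.smult_cl[of f c] unfolding Z s by (simp add: D3.h_smult cl3)
  qed
  have V: "kvs ?V" by (rule H.kvs_restrict[OF HZ])
  interpret V: kvs ?V by (rule V)
  have VB: "V.subsp ?B"
    unfolding V.subsp_def B
  proof (intro conjI ballI allI)
    have "compose (carrier ?W) (d 2) h \<in> ?Z" if h: "h \<in> gmod_hom ?W (I 2)" for h
      unfolding Z D2.N.weyl_gmod_hom_iff
      using h cl2[OF h] unfolding D1.N.weyl_gmod_hom_iff
      by (auto simp: compose_def dd D2.h_add D2.h_smult D2.h_act weyl_act_cl kvs.smult_cl[OF kvs_weyl]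
        abelian_monoid.a_closed[OF abelian_group.axioms(1)[OF module.axioms(2)[OF vectorspace.axioms(1)[OF kvs.vs[OF kvs_weyl]]]]])
    then show "compose (carrier ?W) (d 2) ` gmod_hom ?W (I 2) \<subseteq> carrier ?V" by auto
    have z: "compose (carrier ?W) (d 2) \<zero>\<^bsub>Hom_G ?W (I 2)\<^esub> = \<zero>\<^bsub>?V\<^esub>"
      unfolding s2 by (auto simp: s compose_def fun_eq_iff)
    show "\<zero>\<^bsub>?V\<^esub> \<in> compose (carrier ?W) (d 2) ` gmod_hom ?W (I 2)"
      unfolding z[symmetric] using H2.zero_closed unfolding s2(1) by (rule imageI)
    fix f h assume "f \<in> compose (carrier ?W) (d 2) ` gmod_hom ?W (I 2)" "h \<in> compose (carrier ?W) (d 2) ` gmod_hom ?W (I 2)"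
    then obtain f' h' where f: "f' \<in> gmod_hom ?W (I 2)" "f = compose (carrier ?W) (d 2) f'"
      and h: "h' \<in> gmod_hom ?W (I 2)" "h = compose (carrier ?W) (d 2) h'" by blast
    have "compose (carrier ?W) (d 2) (f' \<oplus>\<^bsub>Hom_G ?W (I 2)\<^esub> h') = f \<oplus>\<^bsub>?V\<^esub> h"
      unfolding s2 using cl2[OF f(1)] cl2[OF h(1)] by (auto simp: s compose_def fun_eq_iff f(2) h(2) D2.h_add)
    then show "f \<oplus>\<^bsub>?V\<^esub> h \<in> compose (carrier ?W) (d 2) ` gmod_hom ?W (I 2)"
      using H2.a_closed[of f' h'] f(1) h(1) unfolding s2(1) by (metis imageI)
  next
    fix c f assume "f \<in> compose (carrier ?W) (d 2) ` gmod_hom ?W (I 2)"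
    then obtain f' where f: "f' \<in> gmod_hom ?W (I 2)" "f = compose (carrier ?W) (d 2) f'" by blast
    have "compose (carrier ?W) (d 2) (c \<odot>\<^bsub>Hom_G ?W (I 2)\<^esub> f') = c \<odot>\<^bsub>?V\<^esub> f"
      unfolding s2 using cl2[OF f(1)] by (auto simp: s compose_def fun_eq_iff f(2) D2.h_smult)
    then show "c \<odot>\<^bsub>?V\<^esub> f \<in> compose (carrier ?W) (d 2) ` gmod_hom ?W (I 2)"
      using H2.smult_cl[of f' c] f(1) unfolding s2(1) by (metis imageI)
  qed
  note q = quotient_space_simps[OF V VB]
  interpret Q: kvs ?Q by (rule kvs_quotient_space[OF V VB])
  have Ext: "Ext_G 3 ?W I d = ?Q" by (simp add: Ext_G_def)
  define R where "R X \<rho> \<longleftrightarrow> (\<exists>f\<in>?Z. X = ?B +>\<^bsub>?V\<^esub> f \<and> zig f \<rho>)" for X \<rho>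
  have "\<exists>A. finite A \<and> card A \<le> card (crit \<alpha> \<mu> 3) \<and> A \<subseteq> carrier ?Q \<and> carrier ?Q \<subseteq> Q.span A"
  proof (rule Q.linear_relation_span[where R = R])
    show "finite (crit \<alpha> \<mu> 3)" using card_crit by blast
    show "X \<oplus>\<^bsub>?Q\<^esub> s \<odot>\<^bsub>?Q\<^esub> Y \<in> carrier ?Q" if "X \<in> carrier ?Q" "Y \<in> carrier ?Q" for X Y s using that by simp
    show "R (X \<oplus>\<^bsub>?Q\<^esub> s' \<odot>\<^bsub>?Q\<^esub> Y) (\<lambda>c. \<rho> c + s' * \<sigma> c)" if "R X \<rho>" "R Y \<sigma>" for X Y \<rho> \<sigma> s'
    proof -
      obtain f where f: "f \<in> ?Z" "X = ?B +>\<^bsub>?V\<^esub> f" "zig f \<rho>" using \<open>R X \<rho>\<close> unfolding R_def by blast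
      obtain g where g: "g \<in> ?Z" "Y = ?B +>\<^bsub>?V\<^esub> g" "zig g \<sigma>" using \<open>R Y \<sigma>\<close> unfolding R_def by blast
      have fg: "f \<in> carrier ?V" "g \<in> carrier ?V" using f(1) g(1) by simp_all
      show ?thesis unfolding R_def
      proof (intro bexI conjI)
        show "f \<oplus>\<^bsub>?V\<^esub> s' \<odot>\<^bsub>?V\<^esub> g \<in> ?Z" using V.a_closed[OF fg(1) V.smult_cl[OF fg(2), of s']] by simp
        show "X \<oplus>\<^bsub>?Q\<^esub> s' \<odot>\<^bsub>?Q\<^esub> Y = ?B +>\<^bsub>?V\<^esub> (f \<oplus>\<^bsub>?V\<^esub> s' \<odot>\<^bsub>?V\<^esub> g)"
          unfolding f(2) g(2) q(4)[OF fg(2)] by (rule q(3)[OF fg(1) V.smult_cl[OF fg(2)]])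
        show "zig (f \<oplus>\<^bsub>?V\<^esub> s' \<odot>\<^bsub>?V\<^esub> g) (\<lambda>c. \<rho> c + s' * \<sigma> c)"
          by (rule zig_linear[OF f(3) g(3)]) (use top in \<open>simp add: s\<close>)
      qed
    qed
    show "\<exists>\<rho>. (\<forall>c. c \<notin> crit \<alpha> \<mu> 3 \<longrightarrow> \<rho> c = 0) \<and> R X \<rho>" if X: "X \<in> carrier ?Q" for X
    proof -
      obtain f where "f \<in> carrier ?V" and fX: "X = ?B +>\<^bsub>?V\<^esub> f" using X unfolding q(1) by blast
      then have fZ: "f \<in> ?Z" by simp
      then have fh: "f \<in> gmod_hom ?W (I 3)" and ft: "d 3 (f ?top) = \<zero>\<^bsub>I 4\<^esub>" unfolding Z using top by auto
      obtain \<rho> where "\<And>\<nu>. \<nu> \<notin> crit \<alpha> \<mu> 3 \<Longrightarrow> \<rho> \<nu> = 0" "zig f \<rho>" by (rule zig_total[OF fh ft]) (rule that)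
      then show ?thesis unfolding R_def using fZ fX by blast
    qed
    show "X = \<zero>\<^bsub>?Q\<^esub>" if R: "R X (\<lambda>_. 0)" for X
    proof -
      obtain f where f: "f \<in> ?Z" "X = ?B +>\<^bsub>?V\<^esub> f" "zig f (\<lambda>_. 0)" using R unfolding R_def by blast
      have "\<exists>h\<in>gmod_hom ?W (I 2). f = compose (carrier ?W) (d 2) h"
        by (rule zig_zero[OF _ f(3)]) (use f(1) in \<open>simp add: Z\<close>)
      then have "f \<in> ?B" unfolding B by blast
      then show ?thesis unfolding f(2) q(2) by (rule q(5))
    qed
  qed auto
  then obtain A where A: "finite A" "card A \<le> card (crit \<alpha> \<mu> 3)" "A \<subseteq> carrier ?Q" "carrier ?Q \<subseteq> Q.span A" by blast
  note dim = Q.fin_dim_dim_le[OF A(1,3,4)]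
  have "Q.dim \<le> 3" using dim(2) A(2) card_crit[of \<alpha> \<mu>] by linarith
  then show ?thesis unfolding Ext using dim(1) by blast
qed

end

theorem corollary5p2:
  fixes p m\<^sub>1 m\<^sub>2 :: nat
    and I :: "nat \<Rightarrow> ('k::alg_closed_field, 'u) gmod"
    and \<epsilon> :: "(('k mat \<Rightarrow> 'k) \<Rightarrow> 'k) \<Rightarrow> 'u"
    and d :: "nat \<Rightarrow> 'u \<Rightarrow> 'u"
  assumes "prime p" and "odd p" and "CHAR('k) = p"
    and "injective_resolution (weyl m\<^sub>1) \<epsilon> I d"
  shows "vectorspace.fin_dim class_ring (Ext_G 3 (weyl m\<^sub>2) I d) \<and>
    vectorspace.dim class_ring (Ext_G 3 (weyl m\<^sub>2) I d) \<le> 3"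
proof -
  interpret weyl_res p m\<^sub>1 m\<^sub>2 I \<epsilon> d
    by unfold_locales (use assms in auto)
  show ?thesis by (rule Ext_bound)
qed

end
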